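(* Let $G$ be a finite non-nilpotent group. Then $G$ has property (P) if and only if it belongs to one of the following families: (a) $\mathrm{Dic}(\mathbb{Z}_3^m \times \mathbb{Z}_2) \times \mathbb{Z}_2^n$, with $m \geqslant 1$ and $n \geqslant 0$. (b) $(U \times V) \rtimes \langle z \rangle$, where $z$ normalizes both $U$ and $V$, the group $\langle U, z \rangle$ is of exponent $3$, $V = V_1 \times \cdots \times V_n$, and for every $i$, $1 \leqslant i \leqslant n$, $V_i \cong \mathbb{Z}_2^2$ and $\langle V_i, z \rangle \cong A_4$. (c) Frobenius groups $K \rtimes H$ with Frobenius kernel $K$ being a $2$-group of exponent $4$ and of class $2$ with $\Omega_1(K) \leqslant Z(K)$, and Frobenius complement $H \cong \mathbb{Z}_3$. (d) $(U \rtimes \langle z \rangle) \times V$, where $\langle z \rangle \cong \mathbb{Z}_3$, $V \cong \mathbb{Z}_2^m$ with $m \geqslant 0$, $U$ is a non-abelian special $2$-group such that $C_U(z) = \Omega_1(U) = Z(U)$, $U = Z(U)\prod_{i=1}^n U_i$, and for every $i$, $1 \leqslant i \leqslant n$, $Z(U)U_i$ is a normal subgroup of $U$, $U_i \cong Q_8$ and $\langle U_i, z \rangle \cong \mathrm{SL}(2,3)$. Furthermore, for any $i \neq j$, $1 \leqslant i, j \leqslant n$, $|U_i \cap U_j| \leqslant 2$.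
   Context: All groups are finite. $o(x)$ denotes the order of an element $x$. A group $G$ has property (P) if $G$ has even order and for all $x, y \in G$ with $o(x) = 2$, the subgroup $\langle x, y \rangle$ is isomorphic to one of the groups $\mathbb{Z}_2$, $\mathbb{Z}_2^2$, $\mathbb{Z}_4$, $\mathbb{Z}_6$, $\mathbb{Z}_2 \times \mathbb{Z}_4$, $\mathbb{Z}_2 \times \mathbb{Z}_6$, $A_4$. $\mathbb{Z}_n$ is the cyclic group of order $n$, $A_4$ is the alternating group of degree $4$, $Q_8$ is the quaternion group of order $8$, and $\mathrm{SL}(2,3)$ is the special linear group of $2\times 2$ matrices over the field with $3$ elements. For an abelian group $A$ with a unique involution $t$ and $|A| > 2$, the generalized dicyclic group $\mathrm{Dic}(A)$ is the group $\langle A, x \rangle$, where $x^2 = t$ and $x^{-1}ax = a^{-1}$ for all $a \in A$. In a semidirect product $G \rtimes H$ the factor $G$ is the normal one. For a group $G$ of even order, $\Omega_1(G)$ is the subgroup generated by all elements of order $2$. $Z(G)$, $\Phi(G)$, $G'$ denote the center, Frattini subgroup and commutator subgroup of $G$; $C_U(z)$ is the set of elements of $U$ commuting with $z$. "Class" means nilpotency class. A Frobenius group is a transitive permutation group on a set $\Omega$ whose point stabilizers are non-trivial and in which no non-identity element fixes more than one point; its Frobenius kernel $K$ consists of the identity and the elements fixing no point, the Frobenius complements are the point stabilizers $H$, and the group is $K \rtimes H$. A $p$-group $P$ is special if it is either elementary abelian, or $P' = \Phi(P) = Z(P)$ is elementary abelian.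
   Formalization: In (c), "of class 2" is replaced by "of class at most 2": with class exactly 2 the claim fails for the Frobenius group Z_4^2 ⋊ Z_3, which has property (P), is non-nilpotent, and lies in none of the families (a)–(d). *)

theory Defs
  imports
    "HOL-Algebra.Sym_Groups"
    "HOL-Algebra.Elementary_Groups"
    "HOL-Algebra.Product_Groups"
    "HOL-Algebra.Group_Action"
    "HOL-Algebra.Multiplicative_Group"
    "HOL-Analysis.Determinants"
begin

section \<open>Concrete groups\<close>

definition cyclic_power :: "nat \<Rightarrow> nat \<Rightarrow> (nat \<Rightarrow> int) monoid" where
  "cyclic_power k n = product_group {1..n} (\<lambda>i. integer_mod_group k)"

text \<open>The eight quaternions \<open>\<plusminus>1, \<plusminus>i, \<plusminus>j, \<plusminus>k\<close>, with \<open>(a, b, c, d)\<close> standing for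
  \<open>a + b i + c j + d k\<close>, under the Hamilton product.\<close>

definition quaternion_group :: "(int \<times> int \<times> int \<times> int) monoid" where
  "quaternion_group =
     \<lparr>carrier = {(a, b, c, d). a^2 + b^2 + c^2 + d^2 = 1},
      monoid.mult = (\<lambda>(a, b, c, d) (a', b', c', d').
        (a * a' - b * b' - c * c' - d * d',
         a * b' + b * a' + c * d' - d * c',
         a * c' - b * d' + c * a' + d * b',
         a * d' + b * c' - c * b' + d * a')),
      one = (1, 0, 0, 0)\<rparr>"

text \<open>The numeral type \<^typ>\<open>3\<close> carries arithmetic modulo 3.\<close>

definition SL23 :: "(3 ^ 2 ^ 2) monoid" where
  "SL23 = \<lparr>carrier = {A. det A = 1}, monoid.mult = (**), one = mat 1\<rparr>"

section \<open>General notions for a group\<close>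

definition group_center :: "('a, 'b) monoid_scheme \<Rightarrow> 'a set" where
  "group_center G = {z \<in> carrier G. \<forall>x\<in>carrier G. z \<otimes>\<^bsub>G\<^esub> x = x \<otimes>\<^bsub>G\<^esub> z}"

definition group_exponent :: "('a, 'b) monoid_scheme \<Rightarrow> nat" where
  "group_exponent G = (LEAST n. 0 < n \<and> (\<forall>x\<in>carrier G. x [^]\<^bsub>G\<^esub> n = \<one>\<^bsub>G\<^esub>))"

definition Omega1 :: "('a, 'b) monoid_scheme \<Rightarrow> 'a set" where
  "Omega1 G = generate G {x \<in> carrier G. group.ord G x = 2}"

definition commutator_subgroup :: "('a, 'b) monoid_scheme \<Rightarrow> 'a set \<Rightarrow> 'a set \<Rightarrow> 'a set" where
  "commutator_subgroup G H K =
     generate G (\<Union>h\<in>H. \<Union>k\<in>K. {h \<otimes>\<^bsub>G\<^esub> k \<otimes>\<^bsub>G\<^esub> inv\<^bsub>G\<^esub> h \<otimes>\<^bsub>G\<^esub> inv\<^bsub>G\<^esub> k})"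

definition lower_central :: "('a, 'b) monoid_scheme \<Rightarrow> nat \<Rightarrow> 'a set" where
  "lower_central G n = ((\<lambda>H. commutator_subgroup G H (carrier G)) ^^ n) (carrier G)"

definition nilpotent_group :: "('a, 'b) monoid_scheme \<Rightarrow> bool" where
  "nilpotent_group G \<longleftrightarrow> group G \<and> (\<exists>n. lower_central G n = {\<one>\<^bsub>G\<^esub>})"

text \<open>Indexing starts at 0 with the whole group, so the trivial group has class 0 and the
  non-trivial abelian groups have class 1.  Only meaningful for nilpotent groups.\<close>

definition nilpotency_class :: "('a, 'b) monoid_scheme \<Rightarrow> nat" where
  "nilpotency_class G = (LEAST n. lower_central G n = {\<one>\<^bsub>G\<^esub>})"

definition maximal_subgroup :: "'a set \<Rightarrow> ('a, 'b) monoid_scheme \<Rightarrow> bool" where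
  "maximal_subgroup M G \<longleftrightarrow> subgroup M G \<and> M \<noteq> carrier G \<and>
     (\<forall>H. subgroup H G \<and> M \<subseteq> H \<longrightarrow> H = M \<or> H = carrier G)"

definition Frattini :: "('a, 'b) monoid_scheme \<Rightarrow> 'a set" where
  "Frattini G = carrier G \<inter> \<Inter>{M. maximal_subgroup M G}"

definition p_group :: "nat \<Rightarrow> ('a, 'b) monoid_scheme \<Rightarrow> bool" where
  "p_group p G \<longleftrightarrow> group G \<and> (\<exists>n. order G = p ^ n)"

definition elementary_abelian :: "nat \<Rightarrow> ('a, 'b) monoid_scheme \<Rightarrow> bool" where
  "elementary_abelian p G \<longleftrightarrow> comm_group G \<and> (\<forall>x\<in>carrier G. x [^]\<^bsub>G\<^esub> p = \<one>\<^bsub>G\<^esub>)"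

definition special_p_group :: "nat \<Rightarrow> ('a, 'b) monoid_scheme \<Rightarrow> bool" where
  "special_p_group p P \<longleftrightarrow> p_group p P \<and>
     (elementary_abelian p P \<or>
      derived P (carrier P) = Frattini P \<and> Frattini P = group_center P \<and>
      elementary_abelian p (P\<lparr>carrier := group_center P\<rparr>))"

section \<open>Internal products\<close>

definition internal_semidirect :: "('a, 'b) monoid_scheme \<Rightarrow> 'a set \<Rightarrow> 'a set \<Rightarrow> bool" where
  "internal_semidirect G N H \<longleftrightarrow>
     N \<lhd> G \<and> subgroup H G \<and> N \<inter> H = {\<one>\<^bsub>G\<^esub>} \<and> N <#>\<^bsub>G\<^esub> H = carrier G"

definition internal_direct :: "('a, 'b) monoid_scheme \<Rightarrow> 'a set \<Rightarrow> 'a set \<Rightarrow> bool" where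
  "internal_direct G A B \<longleftrightarrow>
     A \<lhd> G \<and> B \<lhd> G \<and> A \<inter> B = {\<one>\<^bsub>G\<^esub>} \<and> A <#>\<^bsub>G\<^esub> B = carrier G"

definition internal_direct_family ::
  "('a, 'b) monoid_scheme \<Rightarrow> 'i set \<Rightarrow> ('i \<Rightarrow> 'a set) \<Rightarrow> bool" where
  "internal_direct_family G I S \<longleftrightarrow>
     (\<forall>i\<in>I. S i \<lhd> G) \<and> generate G (\<Union>i\<in>I. S i) = carrier G \<and>
     (\<forall>i\<in>I. S i \<inter> generate G (\<Union>j\<in>I - {i}. S j) = {\<one>\<^bsub>G\<^esub>})"

definition set_product ::
  "('a, 'b) monoid_scheme \<Rightarrow> 'a set \<Rightarrow> (nat \<Rightarrow> 'a set) \<Rightarrow> nat \<Rightarrow> 'a set" where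
  "set_product G Z S n = foldl (\<lambda>X i. X <#>\<^bsub>G\<^esub> S i) Z [1..<Suc n]"

section \<open>Generalized dicyclic groups and Frobenius groups\<close>

text \<open>\<open>D\<close> is a copy of \<open>Dic(A)\<close>, with \<open>B\<close> the copy of \<open>A\<close> inside \<open>D\<close>.\<close>

definition generalized_dicyclic ::
  "('a, 'b) monoid_scheme \<Rightarrow> ('c, 'd) monoid_scheme \<Rightarrow> bool" where
  "generalized_dicyclic D A \<longleftrightarrow>
     group D \<and> comm_group A \<and> (\<exists>!t. t \<in> carrier A \<and> group.ord A t = 2) \<and> 2 < order A \<and>
     (\<exists>B t x. subgroup B D \<and> D\<lparr>carrier := B\<rparr> \<cong> A \<and>
        t \<in> B \<and> group.ord D t = 2 \<and>
        x \<in> carrier D \<and> x \<otimes>\<^bsub>D\<^esub> x = t \<and>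
        (\<forall>a\<in>B. inv\<^bsub>D\<^esub> x \<otimes>\<^bsub>D\<^esub> a \<otimes>\<^bsub>D\<^esub> x = inv\<^bsub>D\<^esub> a) \<and>
        generate D (insert x B) = carrier D)"

text \<open>\<open>G\<close>, viewed as a permutation group through the faithful action \<open>\<phi>\<close> on \<open>\<Omega>\<close>, is a
  Frobenius group.\<close>

definition Frobenius_action ::
  "('a, 'b) monoid_scheme \<Rightarrow> 'c set \<Rightarrow> ('a \<Rightarrow> 'c \<Rightarrow> 'c) \<Rightarrow> bool" where
  "Frobenius_action G \<Omega> \<phi> \<longleftrightarrow>
     faithful_action G \<Omega> \<phi> \<and> transitive_action G \<Omega> \<phi> \<and>
     (\<forall>w\<in>\<Omega>. stabilizer G \<phi> w \<noteq> {\<one>\<^bsub>G\<^esub>}) \<and>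
     (\<forall>g\<in>carrier G. g \<noteq> \<one>\<^bsub>G\<^esub> \<longrightarrow>
        (\<forall>v\<in>\<Omega>. \<forall>w\<in>\<Omega>. \<phi> g v = v \<and> \<phi> g w = w \<longrightarrow> v = w))"

definition Frobenius_kernel ::
  "('a, 'b) monoid_scheme \<Rightarrow> 'c set \<Rightarrow> ('a \<Rightarrow> 'c \<Rightarrow> 'c) \<Rightarrow> 'a set" where
  "Frobenius_kernel G \<Omega> \<phi> = insert \<one>\<^bsub>G\<^esub> {g \<in> carrier G. \<forall>w\<in>\<Omega>. \<phi> g w \<noteq> w}"

text \<open>A transitive permutation domain of a finite group is finite, so taking \<open>\<Omega>\<close> to be a set of
  natural numbers is no restriction for finite \<open>G\<close>.\<close>

definition Frobenius_group ::
  "('a, 'b) monoid_scheme \<Rightarrow> 'a set \<Rightarrow> 'a set \<Rightarrow> bool" where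
  "Frobenius_group G K H \<longleftrightarrow>
     (\<exists>(\<Omega> :: nat set) \<phi>. Frobenius_action G \<Omega> \<phi> \<and> K = Frobenius_kernel G \<Omega> \<phi> \<and>
        (\<exists>w\<in>\<Omega>. H = stabilizer G \<phi> w)) \<and>
     internal_semidirect G K H"

section \<open>Property (P) and the four families\<close>

definition property_P :: "('a, 'b) monoid_scheme \<Rightarrow> bool" where
  "property_P G \<longleftrightarrow> even (order G) \<and>
     (\<forall>x\<in>carrier G. \<forall>y\<in>carrier G. group.ord G x = 2 \<longrightarrow>
        (let S = subgroup_generated G {x, y} in
           S \<cong> integer_mod_group 2 \<or>
           S \<cong> cyclic_power 2 2 \<or>
           S \<cong> integer_mod_group 4 \<or>
           S \<cong> integer_mod_group 6 \<or>
           S \<cong> integer_mod_group 2 \<times>\<times> integer_mod_group 4 \<or>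
           S \<cong> integer_mod_group 2 \<times>\<times> integer_mod_group 6 \<or>
           S \<cong> alt_group 4))"

definition family_a :: "('a, 'b) monoid_scheme \<Rightarrow> bool" where
  "family_a G \<longleftrightarrow>
     (\<exists>D E m n. 1 \<le> m \<and> internal_direct G D E \<and>
        generalized_dicyclic (G\<lparr>carrier := D\<rparr>) (cyclic_power 3 m \<times>\<times> integer_mod_group 2) \<and>
        G\<lparr>carrier := E\<rparr> \<cong> cyclic_power 2 n)"

definition family_b :: "('a, 'b) monoid_scheme \<Rightarrow> bool" where
  "family_b G \<longleftrightarrow>
     (\<exists>W U V z n Vs. z \<in> carrier G \<and>
        internal_semidirect G W (generate G {z}) \<and>
        internal_direct (G\<lparr>carrier := W\<rparr>) U V \<and>
        z \<in> normalizer G U \<and> z \<in> normalizer G V \<and>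
        group_exponent (subgroup_generated G (insert z U)) = 3 \<and>
        internal_direct_family (G\<lparr>carrier := V\<rparr>) {1..n::nat} Vs \<and>
        (\<forall>i\<in>{1..n}. G\<lparr>carrier := Vs i\<rparr> \<cong> cyclic_power 2 2 \<and>
           subgroup_generated G (insert z (Vs i)) \<cong> alt_group 4))"

text \<open>``Of class 2'' is read as ``of class at most 2'': homocyclic abelian kernels such as
  \<open>\<int>\<^sub>4\<^sup>2\<close> must be included, since the Frobenius group of shape \<open>\<int>\<^sub>4\<^sup>2 \<rtimes> \<int>\<^sub>3\<close> has
  property (P) and lies in none of the other families.\<close>

definition family_c :: "('a, 'b) monoid_scheme \<Rightarrow> bool" where
  "family_c G \<longleftrightarrow>
     (\<exists>K H. Frobenius_group G K H \<and>
        p_group 2 (G\<lparr>carrier := K\<rparr>) \<and>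
        group_exponent (G\<lparr>carrier := K\<rparr>) = 4 \<and>
        nilpotent_group (G\<lparr>carrier := K\<rparr>) \<and> nilpotency_class (G\<lparr>carrier := K\<rparr>) \<le> 2 \<and>
        Omega1 (G\<lparr>carrier := K\<rparr>) \<subseteq> group_center (G\<lparr>carrier := K\<rparr>) \<and>
        G\<lparr>carrier := H\<rparr> \<cong> integer_mod_group 3)"

definition family_d :: "('a, 'b) monoid_scheme \<Rightarrow> bool" where
  "family_d G \<longleftrightarrow>
     (\<exists>W V U z m n Us. z \<in> carrier G \<and>
        internal_direct G W V \<and>
        internal_semidirect (G\<lparr>carrier := W\<rparr>) U (generate G {z}) \<and>
        subgroup_generated G {z} \<cong> integer_mod_group 3 \<and>
        G\<lparr>carrier := V\<rparr> \<cong> cyclic_power 2 m \<and>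
        \<not> comm_group (G\<lparr>carrier := U\<rparr>) \<and> special_p_group 2 (G\<lparr>carrier := U\<rparr>) \<and>
        {u \<in> U. u \<otimes>\<^bsub>G\<^esub> z = z \<otimes>\<^bsub>G\<^esub> u} = Omega1 (G\<lparr>carrier := U\<rparr>) \<and>
        Omega1 (G\<lparr>carrier := U\<rparr>) = group_center (G\<lparr>carrier := U\<rparr>) \<and>
        U = set_product G (group_center (G\<lparr>carrier := U\<rparr>)) Us n \<and>
        (\<forall>i\<in>{1..n}. subgroup (Us i) (G\<lparr>carrier := U\<rparr>) \<and>
           group_center (G\<lparr>carrier := U\<rparr>) <#>\<^bsub>G\<^esub> Us i \<lhd> G\<lparr>carrier := U\<rparr> \<and>
           G\<lparr>carrier := Us i\<rparr> \<cong> quaternion_group \<and>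
           subgroup_generated G (insert z (Us i)) \<cong> SL23) \<and>
        (\<forall>i\<in>{1..n}. \<forall>j\<in>{1..n}. i \<noteq> j \<longrightarrow> card (Us i \<inter> Us j) \<le> 2))"

end

theory Submission
  imports Defs "HOL-Algebra.Sylow" "HOL-Computational_Algebra.Primes"
begin

text \<open>Running through the presentations of the listed groups, (P) says that for every involution
  \<open>x\<close> and every \<open>y\<close> either \<open>x\<close> and \<open>y\<close> commute and \<open>y\<^sup>4 = 1\<close> or \<open>y\<^sup>6 = 1\<close>, or
  \<open>y\<^sup>3 = (xy)\<^sup>3 = 1\<close>.  Hence the involutions and \<open>1\<close> form a normal elementary abelian subgroup
  \<open>E\<close>, and \<open>G/E\<close> has element orders at most 3.  An element outside \<open>C = C\<^sub>G(E)\<close> has order 3 and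
  satisfies \<open>1 + t + t\<^sup>2 = 0\<close> on \<open>E\<close>; two such elements that are independent modulo \<open>C\<close> would
  force \<open>E = 1\<close>, so \<open>C\<close> has index at most 3.  If two involutions of \<open>G/E\<close> do not commute,
  then \<open>G/E\<close> is a 3-group inverted by an involution, and \<open>G\<close> lies in family (a).  Otherwise the
  preimage \<open>T\<close> of the involutions of \<open>G/E\<close> is a subgroup.  If \<open>T = E\<close>, then \<open>G/E\<close> has exponent
  3; non-nilpotency forces \<open>C \<noteq> G\<close>, and this is (b).  If \<open>T \<noteq> E\<close>, then \<open>T\<close> has index 3:
  either \<open>C = T\<close> and an element of order 3 acts on \<open>T\<close> without fixed points, giving (c), or
  \<open>E\<close> is central and the \<open>v \<in> T\<close> with \<open>(vz)\<^sup>3 = 1\<close>, where \<open>z\<close> has order 3, generate with their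
  conjugates under \<open>z\<close> the quaternion groups of (d).

  For the converse, the norm \<open>g \<cdot> g\<^sup>z \<cdot> g\<^bsup>zz\<^esup>\<close> controls the order of \<open>gz\<close>; it is multiplicative up to
  central factors, so it is enough to know it on the factors \<open>V\<^sub>i\<close> and \<open>U\<^sub>i\<close>.\<close>

section \<open>Words in a group\<close>

text \<open>The obstacle is that (P) and the families speak of isomorphism types while the argument
  lives in identities between words. Recognition of a type goes through orders alone: if a pair in G
  and a pair in the model satisfy the same relations, so does the pair of pairs in the direct
  product; when the relations fix the order of the generated subgroup, the three orders agree, and
  both projections of the diagonal subgroup are isomorphisms. The norm serves the forward direction
  too: it turns (xy)^3 = 1 into the statement that the three conjugates of an involution multiply to
  1, which makes orbits into Klein four-groups. The lemma on two independent elements is used twice,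
  on \<open>E\<close> inside G for the index of \<open>C\<close>, and on the involutions of G/E for
  the index of \<open>T\<close>. Relations known only modulo a central \<open>E\<close> are lifted
  by cubing: a coset of \<open>E\<close> contains at most one element with cube 1. Non-nilpotency
  excludes that G is a 2-group or that G/E is a 3-group with \<open>E\<close> central; in the
  converse it is what forces a factor \<open>V_i\<close> to exist in family (b).\<close>

context group
begin

lemma inv_cancel_left [simp]:
  assumes "x \<in> carrier G" "y \<in> carrier G"
  shows "inv x \<otimes> (x \<otimes> y) = y" and "x \<otimes> (inv x \<otimes> y) = y"
  using assms by (simp_all flip: m_assoc)

lemma mult_assoc_extend:
  assumes "x \<otimes> y = z" "x \<in> carrier G" "y \<in> carrier G" "w \<in> carrier G"
  shows "x \<otimes> (y \<otimes> w) = z \<otimes> w"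
  using assms by (metis m_assoc)

lemma inv_of_involution:
  assumes "x \<otimes> x = \<one>" "x \<in> carrier G"
  shows "inv x = x"
  using assms inv_equality by blast

lemma inv_of_cube_one:
  assumes "x \<otimes> (x \<otimes> x) = \<one>" "x \<in> carrier G"
  shows "inv x = x \<otimes> x"
  using assms by (metis inv_equality inv_inv m_closed)

lemma involution_extend:
  assumes "x \<otimes> x = \<one>" "x \<in> carrier G" "w \<in> carrier G"
  shows "x \<otimes> (x \<otimes> w) = w"
  using assms by (simp flip: m_assoc)

lemma cube_one_extend:
  assumes "x \<otimes> (x \<otimes> x) = \<one>" "x \<in> carrier G" "w \<in> carrier G"
  shows "x \<otimes> (x \<otimes> (x \<otimes> w)) = w"
proof -
  have "x \<otimes> (x \<otimes> (x \<otimes> w)) = (x \<otimes> (x \<otimes> x)) \<otimes> w" using assms(2,3) by (simp add: m_assoc)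
  then show ?thesis using assms by simp
qed

lemma conj_eq_one_iff:
  assumes "t \<in> carrier G" "x \<in> carrier G"
  shows "t \<otimes> x \<otimes> inv t = \<one> \<longleftrightarrow> x = \<one>"
  using assms by (metis inv_solve_right' one_closed m_closed l_cancel_one l_one)

lemma commute_of_involutions:
  assumes "x \<otimes> x = \<one>" "y \<otimes> y = \<one>" "(x \<otimes> y) \<otimes> (x \<otimes> y) = \<one>" "x \<in> carrier G" "y \<in> carrier G"
  shows "x \<otimes> y = y \<otimes> x"
  using assms by (metis inv_mult_group inv_of_involution m_closed)

lemma square_cube_one:
  assumes "x \<otimes> x = \<one>" "x \<otimes> (x \<otimes> x) = \<one>" "x \<in> carrier G"
  shows "x = \<one>"
  using assms by simp

lemma conj_eq_iff:
  assumes "t \<in> carrier G" "x \<in> carrier G"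
  shows "t \<otimes> x \<otimes> inv t = x \<longleftrightarrow> t \<otimes> x = x \<otimes> t"
  using assms by (metis inv_solve_right m_closed)

lemma conj_mult:
  assumes "t \<in> carrier G" "x \<in> carrier G" "y \<in> carrier G"
  shows "t \<otimes> (x \<otimes> y) \<otimes> inv t = (t \<otimes> x \<otimes> inv t) \<otimes> (t \<otimes> y \<otimes> inv t)"
  using assms by (simp add: m_assoc)

lemma conj_closed:
  assumes "E \<lhd> G" "t \<in> carrier G" "x \<in> E"
  shows "t \<otimes> x \<otimes> inv t \<in> E" "inv t \<otimes> x \<otimes> t \<in> E"
  using assms by (auto simp: normal.inv_op_closed1 normal.inv_op_closed2)

text \<open>Expanding the cube moves each x past powers of t, and t^3 = 1 leaves the norm of x under
  conjugation by t, with t^-1 standing for t^2.\<close>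

lemma cube_twist:
  assumes "x \<in> carrier G" "t \<in> carrier G" "t \<otimes> (t \<otimes> t) = \<one>"
  shows "(x \<otimes> t) \<otimes> ((x \<otimes> t) \<otimes> (x \<otimes> t)) = x \<otimes> ((t \<otimes> x \<otimes> inv t) \<otimes> (inv t \<otimes> x \<otimes> t))"
  using assms inv_of_cube_one[OF assms(3,2)] cube_one_extend[OF assms(3,2)]
  by (simp add: m_assoc)

text \<open>On \<open>E\<close>, written additively, each of \<open>a\<close>, \<open>b\<close>, \<open>ab\<close>, \<open>ab\<^sup>-\<^sup>1\<close> satisfies
  \<open>1 + t + t\<^sup>2 = 0\<close>.  Expanding \<open>(ab)\<^sup>-\<^sup>1\<close> gives \<open>ab = a + b + ba\<close>, and replacing \<open>b\<close> by
  \<open>b\<^sup>-\<^sup>1 = b + 1\<close> gives \<open>ab = a + b + ba + 1\<close>.\<close>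

lemma free_pair_trivial:
  assumes E: "E \<lhd> G" "\<And>x. x \<in> E \<Longrightarrow> x \<otimes> x = \<one>"
    and ab: "a \<in> carrier G" "b \<in> carrier G"
    and cube: "\<And>x t. x \<in> E \<Longrightarrow> t \<in> {a, b, a \<otimes> b, a \<otimes> inv b} \<Longrightarrow>
        (x \<otimes> t) \<otimes> ((x \<otimes> t) \<otimes> (x \<otimes> t)) = \<one>"
    and x: "x \<in> E"
  shows "x = \<one>"
proof -
  have sub: "subgroup E G" using E(1) normal_imp_subgroup by auto
  have car: "\<And>x. x \<in> E \<Longrightarrow> x \<in> carrier G" using subgroup.mem_carrier[OF sub] .
  have cl: "\<And>x y. x \<in> E \<Longrightarrow> y \<in> E \<Longrightarrow> x \<otimes> y \<in> E" using subgroup.m_closed[OF sub] .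
  have comm: "\<And>x y. x \<in> E \<Longrightarrow> y \<in> E \<Longrightarrow> x \<otimes> y = y \<otimes> x"
    using commute_of_involutions E(2) cl car by blast
  define c where "c t x = t \<otimes> x \<otimes> inv t" for t x
  have cE: "\<And>t x. t \<in> carrier G \<Longrightarrow> x \<in> E \<Longrightarrow> c t x \<in> E"
    unfolding c_def using conj_closed[OF E(1)] by blast
  have cm: "\<And>t x y. t \<in> carrier G \<Longrightarrow> x \<in> E \<Longrightarrow> y \<in> E \<Longrightarrow> c t (x \<otimes> y) = c t x \<otimes> c t y"
    unfolding c_def using conj_mult car by blast
  have cc: "\<And>t u x. t \<in> carrier G \<Longrightarrow> u \<in> carrier G \<Longrightarrow> x \<in> E \<Longrightarrow> c (t \<otimes> u) x = c t (c u x)"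
    unfolding c_def using car by (simp add: m_assoc inv_mult_group)
  \<comment> \<open>The cubes of t and of x t are both 1, so the norm of x is trivial: on
    \<open>E\<close>, written additively, t^-1 acts as 1 + t.\<close>
  have R: "c (inv t) x = x \<otimes> c t x" if x: "x \<in> E" and t: "t \<in> {a, b, a \<otimes> b, a \<otimes> inv b}" for x t
  proof -
    have tG: "t \<in> carrier G" using t ab by auto
    have t3: "t \<otimes> (t \<otimes> t) = \<one>"
      using cube[OF subgroup.one_closed[OF sub] t] tG by simp
    have "x \<otimes> (c t x \<otimes> c (inv t) x) = \<one>"
      using cube_twist[OF car[OF x] tG t3] cube[OF x t] tG unfolding c_def by simp
    then have "(x \<otimes> c t x) \<otimes> c (inv t) x = \<one>"
      using car x cE tG by (simp add: m_assoc)
    moreover have "(x \<otimes> c t x) \<otimes> (x \<otimes> c t x) = \<one>" using E(2) cl cE tG x by simp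
    ultimately show ?thesis using car x cE cl tG
      by (metis inv_closed inv_equality inv_inv)
  qed
  define A B AB BA where "A = c a x" "B = c b x" "AB = c a (c b x)" "BA = c b (c a x)"
  have mem: "A \<in> E" "B \<in> E" "AB \<in> E" "BA \<in> E" unfolding A_B_AB_BA_def using cE ab x by auto
  have 1: "x \<otimes> AB = (x \<otimes> B) \<otimes> (A \<otimes> BA)"
  proof -
    have "c (inv (a \<otimes> b)) x = c (inv b) (c (inv a) x)"
      using cc ab x by (simp add: inv_mult_group)
    also have "\<dots> = c (inv b) x \<otimes> c (inv b) (c a x)" using R cm cE ab x by simp
    also have "\<dots> = (x \<otimes> B) \<otimes> (A \<otimes> BA)" using R cE ab x unfolding A_B_AB_BA_def by simp
    finally show ?thesis using R[OF x, of "a \<otimes> b"] cc ab x unfolding A_B_AB_BA_def by simp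
  qed
  have 2: "B \<otimes> BA = x \<otimes> (A \<otimes> AB)"
  proof -
    have "c (inv (a \<otimes> inv b)) x = c b (c (inv a) x)"
      using cc ab x by (simp add: inv_mult_group)
    also have "\<dots> = B \<otimes> BA" using R cm cE ab x unfolding A_B_AB_BA_def by simp
    finally have "B \<otimes> BA = x \<otimes> c (a \<otimes> inv b) x" using R[OF x, of "a \<otimes> inv b"] by simp
    also have "c (a \<otimes> inv b) x = A \<otimes> AB"
      using R cc cm cE ab x unfolding A_B_AB_BA_def by simp
    finally show ?thesis .
  qed
  have lc: "\<And>x y z. x \<in> E \<Longrightarrow> y \<in> E \<Longrightarrow> z \<in> E \<Longrightarrow> x \<otimes> (y \<otimes> z) = y \<otimes> (x \<otimes> z)"
    using comm car by (metis m_assoc)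
  have sq: "\<And>x y. x \<in> E \<Longrightarrow> y \<in> E \<Longrightarrow> x \<otimes> (x \<otimes> y) = y"
    using E(2) car by (metis l_one m_assoc)
  have AB: "AB = B \<otimes> (A \<otimes> BA)" using 1 car x mem cl by (simp add: m_assoc)
  \<comment> \<open>Substituting the first relation into the second cancels both copies of
    \<open>A\<close>; only the factor x is left over.\<close>
  have "B \<otimes> BA = x \<otimes> (B \<otimes> BA)"
    using 2 lc[OF mem(1,2), of "A \<otimes> BA"] sq[OF mem(1,4)] cl mem by (simp add: AB)
  then show ?thesis using car mem cl x by (metis r_cancel_one')
qed

end

section \<open>Groups with element orders at most three\<close>

locale order_le_3_group = group +
  assumes order_le_3: "g \<in> carrier G \<Longrightarrow> g \<otimes> g = \<one> \<or> g \<otimes> (g \<otimes> g) = \<one>"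
begin

text \<open>As s and t do not commute, st has order 3, and a nontrivial such k would make k(st) an
  element of order 6. Concretely, (k st)^2 = (st)^2 is not 1, so the cube is 1, and this cube is
  k.\<close>

lemma centralizer_of_noncommuting_involutions:
  assumes st: "s \<in> carrier G" "t \<in> carrier G" "s \<otimes> s = \<one>" "t \<otimes> t = \<one>" "s \<otimes> t \<noteq> t \<otimes> s"
    and k: "k \<in> carrier G" "k \<otimes> k = \<one>" "k \<otimes> s = s \<otimes> k" "k \<otimes> t = t \<otimes> k"
  shows "k = \<one>"
proof -
  let ?u = "s \<otimes> t"
  have u2: "?u \<otimes> ?u \<noteq> \<one>" using commute_of_involutions st by blast
  then have u3: "?u \<otimes> (?u \<otimes> ?u) = \<one>" using order_le_3 st by blast
  have ku: "k \<otimes> ?u = ?u \<otimes> k" using st k by (metis m_assoc)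
  have e: "(k \<otimes> ?u) \<otimes> (k \<otimes> ?u) = ?u \<otimes> ?u"
    using ku st k by (metis l_one m_assoc m_closed)
  then have "(k \<otimes> ?u) \<otimes> ((k \<otimes> ?u) \<otimes> (k \<otimes> ?u)) = \<one>"
    using order_le_3[of "k \<otimes> ?u"] u2 st k by auto
  then have "(k \<otimes> ?u) \<otimes> (?u \<otimes> ?u) = \<one>" using e by simp
  then show ?thesis using u3 st k by (metis m_assoc m_closed r_one)
qed

text \<open>The pairs \<open>(s,t)\<close> and \<open>(r,t)\<close> braid and \<open>r\<close>, \<open>s\<close> commute, so \<open>r, t, s\<close> satisfy the Coxeter
  relations of \<open>S\<^sub>4\<close>, in which \<open>rts\<close> has order 4.\<close>

lemma involution_centralizer:
  assumes st: "s \<in> carrier G" "t \<in> carrier G" "s \<otimes> s = \<one>" "t \<otimes> t = \<one>" "s \<otimes> t \<noteq> t \<otimes> s"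
    and r: "r \<in> carrier G" "r \<otimes> r = \<one>" "r \<otimes> s = s \<otimes> r" "r \<noteq> \<one>"
  shows "r = s"
proof (rule ccontr)
  assume rs: "r \<noteq> s"
  note c = st(1,2) r(1)
  have ext: "\<And>w. w \<in> carrier G \<Longrightarrow> s \<otimes> (s \<otimes> w) = w" "\<And>w. w \<in> carrier G \<Longrightarrow> t \<otimes> (t \<otimes> w) = w"
     "\<And>w. w \<in> carrier G \<Longrightarrow> r \<otimes> (r \<otimes> w) = w"
    using c st r involution_extend by blast+
  have rt: "r \<otimes> t \<noteq> t \<otimes> r" using centralizer_of_noncommuting_involutions[OF st r(1-3)] r(4) by blast
  \<comment> \<open>x t is not an involution, hence has cube 1, and (xt)^3 regroups as (x t x)(t x
    t), where t x t is an involution.\<close>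
  have braid: "x \<otimes> (t \<otimes> x) = t \<otimes> (x \<otimes> t)"
    if x: "x \<in> carrier G" "x \<otimes> x = \<one>" "x \<otimes> t \<noteq> t \<otimes> x" for x
  proof -
    have "(x \<otimes> t) \<otimes> ((x \<otimes> t) \<otimes> (x \<otimes> t)) = \<one>"
      using order_le_3[of "x \<otimes> t"] commute_of_involutions[OF x(2) st(4)] x st by auto
    then have "(x \<otimes> (t \<otimes> x)) \<otimes> (t \<otimes> (x \<otimes> t)) = \<one>" using x st by (simp add: m_assoc)
    moreover have "(t \<otimes> (x \<otimes> t)) \<otimes> (t \<otimes> (x \<otimes> t)) = \<one>"
      using x st ext(2) mult_assoc_extend[OF x(2) x(1) x(1)] by (simp add: m_assoc)
    ultimately show ?thesis using x st by (meson inv_unique m_closed right_cancel)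
  qed
  have bs: "s \<otimes> (t \<otimes> s) = t \<otimes> (s \<otimes> t)" using braid st by blast
  have br: "r \<otimes> (t \<otimes> r) = t \<otimes> (r \<otimes> t)" using braid r rt by blast
  define g where "g = r \<otimes> (t \<otimes> s)"
  have gG: "g \<in> carrier G" using c g_def by simp
  \<comment> \<open>After swapping the commuting r and s, the two braid relations make g^2 a
    conjugate of r s by t.\<close>
  have g2: "g \<otimes> g = t \<otimes> (r \<otimes> (s \<otimes> t))"
  proof -
    have "g \<otimes> g = r \<otimes> (t \<otimes> ((s \<otimes> r) \<otimes> (t \<otimes> s)))" using c by (simp add: g_def m_assoc)
    also have "\<dots> = (r \<otimes> (t \<otimes> r)) \<otimes> (s \<otimes> (t \<otimes> s))" using c by (simp add: r(3)[symmetric] m_assoc)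
    also have "\<dots> = t \<otimes> (r \<otimes> (s \<otimes> t))" unfolding bs br using c ext by (simp add: m_assoc)
    finally show ?thesis .
  qed
  have rs2: "(r \<otimes> s) \<otimes> (r \<otimes> s) = \<one>" using c r(3) ext r(2) st(3) by (metis m_assoc m_closed)
  have g4: "(g \<otimes> g) \<otimes> (g \<otimes> g) = \<one>"
    unfolding g2 using c ext rs2 st(4) by (simp add: m_assoc) (metis l_one m_assoc m_closed)
  \<comment> \<open>Since g^4 = 1, the alternative g^3 = 1 leaves only g = 1.\<close>
  have g2': "g \<otimes> g = \<one>"
    using order_le_3[OF gG] g4 gG by (auto simp: m_assoc)
  have tk: "(r \<otimes> s) \<otimes> t = t \<otimes> (r \<otimes> s)"
  proof -
    have "t \<otimes> ((r \<otimes> s) \<otimes> t) = \<one>" using g2 g2' c by (simp add: m_assoc)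
    then have "t \<otimes> (t \<otimes> ((r \<otimes> s) \<otimes> t)) = t" using c by simp
    then have "(r \<otimes> s) \<otimes> t = t" using c ext(2)[of "(r \<otimes> s) \<otimes> t"] by simp
    then have "r \<otimes> s = \<one>" using c by simp
    then show ?thesis using c by simp
  qed
  have "r \<otimes> s = \<one>"
    by (rule centralizer_of_noncommuting_involutions[OF st])
       (use c rs2 tk r(3) in \<open>auto simp: m_assoc\<close>)
  then show False using rs c st(3) ext by (metis r_one)
qed

text \<open>By \<open>involution_centralizer\<close> distinct involutions never commute, so a
  product of two of them lies in \<open>K\<close>. Since a times an involution is again an
  involution for every a in \<open>K\<close>, the identity ab = (as)(sb) writes a product of
  elements of \<open>K\<close> as a product of two involutions.\<close>

lemma dihedral_case:
  assumes st: "s \<in> carrier G" "t \<in> carrier G" "s \<otimes> s = \<one>" "t \<otimes> t = \<one>" "s \<otimes> t \<noteq> t \<otimes> s"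
  defines "K \<equiv> {g \<in> carrier G. g \<otimes> (g \<otimes> g) = \<one>}"
  shows "s \<noteq> \<one>"
    and "\<And>a b. a \<in> K \<Longrightarrow> b \<in> K \<Longrightarrow> a \<otimes> b \<in> K"
    and "\<And>a. a \<in> K \<Longrightarrow> s \<otimes> (a \<otimes> s) = inv a"
    and "\<And>g. g \<in> carrier G \<Longrightarrow> g \<in> K \<or> s \<otimes> g \<in> K"
    and "s \<otimes> t \<in> K" "s \<otimes> t \<noteq> \<one>"
proof -
  define I where "I = {g \<in> carrier G. g \<otimes> g = \<one> \<and> g \<noteq> \<one>}"
  show s1: "s \<noteq> \<one>" using st by auto
  have sI: "s \<in> I" using s1 st I_def by auto
  have nc: "r = r'" if "r \<in> I" "r' \<in> I" "r \<otimes> r' = r' \<otimes> r" for r r'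
  proof (cases "r = s")
    case True
    then show ?thesis using involution_centralizer[OF st, of r'] that unfolding I_def by auto
  next
    case False
    then have "r \<otimes> s \<noteq> s \<otimes> r" using involution_centralizer[OF st, of r] that unfolding I_def by auto
    then show ?thesis
      using involution_centralizer[of r s r'] that st unfolding I_def by auto
  qed
  \<comment> \<open>Otherwise (a r)^3 = 1, whose norm form reads p q = r with p, q conjugates of r.
    As p q is an involution, p and q commute, so p = q and r = 1.\<close>
  have inv3: "(a \<otimes> r) \<otimes> (a \<otimes> r) = \<one>" if a: "a \<in> K" and r: "r \<in> I" for a r
  proof (rule ccontr)
    assume n: "(a \<otimes> r) \<otimes> (a \<otimes> r) \<noteq> \<one>"
    have c: "a \<in> carrier G" "r \<in> carrier G" "r \<otimes> r = \<one>" "r \<noteq> \<one>" "a \<otimes> (a \<otimes> a) = \<one>"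
      using a r by (auto simp: K_def I_def)
    have ia: "inv a = a \<otimes> a" using inv_of_cube_one c by blast
    have "(a \<otimes> r) \<otimes> ((a \<otimes> r) \<otimes> (a \<otimes> r)) = \<one>" using order_le_3 n c by blast
    then have e: "(a \<otimes> r \<otimes> inv a) \<otimes> ((inv a \<otimes> r \<otimes> a) \<otimes> r) = \<one>"
      using c ia cube_one_extend[of a] by (simp add: m_assoc)
    let ?p = "a \<otimes> r \<otimes> inv a" and ?q = "inv a \<otimes> r \<otimes> a"
    have rr: "\<And>w. w \<in> carrier G \<Longrightarrow> r \<otimes> (r \<otimes> w) = w" using c involution_extend by blast
    have pq: "?p \<otimes> ?p = \<one>" "?q \<otimes> ?q = \<one>" using c rr by (simp_all add: m_assoc)
    have pqr: "?p \<otimes> ?q = r"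
    proof -
      have "(?p \<otimes> ?q) \<otimes> r = \<one>" using e c by (simp add: m_assoc)
      then show ?thesis using c by (metis inv_closed inv_equality m_closed inv_of_involution inv_inv)
    qed
    then have "?p \<otimes> ?q = ?q \<otimes> ?p" using commute_of_involutions[OF pq] c by simp
    moreover have "?p \<noteq> \<one>" "?q \<noteq> \<one>"
      using c conj_eq_one_iff[of a r] conj_eq_one_iff[of "inv a" r] by simp_all
    ultimately have "?p = ?q" using nc[of ?p ?q] pq c unfolding I_def by auto
    then show False using pq pqr c by simp
  qed
  have Kc: "\<And>a. a \<in> K \<Longrightarrow> a \<in> carrier G" by (auto simp: K_def)
  have ss: "\<And>w. w \<in> carrier G \<Longrightarrow> s \<otimes> (s \<otimes> w) = w" using st involution_extend by blast
  show invert: "s \<otimes> (a \<otimes> s) = inv a" if "a \<in> K" for a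
    using inv3[OF that sI] Kc[OF that] st by (metis inv_equality m_assoc m_closed inv_inv inv_closed)
  have prod: "r \<otimes> r' \<in> K" if "r \<in> I" "r' \<in> I" for r r'
    using nc[OF that] commute_of_involutions[of r r'] order_le_3[of "r \<otimes> r'"] that
    unfolding I_def K_def by auto
  have asI: "a \<otimes> s \<in> I" if a: "a \<in> K" for a
  proof -
    have "a \<otimes> s \<noteq> \<one>"
      using a Kc[OF a] st s1 inv_equality inv_of_involution unfolding K_def
      by (metis (mono_tags, lifting) mem_Collect_eq square_cube_one)
    then show ?thesis using inv3[OF a sI] Kc[OF a] st unfolding I_def by auto
  qed
  have saI: "s \<otimes> a \<in> I" if a: "a \<in> K" for a
  proof -
    have "s \<otimes> a = (inv a) \<otimes> s" using invert[OF a] Kc[OF a] st ss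
      by (metis m_assoc m_closed r_one)
    moreover have "inv a \<in> K" using a Kc[OF a] unfolding K_def
      by (simp add: inv_mult_group[symmetric] m_assoc)
    ultimately show ?thesis using asI by simp
  qed
  show "a \<otimes> b \<in> K" if ab: "a \<in> K" "b \<in> K" for a b
  proof -
    have "a \<otimes> b = (a \<otimes> s) \<otimes> (s \<otimes> b)" using ab Kc st ss by (simp add: m_assoc)
    then show ?thesis using prod asI saI ab by simp
  qed
  show "g \<in> K \<or> s \<otimes> g \<in> K" if g: "g \<in> carrier G" for g
    using prod[OF sI, of g] order_le_3[OF g] g unfolding I_def K_def by auto
  have "t \<in> I" using st unfolding I_def by auto
  then show "s \<otimes> t \<in> K" using prod sI by blast
  show "s \<otimes> t \<noteq> \<one>" using st by (metis inv_equality inv_of_involution r_one)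
qed

text \<open>The second claim bounds the index of a nontrivial \<open>T\<close> by 3: if g avoided
  the three cosets, then g, y, gy, gy^-1 and their translates by \<open>T\<close> would all have
  cube 1, and \<open>free_pair_trivial\<close> would make \<open>T\<close> trivial.\<close>

lemma commuting_case:
  assumes comm: "\<And>x y. x \<in> carrier G \<Longrightarrow> y \<in> carrier G \<Longrightarrow> x \<otimes> x = \<one> \<Longrightarrow> y \<otimes> y = \<one> \<Longrightarrow> x \<otimes> y = y \<otimes> x"
  defines "T \<equiv> {g \<in> carrier G. g \<otimes> g = \<one>}"
  shows "T \<lhd> G"
    and "T \<noteq> {\<one>} \<Longrightarrow> y \<in> carrier G \<Longrightarrow> y \<notin> T \<Longrightarrow> g \<in> carrier G \<Longrightarrow>
           g \<in> T \<or> g \<otimes> y \<in> T \<or> g \<otimes> inv y \<in> T"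
proof -
  have sub: "subgroup T G"
  proof (rule subgroupI)
    fix a b assume ab: "a \<in> T" "b \<in> T"
    then have ba: "b \<otimes> a = a \<otimes> b" using comm unfolding T_def by auto
    have "(a \<otimes> b) \<otimes> (a \<otimes> b) = a \<otimes> ((b \<otimes> a) \<otimes> b)" using ab by (simp add: T_def m_assoc)
    also have "\<dots> = (a \<otimes> a) \<otimes> (b \<otimes> b)" unfolding ba using ab by (simp add: T_def m_assoc)
    finally show "a \<otimes> b \<in> T" using ab by (simp add: T_def)
    show "inv a \<in> T" using ab inv_of_involution by (simp add: T_def)
  qed (auto simp: T_def)
  show nT: "T \<lhd> G"
  proof (rule normal_invI[OF sub])
    fix x h assume "x \<in> carrier G" "h \<in> T"
    moreover from this have "h \<otimes> (h \<otimes> inv x) = inv x" by (auto simp: T_def simp flip: m_assoc)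
    ultimately show "x \<otimes> h \<otimes> inv x \<in> T" by (auto simp: T_def m_assoc)
  qed
  show "g \<in> T \<or> g \<otimes> y \<in> T \<or> g \<otimes> inv y \<in> T"
    if T: "T \<noteq> {\<one>}" and y: "y \<in> carrier G" "y \<notin> T" and g: "g \<in> carrier G"
  proof (rule ccontr)
    assume n: "\<not> ?thesis"
    have cube: "(x \<otimes> t) \<otimes> ((x \<otimes> t) \<otimes> (x \<otimes> t)) = \<one>"
      if x: "x \<in> T" and t: "t \<in> {g, y, g \<otimes> y, g \<otimes> inv y}" for x t
    proof -
      have tG: "t \<in> carrier G" "t \<notin> T" using t n y g by auto
      have xG: "x \<in> carrier G" using x T_def by auto
      have "x \<otimes> t \<notin> T"
        using subgroup.m_closed[OF sub subgroup.m_inv_closed[OF sub x], of "x \<otimes> t"] tG xG by auto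
      then show ?thesis using order_le_3[of "x \<otimes> t"] tG xG unfolding T_def by auto
    qed
    have T2: "\<And>x. x \<in> T \<Longrightarrow> x \<otimes> x = \<one>" by (simp add: T_def)
    have "x = \<one>" if "x \<in> T" for x
      using free_pair_trivial[OF nT T2 g y(1) cube that] by simp
    then show False using T subgroup.one_closed[OF sub] by blast
  qed
qed

end

section \<open>Groups of prime power order\<close>

context group
begin

lemma cauchy:
  assumes "finite (carrier G)" "prime p" "p dvd order G"
  shows "\<exists>x\<in>carrier G. x \<noteq> \<one> \<and> x [^] p = \<one>"
proof -
  obtain m where "order G = p ^ 1 * m" using assms(3) by auto
  then obtain H where H: "subgroup H G" "card H = p"
    using sylow_thm[OF assms(2) is_group _ assms(1), of 1 m] by auto
  have "H \<noteq> {\<one>}" using H(2) assms(2) by auto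
  then obtain x where x: "x \<in> H" "x \<noteq> \<one>" using subgroup.one_closed[OF H(1)] by blast
  interpret H: group "G\<lparr>carrier := H\<rparr>" using subgroup_imp_group[OF H(1)] .
  have "x [^]\<^bsub>G\<lparr>carrier := H\<rparr>\<^esub> order (G\<lparr>carrier := H\<rparr>) = \<one>\<^bsub>G\<lparr>carrier := H\<rparr>\<^esub>"
    by (rule H.pow_order_eq_1) (use x in auto)
  then have "x [^] p = \<one>" using H(2) nat_pow_consistent[of x p H] by (simp add: order_def)
  then show ?thesis using x subgroup.mem_carrier[OF H(1)] by blast
qed

text \<open>A prime q other than p dividing the order would yield, by Cauchy, a nontrivial element
  whose order divides both q and a power of p.\<close>

lemma order_prime_power:
  assumes fin: "finite (carrier G)" and p: "prime p"
    and pow: "\<And>x. x \<in> carrier G \<Longrightarrow> \<exists>k. x [^] (p ^ k) = \<one>"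
  shows "\<exists>n. order G = p ^ n"
proof -
  have "order G \<noteq> 0" using fin order_gt_0_iff_finite by simp
  then obtain n m where nm: "order G = p ^ n * m" "\<not> p dvd m"
    by (metis multiplicity_decompose' not_prime_unit p)
  have "m = 1"
  proof (rule ccontr)
    assume "m \<noteq> 1"
    then obtain q where q: "prime q" "q dvd m" using prime_factor_nat by blast
    then have "q dvd order G" using nm by simp
    then obtain x where x: "x \<in> carrier G" "x \<noteq> \<one>" "x [^] q = \<one>" using cauchy[OF fin q(1)] by blast
    obtain k where "x [^] (p ^ k) = \<one>" using pow[OF x(1)] by blast
    then have "ord x dvd p ^ k" using pow_eq_id[OF x(1)] by simp
    moreover have "ord x dvd q" using x pow_eq_id[OF x(1)] by simp
    moreover have "coprime (p ^ k) q"
      using q nm(2) p by (metis coprime_power_left_iff primes_coprime)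
    ultimately have "ord x = 1" by (metis coprime_common_divisor nat_dvd_1_iff_1)
    then show False using x ord_eq_1 by blast
  qed
  then show ?thesis using nm by auto
qed

lemma card_subgroup_dvd:
  assumes "subgroup H G" "subgroup K G" "H \<subseteq> K"
  shows "card H dvd card K"
proof -
  from group.lagrange[OF subgroup_imp_group[OF assms(2)] subgroup_incl[OF assms]]
  have "card K = card (rcosets\<^bsub>G\<lparr>carrier := K\<rparr>\<^esub> H) * card H" by (simp add: order_def)
  then show ?thesis by simp
qed

lemma group_center_mem:
  "z \<in> group_center G \<longleftrightarrow> z \<in> carrier G \<and> (\<forall>x\<in>carrier G. z \<otimes> x = x \<otimes> z)"
  by (auto simp: group_center_def)

lemma group_center_commute:
  assumes "z \<in> group_center G" "x \<in> carrier G"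
  shows "z \<otimes> x = x \<otimes> z"
  using assms by (auto simp: group_center_def)

lemma group_center_carrier:
  assumes "z \<in> group_center G"
  shows "z \<in> carrier G"
  using assms by (auto simp: group_center_def)

lemma commute_inv:
  assumes "a \<otimes> x = x \<otimes> a" "a \<in> carrier G" "x \<in> carrier G"
  shows "inv a \<otimes> x = x \<otimes> inv a"
proof -
  have "inv a \<otimes> x = inv a \<otimes> ((x \<otimes> a) \<otimes> inv a)" using assms(2,3) by (simp add: m_assoc)
  also have "\<dots> = x \<otimes> inv a" unfolding assms(1)[symmetric] using assms(2,3) by (simp add: m_assoc)
  finally show ?thesis .
qed

lemma commute_mult:
  assumes "a \<otimes> x = x \<otimes> a" "b \<otimes> x = x \<otimes> b" "a \<in> carrier G" "b \<in> carrier G" "x \<in> carrier G"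
  shows "(a \<otimes> b) \<otimes> x = x \<otimes> (a \<otimes> b)"
proof -
  have "(a \<otimes> b) \<otimes> x = a \<otimes> (x \<otimes> b)" using assms(2-5) by (simp add: m_assoc)
  also have "\<dots> = (a \<otimes> x) \<otimes> b" using assms(3-5) by (simp add: m_assoc)
  finally show ?thesis using assms(1,3-5) by (simp add: m_assoc)
qed

lemma subgroup_of_center_normal:
  assumes "subgroup N G" "N \<subseteq> group_center G"
  shows "N \<lhd> G"
proof (rule normal_invI[OF assms(1)])
  fix x h assume xh: "x \<in> carrier G" "h \<in> N"
  then have "x \<otimes> h = h \<otimes> x" "h \<in> carrier G"
    using assms(2) group_center_commute group_center_carrier by (metis subsetD)+
  then show "x \<otimes> h \<otimes> inv x \<in> N" using xh by (simp add: m_assoc)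
qed

lemma group_center_subgroup: "subgroup (group_center G) G"
proof (rule subgroupI)
  show "group_center G \<subseteq> carrier G" by (auto simp: group_center_def)
  show "group_center G \<noteq> {}" using group_center_mem[of \<one>] by auto
  fix a b assume a: "a \<in> group_center G" and b: "b \<in> group_center G"
  note c = group_center_carrier[OF a] group_center_carrier[OF b]
  show "inv a \<in> group_center G"
    unfolding group_center_mem using c a commute_inv group_center_commute by blast
  show "a \<otimes> b \<in> group_center G"
    unfolding group_center_mem using c a b commute_mult group_center_commute by blast
qed

text \<open>Class equation: orbits under conjugation have p-power length. Were the centre trivial,
  {1} would be the only orbit of length 1 and p would divide 1.\<close>

lemma prime_power_center:
  assumes p: "prime p" and o: "order G = p ^ n" "n > 0"
  shows "group_center G \<noteq> {\<one>}"
proof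
  assume triv: "group_center G = {\<one>}"
  define \<phi> where "\<phi> = (\<lambda>g. \<lambda>h \<in> carrier G. g \<otimes> h \<otimes> inv g)"
  interpret group_action G "carrier G" \<phi>
    unfolding \<phi>_def by (rule action_by_conjugation)
  have fin: "finite (carrier G)"
    using o p order_gt_0_iff_finite prime_gt_0_nat by (metis zero_less_power)
  have orb1: "orbit G \<phi> x = {x}" if "x = \<one>" for x
    using that by (auto simp: orbit_def \<phi>_def intro!: exI[of _ \<one>])
  have dv: "p dvd card ob" if ob: "ob \<in> orbits G (carrier G) \<phi>" "ob \<noteq> {\<one>}" for ob
  proof -
    obtain x where x: "x \<in> carrier G" "ob = orbit G \<phi> x" using ob(1) by (auto simp: orbits_def)
    have "card ob dvd p ^ n" using orbit_stabilizer_theorem[OF x(1)] o x(2) by (metis dvd_triv_left)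
    then obtain i where i: "card ob = p ^ i" using p divides_primepow_nat by blast
    have "i \<noteq> 0"
    proof
      assume "i = 0"
      then have "card ob = 1" using i by simp
      moreover have "x \<in> ob" using x orbit_refl by blast
      ultimately have "ob = {x}" by (metis card_1_singletonE singletonD)
      then have "\<And>g. g \<in> carrier G \<Longrightarrow> g \<otimes> x \<otimes> inv g = x"
        using x by (auto simp: orbit_def \<phi>_def)
      then have "x \<in> group_center G" using x conj_eq_iff by (auto simp: group_center_mem)
      then show False using triv ob \<open>ob = {x}\<close> by simp
    qed
    then show ?thesis using i by simp
  qed
  have one_orb: "{\<one>} \<in> orbits G (carrier G) \<phi>" using orb1[of \<one>] by (auto simp: orbits_def)
  have fo: "finite (orbits G (carrier G) \<phi>)"
    using fin by (simp add: orbits_def)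
  have "(\<Sum>ob\<in>orbits G (carrier G) \<phi>. card ob) = order G"
    using disjoint_sum[OF fin, of "\<lambda>_. 1::nat"] by (simp add: order_def)
  then have "order G = 1 + (\<Sum>ob\<in>orbits G (carrier G) \<phi> - {{\<one>}}. card ob)"
    using sum.remove[OF fo one_orb, of card] by simp
  moreover have "p dvd (\<Sum>ob\<in>orbits G (carrier G) \<phi> - {{\<one>}}. card ob)"
    using dv by (intro dvd_sum) auto
  moreover have "p dvd order G" using o by simp
  ultimately have "p dvd 1" by (metis dvd_add_left_iff)
  then show False using p by simp
qed

end

section \<open>Nilpotent groups\<close>

lemma lower_central_Suc:
  "lower_central G (Suc n) = commutator_subgroup G (lower_central G n) (carrier G)"
  by (simp add: lower_central_def)

lemma lower_central_0: "lower_central G 0 = carrier G"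
  by (simp add: lower_central_def)

context group
begin

lemma commutator_subgroup_center:
  assumes "H \<subseteq> group_center G"
  shows "commutator_subgroup G H (carrier G) = {\<one>}"
proof -
  have "h \<otimes> k \<otimes> inv h \<otimes> inv k = \<one>" if "h \<in> H" "k \<in> carrier G" for h k
  proof -
    have "h \<otimes> k = k \<otimes> h" "h \<in> carrier G" using that assms by (auto simp: group_center_def)
    then show ?thesis using that by (simp add: m_assoc)
  qed
  then have "(\<Union>h\<in>H. \<Union>k\<in>carrier G. {h \<otimes> k \<otimes> inv h \<otimes> inv k}) \<subseteq> {\<one>}" by auto
  then have "commutator_subgroup G H (carrier G) \<subseteq> {\<one>}"
    unfolding commutator_subgroup_def using triv_subgroup by (rule generate_subgroup_incl)
  then show ?thesis unfolding commutator_subgroup_def using generate.one by blast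
qed

lemma nilpotent_of_central:
  assumes "lower_central G n \<subseteq> group_center G"
  shows "lower_central G (Suc n) = {\<one>}"
  using commutator_subgroup_center[OF assms] by (simp add: lower_central_Suc)

lemma order_mod:
  assumes "N \<lhd> G"
  shows "order (G Mod N) * card N = order G"
  using lagrange[of N] assms normal_imp_subgroup by (auto simp: order_def FactGroup_def)

lemma quotient_hom:
  assumes "N \<lhd> G"
  shows "group_hom G (G Mod N) (\<lambda>a. N #> a)"
  using normal.r_coset_hom_Mod[OF assms] normal.factorgroup_is_group[OF assms]
  by (simp add: group_hom_def group_hom_axioms_def)

lemma rcos_eq_one_iff:
  assumes "subgroup N G" "x \<in> carrier G"
  shows "N #> x = N \<longleftrightarrow> x \<in> N"
  using assms coset_join1 coset_join2 subgroup.subset by metis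

text \<open>Induction on the index. G/N has a nontrivial centre, and its preimage \<open>Z\<close>
  has smaller index, again a power of p. Once a term of the series lies in \<open>Z\<close>, the
  next one lies in \<open>N\<close>, because commutators of \<open>Z\<close> with G do.\<close>

lemma lower_central_in_prime_power_index:
  assumes fin: "finite (carrier G)" and p: "prime p"
  shows "N \<lhd> G \<Longrightarrow> order (G Mod N) = p ^ k \<Longrightarrow> \<exists>n. lower_central G n \<subseteq> N"
proof (induction k arbitrary: N rule: less_induct)
  case (less k)
  note N = less.prems(1)
  let ?Q = "G Mod N"
  interpret h: group_hom G ?Q "\<lambda>a. N #> a" using quotient_hom[OF N] .
  have sN: "subgroup N G" using N normal_imp_subgroup by blast
  have mem: "\<And>x. x \<in> carrier G \<Longrightarrow> N #> x = \<one>\<^bsub>?Q\<^esub> \<longleftrightarrow> x \<in> N" using rcos_eq_one_iff[OF sN] by simp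
  show ?case
  proof (cases "k = 0")
    case True
    then have "card N = card (carrier G)" using order_mod[OF N] less.prems(2) by (simp add: order_def)
    then have "N = carrier G" using card_subset_eq[OF fin subgroup.subset[OF sN]] by simp
    then show ?thesis using lower_central_0[of G] by blast
  next
    case False
    define Z where "Z = {g \<in> carrier G. N #> g \<in> group_center ?Q}"
    have sZ: "subgroup Z G"
      using subgroup.subset[OF h.H.group_center_subgroup] subgroup.one_closed[OF h.H.group_center_subgroup]
        subgroup.m_closed[OF h.H.group_center_subgroup] subgroup.m_inv_closed[OF h.H.group_center_subgroup]
        h.hom_mult h.hom_inv h.hom_one unfolding Z_def
      by (intro subgroupI) (auto simp del: one_FactGroup mult_FactGroup)
    have nZ: "Z \<lhd> G"
    proof (rule normal_invI[OF sZ])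
      fix x g assume x: "x \<in> carrier G" and g: "g \<in> Z"
      have gG: "g \<in> carrier G" and c: "N #> g \<in> group_center ?Q" using g Z_def by auto
      have "N #> (x \<otimes> g \<otimes> inv x) = (N #> x) \<otimes>\<^bsub>?Q\<^esub> (N #> g) \<otimes>\<^bsub>?Q\<^esub> inv\<^bsub>?Q\<^esub> (N #> x)"
        using x gG h.hom_mult h.hom_inv by (simp del: mult_FactGroup)
      also have "\<dots> = N #> g"
        using c h.hom_closed[OF x] h.hom_closed[OF gG] h.H.conj_eq_iff
        by (metis h.H.group_center_mem)
      finally show "x \<otimes> g \<otimes> inv x \<in> Z" using c x gG by (simp add: Z_def)
    qed
    have NZ: "N \<subseteq> Z"
    proof
      fix x assume x: "x \<in> N"
      then have xG: "x \<in> carrier G" using subgroup.mem_carrier[OF sN] by blast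
      then show "x \<in> Z" using x mem[OF xG] subgroup.one_closed[OF h.H.group_center_subgroup]
        unfolding Z_def by simp
    qed
    obtain q where q: "q \<in> group_center ?Q" "q \<noteq> \<one>\<^bsub>?Q\<^esub>"
      using h.H.prime_power_center[OF p less.prems(2)] False
        subgroup.one_closed[OF h.H.group_center_subgroup] by blast
    obtain g where g: "g \<in> carrier G" "q = N #> g"
      using q(1) by (auto simp: h.H.group_center_mem carrier_FactGroup)
    have "g \<in> Z" "g \<notin> N" using g q mem Z_def by auto
    then have lt: "card N < card Z"
      using NZ finite_subset[OF subgroup.subset[OF sZ] fin] by (intro psubset_card_mono) auto
    have "card N dvd card Z" using card_subgroup_dvd[OF sN sZ NZ] .
    then obtain j where j: "card Z = card N * j" by auto
    have cN: "card N > 0"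
      using subgroup.finite_imp_card_positive[OF sN fin] .
    have "order (G Mod Z) * j * card N = p ^ k * card N"
      using order_mod[OF N] order_mod[OF nZ] less.prems(2) j by (simp add: mult_ac)
    then have e: "order (G Mod Z) * j = p ^ k" using cN by simp
    then obtain i where i: "i \<le> k" "order (G Mod Z) = p ^ i" using p divides_primepow_nat
      by (metis dvd_triv_left)
    have "i \<noteq> k"
    proof
      assume "i = k"
      then have "j = 1" using e i p by (simp add: prime_gt_0_nat)
      then show False using lt j by simp
    qed
    then obtain n where n: "lower_central G n \<subseteq> Z" using less.IH[OF _ nZ i(2)] i(1) by auto
    have "lower_central G (Suc n) \<subseteq> N"
      unfolding lower_central_Suc commutator_subgroup_def
    proof (rule generate_subgroup_incl[OF _ sN], clarify)
      fix x y assume x: "x \<in> lower_central G n" and y: "y \<in> carrier G"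
      have xG: "x \<in> carrier G" and c: "N #> x \<in> group_center ?Q" using x n Z_def by auto
      have "N #> (x \<otimes> y \<otimes> inv x \<otimes> inv y) =
          (N #> x) \<otimes>\<^bsub>?Q\<^esub> (N #> y) \<otimes>\<^bsub>?Q\<^esub> inv\<^bsub>?Q\<^esub> (N #> x) \<otimes>\<^bsub>?Q\<^esub> inv\<^bsub>?Q\<^esub> (N #> y)"
        using xG y h.hom_mult h.hom_inv by (simp del: mult_FactGroup)
      also have "\<dots> = \<one>\<^bsub>?Q\<^esub>"
        using c h.hom_closed[OF xG] h.hom_closed[OF y] h.H.conj_eq_iff[of "N #> x" "N #> y"]
          h.H.r_inv[of "N #> y"] by (auto simp: h.H.group_center_mem simp del: mult_FactGroup one_FactGroup)
      finally have e: "N #> (x \<otimes> y \<otimes> inv x \<otimes> inv y) = \<one>\<^bsub>?Q\<^esub>" .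
      have "x \<otimes> y \<otimes> inv x \<otimes> inv y \<in> carrier G" using xG y by simp
      from iffD1[OF mem[OF this] e] show "x \<otimes> y \<otimes> inv x \<otimes> inv y \<in> N" .
    qed
    then show ?thesis by blast
  qed
qed

text \<open>Once the series has reached the central \<open>N\<close>, one more commutator step makes
  it trivial.\<close>

lemma nilpotent_of_central_prime_power_index:
  assumes "finite (carrier G)" "prime p" "subgroup N G" "N \<subseteq> group_center G" "order (G Mod N) = p ^ k"
  shows "nilpotent_group G"
proof -
  note nN = subgroup_of_center_normal[OF assms(3,4)]
  from lower_central_in_prime_power_index[OF assms(1,2) nN assms(5)]
  obtain n where "lower_central G n \<subseteq> N" ..
  then have "lower_central G (Suc n) = {\<one>}"
    by (rule nilpotent_of_central[OF subset_trans[OF _ assms(4)]])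
  then show ?thesis unfolding nilpotent_group_def using is_group by metis
qed

lemma prime_power_nilpotent:
  assumes "finite (carrier G)" "prime p" "order G = p ^ k"
  shows "nilpotent_group G"
proof (rule nilpotent_of_central_prime_power_index[OF assms(1,2), of "{\<one>}"])
  show "subgroup {\<one>} G" by (rule triv_subgroup)
  show "{\<one>} \<subseteq> group_center G" using subgroup.one_closed[OF group_center_subgroup] by simp
  show "order (G Mod {\<one>}) = p ^ k" using order_mod[OF one_is_normal] assms(3) by simp
qed

end

section \<open>Isomorphism from generators of equal order\<close>

context group
begin

text \<open>\<open>N\<close> need not be known to be a subgroup; in the applications it is a list of
  normal forms. Left multiplication by a generator is an injective self-map of the finite
  \<open>N\<close>, hence onto, so inverses of generators come for free.\<close>

lemma generate_left_closed:
  assumes S: "S \<subseteq> carrier G" and N: "finite N" "N \<subseteq> carrier G" "\<one> \<in> N"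
    and cl: "\<And>s n. s \<in> S \<Longrightarrow> n \<in> N \<Longrightarrow> s \<otimes> n \<in> N"
  shows "generate G S \<subseteq> N"
proof -
  have inv_cl: "inv s \<otimes> n \<in> N" if s: "s \<in> S" and n: "n \<in> N" for s n
  proof -
    have sG: "s \<in> carrier G" using S s by blast
    have "(\<lambda>n. s \<otimes> n) ` N = N"
      by (rule endo_inj_surj[OF N(1)]) (use cl[OF s] sG N(2) in \<open>auto simp: inj_on_def subset_iff\<close>)
    then obtain m where "m \<in> N" "n = s \<otimes> m" using n by blast
    then show ?thesis using sG N(2) by (simp add: subset_iff)
  qed
  have "\<forall>n\<in>N. g \<otimes> n \<in> N" if "g \<in> generate G S" for g
    using that
  proof (induction rule: generate.induct)
    case (eng h1 h2)
    have "h1 \<in> carrier G" "h2 \<in> carrier G" using eng generate_in_carrier S by auto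
    then show ?case using eng N(2) by (auto simp: m_assoc subset_iff)
  qed (use N cl inv_cl in \<open>auto simp: subset_iff\<close>)
  then show ?thesis using N(3) generate_in_carrier[OF S] by force
qed

lemma subgroup_generated_carrier:
  assumes "S \<subseteq> carrier G"
  shows "subgroup_generated G S = G\<lparr>carrier := generate G S\<rparr>"
  using assms by (simp add: subgroup_generated_def Int_absorb1)

end

text \<open>\<open>h\<close> maps the generated subgroup onto the one generated by the images; equal
  finite orders make this map injective.\<close>

lemma (in group_hom) image_iso:
  assumes S: "S \<subseteq> carrier G"
    and fin: "finite (generate G S)" and c: "card (generate H (h ` S)) = card (generate G S)"
  shows "subgroup_generated G S \<cong> subgroup_generated H (h ` S)"
proof -
  have hS: "h ` S \<subseteq> carrier H" using S by auto
  have im: "h ` generate G S = generate H (h ` S)" using generate_img[OF S] by simp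
  have "inj_on h (generate G S)" by (rule eq_card_imp_inj_on[OF fin]) (simp add: im c)
  moreover have "h \<in> hom (subgroup_generated G S) (subgroup_generated H (h ` S))"
    using im G.generate_in_carrier[OF S]
    by (auto simp: hom_def G.subgroup_generated_carrier[OF S] H.subgroup_generated_carrier[OF hS])
  ultimately have "h \<in> iso (subgroup_generated G S) (subgroup_generated H (h ` S))"
    using im by (simp add: iso_def bij_betw_def G.subgroup_generated_carrier[OF S]
        H.subgroup_generated_carrier[OF hS])
  then show ?thesis by (rule is_isoI)
qed

lemma mem_image_pairs: "n \<in> (\<lambda>(c, d). f c d) ` (A \<times> B) \<longleftrightarrow> (\<exists>c\<in>A. \<exists>d\<in>B. n = f c d)"
  by auto

text \<open>By Goursat: the subgroup of \<open>A \<times> B\<close> generated by the pairs projects onto both sides.\<close>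

lemma iso_of_diagonal_order:
  assumes A: "group A" and B: "group B"
    and x: "x \<in> carrier A" "y \<in> carrier A" and x': "x' \<in> carrier B" "y' \<in> carrier B"
    and c: "card (generate A {x, y}) = c" "card (generate B {x', y'}) = c"
      "card (generate (A \<times>\<times> B) {(x, x'), (y, y')}) = c" "c > 0"
  shows "subgroup_generated A {x, y} \<cong> subgroup_generated B {x', y'}"
proof -
  interpret A: group A by fact
  interpret B: group B by fact
  interpret AB: group "A \<times>\<times> B" using A B by (rule DirProd_group)
  let ?S = "{(x, x'), (y, y')}"
  have S: "?S \<subseteq> carrier (A \<times>\<times> B)" using x x' by auto
  have fin: "finite (generate (A \<times>\<times> B) ?S)" using c by (metis card_gt_0_iff)
  have f: "group_hom (A \<times>\<times> B) A fst" and g: "group_hom (A \<times>\<times> B) B snd"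
    using A B AB.is_group by (auto simp: group_hom_def group_hom_axioms_def hom_def mult_DirProd')
  have 1: "subgroup_generated (A \<times>\<times> B) ?S \<cong> subgroup_generated A (fst ` ?S)"
    by (rule group_hom.image_iso[OF f S fin]) (use c in simp)
  have 2: "subgroup_generated (A \<times>\<times> B) ?S \<cong> subgroup_generated B (snd ` ?S)"
    by (rule group_hom.image_iso[OF g S fin]) (use c in simp)
  have "subgroup_generated A (fst ` ?S) \<cong> subgroup_generated (A \<times>\<times> B) ?S"
    using group.iso_sym[OF AB.group_subgroup_generated 1] .
  then show ?thesis using 2 iso_trans by fastforce
qed

lemma DirProd_nat_pow:
  "(a, b) [^]\<^bsub>A \<times>\<times> B\<^esub> (n::nat) = (a [^]\<^bsub>A\<^esub> n, b [^]\<^bsub>B\<^esub> n)"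
  by (induction n) auto

section \<open>Orders of two-generator groups\<close>

context group
begin

text \<open>The subgroup is the union of <y> and x<y>, which are disjoint because x lies outside
  <y>.\<close>

lemma card_generate_commuting_pair:
  assumes x: "x \<in> carrier G" "x \<otimes> x = \<one>" and y: "y \<in> carrier G" "ord y = k" "k > 0"
    and xy: "x \<otimes> y = y \<otimes> x" "x \<notin> generate G {y}"
  shows "card (generate G {x, y}) = 2 * k"
proof -
  let ?Y = "generate G {y}"
  have Y: "subgroup ?Y G" using y by (intro generate_is_subgroup) auto
  have cY: "card ?Y = k" using generate_pow_card[OF y(1)] y by simp
  have fY: "finite ?Y" using cY y by (metis card_gt_0_iff)
  have YG: "\<And>v. v \<in> ?Y \<Longrightarrow> v \<in> carrier G" using subgroup.mem_carrier[OF Y] .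
  let ?N = "?Y \<union> (\<lambda>v. x \<otimes> v) ` ?Y"
  have yY: "y \<in> ?Y" by (simp add: generate.incl)
  have "generate G {x, y} \<subseteq> ?N"
  proof (rule generate_left_closed)
    fix s n assume s: "s \<in> {x, y}" and n: "n \<in> ?N"
    then obtain v where v: "v \<in> ?Y" "n = v \<or> n = x \<otimes> v" by blast
    have e: "y \<otimes> (x \<otimes> v) = x \<otimes> (y \<otimes> v)" using xy x y YG[OF v(1)] by (metis m_assoc)
    have yv: "y \<otimes> v \<in> ?Y" using subgroup.m_closed[OF Y yY v(1)] .
    show "s \<otimes> n \<in> ?N"
      using s v(2) e yv v(1) involution_extend[OF x(2,1) YG[OF v(1)]] by auto
  qed (use x y fY YG subgroup.one_closed[OF Y] in auto)
  moreover have "?N \<subseteq> generate G {x, y}"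
    using mono_generate[of "{y}" "{x, y}"] generate.eng[OF generate.incl[of x "{x,y}"]] by blast
  ultimately have e: "generate G {x, y} = ?N" by blast
  have "inj_on (\<lambda>v. x \<otimes> v) ?Y" using x YG by (auto simp: inj_on_def)
  then have c: "card ((\<lambda>v. x \<otimes> v) ` ?Y) = k" using cY by (simp add: card_image)
  have "?Y \<inter> (\<lambda>v. x \<otimes> v) ` ?Y = {}"
  proof (rule ccontr)
    assume "\<not> ?thesis"
    then obtain u v where uv: "u \<in> ?Y" "v \<in> ?Y" "u = x \<otimes> v" by blast
    then have "x = u \<otimes> inv v" using x YG by (simp add: m_assoc)
    moreover have "u \<otimes> inv v \<in> ?Y"
      using uv subgroup.m_closed[OF Y] subgroup.m_inv_closed[OF Y] by blast
    ultimately show False using xy(2) by simp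
  qed
  then show ?thesis unfolding e using card_Un_disjoint[OF fY _] fY cY c by simp
qed

end

text \<open>The (2,3,3) triangle relations, a presentation of A_4. In every proper quotient of A_4
  the image of x is trivial, so requiring x nontrivial excludes collapse.\<close>

locale tetrahedral_pair = group +
  fixes x y
  assumes xy: "x \<in> carrier G" "y \<in> carrier G"
    and x2: "x \<otimes> x = \<one>" and x1: "x \<noteq> \<one>" and y3: "y \<otimes> (y \<otimes> y) = \<one>"
    and xy3: "(x \<otimes> y) \<otimes> ((x \<otimes> y) \<otimes> (x \<otimes> y)) = \<one>"
begin

text \<open>With x, these conjugates are the involutions of a Klein four-group \<open>V\<close>, and
  \<open>N\<close> collects the normal forms of A_4 = \<open>V\<close> <y>.\<close>

definition "p = y \<otimes> x \<otimes> inv y"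
definition "q = inv y \<otimes> x \<otimes> y"
definition "V = {\<one>, x, p, q}"
definition "N = (\<lambda>(v, w). v \<otimes> w) ` (V \<times> {\<one>, y, inv y})"

lemma pq [simp]: "p \<in> carrier G" "q \<in> carrier G"
  using xy by (simp_all add: p_def q_def)

lemma inv_y: "inv y = y \<otimes> y" using inv_of_cube_one y3 xy by blast

lemma squares: "p \<otimes> p = \<one>" "q \<otimes> q = \<one>"
  using involution_extend[OF x2] xy by (simp_all add: p_def q_def m_assoc)

text \<open>This is (xy)^3 = 1 in the norm form of \<open>cube_twist\<close>.\<close>

lemma x_p_q: "x \<otimes> (p \<otimes> q) = \<one>"
  using cube_twist[OF xy y3] xy3 by (simp add: p_def q_def)

lemma p_q: "p \<otimes> q = x"
  using x_p_q xy x2 by (metis involution_extend m_closed pq r_one)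

lemma q_p: "q \<otimes> p = x"
  using p_q commute_of_involutions[OF squares] x2 by simp

lemma V_table:
  "x \<otimes> p = q" "p \<otimes> x = q" "x \<otimes> q = p" "q \<otimes> x = p"
  using p_q q_p squares involution_extend pq mult_assoc_extend r_one
  by (metis m_assoc)+

lemma nontrivial: "p \<noteq> \<one>" "q \<noteq> \<one>"
  using conj_eq_one_iff[of y x] conj_eq_one_iff[of "inv y" x] xy x1 by (simp_all add: p_def q_def)

lemma distinct_V: "x \<noteq> p" "x \<noteq> q" "p \<noteq> q"
  using nontrivial V_table p_q squares x1 x2 by metis+

lemma subgroup_V: "subgroup V G"
  by (rule subgroupI)
     (use xy inv_of_involution x2 squares V_table p_q q_p in \<open>auto simp: V_def\<close>)

lemma card_V: "card V = 4"
  using distinct_V nontrivial x1 by (auto simp: V_def)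

lemma conj_V: "y \<otimes> x = p \<otimes> y" "y \<otimes> p = q \<otimes> y" "y \<otimes> q = x \<otimes> y"
proof -
  show "y \<otimes> x = p \<otimes> y" using xy by (simp add: p_def m_assoc)
  show "y \<otimes> q = x \<otimes> y" using xy by (simp add: q_def m_assoc)
  have "y \<otimes> p = y \<otimes> (y \<otimes> (x \<otimes> (y \<otimes> y)))" using xy by (simp add: p_def inv_y m_assoc)
  also have "\<dots> = q \<otimes> y" using xy by (simp add: q_def inv_y m_assoc)
  finally show "y \<otimes> p = q \<otimes> y" .
qed

lemma V_conj_closed: "v \<in> V \<Longrightarrow> y \<otimes> v \<otimes> inv y \<in> V" "v \<in> V \<Longrightarrow> inv y \<otimes> v \<otimes> y \<in> V"
proof -
  have "\<And>u. u \<in> V \<Longrightarrow> u \<in> carrier G" using subgroup.mem_carrier[OF subgroup_V] .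
  show "v \<in> V \<Longrightarrow> y \<otimes> v \<otimes> inv y \<in> V" using conj_V xy by (auto simp: V_def m_assoc)
  have "inv y \<otimes> x \<otimes> y = q" "inv y \<otimes> p \<otimes> y = x" "inv y \<otimes> q \<otimes> y = p"
    using conj_V[symmetric] xy by (simp_all add: q_def[symmetric] m_assoc)
  then show "v \<in> V \<Longrightarrow> inv y \<otimes> v \<otimes> y \<in> V" using xy by (auto simp: V_def)
qed

lemma generate_subset_N: "generate G {x, y} \<subseteq> N"
proof (rule generate_left_closed)
  have VG: "\<And>u. u \<in> V \<Longrightarrow> u \<in> carrier G" using subgroup.mem_carrier[OF subgroup_V] .
  show "finite N" by (simp add: N_def V_def)
  show "N \<subseteq> carrier G" using VG xy by (auto simp: N_def)
  show "\<one> \<in> N" unfolding N_def by (rule image_eqI[of _ _ "(\<one>, \<one>)"]) (auto simp: V_def)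
  fix s n assume s: "s \<in> {x, y}" and "n \<in> N"
  then obtain v w where vw: "v \<in> V" "w \<in> {\<one>, y, inv y}" "n = v \<otimes> w" unfolding N_def mem_image_pairs by blast
  have wG: "w \<in> carrier G" using vw xy by auto
  have N: "a \<otimes> b \<in> N" if "a \<in> V" "b \<in> {\<one>, y, inv y}" for a b
    unfolding N_def using that by (intro image_eqI[of _ _ "(a, b)"]) auto
  have "x \<otimes> n = (x \<otimes> v) \<otimes> w" using vw VG wG xy by (simp add: m_assoc)
  moreover have "x \<otimes> v \<in> V" using subgroup.m_closed[OF subgroup_V] vw(1) by (auto simp: V_def)
  ultimately have 1: "x \<otimes> n \<in> N" using N vw by simp
  have "y \<otimes> n = (y \<otimes> v \<otimes> inv y) \<otimes> (y \<otimes> w)" using vw VG wG xy by (simp add: m_assoc)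
  moreover have "y \<otimes> w \<in> {\<one>, y, inv y}" using vw(2) xy inv_y r_inv[of y] by fastforce
  ultimately have "y \<otimes> n \<in> N" using N V_conj_closed(1)[OF vw(1)] by simp
  then show "s \<otimes> n \<in> N" using 1 s by auto
qed (use xy in auto)

lemma card_N: "card N \<le> 12"
proof -
  have "finite (V \<times> {\<one>, y, inv y})" by (simp add: V_def)
  then have "card N \<le> card (V \<times> {\<one>, y, inv y})" unfolding N_def by (rule card_image_le)
  also have "\<dots> \<le> 4 * 3"
    unfolding card_cartesian_product card_V by (intro mult_le_mono) (auto simp: card_insert_if)
  finally show ?thesis by simp
qed

lemma y_neq_one: "y \<noteq> \<one>"
  using xy3 x1 x2 xy by auto

lemma ord_y: "ord y = 3"
proof -
  have "ord y dvd 3" using pow_eq_id[of y 3] y3 xy by (simp add: numeral_3_eq_3 m_assoc)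
  moreover have "ord y \<noteq> 1" using ord_eq_1 xy y_neq_one by blast
  moreover have "prime (3::nat)" by simp
  ultimately show ?thesis by (meson prime_nat_iff)
qed

text \<open>The subgroups \<open>V\<close> of order 4 and <y> of order 3 give divisibility by 12;
  the normal forms give the bound 12.\<close>

lemma card_generate: "card (generate G {x, y}) = 12"
proof -
  let ?H = "generate G {x, y}"
  have H: "subgroup ?H G" using xy by (intro generate_is_subgroup) auto
  have i: "x \<in> ?H" "y \<in> ?H" by (auto intro: generate.incl)
  have "p \<in> ?H" "q \<in> ?H" unfolding p_def q_def
    using i subgroup.m_closed[OF H] subgroup.m_inv_closed[OF H] by simp_all
  then have "V \<subseteq> ?H" using i subgroup.one_closed[OF H] by (auto simp: V_def)
  then have 4: "4 dvd card ?H" using card_subgroup_dvd[OF subgroup_V H] card_V by simp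
  have "generate G {y} \<subseteq> ?H" by (rule mono_generate) auto
  then have 3: "3 dvd card ?H"
    using card_subgroup_dvd[OF generate_is_subgroup H, of "{y}"] generate_pow_card[of y] ord_y xy by simp
  have fN: "finite N" by (simp add: N_def V_def)
  have "card ?H \<le> 12" using card_mono[OF fN generate_subset_N] card_N by simp
  moreover have "card ?H > 0"
    using finite_subset[OF generate_subset_N fN] i by (auto simp: card_gt_0_iff)
  moreover have "12 dvd card ?H" using 3 4 by presburger
  ultimately show ?thesis by (meson dvd_imp_le le_antisym)
qed

text \<open>Such an element is v w with w = y or w = y^-1, and its cube is the norm of v under w.
  The norm of an involution of \<open>V\<close> is the product of all three involutions, which is
  1.\<close>

lemma outside_V:
  assumes "g \<in> generate G {x, y}" "g \<notin> V"
  shows "g \<otimes> (g \<otimes> g) = \<one>"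
proof -
  have VG: "\<And>u. u \<in> V \<Longrightarrow> u \<in> carrier G" using subgroup.mem_carrier[OF subgroup_V] .
  obtain v w where vw: "v \<in> V" "w \<in> {\<one>, y, inv y}" "g = v \<otimes> w"
    using subsetD[OF generate_subset_N assms(1)] unfolding N_def mem_image_pairs by blast
  have w: "w = y \<or> w = inv y" using vw assms(2) VG by auto
  have w3: "w \<otimes> (w \<otimes> w) = \<one>" using w y3 xy by (auto simp: m_assoc inv_y)
  have cj: "y \<otimes> x \<otimes> inv y = p" "y \<otimes> p \<otimes> inv y = q" "y \<otimes> q \<otimes> inv y = x"
    unfolding conj_V using xy by (simp_all add: m_assoc)
  have cj': "inv y \<otimes> x \<otimes> y = q" "inv y \<otimes> p \<otimes> y = x" "inv y \<otimes> q \<otimes> y = p"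
    using conj_V[symmetric] xy by (simp_all add: m_assoc)
  have "v \<otimes> ((w \<otimes> v \<otimes> inv w) \<otimes> (inv w \<otimes> v \<otimes> w)) = \<one>"
    using vw(1) w cj cj' V_table p_q q_p x2 squares xy by (auto simp: V_def)
  then show ?thesis using cube_twist[of v w] w3 w vw VG xy by auto
qed

lemma V_squares: "u \<in> V \<Longrightarrow> u \<otimes> u = \<one>"
  using x2 squares by (auto simp: V_def)

end

text \<open>Defining relations of the quaternion group with t in the role of -1; requiring t
  nontrivial keeps a and b from commuting.\<close>

locale quaternion_pair = group +
  fixes a b t
  assumes ab: "a \<in> carrier G" "b \<in> carrier G"
    and aa: "a \<otimes> a = t" and bb: "b \<otimes> b = t" and t1: "t \<noteq> \<one>" and tt: "t \<otimes> t = \<one>"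
    and ba: "b \<otimes> a = t \<otimes> (a \<otimes> b)"
begin

definition "M = (\<lambda>(c, d). c \<otimes> d) ` ({\<one>, t} \<times> {\<one>, a, b, a \<otimes> b})"

lemma tG [simp]: "t \<in> carrier G"
  using aa ab by auto

lemma t_central: "a \<otimes> t = t \<otimes> a" "b \<otimes> t = t \<otimes> b"
  using aa bb ab m_assoc by metis+

lemma generate_subset_M: "generate G {a, b} \<subseteq> M"
proof (rule generate_left_closed)
  show "finite M" by (simp add: M_def)
  show "M \<subseteq> carrier G" using ab by (auto simp: M_def)
  have M: "c \<otimes> d \<in> M" if "c \<in> {\<one>, t}" "d \<in> {\<one>, a, b, a \<otimes> b}" for c d
    unfolding M_def using that by (intro image_eqI[of _ _ "(c, d)"]) auto
  show "\<one> \<in> M" using M[of \<one> \<one>] by simp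
  fix s n assume s: "s \<in> {a, b}" and "n \<in> M"
  then obtain c d where cd: "c \<in> {\<one>, t}" "d \<in> {\<one>, a, b, a \<otimes> b}" "n = c \<otimes> d"
    unfolding M_def mem_image_pairs by blast
  have cG: "c \<in> carrier G" "d \<in> carrier G" "s \<in> carrier G" using cd s ab by auto
  have ct: "c \<otimes> t \<in> {\<one>, t}" "c \<in> {\<one>, t}" using cd(1) tt by auto
  have "s \<otimes> c = c \<otimes> s" using cd(1) s t_central ab by auto
  then have e: "s \<otimes> n = c \<otimes> (s \<otimes> d)" using cG cd(3) by (metis m_assoc)
  have "\<exists>c'\<in>{\<one>, t}. \<exists>d'\<in>{\<one>, a, b, a \<otimes> b}. s \<otimes> d = c' \<otimes> d'"
  proof -
    have "a \<otimes> (a \<otimes> b) = t \<otimes> b" using aa ab by (simp flip: m_assoc)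
    moreover have "b \<otimes> (a \<otimes> b) = \<one> \<otimes> a"
    proof -
      have "b \<otimes> (a \<otimes> b) = (b \<otimes> a) \<otimes> b" using ab by (simp add: m_assoc)
      also have "\<dots> = t \<otimes> (a \<otimes> t)" unfolding ba using ab bb by (simp add: m_assoc)
      also have "\<dots> = t \<otimes> (t \<otimes> a)" by (simp add: t_central)
      finally show ?thesis using involution_extend[OF tt] ab by simp
    qed
    moreover have "a \<otimes> b = \<one> \<otimes> (a \<otimes> b)" "a \<otimes> \<one> = \<one> \<otimes> a" "b \<otimes> \<one> = \<one> \<otimes> b"
      "a \<otimes> a = t \<otimes> \<one>" "b \<otimes> b = t \<otimes> \<one>" using ab aa bb by auto
    ultimately show ?thesis using s cd(2) ba by blast
  qed
  then obtain c' d' where c': "c' \<in> {\<one>, t}" "d' \<in> {\<one>, a, b, a \<otimes> b}" "s \<otimes> d = c' \<otimes> d'" by blast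
  have "c \<otimes> c' \<in> {\<one>, t}" using cd(1) c'(1) tt by auto
  moreover have "s \<otimes> n = (c \<otimes> c') \<otimes> d'" using e c' cG ab by (auto simp: m_assoc)
  ultimately show "s \<otimes> n \<in> M" using M c'(2) by simp
qed (use ab in auto)

lemma a_powers:
  "generate G {a} \<subseteq> {\<one>, t, a, t \<otimes> a}" "ord a = 4"
proof -
  have a4: "a [^] (4::nat) = \<one>" and a2: "a [^] (2::nat) = t"
    using aa tt ab by (simp_all add: numeral_eq_Suc m_assoc)
  have "ord a dvd 2 ^ 2" using pow_eq_id[OF ab(1)] a4 by simp
  then obtain i where i: "i \<le> 2" "ord a = 2 ^ i" using divides_primepow_nat two_is_prime_nat by blast
  have "\<not> ord a dvd 2" using pow_eq_id[OF ab(1), of 2] a2 t1 by simp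
  then have "i = 2" using i by (cases "i = 0"; cases "i = 1") auto
  then show "ord a = 4" using i by simp
  show "generate G {a} \<subseteq> {\<one>, t, a, t \<otimes> a}"
    by (rule generate_left_closed) (use ab t_central aa tt in \<open>auto simp flip: m_assoc simp: involution_extend\<close>)
qed

text \<open>Powers of a commute with a, while b a = t (a b) with t nontrivial.\<close>

lemma b_notin: "b \<notin> generate G {a}"
proof
  assume "b \<in> generate G {a}"
  then have "b \<in> {\<one>, t, a, t \<otimes> a}" using a_powers by blast
  then have "b \<otimes> a = a \<otimes> b" using t_central ab by (auto simp: m_assoc) (metis m_assoc tG t_central)
  then have "t \<otimes> (a \<otimes> b) = a \<otimes> b" using ba by simp
  then show False using t1 ab by simp
qed

text \<open>At most 8 by the normal forms \<open>M\<close>, a multiple of 4 by Lagrange, and more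
  than 4 because b lies outside <a>.\<close>

lemma card_quaternion: "card (generate G {a, b}) = 8"
proof -
  let ?H = "generate G {a, b}"
  have H: "subgroup ?H G" using ab by (intro generate_is_subgroup) auto
  have A: "subgroup (generate G {a}) G" using ab by (intro generate_is_subgroup) auto
  have fM: "finite M" by (simp add: M_def)
  have fin: "finite ?H" using finite_subset[OF generate_subset_M fM] .
  have "card M \<le> card ({\<one>, t} \<times> {\<one>, a, b, a \<otimes> b})" unfolding M_def by (rule card_image_le) simp
  also have "\<dots> \<le> 2 * 4" unfolding card_cartesian_product by (intro mult_le_mono) (auto simp: card_insert_if)
  finally have le: "card ?H \<le> 8" using card_mono[OF fM generate_subset_M] by simp
  have sub: "generate G {a} \<subseteq> ?H" by (rule mono_generate) auto
  have ca: "card (generate G {a}) = 4" using generate_pow_card[OF ab(1)] a_powers by simp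
  have "b \<in> ?H" by (auto intro: generate.incl)
  then have "card (generate G {a}) < card ?H" using sub b_notin fin by (intro psubset_card_mono) auto
  moreover have "4 dvd card ?H" using card_subgroup_dvd[OF A H sub] ca by simp
  ultimately show ?thesis using ca le by presburger
qed

end

text \<open>The conjugates of \<open>v\<close> under \<open>z\<close> generate a \<open>Q\<^sub>8\<close>.\<close>

locale binary_tetrahedral_pair = group +
  fixes v z
  assumes vz: "v \<in> carrier G" "z \<in> carrier G"
    and z3: "z \<otimes> (z \<otimes> z) = \<one>" and vz3: "(v \<otimes> z) \<otimes> ((v \<otimes> z) \<otimes> (v \<otimes> z)) = \<one>"
    and v2: "v \<otimes> v \<noteq> \<one>" and v4: "(v \<otimes> v) \<otimes> (v \<otimes> v) = \<one>"
    and zv2: "z \<otimes> (v \<otimes> v) = (v \<otimes> v) \<otimes> z"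
begin

definition "w = z \<otimes> v \<otimes> inv z"
definition "w' = inv z \<otimes> v \<otimes> z"
definition "t = v \<otimes> v"

lemma ww' [simp]: "w \<in> carrier G" "w' \<in> carrier G" "t \<in> carrier G"
  using vz by (simp_all add: w_def w'_def t_def)

lemma inv_z: "inv z = z \<otimes> z" using inv_of_cube_one z3 vz by blast

lemma t_square: "t \<otimes> t = \<one>" using v4 by (simp add: t_def)

lemma w_square: "w \<otimes> w = t" "w' \<otimes> w' = t"
proof -
  have zt: "z \<otimes> t = t \<otimes> z" using zv2 by (simp add: t_def)
  have "w \<otimes> w = z \<otimes> t \<otimes> inv z" using vz by (simp add: w_def t_def m_assoc)
  then show "w \<otimes> w = t" unfolding zt using vz by (simp add: m_assoc)
  have "w' \<otimes> w' = inv z \<otimes> (t \<otimes> z)" using vz by (simp add: w'_def t_def m_assoc)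
  then show "w' \<otimes> w' = t" unfolding zt[symmetric] using vz by (simp add: m_assoc)
qed

lemma inv_vw: "inv v = t \<otimes> v" "inv w = t \<otimes> w" "inv w' = t \<otimes> w'"
proof -
  have "inv x = t \<otimes> x" if "x \<otimes> x = t" "x \<in> carrier G" for x
    using that t_square by (intro inv_equality) (auto simp: m_assoc)
  then show "inv v = t \<otimes> v" "inv w = t \<otimes> w" "inv w' = t \<otimes> w'"
    using w_square vz t_def by auto
qed

lemma t_comm: "v \<otimes> t = t \<otimes> v" "w \<otimes> t = t \<otimes> w"
proof -
  have "x \<otimes> t = t \<otimes> x" if e: "x \<otimes> x = t" and x: "x \<in> carrier G" for x
    unfolding e[symmetric] using x by (simp add: m_assoc)
  then show "v \<otimes> t = t \<otimes> v" "w \<otimes> t = t \<otimes> w" using w_square vz t_def by auto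
qed

lemma v_w_w': "v \<otimes> (w \<otimes> w') = \<one>"
  using cube_twist[OF vz z3] vz3 by (simp add: w_def w'_def)

lemma vw_w': "v \<otimes> w = inv w'"
  using v_w_w' vz by (metis inv_equality inv_inv m_assoc m_closed ww')

text \<open>From v w w' = 1 follows w' = (vw)^-1 = w^-1 v^-1, which is w v once the two factors t
  have cancelled. Since v w = w'^-1 = t w', the products in the two orders differ by t.\<close>

lemma w_v: "w \<otimes> v = t \<otimes> (v \<otimes> w)"
proof -
  have "inv (v \<otimes> w) = w'" using vw_w' by simp
  then have "(t \<otimes> w) \<otimes> (t \<otimes> v) = w'" using inv_mult_group[of v w] inv_vw vz by simp
  moreover have "(t \<otimes> w) \<otimes> (t \<otimes> v) = t \<otimes> ((w \<otimes> t) \<otimes> v)" using vz by (simp add: m_assoc)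
  moreover have "\<dots> = t \<otimes> (t \<otimes> (w \<otimes> v))" unfolding t_comm using vz by (simp add: m_assoc)
  ultimately have "w \<otimes> v = w'" using vz involution_extend[OF t_square] by simp
  then show ?thesis using vw_w' inv_vw involution_extend[OF t_square] by simp
qed

sublocale Q: quaternion_pair G v w t
  by unfold_locales (use vz w_square v2 t_square w_v in \<open>auto simp: t_def[symmetric]\<close>)

abbreviation "Q \<equiv> generate G {v, w}"

lemma subgroup_Q: "subgroup Q G"
  using vz by (intro generate_is_subgroup) auto

lemma w'_in_Q: "w' \<in> Q"
proof -
  have "w' = inv (v \<otimes> w)" using vw_w' by simp
  moreover have "v \<in> Q" "w \<in> Q" by (auto intro: generate.incl)
  ultimately show ?thesis
    using subgroup.m_closed[OF subgroup_Q] subgroup.m_inv_closed[OF subgroup_Q] by simp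
qed

text \<open>Conjugation by z cycles v, w, w', and w' = (vw)^-1 already lies in
  \<open>Q\<close>.\<close>

lemma Q_conj: "u \<in> Q \<Longrightarrow> z \<otimes> u \<otimes> inv z \<in> Q"
proof (induction rule: generate.induct)
  have zw: "z \<otimes> w \<otimes> inv z = w'" and zv: "z \<otimes> v \<otimes> inv z = w"
    using vz by (simp_all add: w_def w'_def inv_z m_assoc cube_one_extend[OF z3])
  {
    case one
    then show ?case using vz subgroup.one_closed[OF subgroup_Q] by simp
  next
    case (incl h)
    then show ?case using zw zv w'_in_Q by (auto intro: generate.incl)
  next
    case (inv h)
    then have "z \<otimes> h \<otimes> inv z \<in> Q" "h \<in> carrier G" using zw zv w'_in_Q vz by (auto intro: generate.incl)
    then have "inv (z \<otimes> h \<otimes> inv z) \<in> Q" using subgroup.m_inv_closed[OF subgroup_Q] by blast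
    then show ?case using \<open>h \<in> carrier G\<close> vz by (simp add: inv_mult_group m_assoc)
  next
    case (eng h1 h2)
    then have "h1 \<in> carrier G" "h2 \<in> carrier G" using subgroup.mem_carrier[OF subgroup_Q] by auto
    then show ?case using conj_mult vz subgroup.m_closed[OF subgroup_Q eng.IH] by simp
  }
qed

lemma z_neq_one: "z \<noteq> \<one>"
proof
  assume "z = \<one>"
  then have "t \<otimes> v = \<one>" using vz3 vz by (simp add: t_def m_assoc)
  then have "v = t" using inv_equality[of t v] inv_of_involution[OF t_square] vz by (metis inv_inv ww'(3))
  then show False using t_square v2 by simp
qed

text \<open>Products of elements of \<open>Q\<close> with powers of z number at most 8 times 3, and
  both 8 and 3 divide the order.\<close>

lemma card_generate: "card (generate G {v, z}) = 24"
proof -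
  let ?H = "generate G {v, z}"
  let ?Z = "{\<one>, z, inv z}"
  define R where "R = (\<lambda>(u, c). u \<otimes> c) ` (Q \<times> ?Z)"
  have H: "subgroup ?H G" using vz by (intro generate_is_subgroup) auto
  have i: "v \<in> ?H" "z \<in> ?H" by (auto intro: generate.incl)
  have QG: "\<And>u. u \<in> Q \<Longrightarrow> u \<in> carrier G" using subgroup.mem_carrier[OF subgroup_Q] .
  have fQ: "finite Q" using Q.card_quaternion by (metis card.infinite zero_neq_numeral)
  have fR: "finite R" using fQ by (simp add: R_def)
  have sub: "?H \<subseteq> R"
  proof (rule generate_left_closed)
    show "R \<subseteq> carrier G" using QG vz by (auto simp: R_def)
    have R: "u \<otimes> c \<in> R" if "u \<in> Q" "c \<in> ?Z" for u c
      unfolding R_def using that by (intro image_eqI[of _ _ "(u, c)"]) auto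
    show "\<one> \<in> R" using R[of \<one> \<one>] subgroup.one_closed[OF subgroup_Q] by simp
    fix s n assume s: "s \<in> {v, z}" and "n \<in> R"
    then obtain u c where uc: "u \<in> Q" "c \<in> ?Z" "n = u \<otimes> c"
      unfolding R_def mem_image_pairs by blast
    have cG: "c \<in> carrier G" using uc vz by auto
    have "v \<otimes> n = (v \<otimes> u) \<otimes> c" using uc QG cG vz by (simp add: m_assoc)
    moreover have "v \<otimes> u \<in> Q" using subgroup.m_closed[OF subgroup_Q] uc(1) by (auto intro: generate.incl)
    ultimately have 1: "v \<otimes> n \<in> R" using R uc by simp
    have "z \<otimes> n = (z \<otimes> u \<otimes> inv z) \<otimes> (z \<otimes> c)" using uc QG cG vz by (simp add: m_assoc)
    moreover have "z \<otimes> c \<in> ?Z" using uc(2) vz inv_z r_inv[of z] by fastforce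
    ultimately have "z \<otimes> n \<in> R" using R Q_conj uc(1) by simp
    then show "s \<otimes> n \<in> R" using s 1 by auto
  qed (use vz fR in auto)
  have "card R \<le> card (Q \<times> ?Z)" unfolding R_def using fQ by (intro card_image_le) auto
  also have "\<dots> \<le> 8 * 3"
    unfolding card_cartesian_product Q.card_quaternion by (intro mult_le_mono) (auto simp: card_insert_if)
  finally have le: "card ?H \<le> 24" using card_mono[OF fR sub] by simp
  have "w \<in> ?H" unfolding w_def
    using i subgroup.m_closed[OF H] subgroup.m_inv_closed[OF H] by simp
  then have "Q \<subseteq> ?H" using i H by (intro generate_subgroup_incl) auto
  then have 8: "8 dvd card ?H" using card_subgroup_dvd[OF subgroup_Q H] Q.card_quaternion by simp
  have "generate G {z} \<subseteq> ?H" by (rule mono_generate) auto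
  moreover have "ord z = 3"
  proof -
    have "ord z dvd 3" using pow_eq_id[of z 3] z3 vz by (simp add: numeral_3_eq_3 m_assoc)
    moreover have "ord z \<noteq> 1" using ord_eq_1 vz z_neq_one by blast
    moreover have "prime (3::nat)" by simp
    ultimately show ?thesis by (meson prime_nat_iff)
  qed
  ultimately have 3: "3 dvd card ?H"
    using card_subgroup_dvd[OF generate_is_subgroup H, of "{z}"] generate_pow_card[of z] vz by simp
  have "card ?H > 0" using finite_subset[OF sub fR] i by (auto simp: card_gt_0_iff)
  moreover have "24 dvd card ?H" using 3 8 by presburger
  ultimately show ?thesis using le by (meson dvd_imp_le le_antisym)
qed

end

section \<open>The concrete groups\<close>

lemma (in group) iso_pow_one:
  assumes i: "G \<cong> H" and H: "group H"
    and e: "\<And>t. t \<in> carrier H \<Longrightarrow> t [^]\<^bsub>H\<^esub> (n::nat) = \<one>\<^bsub>H\<^esub> \<or> t [^]\<^bsub>H\<^esub> (m::nat) = \<one>\<^bsub>H\<^esub>"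
    and g: "g \<in> carrier G"
  shows "g [^] n = \<one> \<or> g [^] m = \<one>"
proof -
  obtain f where f: "f \<in> iso G H" using i by (auto simp: is_iso_def)
  interpret group_hom G H f using f H by (simp add: group_hom_def group_hom_axioms_def iso_def)
  have inj: "inj_on f (carrier G)" using f by (simp add: iso_def bij_betw_def)
  have "g [^] k = \<one>" if "(f g) [^]\<^bsub>H\<^esub> k = \<one>\<^bsub>H\<^esub>" for k :: nat
  proof -
    have "f (g [^] k) = f \<one>" using that g hom_nat_pow hom_one by simp
    from inj_onD[OF inj this] show ?thesis using g by simp
  qed
  then show ?thesis using e g hom_closed by blast
qed

lemma product_group_pow:
  "f \<in> carrier (product_group I H) \<Longrightarrow> f [^]\<^bsub>product_group I H\<^esub> (n::nat) = (\<lambda>i\<in>I. f i [^]\<^bsub>H i\<^esub> n)"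
  by (induction n) (auto simp: fun_eq_iff)

lemma group_cyclic_power [simp]: "group (cyclic_power k n)"
  by (simp add: cyclic_power_def)

lemma comm_group_product:
  assumes "\<And>i. i \<in> I \<Longrightarrow> comm_group (H i)"
  shows "comm_group (product_group I H)"
proof -
  have "group (product_group I H)" using assms comm_group.axioms(2) by (intro product_group) blast
  moreover have "x \<otimes>\<^bsub>product_group I H\<^esub> y = y \<otimes>\<^bsub>product_group I H\<^esub> x"
    if "x \<in> carrier (product_group I H)" "y \<in> carrier (product_group I H)" for x y
    using that assms by (auto simp: fun_eq_iff comm_groupE(4) PiE_iff)
  ultimately show ?thesis by (rule group.group_comm_groupI)
qed

lemma comm_group_cyclic_power [simp]: "comm_group (cyclic_power k n)"
  unfolding cyclic_power_def by (rule comm_group_product) simp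

lemma comm_group_DirProd:
  assumes "comm_group A" "comm_group B"
  shows "comm_group (A \<times>\<times> B)"
  using assms comm_groupE(4)[OF assms(1)] comm_groupE(4)[OF assms(2)]
  by (intro group.group_comm_groupI DirProd_group) (auto simp: comm_group.axioms)

lemma cyclic_power_pow:
  assumes "f \<in> carrier (cyclic_power k n)"
  shows "f [^]\<^bsub>cyclic_power k n\<^esub> k = \<one>\<^bsub>cyclic_power k n\<^esub>"
  using assms product_group_pow[of f "{1..n}" "\<lambda>_. integer_mod_group k" k]
  by (auto simp: cyclic_power_def fun_eq_iff)

lemma card_cyclic_power: "k > 0 \<Longrightarrow> card (carrier (cyclic_power k n)) = k ^ n"
  by (simp add: cyclic_power_def card_PiE carrier_integer_mod_group)

lemma integer_mod_group_ord:
  assumes "k > 0" "k \<noteq> 1"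
  shows "group.ord (integer_mod_group k) 1 = k"
proof -
  interpret group "integer_mod_group k" by simp
  have "1 \<in> carrier (integer_mod_group k)" using assms by simp
  moreover have "1 [^]\<^bsub>integer_mod_group k\<^esub> (n::nat) = \<one>\<^bsub>integer_mod_group k\<^esub> \<longleftrightarrow> k dvd n" for n
    using assms by (simp add: mod_eq_0_iff_dvd)
  ultimately show ?thesis using ord_unique by metis
qed

subsection \<open>The alternating group\<close>

text \<open>This and \<open>A4_rotation\<close> are (1 2)(3 4) and the 3-cycle 1 -> 2 -> 3 -> 1;
  their product again has order 3.\<close>

definition A4_involution where "A4_involution = Transposition.transpose 1 2 \<circ> Transposition.transpose 3 (4::nat)"
definition A4_rotation where "A4_rotation = Transposition.transpose 1 2 \<circ> Transposition.transpose 2 (3::nat)"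

lemma A4_apply:
  "A4_involution n = (if n = 1 then 2 else if n = 2 then 1 else if n = 3 then 4 else if n = 4 then 3 else n)"
  "A4_rotation n = (if n = 1 then 2 else if n = 2 then 3 else if n = 3 then 1 else n)"
  by (simp_all add: A4_involution_def A4_rotation_def Transposition.transpose_def)

lemma A4_words:
  "A4_involution \<circ> A4_involution = id" "A4_rotation \<circ> (A4_rotation \<circ> A4_rotation) = id"
  "(A4_involution \<circ> A4_rotation) \<circ> ((A4_involution \<circ> A4_rotation) \<circ> (A4_involution \<circ> A4_rotation)) = id"
  "A4_involution \<noteq> id"
proof -
  have cs: "n = 1 \<or> n = 2 \<or> n = 3 \<or> n = 4 \<or> (n \<noteq> 1 \<and> n \<noteq> 2 \<and> n \<noteq> 3 \<and> n \<noteq> 4)" for n :: nat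
    by blast
  have "(A4_involution \<circ> A4_involution) n = n \<and> (A4_rotation \<circ> (A4_rotation \<circ> A4_rotation)) n = n \<and>
    ((A4_involution \<circ> A4_rotation) \<circ> ((A4_involution \<circ> A4_rotation) \<circ> (A4_involution \<circ> A4_rotation))) n = n" for n
    using cs[of n] by (elim disjE) (simp_all add: A4_apply)
  then show "A4_involution \<circ> A4_involution = id" "A4_rotation \<circ> (A4_rotation \<circ> A4_rotation) = id"
    "(A4_involution \<circ> A4_rotation) \<circ> ((A4_involution \<circ> A4_rotation) \<circ> (A4_involution \<circ> A4_rotation)) = id"
    unfolding fun_eq_iff id_apply by blast+
  have "A4_involution 1 \<noteq> id 1" by (simp add: A4_apply)
  then show "A4_involution \<noteq> id" by metis
qed

lemma A4_mem: "A4_involution \<in> carrier (alt_group 4)" "A4_rotation \<in> carrier (alt_group 4)"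
  unfolding A4_involution_def A4_rotation_def alt_group_carrier
  by (auto intro!: permutes_compose permutes_swap_id simp: evenperm_comp permutation_swap_id evenperm_swap)

interpretation A4: tetrahedral_pair "alt_group 4" A4_involution A4_rotation
  using alt_group_is_group[of 4] A4_words A4_mem
  by (simp add: tetrahedral_pair_def tetrahedral_pair_axioms_def alt_group_mult alt_group_one)

lemma A4_generate: "generate (alt_group 4) {A4_involution, A4_rotation} = carrier (alt_group 4)"
proof (rule card_subset_eq)
  have "2 * card (carrier (alt_group 4)) = fact 4" by (rule alt_group_card_carrier) simp
  then show "card (generate (alt_group 4) {A4_involution, A4_rotation}) = card (carrier (alt_group 4))"
    using A4.card_generate by (simp add: fact_numeral)
  then show "finite (carrier (alt_group 4))" using A4.card_generate by (metis card.infinite zero_neq_numeral)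
  show "generate (alt_group 4) {A4_involution, A4_rotation} \<subseteq> carrier (alt_group 4)"
    using A4_mem by (intro A4.generate_incl) auto
qed

text \<open>The pairs in the direct product satisfy the same relations, so all three orders are 12
  and \<open>iso_of_diagonal_order\<close> applies. \<open>iso_Q8\<close> and
  \<open>iso_SL23\<close> follow the same pattern with orders 8 and 24.\<close>

lemma (in tetrahedral_pair) iso_A4: "subgroup_generated G {x, y} \<cong> alt_group 4"
proof -
  interpret P: tetrahedral_pair "G \<times>\<times> alt_group 4" "(x, A4_involution)" "(y, A4_rotation)"
    using DirProd_group[OF is_group alt_group_is_group[of 4]] xy A4.xy x1 A4.x1 x2 A4.x2 y3 A4.y3 xy3 A4.xy3
    by (simp add: tetrahedral_pair_def tetrahedral_pair_axioms_def)
  have "subgroup_generated G {x, y} \<cong> subgroup_generated (alt_group 4) {A4_involution, A4_rotation}"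
    using iso_of_diagonal_order[OF is_group A4.is_group xy A4.xy card_generate A4.card_generate P.card_generate]
    by simp
  moreover have "subgroup_generated (alt_group 4) {A4_involution, A4_rotation} = alt_group 4"
    using A4.subgroup_generated_carrier[of "{A4_involution, A4_rotation}"] A4.xy A4_generate by simp
  ultimately show ?thesis by simp
qed

lemma A4_exponents:
  assumes "g \<in> carrier (alt_group 4)"
  shows "g [^]\<^bsub>alt_group 4\<^esub> (2::nat) = \<one>\<^bsub>alt_group 4\<^esub> \<or> g [^]\<^bsub>alt_group 4\<^esub> (3::nat) = \<one>\<^bsub>alt_group 4\<^esub>"
proof (cases "g \<in> A4.V")
  case True
  then have "g [^]\<^bsub>alt_group 4\<^esub> (2::nat) = \<one>\<^bsub>alt_group 4\<^esub>"
    using A4.V_squares assms by (simp add: numeral_2_eq_2)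
  then show ?thesis ..
next
  case False
  then have "g [^]\<^bsub>alt_group 4\<^esub> (3::nat) = \<one>\<^bsub>alt_group 4\<^esub>"
    using A4.outside_V A4_generate assms by (simp add: numeral_3_eq_3 A4.m_assoc)
  then show ?thesis ..
qed

text \<open>The image of x is an involution, hence lies in the Klein four-group. The image of y does
  not, as otherwise both would generate at most 4 elements; so the image of xy lies outside too, and
  elements outside have cube 1.\<close>

lemma (in group) A4_generators:
  assumes xy: "x \<in> carrier G" "y \<in> carrier G" and x: "x \<otimes> x = \<one>" "x \<noteq> \<one>"
    and iso: "subgroup_generated G {x, y} \<cong> alt_group 4"
  shows "y \<otimes> (y \<otimes> y) = \<one>" "(x \<otimes> y) \<otimes> ((x \<otimes> y) \<otimes> (x \<otimes> y)) = \<one>"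
proof -
  let ?S = "subgroup_generated G {x, y}" and ?A = "alt_group 4"
  have cS: "carrier ?S = generate G {x, y}" using xy by (simp add: subgroup_generated_carrier)
  have mem: "x \<in> carrier ?S" "y \<in> carrier ?S" unfolding cS by (auto intro: generate.incl)
  have "generate (G\<lparr>carrier := generate G {x, y}\<rparr>) {x, y} = generate G {x, y}"
    using xy by (intro generate_consistent generate_is_subgroup) (auto intro: generate.incl)
  then have genS: "generate ?S {x, y} = carrier ?S" using xy by (simp add: subgroup_generated_carrier)
  obtain f where f: "f \<in> iso ?S ?A" using iso by (auto simp: is_iso_def)
  interpret group_hom ?S ?A f using f by (simp add: group_hom_def group_hom_axioms_def iso_def A4.is_group)
  have inj: "inj_on f (carrier ?S)" and im: "f ` carrier ?S = carrier ?A"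
    using f by (auto simp: iso_def bij_betw_def)
  have ker: "u = \<one>" if "u \<in> carrier ?S" "f u = \<one>\<^bsub>?A\<^esub>" for u
    using inj_onD[OF inj, of u \<one>] that hom_one G.one_closed by simp
  have fx2: "f x \<otimes>\<^bsub>?A\<^esub> f x = \<one>\<^bsub>?A\<^esub>" using hom_mult[OF mem(1) mem(1)] x(1) hom_one by simp
  have fxV: "f x \<in> A4.V"
  proof (rule ccontr)
    assume "f x \<notin> A4.V"
    then have "f x = \<one>\<^bsub>?A\<^esub>"
      using A4.square_cube_one[OF fx2 A4.outside_V[of "f x"]] A4_generate hom_closed[OF mem(1)] by blast
    then show False using ker[OF mem(1)] x(2) by simp
  qed
  have gen: "generate ?A {f x, f y} = carrier ?A"
    using generate_img[of "{x, y}"] mem im genS by simp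
  have fyV: "f y \<notin> A4.V"
  proof
    assume "f y \<in> A4.V"
    then have "carrier ?A \<subseteq> A4.V"
      unfolding gen[symmetric] using fxV A4.subgroup_V by (intro A4.generate_subgroup_incl) auto
    then have "card (carrier ?A) \<le> 4" using A4.card_V card_mono[of A4.V "carrier ?A"] by (simp add: A4.V_def)
    then show False using A4.card_generate A4_generate by simp
  qed
  have fxyV: "f x \<otimes>\<^bsub>?A\<^esub> f y \<notin> A4.V"
  proof
    assume "f x \<otimes>\<^bsub>?A\<^esub> f y \<in> A4.V"
    then have "inv\<^bsub>?A\<^esub> f x \<otimes>\<^bsub>?A\<^esub> (f x \<otimes>\<^bsub>?A\<^esub> f y) \<in> A4.V"
      using subgroup.m_closed[OF A4.subgroup_V subgroup.m_inv_closed[OF A4.subgroup_V fxV]] by blast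
    then show False using fyV mem by simp
  qed
  have cube: "u \<otimes> (u \<otimes> u) = \<one>" if u: "u \<in> carrier ?S" "f u \<notin> A4.V" for u
  proof -
    have "f (u \<otimes> (u \<otimes> u)) = f u \<otimes>\<^bsub>?A\<^esub> (f u \<otimes>\<^bsub>?A\<^esub> f u)"
      using hom_mult[OF u(1)] u(1) G.m_closed[OF u(1) u(1)] by simp
    also have "\<dots> = \<one>\<^bsub>?A\<^esub>" using A4.outside_V u A4_generate hom_closed by simp
    finally show ?thesis using ker G.m_closed[OF u(1) G.m_closed[OF u(1) u(1)]] by simp
  qed
  show "y \<otimes> (y \<otimes> y) = \<one>" using cube mem fyV by blast
  have "x \<otimes> y \<in> carrier ?S" "f (x \<otimes> y) = f x \<otimes>\<^bsub>?A\<^esub> f y"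
    using G.m_closed[OF mem] hom_mult[OF mem] by simp_all
  then show "(x \<otimes> y) \<otimes> ((x \<otimes> y) \<otimes> (x \<otimes> y)) = \<one>" using cube[of "x \<otimes> y"] fxyV by simp
qed

subsection \<open>The quaternion group\<close>

text \<open>Four integer squares sum to 1 only if one of them is 1 and the rest vanish. The explicit
  list reduces closure and the order to finite checks.\<close>

lemma quaternion_carrier:
  "carrier quaternion_group = {(1,0,0,0), (-1,0,0,0), (0,1,0,0), (0,-1,0,0),
     (0,0,1,0), (0,0,-1,0), (0,0,0,1), (0,0,0,-1)}"
proof -
  have unit: "a = -1 \<or> a = 0 \<or> a = 1" if "a\<^sup>2 \<le> 1" for a :: int
    using that by (simp add: abs_square_le_1) linarith
  have "(a, b, c, d) \<in> {(1,0,0,0), (-1,0,0,0), (0,1,0,0), (0,-1,0,0),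
     (0,0,1,0), (0,0,-1,0), (0,0,0,1), (0,0,0,-1)}" if e: "a\<^sup>2 + b\<^sup>2 + c\<^sup>2 + d\<^sup>2 = 1" for a b c d :: int
  proof -
    have "a\<^sup>2 \<le> 1" "b\<^sup>2 \<le> 1" "c\<^sup>2 \<le> 1" "d\<^sup>2 \<le> 1"
      using e zero_le_power2[of a] zero_le_power2[of b] zero_le_power2[of c] zero_le_power2[of d]
      by linarith+
    then have "a = -1 \<or> a = 0 \<or> a = 1" "b = -1 \<or> b = 0 \<or> b = 1"
      "c = -1 \<or> c = 0 \<or> c = 1" "d = -1 \<or> d = 0 \<or> d = 1" using unit by blast+
    then show ?thesis using e by (elim disjE) simp_all
  qed
  note sub = this
  show ?thesis
  proof (intro equalityI subsetI)
    fix u assume "u \<in> carrier quaternion_group"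
    moreover obtain a b c d where "u = (a, b, c, d)" by (cases u)
    ultimately show "u \<in> {(1,0,0,0), (-1,0,0,0), (0,1,0,0), (0,-1,0,0),
     (0,0,1,0), (0,0,-1,0), (0,0,0,1), (0,0,0,-1)}" using sub[of a b c d] by (simp add: quaternion_group_def)
  qed (elim insertE emptyE; simp add: quaternion_group_def)
qed

lemma group_quaternion: "group quaternion_group"
proof (rule groupI)
  fix u assume "u \<in> carrier quaternion_group"
  moreover obtain a b c d where "u = (a, b, c, d)" by (cases u)
  ultimately have u: "u = (a, b, c, d)" "a\<^sup>2 + b\<^sup>2 + c\<^sup>2 + d\<^sup>2 = 1"
    by (simp_all add: quaternion_group_def)
  \<comment> \<open>The inverse of a unit quaternion is its conjugate.\<close>
  then have "(a, -b, -c, -d) \<otimes>\<^bsub>quaternion_group\<^esub> u = \<one>\<^bsub>quaternion_group\<^esub>"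
    by (simp add: quaternion_group_def power2_eq_square algebra_simps)
  moreover have "(a, -b, -c, -d) \<in> carrier quaternion_group" using u by (simp add: quaternion_group_def)
  ultimately show "\<exists>v\<in>carrier quaternion_group. v \<otimes>\<^bsub>quaternion_group\<^esub> u = \<one>\<^bsub>quaternion_group\<^esub>" by blast
next
  fix u v assume "u \<in> carrier quaternion_group" "v \<in> carrier quaternion_group"
  then show "u \<otimes>\<^bsub>quaternion_group\<^esub> v \<in> carrier quaternion_group"
    unfolding quaternion_carrier by (elim insertE emptyE) (simp_all add: quaternion_group_def)
next
  show "\<one>\<^bsub>quaternion_group\<^esub> \<in> carrier quaternion_group" by (simp add: quaternion_group_def)
qed (auto simp: quaternion_group_def algebra_simps)

text \<open>The quaternions i, j and -1.\<close>

interpretation Q8: quaternion_pair quaternion_group "(0,1,0,0)" "(0,0,1,0)" "(-1,0,0,0)"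
  using group_quaternion
  by (simp add: quaternion_pair_def quaternion_pair_axioms_def) (simp add: quaternion_group_def)

lemma Q8_generate: "generate quaternion_group {(0,1,0,0), (0,0,1,0)} = carrier quaternion_group"
proof (rule card_subset_eq)
  show "card (generate quaternion_group {(0,1,0,0), (0,0,1,0)}) = card (carrier quaternion_group)"
    unfolding Q8.card_quaternion by (simp add: quaternion_carrier)
  show "finite (carrier quaternion_group)" by (simp add: quaternion_carrier)
  show "generate quaternion_group {(0,1,0,0), (0,0,1,0)} \<subseteq> carrier quaternion_group"
    using Q8.ab by (intro Q8.generate_incl) auto
qed

lemma (in quaternion_pair) iso_Q8: "subgroup_generated G {a, b} \<cong> quaternion_group"
proof -
  interpret P: quaternion_pair "G \<times>\<times> quaternion_group" "(a, (0,1,0,0))" "(b, (0,0,1,0))" "(t, (-1,0,0,0))"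
    using DirProd_group[OF is_group group_quaternion] ab Q8.ab aa Q8.aa bb Q8.bb t1 Q8.t1 tt Q8.tt ba Q8.ba
    by (simp add: quaternion_pair_def quaternion_pair_axioms_def)
  have "subgroup_generated G {a, b} \<cong> subgroup_generated quaternion_group {(0,1,0,0), (0,0,1,0)}"
    using iso_of_diagonal_order[OF is_group Q8.is_group ab Q8.ab card_quaternion Q8.card_quaternion
        P.card_quaternion] by simp
  moreover have "subgroup_generated quaternion_group {(0,1,0,0), (0,0,1,0)} = quaternion_group"
    using Q8.subgroup_generated_carrier[of "{(0,1,0,0), (0,0,1,0)}"] Q8.ab Q8_generate by simp
  ultimately show ?thesis by simp
qed

subsection \<open>The special linear group\<close>

lemma three_eq_zero: "(3::3) = 0"
  unfolding iszero_def[symmetric] by simp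

lemma arith_3 [simp]: "(1::3) + 1 = -1" "-1 - 1 = (1::3)" "(-1::3) \<noteq> 1" "(1::3) \<noteq> -1"
proof -
  have "(1::3) + 1 + 1 = 0" using three_eq_zero by (simp add: numeral_3_eq_3)
  then show a: "(1::3) + 1 = -1" by (simp add: eq_neg_iff_add_eq_0)
  show "-1 - 1 = (1::3)" using a by (metis add.inverse_inverse minus_add_distrib uminus_add_conv_diff add.commute diff_conv_add_uminus)
  show "(-1::3) \<noteq> 1" using a by (metis add_cancel_left_left zero_neq_one)
  then show "(1::3) \<noteq> -1" by metis
qed

lemma UNIV_3': "(UNIV :: 3 set) = {0, 1, -1}"
proof -
  have "card {0, 1, -1 :: 3} = CARD(3)" by simp
  then show ?thesis by (metis card_subset_eq finite subset_UNIV)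
qed

lemma all_3: "(\<forall>x::3. P x) \<longleftrightarrow> P 0 \<and> P 1 \<and> P (-1)"
proof -
  have "(\<forall>x::3. P x) \<longleftrightarrow> (\<forall>x\<in>UNIV. P x)" by simp
  then show ?thesis unfolding UNIV_3' by simp
qed

text \<open>All 81 quadruples are run through, with the field written as 0, 1, -1.\<close>

lemma card_det: "card {(a,b,c,d). a * d - b * c = (1::3)} = 24"
proof -
  have "card {(a,b,c,d). a * d - b * c = (1::3)} = (\<Sum>x\<in>UNIV. of_bool (case x of (a,b,c,d) \<Rightarrow> a * d - b * c = (1::3)))"
    by (simp add: sum_of_bool_eq) 
  also have "\<dots> = (\<Sum>a\<in>UNIV. \<Sum>b\<in>UNIV. \<Sum>c\<in>UNIV. \<Sum>d\<in>UNIV. of_bool (a * d - b * c = (1::3)))"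
    unfolding UNIV_Times_UNIV[symmetric] sum.cartesian_product' by simp
  also have "\<dots> = 24" unfolding UNIV_3' by simp
  finally show ?thesis .
qed

definition "mat22 a b c d = (vector [vector [a, b], vector [c, d]] :: 'a::comm_ring_1^2^2)"

lemma mat22_cases: "\<exists>a b c d. A = mat22 a b c d"
  by (intro exI[of _ "A$1$1"] exI[of _ "A$1$2"] exI[of _ "A$2$1"] exI[of _ "A$2$2"])
     (simp add: mat22_def vec_eq_iff forall_2)

lemma mat22_simps [simp]:
  "mat22 a b c d ** mat22 a' b' c' d' =
     mat22 (a * a' + b * c') (a * b' + b * d') (c * a' + d * c') (c * b' + d * d')"
  "det (mat22 a b c d) = a * d - b * c" "mat 1 = mat22 1 0 0 1"
  "mat22 a b c d = mat22 a' b' c' d' \<longleftrightarrow> a = a' \<and> b = b' \<and> c = c' \<and> d = d'"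
  by (auto simp: mat22_def det_2 matrix_matrix_mult_def mat_def vec_eq_iff forall_2 sum_2)

lemma card_SL23: "card (carrier SL23) = 24"
proof -
  have "carrier SL23 = (\<lambda>(a,b,c,d). mat22 a b c d) ` {(a,b,c,d). a * d - b * c = (1::3)}"
  proof (intro equalityI subsetI)
    fix A assume "A \<in> carrier SL23"
    moreover obtain a b c d where "A = mat22 a b c d" using mat22_cases by blast
    ultimately show "A \<in> (\<lambda>(a,b,c,d). mat22 a b c d) ` {(a,b,c,d). a * d - b * c = (1::3)}"
      by (auto simp: SL23_def intro!: image_eqI[of _ _ "(a,b,c,d)"])
  qed (auto simp: SL23_def)
  moreover have "inj_on (\<lambda>(a,b,c,d). mat22 a b c d) {(a,b,c,d). a * d - b * c = (1::3)}"
    by (auto simp: inj_on_def)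
  ultimately show ?thesis using card_det by (simp add: card_image)
qed

lemma group_SL23: "group SL23"
proof (rule groupI)
  fix A assume "A \<in> carrier SL23"
  then obtain a b c d where A: "A = mat22 a b c d" "a * d - b * c = 1"
    using mat22_cases[of A] by (auto simp: SL23_def)
  then have "mat22 d (-b) (-c) a \<otimes>\<^bsub>SL23\<^esub> A = \<one>\<^bsub>SL23\<^esub>" "mat22 d (-b) (-c) a \<in> carrier SL23"
    by (auto simp: SL23_def algebra_simps)
  then show "\<exists>B\<in>carrier SL23. B \<otimes>\<^bsub>SL23\<^esub> A = \<one>\<^bsub>SL23\<^esub>" by blast
qed (auto simp: SL23_def det_mul matrix_mul_assoc matrix_mul_lid simp del: mat22_simps)

text \<open>The element orders of SL(2,3) are 1, 2, 3, 4, 6; this is checked over all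
  entries.\<close>

lemma SL23_exponent:
  assumes "A \<in> carrier SL23"
  shows "A [^]\<^bsub>SL23\<^esub> (4::nat) = \<one>\<^bsub>SL23\<^esub> \<or> A [^]\<^bsub>SL23\<^esub> (6::nat) = \<one>\<^bsub>SL23\<^esub>"
proof -
  obtain a b c d where A: "A = mat22 a b c d" "a * d - b * c = 1"
    using mat22_cases[of A] assms by (auto simp: SL23_def)
  have "\<forall>a b c d. a * d - b * c = 1 \<longrightarrow>
     (mat22 a b c d) [^]\<^bsub>SL23\<^esub> (4::nat) = \<one>\<^bsub>SL23\<^esub> \<or> (mat22 a b c d) [^]\<^bsub>SL23\<^esub> (6::nat) = \<one>\<^bsub>SL23\<^esub>"
    unfolding all_3 by (simp add: SL23_def numeral_eq_Suc)
  then show ?thesis using A by blast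
qed

text \<open>The first matrix squares to -1, the second is a transvection of order 3, and their
  product has trace -1 and determinant 1, so its cube is 1.\<close>

interpretation SL: binary_tetrahedral_pair SL23 "mat22 0 1 (-1) 0" "mat22 1 1 0 1"
  using group_SL23
  by (simp add: binary_tetrahedral_pair_def binary_tetrahedral_pair_axioms_def) (simp add: SL23_def)

lemma SL_generate: "generate SL23 {mat22 0 1 (-1) 0, mat22 1 1 0 1} = carrier SL23"
proof (rule card_subset_eq)
  show "card (generate SL23 {mat22 0 1 (-1) 0, mat22 1 1 0 1}) = card (carrier SL23)"
    unfolding SL.card_generate card_SL23 ..
  show "finite (carrier SL23)" using card_SL23 by (metis card.infinite zero_neq_numeral)
  show "generate SL23 {mat22 0 1 (-1) 0, mat22 1 1 0 1} \<subseteq> carrier SL23"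
    using SL.vz by (intro SL.generate_incl) auto
qed

lemma (in binary_tetrahedral_pair) iso_SL23: "subgroup_generated G {v, z} \<cong> SL23"
proof -
  interpret P: binary_tetrahedral_pair "G \<times>\<times> SL23" "(v, mat22 0 1 (-1) 0)" "(z, mat22 1 1 0 1)"
    using DirProd_group[OF is_group group_SL23] vz SL.vz z3 SL.z3 vz3 SL.vz3 v2 v4 SL.v4 zv2 SL.zv2
    by (simp add: binary_tetrahedral_pair_def binary_tetrahedral_pair_axioms_def)
  have "subgroup_generated G {v, z} \<cong> subgroup_generated SL23 {mat22 0 1 (-1) 0, mat22 1 1 0 1}"
    using iso_of_diagonal_order[OF is_group SL.is_group vz SL.vz card_generate SL.card_generate
        P.card_generate] by simp
  moreover have "subgroup_generated SL23 {mat22 0 1 (-1) 0, mat22 1 1 0 1} = SL23"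
    using SL.subgroup_generated_carrier[of "{mat22 0 1 (-1) 0, mat22 1 1 0 1}"] SL.vz SL_generate by simp
  ultimately show ?thesis by simp
qed

section \<open>Property (P) in terms of words\<close>

lemma (in group) ord_eq_2:
  assumes "x \<in> carrier G"
  shows "ord x = 2 \<longleftrightarrow> x \<otimes> x = \<one> \<and> x \<noteq> \<one>"
proof
  assume o: "ord x = 2"
  have "x [^] (2::nat) = \<one>" using pow_ord_eq_1[OF assms] o by simp
  moreover have "x \<noteq> \<one>" using o ord_id by auto
  ultimately show "x \<otimes> x = \<one> \<and> x \<noteq> \<one>" using assms by (simp add: numeral_2_eq_2)
next
  assume "x \<otimes> x = \<one> \<and> x \<noteq> \<one>"
  then have "ord x dvd 2" "ord x \<noteq> 1"
    using pow_eq_id[OF assms, of 2] ord_eq_1[OF assms] assms by (auto simp: numeral_2_eq_2)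
  then show "ord x = 2" using two_is_prime_nat prime_nat_iff by blast
qed

text \<open>The model pair generates 2k elements, hence all of \<open>B\<close>. The pair in the
  direct product satisfies the same hypotheses, so it also generates a group of order 2k.\<close>

lemma (in group) iso_commuting_pair:
  assumes x: "x \<in> carrier G" "x \<otimes> x = \<one>" and y: "y \<in> carrier G" "ord y = k" "k > 0"
    and xy: "x \<otimes> y = y \<otimes> x" "x \<notin> generate G {y}"
    and B: "comm_group B" "card (carrier B) = 2 * k"
    and x': "x' \<in> carrier B" "x' \<otimes>\<^bsub>B\<^esub> x' = \<one>\<^bsub>B\<^esub>" and y': "y' \<in> carrier B" "group.ord B y' = k"
    and n: "\<And>n::nat. x' \<noteq> y' [^]\<^bsub>B\<^esub> n"
  shows "subgroup_generated G {x, y} \<cong> B"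
proof -
  interpret B: comm_group B by fact
  have fB: "finite (carrier B)" using B(2) y(3) by (metis card_gt_0_iff mult_pos_pos zero_less_numeral)
  interpret P: group "G \<times>\<times> B" using is_group B.is_group by (rule DirProd_group)
  have c: "card (generate G {x, y}) = 2 * k"
    using card_generate_commuting_pair[OF x y xy] .
  have n': "x' \<notin> generate B {y'}"
    using n B.generate_pow_on_finite_carrier[OF fB y'(1)] by auto
  have c': "card (generate B {x', y'}) = 2 * k"
    using B.card_generate_commuting_pair[OF x' y' y(3) B.m_comm[OF x'(1) y'(1)] n'] .
  have o: "P.ord (y, y') = k"
    using y y' pow_eq_id[OF y(1)] B.pow_eq_id[OF y'(1)] by (subst P.ord_unique) (auto simp: DirProd_nat_pow)
  have "(x, x') \<notin> generate (G \<times>\<times> B) {(y, y')}"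
    using n P.generate_pow_nat[of "(y, y')"] o y y' by (auto simp: DirProd_nat_pow)
  then have "card (generate (G \<times>\<times> B) {(x, x'), (y, y')}) = 2 * k"
    using x x' y y' xy o B.m_comm by (intro P.card_generate_commuting_pair) auto
  then have "subgroup_generated G {x, y} \<cong> subgroup_generated B {x', y'}"
    using iso_of_diagonal_order[OF is_group B.is_group x(1) y(1) x'(1) y'(1) c c'] y(3) by simp
  moreover have "generate B {x', y'} = carrier B"
    by (rule card_subset_eq[OF fB]) (use c' B(2) x' y' B.generate_incl in auto)
  then have "subgroup_generated B {x', y'} = B"
    using B.subgroup_generated_carrier[of "{x', y'}"] x' y' by simp
  ultimately show ?thesis by simp
qed

lemma (in group) iso_cyclic:
  assumes y: "y \<in> carrier G" "ord y = k" "k > 1"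
  shows "subgroup_generated G {y} \<cong> integer_mod_group k"
proof -
  let ?B = "integer_mod_group k"
  interpret B: group ?B by simp
  interpret P: group "G \<times>\<times> ?B" using is_group B.is_group by (rule DirProd_group)
  have m: "1 \<in> carrier ?B" using y by simp
  have o: "B.ord 1 = k" using integer_mod_group_ord y by simp
  \<comment> \<open>The generator is listed twice because the diagonal argument is stated for
    pairs.\<close>
  have c: "card (generate G {y, y}) = k" "card (generate ?B {1, 1}) = k"
    using generate_pow_card[OF y(1)] B.generate_pow_card[OF m] y o by simp_all
  have "P.ord (y, 1) = k"
    using y o pow_eq_id[OF y(1)] B.pow_eq_id[OF m] m
    by (subst P.ord_unique) (auto simp: DirProd_nat_pow simp del: pow_integer_mod_group)
  then have "card (generate (G \<times>\<times> ?B) {(y, 1), (y, 1)}) = k"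
    using P.generate_pow_card[of "(y, 1)"] y m by simp
  then have "subgroup_generated G {y, y} \<cong> subgroup_generated ?B {1, 1}"
    using iso_of_diagonal_order[OF is_group B.is_group y(1) y(1) m m c] y(3) by simp
  moreover have "generate ?B {1} = carrier ?B"
    by (rule card_subset_eq) (use c y m B.generate_incl in \<open>auto simp: carrier_integer_mod_group\<close>)
  then have "subgroup_generated ?B {1} = ?B"
    using B.subgroup_generated_carrier[of "{1}"] m by simp
  ultimately show ?thesis by simp
qed

lemma abelian_targets:
  assumes "T = integer_mod_group 2 \<or> T = integer_mod_group 4 \<or> T = integer_mod_group 6"
  shows "comm_group T" and "(\<forall>t\<in>carrier T. t [^]\<^bsub>T\<^esub> (4::nat) = \<one>\<^bsub>T\<^esub>) \<or> (\<forall>t\<in>carrier T. t [^]\<^bsub>T\<^esub> (6::nat) = \<one>\<^bsub>T\<^esub>)"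
  using assms by (auto; presburger)+

lemma abelian_targets':
  assumes "T = integer_mod_group 2 \<times>\<times> integer_mod_group 4 \<or> T = integer_mod_group 2 \<times>\<times> integer_mod_group 6"
  shows "comm_group T" and "(\<forall>t\<in>carrier T. t [^]\<^bsub>T\<^esub> (4::nat) = \<one>\<^bsub>T\<^esub>) \<or> (\<forall>t\<in>carrier T. t [^]\<^bsub>T\<^esub> (6::nat) = \<one>\<^bsub>T\<^esub>)"
  using assms by (auto simp: DirProd_nat_pow intro!: comm_group_DirProd; presburger)+

lemma Klein_target:
  "\<forall>t\<in>carrier (cyclic_power 2 2). t [^]\<^bsub>cyclic_power 2 2\<^esub> (4::nat) = \<one>\<^bsub>cyclic_power 2 2\<^esub>"
proof
  fix t assume t: "t \<in> carrier (cyclic_power 2 2)"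
  interpret group "cyclic_power 2 2" by simp
  have "t [^]\<^bsub>cyclic_power 2 2\<^esub> (2 * 2 :: nat) = \<one>\<^bsub>cyclic_power 2 2\<^esub>"
    using cyclic_power_pow[OF t] t by (metis nat_pow_one nat_pow_pow)
  then show "t [^]\<^bsub>cyclic_power 2 2\<^esub> (4::nat) = \<one>\<^bsub>cyclic_power 2 2\<^esub>" by simp
qed

lemma (in group) abelian_pair:
  assumes xy: "x \<in> carrier G" "y \<in> carrier G"
    and i: "subgroup_generated G {x, y} \<cong> T" and T: "comm_group T"
      "(\<forall>t\<in>carrier T. t [^]\<^bsub>T\<^esub> (4::nat) = \<one>\<^bsub>T\<^esub>) \<or> (\<forall>t\<in>carrier T. t [^]\<^bsub>T\<^esub> (6::nat) = \<one>\<^bsub>T\<^esub>)"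
  shows "x \<otimes> y = y \<otimes> x \<and> (y [^] (4::nat) = \<one> \<or> y [^] (6::nat) = \<one>)"
proof -
  let ?S = "subgroup_generated G {x, y}"
  interpret S: group ?S by simp
  have m: "x \<in> carrier ?S" "y \<in> carrier ?S"
    using xy by (auto simp: subgroup_generated_carrier intro: generate.incl)
  have "T \<cong> ?S" using S.iso_sym[OF i] .
  then have "comm_group ?S" using comm_group.iso_imp_comm_group[OF T(1)] S.is_monoid by blast
  then have "x \<otimes> y = y \<otimes> x" using comm_groupE(4)[of ?S x y] m by simp
  moreover have "y [^]\<^bsub>?S\<^esub> (4::nat) = \<one>\<^bsub>?S\<^esub> \<or> y [^]\<^bsub>?S\<^esub> (6::nat) = \<one>\<^bsub>?S\<^esub>"
    using S.iso_pow_one[OF i comm_group.axioms(2)[OF T(1)] _ m(2)] T(2) by blast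
  ultimately show ?thesis by (simp add: pow_subgroup_generated)
qed

text \<open>With k the order of y, either x lies in <y>, which is then cyclic of order 2, 4 or 6, or
  the group is Z_2 x Z_k; for k = 3 the latter is Z_6.\<close>

lemma (in group) commuting_pair_target:
  assumes fin: "finite (carrier G)" and x: "x \<in> carrier G" "x \<otimes> x = \<one>" "x \<noteq> \<one>" and y: "y \<in> carrier G"
    and xy: "x \<otimes> y = y \<otimes> x" and e: "y [^] (4::nat) = \<one> \<or> y [^] (6::nat) = \<one>"
  defines "S \<equiv> subgroup_generated G {x, y}"
  shows "S \<cong> integer_mod_group 2 \<or> S \<cong> cyclic_power 2 2 \<or> S \<cong> integer_mod_group 4 \<or>
     S \<cong> integer_mod_group 6 \<or> S \<cong> integer_mod_group 2 \<times>\<times> integer_mod_group 4 \<or>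
     S \<cong> integer_mod_group 2 \<times>\<times> integer_mod_group 6"
proof -
  define k where "k = ord y"
  have k0: "k > 0" using ord_ge_1[OF fin y] k_def by simp
  have "k dvd 4 \<or> k dvd 6" using e pow_eq_id[OF y] k_def by blast
  moreover have "k \<le> 6" using calculation by (auto dest: dvd_imp_le)
  ultimately have k: "k \<in> {1, 2, 3, 4, 6}"
    using k0 by (auto simp: numeral_eq_Suc le_Suc_eq dvd_def) presburger+
  show ?thesis
  proof (cases "x \<in> generate G {y}")
    case True
    have "generate G {x, y} = generate G {y}"
    proof
      show "generate G {x, y} \<subseteq> generate G {y}"
        using True y by (intro generate_subgroup_incl generate_is_subgroup) (auto intro: generate.incl)
    qed (rule mono_generate, simp)
    then have S: "S = subgroup_generated G {y}"
      unfolding S_def using x y by (simp add: subgroup_generated_carrier)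
    have "ord x dvd card (generate G {y})"
      using card_subgroup_dvd[OF generate_is_subgroup generate_is_subgroup, of "{x}" "{y}"] x y True
        generate_pow_card[OF x(1)] generate_subgroup_incl[of "{x}" "generate G {y}"]
        generate_is_subgroup[of "{y}"] by simp
    moreover have "ord x = 2" using ord_eq_2[OF x(1)] x by blast
    ultimately have "2 dvd k" using generate_pow_card[OF y] k_def by simp
    then have "k = 2 \<or> k = 4 \<or> k = 6" using k by auto
    moreover have "S \<cong> integer_mod_group k" if "k > 1"
      unfolding S using iso_cyclic[OF y k_def[symmetric] that] .
    ultimately show ?thesis by auto
  next
    case False
    note iso = iso_commuting_pair[OF x(1,2) y k_def[symmetric] k0 xy False]
    consider "k = 1" | "k = 2" | "k = 3" | "k = 4 \<or> k = 6" using k by blast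
    then show ?thesis
    proof cases
      case 1
      have "group.ord (integer_mod_group 2) 0 = 1"
        using group.ord_id[of "integer_mod_group 2"] by simp
      then have "S \<cong> integer_mod_group 2" unfolding S_def
        by (intro iso[where x' = 1 and y' = 0]) (use 1 in \<open>auto simp: carrier_integer_mod_group\<close>)
      then show ?thesis by blast
    next
      case 2
      let ?B = "cyclic_power 2 2"
      let ?x = "\<lambda>i\<in>{1..2::nat}. if i = 1 then 1 else 0 :: int"
      let ?y = "\<lambda>i\<in>{1..2::nat}. if i = 1 then 0 else 1 :: int"
      have m: "?x \<in> carrier ?B" "?y \<in> carrier ?B"
        by (auto simp: cyclic_power_def carrier_integer_mod_group)
      have p: "(?y [^]\<^bsub>?B\<^esub> n) = (\<lambda>i\<in>{1..2}. (if i = 1 then 0 else int n mod 2))" for n :: nat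
        using product_group_pow[of ?y "{1..2}" "\<lambda>_. integer_mod_group 2" n] m(2)
        by (auto simp: cyclic_power_def fun_eq_iff)
      have "\<And>n::nat. ?x \<noteq> ?y [^]\<^bsub>?B\<^esub> n"
        unfolding p by (auto simp: fun_eq_iff intro!: exI[of _ 1])
      moreover have "group.ord ?B ?y = 2"
        unfolding group.ord_eq_2[OF group_cyclic_power m(2)]
        by (auto simp: cyclic_power_def fun_eq_iff intro!: exI[of _ 2])
      moreover have "?x \<otimes>\<^bsub>?B\<^esub> ?x = \<one>\<^bsub>?B\<^esub>" by (auto simp: cyclic_power_def fun_eq_iff)
      ultimately have "S \<cong> ?B" unfolding S_def
        by (intro iso[where x' = ?x and y' = ?y]) (use 2 m in \<open>auto simp: card_cyclic_power\<close>)
      then show ?thesis by blast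
    next
      case 3
      \<comment> \<open>The model pair inside Z_6: the involution 3 and the element 2 of order
        3.\<close>
      have "group.ord (integer_mod_group 6) 2 = 3"
        by (subst group.ord_unique) (auto simp: carrier_integer_mod_group; presburger)+
      moreover have "3 \<noteq> 2 [^]\<^bsub>integer_mod_group 6\<^esub> n" for n :: nat by simp presburger
      ultimately have "S \<cong> integer_mod_group 6" unfolding S_def
        by (intro iso[where x' = 3 and y' = 2]) (use 3 in \<open>auto simp: carrier_integer_mod_group\<close>)
      then show ?thesis by blast
    next
      case 4
      let ?B = "integer_mod_group 2 \<times>\<times> integer_mod_group k"
      have "group.ord ?B (0, 1) = k"
      proof (subst group.ord_unique)
        show "group ?B" by (intro DirProd_group) auto
        show "(0, 1) \<in> carrier ?B" using 4 by (auto simp: carrier_integer_mod_group)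
        show "\<forall>n. (0, 1) [^]\<^bsub>?B\<^esub> n = \<one>\<^bsub>?B\<^esub> \<longleftrightarrow> k dvd n"
          using 4 by (auto simp: DirProd_nat_pow mod_eq_0_iff_dvd; presburger)
      qed
      then have "S \<cong> ?B" unfolding S_def
        by (intro iso[where x' = "(1, 0)" and y' = "(0, 1)"])
           (use 4 in \<open>auto simp: carrier_integer_mod_group DirProd_nat_pow intro!: comm_group_DirProd\<close>)
      then show ?thesis using 4 by auto
    qed
  qed
qed

text \<open>The six abelian types merge into commutation with an exponent condition on y, and A_4
  becomes its (2,3,3) relations. Both directions of the classification use (P) only in this
  form.\<close>

lemma (in group) property_P_iff:
  assumes fin: "finite (carrier G)"
  shows "property_P G \<longleftrightarrow> even (order G) \<and>
    (\<forall>x\<in>carrier G. \<forall>y\<in>carrier G. x \<otimes> x = \<one> \<and> x \<noteq> \<one> \<longrightarrow>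
       x \<otimes> y = y \<otimes> x \<and> (y [^] (4::nat) = \<one> \<or> y [^] (6::nat) = \<one>) \<or>
       y \<otimes> (y \<otimes> y) = \<one> \<and> (x \<otimes> y) \<otimes> ((x \<otimes> y) \<otimes> (x \<otimes> y)) = \<one>)"
  (is "_ \<longleftrightarrow> _ \<and> (\<forall>x\<in>_. \<forall>y\<in>_. _ \<longrightarrow> ?R x y)")
proof -
  have "(let S = subgroup_generated G {x, y} in
           S \<cong> integer_mod_group 2 \<or> S \<cong> cyclic_power 2 2 \<or> S \<cong> integer_mod_group 4 \<or>
           S \<cong> integer_mod_group 6 \<or> S \<cong> integer_mod_group 2 \<times>\<times> integer_mod_group 4 \<or>
           S \<cong> integer_mod_group 2 \<times>\<times> integer_mod_group 6 \<or> S \<cong> alt_group 4) \<longleftrightarrow> ?R x y"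
    (is "?L \<longleftrightarrow> _") if x: "x \<in> carrier G" "x \<otimes> x = \<one>" "x \<noteq> \<one>" and y: "y \<in> carrier G" for x y
  proof
    assume L: ?L
    show "?R x y"
    proof (cases "subgroup_generated G {x, y} \<cong> alt_group 4")
      case True
      then show ?thesis using A4_generators[OF x(1) y x(2,3)] by blast
    next
      case False
      then consider T where "subgroup_generated G {x, y} \<cong> T" "T = integer_mod_group 2 \<or> T = integer_mod_group 4 \<or> T = integer_mod_group 6"
        | T where "subgroup_generated G {x, y} \<cong> T" "T = integer_mod_group 2 \<times>\<times> integer_mod_group 4 \<or> T = integer_mod_group 2 \<times>\<times> integer_mod_group 6"
        | "subgroup_generated G {x, y} \<cong> cyclic_power 2 2"
        using L unfolding Let_def by blast
      then show ?thesis
      proof cases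
        case 1
        then show ?thesis using abelian_pair[OF x(1) y] abelian_targets by blast
      next
        case 2
        then show ?thesis using abelian_pair[OF x(1) y] abelian_targets' by blast
      next
        case 3
        then show ?thesis using abelian_pair[OF x(1) y 3 comm_group_cyclic_power] Klein_target by blast
      qed
    qed
  next
    assume "?R x y"
    then show ?L
    proof
      assume "x \<otimes> y = y \<otimes> x \<and> (y [^] (4::nat) = \<one> \<or> y [^] (6::nat) = \<one>)"
      note commuting_pair_target[OF fin x y conjunct1[OF this] conjunct2[OF this]]
      then show ?L unfolding Let_def by (elim disjE) simp_all
    next
      assume "y \<otimes> (y \<otimes> y) = \<one> \<and> (x \<otimes> y) \<otimes> ((x \<otimes> y) \<otimes> (x \<otimes> y)) = \<one>"
      then interpret tetrahedral_pair G x y using x y by unfold_locales auto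
      show ?L unfolding Let_def using iso_A4 by simp
    qed
  qed
  note eq = this
  show ?thesis
    unfolding property_P_def
  proof (intro conj_cong refl ball_cong imp_cong)
    fix x y assume x: "x \<in> carrier G"
    show "ord x = 2 \<longleftrightarrow> x \<otimes> x = \<one> \<and> x \<noteq> \<one>" using ord_eq_2[OF x] .
  next
    fix x y assume "x \<in> carrier G" "y \<in> carrier G" "x \<otimes> x = \<one> \<and> x \<noteq> \<one>"
    then show "(let S = subgroup_generated G {x, y} in
           S \<cong> integer_mod_group 2 \<or> S \<cong> cyclic_power 2 2 \<or> S \<cong> integer_mod_group 4 \<or>
           S \<cong> integer_mod_group 6 \<or> S \<cong> integer_mod_group 2 \<times>\<times> integer_mod_group 4 \<or>
           S \<cong> integer_mod_group 2 \<times>\<times> integer_mod_group 6 \<or> S \<cong> alt_group 4) \<longleftrightarrow> ?R x y"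
      by (intro eq) auto
  qed
qed

section \<open>Internal products and elementary abelian groups\<close>

text \<open>Stands in for induction: complements, bases and decompositions are chosen of maximal
  order and then shown to be everything.\<close>

lemma ex_max_card:
  assumes "P A" "\<And>A. P A \<Longrightarrow> card A \<le> n"
  shows "\<exists>F. P F \<and> (\<forall>F'. P F' \<longrightarrow> card F' \<le> card F)"
  using ex_has_greatest_nat[of P A card "Suc n"] assms by (auto simp: less_Suc_eq_le)

section \<open>Complements and bases in elementary abelian groups\<close>

context group
begin

lemma set_mult_mem: "x \<in> H <#> K \<longleftrightarrow> (\<exists>h\<in>H. \<exists>k\<in>K. x = h \<otimes> k)"
  by (auto simp: set_mult_def)

lemma set_multI: "h \<in> H \<Longrightarrow> k \<in> K \<Longrightarrow> h \<otimes> k \<in> H <#> K"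
  by (auto simp: set_mult_def)

lemma set_mult_subset:
  assumes "subgroup L G" "H \<subseteq> L" "K \<subseteq> L"
  shows "H <#> K \<subseteq> L"
  unfolding set_mult_def using subgroup.m_closed[OF assms(1)] assms(2,3) by fastforce

lemma set_mult_upper:
  assumes "subgroup H G" "subgroup K G"
  shows "H \<subseteq> H <#> K" "K \<subseteq> H <#> K"
proof -
  show "H \<subseteq> H <#> K"
  proof
    fix h assume "h \<in> H"
    then show "h \<in> H <#> K"
      using set_multI[OF _ subgroup.one_closed[OF assms(2)], of h] subgroup.mem_carrier[OF assms(1)] by auto
  qed
  show "K \<subseteq> H <#> K"
  proof
    fix k assume "k \<in> K"
    then show "k \<in> H <#> K"
      using set_multI[OF subgroup.one_closed[OF assms(1)], of k] subgroup.mem_carrier[OF assms(2)] by auto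
  qed
qed

lemma commuting_product_subgroup:
  assumes H: "subgroup H G" and K: "subgroup K G"
    and c: "\<And>h k. h \<in> H \<Longrightarrow> k \<in> K \<Longrightarrow> h \<otimes> k = k \<otimes> h"
  shows "subgroup (H <#> K) G"
proof -
  have HG: "\<And>h. h \<in> H \<Longrightarrow> h \<in> carrier G" and KG: "\<And>k. k \<in> K \<Longrightarrow> k \<in> carrier G"
    by (fact subgroup.mem_carrier[OF H] subgroup.mem_carrier[OF K])+
  show ?thesis
  proof (rule subgroupI)
    show "H <#> K \<subseteq> carrier G" using HG KG by (auto simp: set_mult_mem)
    show "H <#> K \<noteq> {}" using subgroup.one_closed[OF H] subgroup.one_closed[OF K] by (auto simp: set_mult_def)
    fix a assume "a \<in> H <#> K"
    then obtain h k where a: "h \<in> H" "k \<in> K" "a = h \<otimes> k" by (auto simp: set_mult_mem)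
    then have "a = k \<otimes> h" using c by simp
    then have "inv a = inv h \<otimes> inv k" using a HG KG by (simp add: inv_mult_group)
    then show "inv a \<in> H <#> K"
      using a subgroup.m_inv_closed[OF H] subgroup.m_inv_closed[OF K] by (auto simp: set_mult_mem)
    fix b assume "b \<in> H <#> K"
    then obtain h' k' where b: "h' \<in> H" "k' \<in> K" "b = h' \<otimes> k'" by (auto simp: set_mult_mem)
    have "a \<otimes> b = h \<otimes> ((k \<otimes> h') \<otimes> k')" using a b HG KG by (simp add: m_assoc)
    also have "\<dots> = (h \<otimes> h') \<otimes> (k \<otimes> k')"
      unfolding c[OF b(1) a(2), symmetric] using a b HG KG by (simp add: m_assoc)
    finally show "a \<otimes> b \<in> H <#> K"
      using set_multI[OF subgroup.m_closed[OF H a(1) b(1)] subgroup.m_closed[OF K a(2) b(2)]] a b by simp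
  qed
qed

lemma commuting_product_iso:
  assumes H: "subgroup H G" and K: "subgroup K G"
    and c: "\<And>h k. h \<in> H \<Longrightarrow> k \<in> K \<Longrightarrow> h \<otimes> k = k \<otimes> h" and i: "H \<inter> K = {\<one>}"
  shows "G\<lparr>carrier := H\<rparr> \<times>\<times> G\<lparr>carrier := K\<rparr> \<cong> G\<lparr>carrier := H <#> K\<rparr>"
proof -
  have HG: "\<And>h. h \<in> H \<Longrightarrow> h \<in> carrier G" and KG: "\<And>k. k \<in> K \<Longrightarrow> k \<in> carrier G"
    by (fact subgroup.mem_carrier[OF H] subgroup.mem_carrier[OF K])+
  let ?f = "\<lambda>(h, k). h \<otimes> k"
  have "?f \<in> hom (G\<lparr>carrier := H\<rparr> \<times>\<times> G\<lparr>carrier := K\<rparr>) (G\<lparr>carrier := H <#> K\<rparr>)"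
  proof (rule homI)
    fix x y assume "x \<in> carrier (G\<lparr>carrier := H\<rparr> \<times>\<times> G\<lparr>carrier := K\<rparr>)"
      "y \<in> carrier (G\<lparr>carrier := H\<rparr> \<times>\<times> G\<lparr>carrier := K\<rparr>)"
    then obtain h k h' k' where m: "x = (h, k)" "y = (h', k')" "h \<in> H" "k \<in> K" "h' \<in> H" "k' \<in> K" by auto
    have "(h \<otimes> h') \<otimes> (k \<otimes> k') = h \<otimes> ((h' \<otimes> k) \<otimes> k')" using m HG KG by (simp add: m_assoc)
    also have "\<dots> = (h \<otimes> k) \<otimes> (h' \<otimes> k')" unfolding c[OF m(5,4)] using m HG KG by (simp add: m_assoc)
    finally show "?f (x \<otimes>\<^bsub>G\<lparr>carrier := H\<rparr> \<times>\<times> G\<lparr>carrier := K\<rparr>\<^esub> y) = ?f x \<otimes>\<^bsub>G\<lparr>carrier := H <#> K\<rparr>\<^esub> ?f y"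
      using m by simp
  qed (auto simp: set_mult_mem)
  moreover have "bij_betw ?f (H \<times> K) (H <#> K)"
    unfolding bij_betw_def
  proof
    show "?f ` (H \<times> K) = H <#> K" by (auto simp: set_mult_def)
    interpret group_disjoint_sum G H K using H K is_group by (simp add: group_disjoint_sum_def)
    have "\<forall>x\<in>H. \<forall>y\<in>K. \<forall>x'\<in>H. \<forall>y'\<in>K. x \<otimes> y = x' \<otimes> y' \<longrightarrow> x = x' \<and> y = y'"
      using iffD1[OF cancel] i by simp
    then show "inj_on ?f (H \<times> K)" by (intro inj_onI) auto
  qed
  ultimately show ?thesis by (intro is_isoI isoI) (auto simp: DirProd_def)
qed

lemma exponent_2_commute:
  assumes "subgroup E G" "\<And>x. x \<in> E \<Longrightarrow> x \<otimes> x = \<one>" "x \<in> E" "y \<in> E"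
  shows "x \<otimes> y = y \<otimes> x"
  using assms commute_of_involutions[of x y] subgroup.m_closed[OF assms(1)] subgroup.mem_carrier[OF assms(1)]
  by blast

text \<open>Take F maximal among the subgroups meeting S trivially. For g outside S F the group F<g>
  would still meet S trivially, since u = f g in S gives g = u f in S F.\<close>

lemma exponent_2_complement:
  assumes E: "subgroup E G" "finite E" "\<And>x. x \<in> E \<Longrightarrow> x \<otimes> x = \<one>" and S: "subgroup S G" "S \<subseteq> E"
  shows "\<exists>F. subgroup F G \<and> F \<subseteq> E \<and> S \<inter> F = {\<one>} \<and> S <#> F = E"
proof -
  define P where "P F \<longleftrightarrow> subgroup F G \<and> F \<subseteq> E \<and> S \<inter> F = {\<one>}" for F
  have comm: "\<And>x y. x \<in> E \<Longrightarrow> y \<in> E \<Longrightarrow> x \<otimes> y = y \<otimes> x" 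
    by (rule exponent_2_commute[OF E(1,3)])
  have EG: "\<And>x. x \<in> E \<Longrightarrow> x \<in> carrier G" using subgroup.mem_carrier[OF E(1)] .
  have "P {\<one>}" unfolding P_def
    using triv_subgroup subgroup.one_closed[OF E(1)] subgroup.one_closed[OF S(1)] by auto
  moreover have "\<forall>F. P F \<longrightarrow> card F \<le> card E" using card_mono[OF E(2)] P_def by simp
  ultimately have "\<exists>F. P F \<and> (\<forall>F'. P F' \<longrightarrow> card F' \<le> card F)" by (intro ex_max_card) auto
  then obtain F where F: "P F" and max: "\<And>F'. P F' \<Longrightarrow> card F' \<le> card F" by blast
  have sF: "subgroup F G" "F \<subseteq> E" "S \<inter> F = {\<one>}" using F unfolding P_def by auto
  have "E \<subseteq> S <#> F"
  proof
    fix g assume g: "g \<in> E"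
    show "g \<in> S <#> F"
    proof (rule ccontr)
      assume n: "g \<notin> S <#> F"
      have sg: "subgroup {\<one>, g} G"
        by (rule subgroupI) (use g EG E(3) inv_of_involution in auto)
      have sFg: "subgroup (F <#> {\<one>, g}) G"
        by (rule commuting_product_subgroup[OF sF(1) sg]) (use comm g sF(2) EG in auto)
      have gF: "g \<notin> F" using n set_multI[OF subgroup.one_closed[OF S(1)], of g F] EG[OF g] by auto
      have sub: "F <#> {\<one>, g} \<subseteq> E"
        using g subgroup.one_closed[OF E(1)] by (intro set_mult_subset[OF E(1) sF(2)]) auto
      have "S \<inter> (F <#> {\<one>, g}) = {\<one>}"
      proof (intro equalityI subsetI)
        fix u assume u: "u \<in> S \<inter> (F <#> {\<one>, g})"
        then obtain f where f: "f \<in> F" "u = f \<otimes> \<one> \<or> u = f \<otimes> g" by (auto simp: set_mult_mem)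
        show "u \<in> {\<one>}"
        proof (cases "u = f \<otimes> \<one>")
          case True
          then have "u = f" using f sF(2) EG by auto
          then show ?thesis using u f sF(3) by auto
        next
          case False
          then have e: "u = f \<otimes> g" using f by blast
          have fE: "f \<in> E" using f sF by blast
          have "g = f \<otimes> u" using e involution_extend[OF E(3)[OF fE]] fE g EG by simp
          also have "\<dots> = u \<otimes> f" using comm fE u S(2) by blast
          finally have "g \<in> S <#> F" using u f by (auto simp: set_mult_mem)
          then show ?thesis using n by simp
        qed
      qed (use subgroup.one_closed[OF S(1)] subgroup.one_closed[OF sFg] in auto)
      then have "card (F <#> {\<one>, g}) \<le> card F" using max[of "F <#> {\<one>, g}"] sFg sub P_def by simp
      moreover have "F \<subseteq> F <#> {\<one>, g}" "g \<in> F <#> {\<one>, g}"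
        using set_mult_upper[OF sF(1) sg] by auto
      moreover have "finite (F <#> {\<one>, g})" using sub E(2) finite_subset by blast
      ultimately have "card F < card (F <#> {\<one>, g})" using gF by (intro psubset_card_mono) auto
      then show False using \<open>card (F <#> {\<one>, g}) \<le> card F\<close> by simp
    qed
  qed
  moreover have "S <#> F \<subseteq> E" using set_mult_subset[OF E(1) S(2) sF(2)] .
  ultimately show ?thesis using sF by blast
qed

end

lemma cyclic_power_Suc: "cyclic_power p n \<times>\<times> integer_mod_group p \<cong> cyclic_power p (Suc n)"
proof -
  let ?f = "\<lambda>(f, c). (f :: nat \<Rightarrow> int)(Suc n := c)"
  let ?A = "cyclic_power p n \<times>\<times> integer_mod_group p" and ?B = "cyclic_power p (Suc n)"
  have "?f \<in> hom ?A ?B"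
    by (rule homI) (auto simp: cyclic_power_def fun_eq_iff PiE_iff extensional_def)
  moreover have "bij_betw ?f (carrier ?A) (carrier ?B)"
  proof (rule bij_betw_byWitness[where f' = "\<lambda>g. (restrict g {1..n}, g (Suc n))"])
    show "\<forall>a\<in>carrier ?A. (\<lambda>g. (restrict g {1..n}, g (Suc n))) (?f a) = a"
      by (auto simp: cyclic_power_def fun_eq_iff PiE_iff extensional_def)
    show "\<forall>g\<in>carrier ?B. ?f (restrict g {1..n}, g (Suc n)) = g"
      by (auto simp: cyclic_power_def fun_eq_iff PiE_iff extensional_def)
    show "?f ` carrier ?A \<subseteq> carrier ?B"
      by (auto simp: cyclic_power_def fun_eq_iff PiE_iff extensional_def)
    show "(\<lambda>g. (restrict g {1..n}, g (Suc n))) ` carrier ?B \<subseteq> carrier ?A"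
      by (auto simp: cyclic_power_def fun_eq_iff PiE_iff extensional_def)
  qed
  ultimately show ?thesis by (intro is_isoI isoI)
qed

context group
begin

text \<open>A basis by maximality: for H of the required type and g outside H, the group <g> has
  prime order, so it meets H trivially and H x <g> is larger and of the same type.\<close>

lemma elementary_abelian_cyclic_power:
  assumes p: "prime p" and Q: "subgroup Q G" "finite Q"
    and comm: "\<And>x y. x \<in> Q \<Longrightarrow> y \<in> Q \<Longrightarrow> x \<otimes> y = y \<otimes> x" and pw: "\<And>x. x \<in> Q \<Longrightarrow> x [^] p = \<one>"
  shows "\<exists>m. G\<lparr>carrier := Q\<rparr> \<cong> cyclic_power p m"
proof -
  have QG: "\<And>x. x \<in> Q \<Longrightarrow> x \<in> carrier G" using subgroup.mem_carrier[OF Q(1)] .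
  define P where "P H \<longleftrightarrow> subgroup H G \<and> H \<subseteq> Q \<and> (\<exists>m. G\<lparr>carrier := H\<rparr> \<cong> cyclic_power p m)" for H
  have "(\<lambda>_. \<one>\<^bsub>cyclic_power p 0\<^esub>) \<in> iso (G\<lparr>carrier := {\<one>}\<rparr>) (cyclic_power p 0)"
    by (auto simp: iso_def hom_def bij_betw_def cyclic_power_def)
  then have "P {\<one>}" unfolding P_def using triv_subgroup subgroup.one_closed[OF Q(1)]
    by (auto dest: is_isoI)
  moreover have "\<forall>H. P H \<longrightarrow> card H \<le> card Q" using card_mono[OF Q(2)] P_def by simp
  ultimately have "\<exists>H. P H \<and> (\<forall>H'. P H' \<longrightarrow> card H' \<le> card H)" by (intro ex_max_card) auto
  then obtain H where H: "P H" and max: "\<And>H'. P H' \<Longrightarrow> card H' \<le> card H" by blast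
  obtain m where m: "G\<lparr>carrier := H\<rparr> \<cong> cyclic_power p m" using H P_def by auto
  have sH: "subgroup H G" "H \<subseteq> Q" using H P_def by auto
  have "H = Q"
  proof (rule ccontr)
    assume "H \<noteq> Q"
    then obtain g where g: "g \<in> Q" "g \<notin> H" using sH by blast
    let ?K = "generate G {g}"
    have K: "subgroup ?K G" using g QG by (intro generate_is_subgroup) auto
    have KQ: "?K \<subseteq> Q" using g Q by (intro generate_subgroup_incl) auto
    have "ord g dvd p" using pw[OF g(1)] pow_eq_id QG[OF g(1)] by blast
    moreover have "ord g \<noteq> 1" using g(2) ord_eq_1[OF QG[OF g(1)]] subgroup.one_closed[OF sH(1)] by auto
    ultimately have og: "ord g = p" using p prime_nat_iff by blast
    have cK: "card ?K = p" using generate_pow_card[OF QG[OF g(1)]] og by simp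
    have HK: "subgroup (H \<inter> ?K) G" using subgroups_Inter_pair[OF sH(1) K] .
    have "H \<inter> ?K = {\<one>}"
    proof -
      have "card (H \<inter> ?K) dvd p" using card_subgroup_dvd[OF HK K] cK by simp
      moreover have "card (H \<inter> ?K) \<noteq> p"
      proof
        assume "card (H \<inter> ?K) = p"
        then have "H \<inter> ?K = ?K" using cK Q(2) KQ finite_subset by (intro card_subset_eq) auto
        then show False using g(2) generate.incl[of g "{g}"] by blast
      qed
      ultimately have "card (H \<inter> ?K) = 1" using p prime_nat_iff by blast
      then show ?thesis using subgroup.one_closed[OF HK] by (metis card_1_singletonE singletonD)
    qed
    moreover have hk: "h \<otimes> k = k \<otimes> h" if "h \<in> H" "k \<in> ?K" for h k
      using comm[OF subsetD[OF sH(2) that(1)] subsetD[OF KQ that(2)]] .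
    ultimately have "G\<lparr>carrier := H\<rparr> \<times>\<times> G\<lparr>carrier := ?K\<rparr> \<cong> G\<lparr>carrier := H <#> ?K\<rparr>"
      by (intro commuting_product_iso sH(1) K)
    moreover have "G\<lparr>carrier := ?K\<rparr> \<cong> integer_mod_group p"
      using iso_cyclic[OF QG[OF g(1)] og] p prime_gt_1_nat QG[OF g(1)] by (simp add: subgroup_generated_carrier)
    then have "G\<lparr>carrier := H\<rparr> \<times>\<times> G\<lparr>carrier := ?K\<rparr> \<cong> cyclic_power p m \<times>\<times> integer_mod_group p"
      using group.DirProd_iso_trans[OF subgroup_imp_group[OF sH(1)] m] by blast
    ultimately have "G\<lparr>carrier := H <#> ?K\<rparr> \<cong> cyclic_power p (Suc m)"
      using cyclic_power_Suc iso_trans group.iso_sym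
        DirProd_group[OF subgroup_imp_group[OF sH(1)] subgroup_imp_group[OF K]] by metis
    moreover have "subgroup (H <#> ?K) G"
      using hk by (intro commuting_product_subgroup sH(1) K)
    moreover have sub: "H <#> ?K \<subseteq> Q"
      using set_mult_subset[OF Q(1) sH(2) KQ] .
    ultimately have "card (H <#> ?K) \<le> card H" using max[of "H <#> ?K"] unfolding P_def by blast
    moreover have "H \<subseteq> H <#> ?K" "g \<in> H <#> ?K"
      using set_mult_upper[OF sH(1) K] generate.incl[of g "{g}" G] by auto
    moreover have "finite (H <#> ?K)" using sub Q(2) finite_subset by blast
    ultimately show False using g(2) psubset_card_mono[of "H <#> ?K" H] by auto
  qed
  then show ?thesis using m by blast
qed

end

section \<open>Structure of groups with property (P)\<close>

context group
begin

lemma involutions_normal: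
  assumes comm: "\<And>x y. x \<in> carrier G \<Longrightarrow> y \<in> carrier G \<Longrightarrow> x \<otimes> x = \<one> \<Longrightarrow> y \<otimes> y = \<one> \<Longrightarrow> x \<otimes> y = y \<otimes> x"
  shows "{g \<in> carrier G. g \<otimes> g = \<one>} \<lhd> G" (is "?T \<lhd> G")
proof (rule normal_invI)
  show "subgroup ?T G"
  proof (rule subgroupI)
    fix a b assume ab: "a \<in> ?T" "b \<in> ?T"
    then have ba: "b \<otimes> a = a \<otimes> b" using comm by auto
    have "(a \<otimes> b) \<otimes> (a \<otimes> b) = a \<otimes> ((b \<otimes> a) \<otimes> b)" using ab by (simp add: m_assoc)
    also have "\<dots> = (a \<otimes> a) \<otimes> (b \<otimes> b)" unfolding ba using ab by (simp add: m_assoc)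
    finally show "a \<otimes> b \<in> ?T" using ab by simp
    show "inv a \<in> ?T" using ab inv_of_involution by simp
  qed auto
  fix x h assume "x \<in> carrier G" "h \<in> ?T"
  moreover from this have "h \<otimes> (h \<otimes> inv x) = inv x" by (auto simp flip: m_assoc)
  ultimately show "x \<otimes> h \<otimes> inv x \<in> ?T" by (auto simp: m_assoc)
qed

lemma commutator_one_iff:
  assumes "x \<in> carrier G" "y \<in> carrier G"
  shows "x \<otimes> y \<otimes> inv x \<otimes> inv y = \<one> \<longleftrightarrow> x \<otimes> y = y \<otimes> x"
proof
  assume e: "x \<otimes> y \<otimes> inv x \<otimes> inv y = \<one>"
  have "x \<otimes> y = (x \<otimes> y \<otimes> inv x \<otimes> inv y) \<otimes> (y \<otimes> x)" using assms by (simp add: m_assoc)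
  then show "x \<otimes> y = y \<otimes> x" unfolding e using assms by simp
next
  assume "x \<otimes> y = y \<otimes> x"
  then have "x \<otimes> y \<otimes> inv x \<otimes> inv y = y \<otimes> x \<otimes> inv x \<otimes> inv y" by simp
  then show "x \<otimes> y \<otimes> inv x \<otimes> inv y = \<one>" using assms by (simp add: m_assoc)
qed

lemma commuting_square:
  assumes "a \<otimes> b = b \<otimes> a" "a \<in> carrier G" "b \<in> carrier G"
  shows "(a \<otimes> b) \<otimes> (a \<otimes> b) = (a \<otimes> a) \<otimes> (b \<otimes> b)"
proof -
  have "(a \<otimes> b) \<otimes> (a \<otimes> b) = a \<otimes> ((b \<otimes> a) \<otimes> b)" using assms(2,3) by (simp add: m_assoc)
  also have "\<dots> = (a \<otimes> a) \<otimes> (b \<otimes> b)" unfolding assms(1)[symmetric] using assms(2,3) by (simp add: m_assoc)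
  finally show ?thesis .
qed

lemma commuting_cube:
  assumes "a \<otimes> b = b \<otimes> a" "a \<in> carrier G" "b \<in> carrier G"
  shows "(a \<otimes> b) \<otimes> ((a \<otimes> b) \<otimes> (a \<otimes> b)) = (a \<otimes> (a \<otimes> a)) \<otimes> (b \<otimes> (b \<otimes> b))"
proof -
  have aab: "b \<otimes> (a \<otimes> a) = (a \<otimes> a) \<otimes> b" using commute_mult[OF assms(1,1) assms(2,2,3)] by simp
  have "(a \<otimes> b) \<otimes> ((a \<otimes> b) \<otimes> (a \<otimes> b)) = a \<otimes> ((b \<otimes> (a \<otimes> a)) \<otimes> (b \<otimes> b))"
    unfolding commuting_square[OF assms] using assms(2,3) by (simp add: m_assoc)
  also have "\<dots> = (a \<otimes> (a \<otimes> a)) \<otimes> (b \<otimes> (b \<otimes> b))"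
    unfolding aab using assms(2,3) by (simp add: m_assoc)
  finally show ?thesis .
qed

lemma conj_cube_one:
  assumes "g \<otimes> (g \<otimes> g) = \<one>" "g \<in> carrier G" "x \<in> carrier G"
  shows "(x \<otimes> g \<otimes> inv x) \<otimes> ((x \<otimes> g \<otimes> inv x) \<otimes> (x \<otimes> g \<otimes> inv x)) = \<one>"
proof -
  have "(x \<otimes> g \<otimes> inv x) \<otimes> ((x \<otimes> g \<otimes> inv x) \<otimes> (x \<otimes> g \<otimes> inv x)) = x \<otimes> ((g \<otimes> (g \<otimes> g)) \<otimes> inv x)"
    using assms(2,3) by (simp add: m_assoc)
  then show ?thesis using assms by simp
qed

lemma inv_cube_one:
  assumes "g \<otimes> (g \<otimes> g) = \<one>" "g \<in> carrier G"
  shows "inv g \<otimes> (inv g \<otimes> inv g) = \<one>"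
  using assms by (metis inv_mult_group inv_one m_assoc m_closed)

text \<open>(eb)^3 = e^3 b^3 = e. This makes congruences modulo a central \<open>E\<close> between
  elements of cube 1 into equations.\<close>

lemma central_involution_cube:
  assumes "e \<otimes> b = b \<otimes> e" "e \<otimes> e = \<one>" "b \<otimes> (b \<otimes> b) = \<one>"
    "(e \<otimes> b) \<otimes> ((e \<otimes> b) \<otimes> (e \<otimes> b)) = \<one>" "e \<in> carrier G" "b \<in> carrier G"
  shows "e = \<one>"
  using commuting_cube[OF assms(1,5,6)] assms(2-6) by simp

end

section \<open>Groups with (P): the sets \<open>E\<close>, \<open>C\<close>, \<open>T\<close>,
  \<open>K\<close> and the quotient by \<open>E\<close>\<close>

locale P_group = group +
  assumes fin: "finite (carrier G)"
    and involution_ex: "\<exists>x\<in>carrier G. x \<otimes> x = \<one> \<and> x \<noteq> \<one>"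
    and P: "\<And>x y. x \<in> carrier G \<Longrightarrow> y \<in> carrier G \<Longrightarrow> x \<otimes> x = \<one> \<Longrightarrow> x \<noteq> \<one> \<Longrightarrow>
       x \<otimes> y = y \<otimes> x \<and> (y [^] (4::nat) = \<one> \<or> y [^] (6::nat) = \<one>) \<or>
       y \<otimes> (y \<otimes> y) = \<one> \<and> (x \<otimes> y) \<otimes> ((x \<otimes> y) \<otimes> (x \<otimes> y)) = \<one>"
begin

definition "E = {x \<in> carrier G. x \<otimes> x = \<one>}"
definition "C = {g \<in> carrier G. \<forall>x\<in>E. g \<otimes> x = x \<otimes> g}"
text \<open>\<open>T\<close> and \<open>K\<close> are the preimages of the elements of G/E with
  square 1 and with cube 1; in general these are only subsets.\<close>

definition "T = {g \<in> carrier G. g \<otimes> g \<in> E}"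
definition "K = {g \<in> carrier G. g \<otimes> (g \<otimes> g) \<in> E}"

lemma E_mem: "x \<in> E \<longleftrightarrow> x \<in> carrier G \<and> x \<otimes> x = \<one>"
  by (simp add: E_def)

lemma E_carrier: "x \<in> E \<Longrightarrow> x \<in> carrier G"
  by (simp add: E_def)

lemma E_square: "x \<in> E \<Longrightarrow> x \<otimes> x = \<one>"
  by (simp add: E_def)

text \<open>For involutions x and y the A_4 alternative of (P) would give y^3 = 1 besides y^2 = 1,
  so x and y commute.\<close>

lemma normal_E: "E \<lhd> G"
  unfolding E_def
proof (rule involutions_normal)
  fix x y assume xy: "x \<in> carrier G" "y \<in> carrier G" "x \<otimes> x = \<one>" "y \<otimes> y = \<one>"
  show "x \<otimes> y = y \<otimes> x"
  proof (cases "x = \<one>")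
    case False
    then show ?thesis using P[OF xy(1,2,3)] square_cube_one[OF xy(4)] xy by auto
  qed (use xy in simp)
qed

lemma subgroup_E: "subgroup E G"
  using normal_E normal_imp_subgroup by blast

lemma E_commute: "x \<in> E \<Longrightarrow> y \<in> E \<Longrightarrow> x \<otimes> y = y \<otimes> x"
  by (rule exponent_2_commute[OF subgroup_E E_square])

lemma C_commute: "g \<in> C \<Longrightarrow> x \<in> E \<Longrightarrow> g \<otimes> x = x \<otimes> g"
  by (simp add: C_def)

lemma subgroup_C: "subgroup C G"
proof (rule subgroupI)
  show "C \<noteq> {}" using E_carrier by (auto simp: C_def intro!: exI[of _ \<one>])
  fix a b assume a: "a \<in> C" and b: "b \<in> C"
  show "inv a \<in> C" using a commute_inv E_carrier by (simp add: C_def)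
  show "a \<otimes> b \<in> C" using a b commute_mult E_carrier by (simp add: C_def)
qed (auto simp: C_def)

lemma E_subset_C: "E \<subseteq> C"
  using E_commute E_carrier by (auto simp: C_def)

text \<open>Some x in \<open>E\<close> does not commute with g, so only the A_4 alternative of (P)
  remains for x and g.\<close>

lemma outside_C:
  assumes "g \<in> carrier G" "g \<notin> C"
  shows "g \<otimes> (g \<otimes> g) = \<one>"
proof -
  obtain x where x: "x \<in> E" "g \<otimes> x \<noteq> x \<otimes> g" using assms by (auto simp: C_def)
  then have "x \<noteq> \<one>" using assms by auto
  then show ?thesis using P[OF E_carrier[OF x(1)] assms(1) E_square[OF x(1)]] x by auto
qed

text \<open>Testing g against any single involution gives g^4 = 1, g^6 = 1 or g^3 = 1.\<close>

lemma square_or_cube: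
  assumes g: "g \<in> carrier G"
  shows "g \<otimes> g \<in> E \<or> g \<otimes> (g \<otimes> g) \<in> E"
proof -
  obtain x where x: "x \<in> carrier G" "x \<otimes> x = \<one>" "x \<noteq> \<one>" using involution_ex by blast
  have "g [^] (4::nat) = \<one> \<or> g [^] (6::nat) = \<one> \<or> g \<otimes> (g \<otimes> g) = \<one>" using P[OF x(1) g x(2,3)] by blast
  moreover have "g [^] (4::nat) = (g \<otimes> g) \<otimes> (g \<otimes> g)"
    "g [^] (6::nat) = (g \<otimes> (g \<otimes> g)) \<otimes> (g \<otimes> (g \<otimes> g))"
    using g by (simp_all add: numeral_eq_Suc m_assoc)
  ultimately show ?thesis using g by (auto simp: E_mem)
qed

abbreviation coset_E where "coset_E g \<equiv> E #> g"

sublocale quotient: group_hom G "G Mod E" coset_E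
  by (rule quotient_hom[OF normal_E])

lemma coset_E_one: "x \<in> carrier G \<Longrightarrow> coset_E x = \<one>\<^bsub>G Mod E\<^esub> \<longleftrightarrow> x \<in> E"
  using rcos_eq_one_iff[OF subgroup_E] by simp

declare quotient.hom_mult [simp del] quotient.hom_inv [simp del] quotient.hom_one [simp del]
  mult_FactGroup [simp del] one_FactGroup [simp del]

lemma coset_E_mult [simp]: "x \<in> carrier G \<Longrightarrow> y \<in> carrier G \<Longrightarrow> coset_E x \<otimes>\<^bsub>G Mod E\<^esub> coset_E y = coset_E (x \<otimes> y)"
  using quotient.hom_mult by metis

lemma coset_E_inv [simp]: "x \<in> carrier G \<Longrightarrow> inv\<^bsub>G Mod E\<^esub> (coset_E x) = coset_E (inv x)"
  using quotient.hom_inv by metis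

lemma coset_E_commute_iff:
  assumes "x \<in> carrier G" "y \<in> carrier G"
  shows "coset_E (x \<otimes> y) = coset_E (y \<otimes> x) \<longleftrightarrow> x \<otimes> y \<otimes> inv x \<otimes> inv y \<in> E"
proof -
  have "x \<otimes> y \<otimes> inv x \<otimes> inv y \<in> E \<longleftrightarrow> coset_E (x \<otimes> y \<otimes> inv x \<otimes> inv y) = \<one>\<^bsub>G Mod E\<^esub>"
    using coset_E_one assms by simp
  also have "\<dots> \<longleftrightarrow> coset_E x \<otimes>\<^bsub>G Mod E\<^esub> coset_E y = coset_E y \<otimes>\<^bsub>G Mod E\<^esub> coset_E x"
    using quotient.H.commutator_one_iff[of "coset_E x" "coset_E y"] assms by simp
  finally show ?thesis using assms by simp
qed

lemma coset_E_ex: "q \<in> carrier (G Mod E) \<Longrightarrow> \<exists>g\<in>carrier G. q = coset_E g"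
  by (auto simp: carrier_FactGroup)

lemma coset_E_carrier: "g \<in> carrier G \<Longrightarrow> coset_E g \<in> carrier (G Mod E)"
  using quotient.hom_closed .

sublocale quotient: order_le_3_group "G Mod E"
proof unfold_locales
  fix q assume "q \<in> carrier (G Mod E)"
  then obtain g where g: "g \<in> carrier G" "q = coset_E g" using coset_E_ex by blast
  show "q \<otimes>\<^bsub>G Mod E\<^esub> q = \<one>\<^bsub>G Mod E\<^esub> \<or> q \<otimes>\<^bsub>G Mod E\<^esub> (q \<otimes>\<^bsub>G Mod E\<^esub> q) = \<one>\<^bsub>G Mod E\<^esub>"
    using square_or_cube[OF g(1)] g coset_E_mult coset_E_one by simp
qed

lemma K_mem: "g \<in> K \<longleftrightarrow> g \<in> carrier G \<and> g \<otimes> (g \<otimes> g) \<in> E"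
  by (simp add: K_def)

lemma T_mem: "g \<in> T \<longleftrightarrow> g \<in> carrier G \<and> g \<otimes> g \<in> E"
  by (simp add: T_def)

lemma K_coset:
  assumes "g \<in> carrier G"
  shows "g \<in> K \<longleftrightarrow> coset_E g \<in> {q \<in> carrier (G Mod E). q \<otimes>\<^bsub>G Mod E\<^esub> (q \<otimes>\<^bsub>G Mod E\<^esub> q) = \<one>\<^bsub>G Mod E\<^esub>}"
  using assms coset_E_mult coset_E_one[of "g \<otimes> (g \<otimes> g)"] coset_E_carrier
  by (simp add: K_mem)

lemma T_coset:
  assumes "g \<in> carrier G"
  shows "g \<in> T \<longleftrightarrow> coset_E g \<in> {q \<in> carrier (G Mod E). q \<otimes>\<^bsub>G Mod E\<^esub> q = \<one>\<^bsub>G Mod E\<^esub>}"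
  using assms coset_E_mult coset_E_one[of "g \<otimes> g"] coset_E_carrier
  by (simp add: T_mem)

text \<open>g is g^3 times the inverse of g^2.\<close>

lemma T_K_subset_E:
  assumes "g \<in> T" "g \<in> K"
  shows "g \<in> E"
proof -
  have g: "g \<in> carrier G" "g \<otimes> g \<in> E" "g \<otimes> (g \<otimes> g) \<in> E" using assms by (auto simp: T_mem K_mem)
  have "g = (g \<otimes> (g \<otimes> g)) \<otimes> inv (g \<otimes> g)" using g(1) by (simp add: m_assoc inv_mult_group)
  then show ?thesis
    using subgroup.m_closed[OF subgroup_E g(3) subgroup.m_inv_closed[OF subgroup_E g(2)]] by simp
qed

text \<open>This is \<open>dihedral_case\<close> for G/E, read in G, together with the commutativity
  of K/E: inversion on it is induced by s and hence an automorphism.\<close>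

lemma dihedral_lift:
  assumes nc: "\<exists>s\<in>T. \<exists>t\<in>T. s \<otimes> t \<otimes> inv s \<otimes> inv t \<notin> E"
  shows "\<exists>s\<in>T. s \<notin> E \<and> (\<forall>a\<in>K. \<forall>b\<in>K. a \<otimes> b \<in> K \<and> a \<otimes> b \<otimes> inv a \<otimes> inv b \<in> E) \<and>
     (\<forall>a\<in>K. s \<otimes> (a \<otimes> (s \<otimes> a)) \<in> E) \<and> (\<forall>g\<in>carrier G. g \<in> K \<or> s \<otimes> g \<in> K) \<and> (\<exists>k\<in>K. k \<notin> E)"
proof -
  let ?Q = "G Mod E"
  obtain s t where st: "s \<in> T" "t \<in> T" "s \<otimes> t \<otimes> inv s \<otimes> inv t \<notin> E" using nc by blast
  have G: "s \<in> carrier G" "t \<in> carrier G" using st by (auto simp: T_mem)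
  let ?s = "coset_E s" and ?t = "coset_E t"
  have nc': "?s \<otimes>\<^bsub>?Q\<^esub> ?t \<noteq> ?t \<otimes>\<^bsub>?Q\<^esub> ?s"
    using coset_E_commute_iff[OF G] st(3) G by simp
  have sq: "?s \<otimes>\<^bsub>?Q\<^esub> ?s = \<one>\<^bsub>?Q\<^esub>" "?t \<otimes>\<^bsub>?Q\<^esub> ?t = \<one>\<^bsub>?Q\<^esub>" using st T_coset G by auto
  note D = quotient.dihedral_case[OF coset_E_carrier[OF G(1)] coset_E_carrier[OF G(2)] sq nc']
  let ?K = "{q \<in> carrier ?Q. q \<otimes>\<^bsub>?Q\<^esub> (q \<otimes>\<^bsub>?Q\<^esub> q) = \<one>\<^bsub>?Q\<^esub>}"
  have KG: "\<And>a. a \<in> K \<Longrightarrow> a \<in> carrier G" by (simp add: K_mem)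
  have Kq: "\<And>a. a \<in> K \<Longrightarrow> coset_E a \<in> ?K" using K_coset KG by blast
  have sE: "s \<notin> E" using D(1) coset_E_one G by blast
  have cl: "a \<otimes> b \<in> K" if "a \<in> K" "b \<in> K" for a b
  proof -
    have "coset_E (a \<otimes> b) \<in> ?K"
      using D(2)[OF Kq[OF that(1)] Kq[OF that(2)]] unfolding coset_E_mult[OF KG[OF that(1)] KG[OF that(2)]] .
    with K_coset[OF m_closed[OF KG[OF that(1)] KG[OF that(2)]]] show ?thesis by (rule iffD2)
  qed
  have inv: "coset_E (s \<otimes> (a \<otimes> s)) = coset_E (inv a)" if "a \<in> K" for a
    using D(3)[OF Kq[OF that]] that KG G by (simp add: coset_E_mult coset_E_inv)
  have si: "s \<otimes> (a \<otimes> (s \<otimes> a)) \<in> E" if a: "a \<in> K" for a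
  proof -
    have "coset_E ((s \<otimes> (a \<otimes> s)) \<otimes> a) = coset_E (inv a \<otimes> a)"
      using coset_E_mult[of "s \<otimes> (a \<otimes> s)" a] coset_E_mult[of "inv a" a] inv[OF a] a KG G by (simp del: coset_E_mult)
    then have "(s \<otimes> (a \<otimes> s)) \<otimes> a \<in> E"
      using coset_E_one[of "(s \<otimes> (a \<otimes> s)) \<otimes> a"] coset_E_one[of \<one>] subgroup.one_closed[OF subgroup_E] a KG G by simp
    then show ?thesis using a KG G by (simp add: m_assoc)
  qed
  \<comment> \<open>Modulo \<open>E\<close>, (ab)^-1 = s(ab)s = (s a s)(s b s) = a^-1 b^-1, with s s
    inserted between a and b.\<close>
  have cm: "a \<otimes> b \<otimes> inv a \<otimes> inv b \<in> E" if ab: "a \<in> K" "b \<in> K" for a b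
  proof -
    have G': "a \<in> carrier G" "b \<in> carrier G" using KG ab by auto
    note ss = quotient.H.involution_extend[OF sq(1) coset_E_carrier[OF G(1)]]
    have "coset_E (inv (a \<otimes> b)) = coset_E (s \<otimes> ((a \<otimes> b) \<otimes> s))" using inv[OF cl[OF ab]] by simp
    also have "\<dots> = ?s \<otimes>\<^bsub>?Q\<^esub> coset_E (a \<otimes> (b \<otimes> s))" using G G' by (simp add: m_assoc)
    also have "\<dots> = coset_E (s \<otimes> a) \<otimes>\<^bsub>?Q\<^esub> coset_E (b \<otimes> s)" using G G' by (simp add: m_assoc)
    also have "\<dots> = coset_E (s \<otimes> a) \<otimes>\<^bsub>?Q\<^esub> (?s \<otimes>\<^bsub>?Q\<^esub> (?s \<otimes>\<^bsub>?Q\<^esub> coset_E (b \<otimes> s)))"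
      using ss[of "coset_E (b \<otimes> s)"] coset_E_carrier G G' by (simp del: coset_E_mult)
    also have "\<dots> = coset_E (s \<otimes> (a \<otimes> s)) \<otimes>\<^bsub>?Q\<^esub> coset_E (s \<otimes> (b \<otimes> s))" using G G' by (simp add: m_assoc)
    also have "\<dots> = coset_E (inv a \<otimes> inv b)" unfolding inv[OF ab(1)] inv[OF ab(2)] using G' by simp
    finally have "coset_E (inv b \<otimes> inv a) = coset_E (inv a \<otimes> inv b)" using G' by (simp add: inv_mult_group)
    then have "coset_E (inv (inv b \<otimes> inv a)) = coset_E (inv (inv a \<otimes> inv b))"
      using G' coset_E_inv by (metis inv_closed m_closed)
    then show ?thesis using coset_E_commute_iff[OF G'] G' by (simp add: inv_mult_group)
  qed
  have gK: "g \<in> K \<or> s \<otimes> g \<in> K" if g: "g \<in> carrier G" for g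
    using D(4)[OF coset_E_carrier[OF g]] K_coset[OF g] K_coset[of "s \<otimes> g"] g G coset_E_mult by simp
  have stK: "s \<otimes> t \<in> K" "s \<otimes> t \<notin> E"
    using D(5,6) K_coset[of "s \<otimes> t"] coset_E_one[of "s \<otimes> t"] coset_E_mult G by simp_all
  have ex: "\<exists>k\<in>K. k \<notin> E" using stK by blast
  show ?thesis
    by (rule bexI[OF _ st(1)] conjI ballI sE cl cm si gK ex | assumption)+
qed

text \<open>Pulls \<open>commuting_case\<close> back from G/E: the involutions there form a
  subgroup, of index at most 3 if nontrivial.\<close>

lemma commuting_lift:
  assumes nc: "\<And>s t. s \<in> T \<Longrightarrow> t \<in> T \<Longrightarrow> s \<otimes> t \<otimes> inv s \<otimes> inv t \<in> E"
  shows "subgroup T G"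
    and "T \<noteq> E \<Longrightarrow> y \<in> carrier G \<Longrightarrow> y \<notin> T \<Longrightarrow> g \<in> carrier G \<Longrightarrow> g \<in> T \<or> g \<otimes> y \<in> T \<or> g \<otimes> inv y \<in> T"
proof -
  let ?Q = "G Mod E"
  let ?T = "{q \<in> carrier ?Q. q \<otimes>\<^bsub>?Q\<^esub> q = \<one>\<^bsub>?Q\<^esub>}"
  have comm: "x \<otimes>\<^bsub>?Q\<^esub> y = y \<otimes>\<^bsub>?Q\<^esub> x"
    if xy: "x \<in> carrier ?Q" "y \<in> carrier ?Q" "x \<otimes>\<^bsub>?Q\<^esub> x = \<one>\<^bsub>?Q\<^esub>" "y \<otimes>\<^bsub>?Q\<^esub> y = \<one>\<^bsub>?Q\<^esub>" for x y
  proof -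
    from coset_E_ex[OF xy(1)] obtain s where s: "s \<in> carrier G" "x = coset_E s" by (rule bexE)
    from coset_E_ex[OF xy(2)] obtain t where t: "t \<in> carrier G" "y = coset_E t" by (rule bexE)
    note st = s(1) t(1) s(2) t(2)
    have "s \<in> T" "t \<in> T" using T_coset[OF s(1)] T_coset[OF t(1)] s t xy by simp_all
    then have "coset_E (s \<otimes> t) = coset_E (t \<otimes> s)" using nc coset_E_commute_iff st by simp
    then show ?thesis using st by simp
  qed
  note Q = quotient.commuting_case[OF comm]
  have nT: "?T \<lhd> ?Q" by (rule Q(1))
  have sT: "subgroup ?T ?Q" by (rule normal_imp_subgroup[OF nT])
  have TG: "\<And>a. a \<in> T \<Longrightarrow> a \<in> carrier G" by (simp add: T_mem)
  have Tq: "\<And>a. a \<in> T \<Longrightarrow> coset_E a \<in> ?T" using T_coset TG by blast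
  show "subgroup T G"
  proof (rule subgroupI)
    show "T \<noteq> {}" using T_mem[of \<one>] subgroup.one_closed[OF subgroup_E] by auto
    fix a b assume a: "a \<in> T" and b: "b \<in> T"
    note aG = TG[OF a] and bG = TG[OF b]
    have "coset_E (inv a) \<in> ?T"
      using subgroup.m_inv_closed[OF sT Tq[OF a]] unfolding coset_E_inv[OF aG] .
    with T_coset[OF inv_closed[OF aG]] show "inv a \<in> T" by (rule iffD2)
    have "coset_E (a \<otimes> b) \<in> ?T"
      using subgroup.m_closed[OF sT Tq[OF a] Tq[OF b]] unfolding coset_E_mult[OF aG bG] .
    with T_coset[OF m_closed[OF aG bG]] show "a \<otimes> b \<in> T" by (rule iffD2)
  qed (auto simp: T_mem)
  show "g \<in> T \<or> g \<otimes> y \<in> T \<or> g \<otimes> inv y \<in> T"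
    if TE: "T \<noteq> E" and y: "y \<in> carrier G" "y \<notin> T" and g: "g \<in> carrier G"
  proof -
    have "E \<subseteq> T" using subgroup.one_closed[OF subgroup_E] by (auto simp: E_mem T_mem)
    then obtain u where u: "u \<in> T" "u \<notin> E" using TE by blast
    then have "?T \<noteq> {\<one>\<^bsub>?Q\<^esub>}" using Tq[OF u(1)] coset_E_one TG[OF u(1)] by blast
    moreover have "coset_E y \<notin> ?T" using y(2) unfolding T_coset[OF y(1)] .
    ultimately have "coset_E g \<in> ?T \<or> coset_E g \<otimes>\<^bsub>?Q\<^esub> coset_E y \<in> ?T \<or>
        coset_E g \<otimes>\<^bsub>?Q\<^esub> inv\<^bsub>?Q\<^esub> coset_E y \<in> ?T"
      by (intro Q(2) coset_E_carrier y(1) g)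
    then show ?thesis
      unfolding coset_E_inv[OF y(1)] coset_E_mult[OF g y(1)] coset_E_mult[OF g inv_closed[OF y(1)]]
      unfolding T_coset[OF g] T_coset[OF m_closed[OF g y(1)]] T_coset[OF m_closed[OF g inv_closed[OF y(1)]]] .
  qed
qed

end

subsection \<open>Generalized dicyclic quotients\<close>

lemma (in group) pow_3: "x \<in> carrier G \<Longrightarrow> x [^] (3::nat) = x \<otimes> (x \<otimes> x)"
  by (simp add: numeral_3_eq_3 m_assoc)

text \<open>Every x agrees with an element of D up to a central factor, so it conjugates D as that
  element does.\<close>

lemma (in group) normal_of_central_supplement:
  assumes D: "subgroup D G" and F: "F \<subseteq> group_center G" and DF: "D <#> F = carrier G"
  shows "D \<lhd> G"
proof (rule normal_invI[OF D])
  fix x d assume x: "x \<in> carrier G" and d: "d \<in> D"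
  obtain d' f where df: "d' \<in> D" "f \<in> F" "x = d' \<otimes> f" using x DF set_mult_mem by metis
  have f: "f \<in> group_center G" using df(2) F by blast
  have G: "d \<in> carrier G" "d' \<in> carrier G" "f \<in> carrier G"
    using d df(1) subgroup.mem_carrier[OF D] group_center_carrier[OF f] by auto
  have "x \<otimes> d \<otimes> inv x = d' \<otimes> ((f \<otimes> d) \<otimes> (inv f \<otimes> inv d'))"
    using G by (simp add: df(3) inv_mult_group m_assoc)
  also have "\<dots> = d' \<otimes> d \<otimes> inv d'"
    unfolding group_center_commute[OF f G(1)] using G by (simp add: m_assoc)
  finally show "x \<otimes> d \<otimes> inv x \<in> D"
    using subgroup.m_closed[OF D subgroup.m_closed[OF D df(1) d] subgroup.m_inv_closed[OF D df(1)]] by simp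
qed

lemma (in group) ord_subgroup_eq_2:
  assumes "subgroup H G" "x \<in> H"
  shows "group.ord (G\<lparr>carrier := H\<rparr>) x = 2 \<longleftrightarrow> x \<otimes> x = \<one> \<and> x \<noteq> \<one>"
  using group.ord_eq_2[OF subgroup_imp_group[OF assms(1)], of x] assms(2) by simp

text \<open>In Z_3^m an element of square 1 is trivial, so the only involution comes from the factor
  Z_2.\<close>

lemma dicyclic_kernel:
  assumes "m \<ge> 1"
  defines "A \<equiv> cyclic_power 3 m \<times>\<times> integer_mod_group 2"
  shows "comm_group A" "\<exists>!t. t \<in> carrier A \<and> group.ord A t = 2" "2 < order A"
proof -
  interpret Z: group "cyclic_power 3 m" by simp
  show cA: "comm_group A" unfolding A_def by (intro comm_group_DirProd) auto
  interpret A: comm_group A by fact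
  have one: "\<one>\<^bsub>A\<^esub> = (\<one>\<^bsub>cyclic_power 3 m\<^esub>, 0)" by (simp add: A_def)
  have ord: "A.ord t = 2 \<longleftrightarrow> t = (\<one>\<^bsub>cyclic_power 3 m\<^esub>, 1)" if t: "t \<in> carrier A" for t
  proof -
    obtain f i where fi: "t = (f, i)" by (cases t)
    have f: "f \<in> carrier (cyclic_power 3 m)" and i: "i = 0 \<or> i = 1"
      using t fi by (auto simp: A_def carrier_integer_mod_group)
    have f3: "f \<otimes>\<^bsub>cyclic_power 3 m\<^esub> (f \<otimes>\<^bsub>cyclic_power 3 m\<^esub> f) = \<one>\<^bsub>cyclic_power 3 m\<^esub>"
      using cyclic_power_pow[OF f] Z.pow_3[OF f] by simp
    have "t \<otimes>\<^bsub>A\<^esub> t = \<one>\<^bsub>A\<^esub> \<longleftrightarrow> f \<otimes>\<^bsub>cyclic_power 3 m\<^esub> f = \<one>\<^bsub>cyclic_power 3 m\<^esub>"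
      using i by (auto simp: fi A_def)
    also have "\<dots> \<longleftrightarrow> f = \<one>\<^bsub>cyclic_power 3 m\<^esub>" using Z.square_cube_one[OF _ f3 f] f by auto
    finally show ?thesis using A.ord_eq_2[OF t] i by (auto simp: fi one)
  qed
  have "(\<one>\<^bsub>cyclic_power 3 m\<^esub>, 1) \<in> carrier A" by (simp add: A_def carrier_integer_mod_group)
  then show "\<exists>!t. t \<in> carrier A \<and> group.ord A t = 2" using ord by blast
  have "order A = 3 ^ m * 2"
    by (simp add: order_def A_def card_cartesian_product card_cyclic_power carrier_integer_mod_group)
  moreover have "(3::nat) ^ m \<ge> 3" using assms(1) power_increasing[of 1 m "3::nat"] by simp
  ultimately show "2 < order A" by simp
qed

section \<open>Central \<open>E\<close> and a dihedral quotient: family (a)\<close>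

context P_group
begin

lemma C_carrier: "g \<in> C \<Longrightarrow> g \<in> carrier G"
  by (simp add: C_def)

lemma finite_E: "finite E"
  using fin by (simp add: E_def)

lemma exponent_2_cyclic_power:
  assumes "subgroup F G" "F \<subseteq> E"
  shows "\<exists>m. G\<lparr>carrier := F\<rparr> \<cong> cyclic_power 2 m"
proof (rule elementary_abelian_cyclic_power[OF two_is_prime_nat assms(1)])
  show "finite F" using finite_subset[OF assms(2) finite_E] .
  show "x \<otimes> y = y \<otimes> x" if "x \<in> F" "y \<in> F" for x y
    using E_commute[OF subsetD[OF assms(2) that(1)] subsetD[OF assms(2) that(2)]] .
  show "x [^] (2::nat) = \<one>" if "x \<in> F" for x
    using E_mem[of x] subsetD[OF assms(2) that] by (simp add: numeral_2_eq_2)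
qed

text \<open>The elements \<open>Q\<close> of cube 1 complement \<open>E\<close> in \<open>K\<close>.
  That they commute and are inverted by s holds modulo \<open>E\<close> and becomes exact by
  \<open>central_involution_cube\<close>. With t = s^2, the group generated by \<open>Q\<close>, t
  and s is Dic(Q x <t>), and a complement F of <t> in \<open>E\<close> splits off as the other
  direct factor.\<close>

lemma family_a_of_central:
  assumes central: "C = carrier G"
    and s: "s \<in> T" "s \<notin> E"
    and K_closed: "\<And>a b. a \<in> K \<Longrightarrow> b \<in> K \<Longrightarrow> a \<otimes> b \<in> K"
    and K_comm: "\<And>a b. a \<in> K \<Longrightarrow> b \<in> K \<Longrightarrow> a \<otimes> b \<otimes> inv a \<otimes> inv b \<in> E"
    and K_inv: "\<And>a. a \<in> K \<Longrightarrow> s \<otimes> (a \<otimes> (s \<otimes> a)) \<in> E"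
    and index: "\<And>g. g \<in> carrier G \<Longrightarrow> g \<in> K \<or> s \<otimes> g \<in> K"
    and k: "k \<in> K" "k \<notin> E"
  shows "family_a G"
proof -
  have ce: "e \<otimes> g = g \<otimes> e" if "e \<in> E" "g \<in> carrier G" for e g
    using C_commute[of g e] that central by simp
  have EK: "E \<subseteq> K"
  proof
    fix e assume e: "e \<in> E"
    have "e \<otimes> (e \<otimes> e) = e" using e E_square E_carrier by simp
    then show "e \<in> K" using e E_carrier by (simp add: K_mem)
  qed
  have KG: "\<And>a. a \<in> K \<Longrightarrow> a \<in> carrier G" by (simp add: K_mem)
  have sG: "s \<in> carrier G" using s by (simp add: T_mem)
  define t where "t = s \<otimes> s"
  have tE: "t \<in> E" using s by (simp add: T_mem t_def)
  have tG: "t \<in> carrier G" using E_carrier[OF tE] .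
  have tt: "t \<otimes> t = \<one>" using E_square[OF tE] .
  have t1: "t \<noteq> \<one>" using s sG by (auto simp: E_mem t_def)
  have inv_s: "inv s = s \<otimes> t" using tt sG by (intro inv_equality) (simp_all add: t_def m_assoc)
  define Q where "Q = {g \<in> carrier G. g \<otimes> (g \<otimes> g) = \<one>}"
  have QG: "\<And>a. a \<in> Q \<Longrightarrow> a \<in> carrier G" by (simp add: Q_def)
  have Q3: "\<And>a. a \<in> Q \<Longrightarrow> a \<otimes> (a \<otimes> a) = \<one>" by (simp add: Q_def)
  have QK: "\<And>a. a \<in> Q \<Longrightarrow> a \<in> K" using subgroup.one_closed[OF subgroup_E] by (simp add: Q_def K_mem)
  have QE: "a = \<one>" if "a \<in> Q" "a \<in> E" for a
    using square_cube_one[OF E_square[OF that(2)] Q3[OF that(1)] QG[OF that(1)]] .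
  have Qcomm: "a \<otimes> b = b \<otimes> a" if ab: "a \<in> Q" "b \<in> Q" for a b
  proof -
    define e where "e = a \<otimes> b \<otimes> inv a \<otimes> inv b"
    have eE: "e \<in> E" unfolding e_def using K_comm QK ab by blast
    have G: "a \<in> carrier G" "b \<in> carrier G" "e \<in> carrier G" using ab QG E_carrier[OF eE] by auto
    have eb: "e \<otimes> b = a \<otimes> b \<otimes> inv a" using G by (simp add: e_def m_assoc)
    have "(e \<otimes> b) \<otimes> ((e \<otimes> b) \<otimes> (e \<otimes> b)) = \<one>"
      unfolding eb by (rule conj_cube_one[OF Q3[OF ab(2)] G(2,1)])
    then have "e = \<one>"
      by (rule central_involution_cube[OF ce[OF eE G(2)] E_square[OF eE] Q3[OF ab(2)] _ G(3,2)])
    then show ?thesis using commutator_one_iff[OF G(1,2)] by (simp add: e_def)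
  qed
  have sQ: "subgroup Q G"
  proof (rule subgroupI)
    show "Q \<noteq> {}" by (auto simp: Q_def intro!: exI[of _ \<one>])
    fix a b assume a: "a \<in> Q" and b: "b \<in> Q"
    show "inv a \<in> Q" using inv_cube_one[OF Q3[OF a] QG[OF a]] QG[OF a] by (simp add: Q_def)
    show "a \<otimes> b \<in> Q"
      using commuting_cube[OF Qcomm[OF a b] QG[OF a] QG[OF b]] Q3[OF a] Q3[OF b] QG[OF a] QG[OF b]
      by (simp add: Q_def)
  qed (auto simp: Q_def)
  have Qinv: "s \<otimes> a \<otimes> inv s = inv a" if a: "a \<in> Q" for a
  proof -
    have aG: "a \<in> carrier G" using QG[OF a] .
    define e where "e = s \<otimes> a \<otimes> inv s \<otimes> a"
    have "e = s \<otimes> (a \<otimes> (s \<otimes> (t \<otimes> a)))" using aG sG tG by (simp add: e_def inv_s m_assoc)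
    also have "\<dots> = (s \<otimes> (a \<otimes> (s \<otimes> a))) \<otimes> t" unfolding ce[OF tE aG] using aG sG tG by (simp add: m_assoc)
    finally have eE: "e \<in> E" using subgroup.m_closed[OF subgroup_E K_inv[OF QK[OF a]] tE] by simp
    have eG: "e \<in> carrier G" using E_carrier[OF eE] .
    have ea: "e \<otimes> inv a = s \<otimes> a \<otimes> inv s" using aG sG by (simp add: e_def m_assoc)
    have "(e \<otimes> inv a) \<otimes> ((e \<otimes> inv a) \<otimes> (e \<otimes> inv a)) = \<one>"
      unfolding ea by (rule conj_cube_one[OF Q3[OF a] aG sG])
    then have "e = \<one>"
      by (rule central_involution_cube[OF ce[OF eE inv_closed[OF aG]] E_square[OF eE]
            inv_cube_one[OF Q3[OF a] aG] _ eG inv_closed[OF aG]])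
    then show ?thesis using ea aG by simp
  qed
  have Qinv': "inv s \<otimes> a \<otimes> s = inv a" if a: "a \<in> Q" for a
  proof -
    have "inv s \<otimes> a \<otimes> s = inv s \<otimes> (s \<otimes> (inv a) \<otimes> inv s) \<otimes> s"
      using Qinv[OF subgroup.m_inv_closed[OF sQ a]] QG[OF a] by simp
    also have "\<dots> = inv a" using QG[OF a] sG by (simp add: m_assoc)
    finally show ?thesis .
  qed
  \<comment> \<open>With e = g^3 central of square 1, g e = g^4 has cube e^4 = 1; it is the
    component of g in \<open>Q\<close>.\<close>
  have K_dec: "\<exists>q\<in>Q. \<exists>e\<in>E. g = q \<otimes> e" if g: "g \<in> K" for g
  proof -
    define e where "e = g \<otimes> (g \<otimes> g)"
    have eE: "e \<in> E" using g by (simp add: K_mem e_def)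
    have G: "g \<in> carrier G" "e \<in> carrier G" using KG[OF g] E_carrier[OF eE] by auto
    have "(g \<otimes> e) \<otimes> ((g \<otimes> e) \<otimes> (g \<otimes> e)) = e \<otimes> (e \<otimes> (e \<otimes> e))"
      using commuting_cube[OF ce[OF eE G(1), symmetric] G] by (simp add: e_def)
    then have "g \<otimes> e \<in> Q" using E_square[OF eE] G by (simp add: Q_def)
    moreover have "g = (g \<otimes> e) \<otimes> e" using E_square[OF eE] G by (simp add: m_assoc)
    ultimately show ?thesis using eE by blast
  qed
  define Z where "Z = {\<one>, t}"
  have sZ: "subgroup Z G" unfolding Z_def
    by (rule subgroupI) (use tt tG inv_of_involution in auto)
  have ZE: "Z \<subseteq> E" using tE subgroup.one_closed[OF subgroup_E] by (auto simp: Z_def)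
  obtain F where F: "subgroup F G" "F \<subseteq> E" "Z \<inter> F = {\<one>}" "Z <#> F = E"
    using exponent_2_complement[OF subgroup_E finite_E E_square sZ ZE] by blast
  have QZ: "q \<otimes> c = c \<otimes> q" if "q \<in> Q" "c \<in> Z" for q c
    using ce[OF subsetD[OF ZE that(2)] QG[OF that(1)]] by simp
  define B where "B = Q <#> Z"
  have sB: "subgroup B G" unfolding B_def by (rule commuting_product_subgroup[OF sQ sZ QZ])
  have BG: "\<And>b. b \<in> B \<Longrightarrow> b \<in> carrier G" using subgroup.mem_carrier[OF sB] .
  have QB: "Q \<subseteq> B" "Z \<subseteq> B" unfolding B_def using set_mult_upper[OF sQ sZ] by auto
  have Binv: "inv s \<otimes> b \<otimes> s = inv b" if bB: "b \<in> B" for b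
  proof -
    obtain q c where qc: "q \<in> Q" "c \<in> Z" "b = q \<otimes> c" using bB by (auto simp: B_def set_mult_mem)
    have G: "q \<in> carrier G" "c \<in> carrier G" "c \<in> E" using qc QG ZE E_carrier by auto
    have "inv s \<otimes> b \<otimes> s = (inv s \<otimes> q) \<otimes> (c \<otimes> s)" using qc G sG by (simp add: m_assoc)
    also have "\<dots> = (inv s \<otimes> q \<otimes> s) \<otimes> c" unfolding ce[OF G(3) sG] using G sG by (simp add: m_assoc)
    also have "\<dots> = inv q \<otimes> inv c" unfolding Qinv'[OF qc(1)] using inv_of_involution[OF E_square[OF G(3)] G(2)] by simp
    also have "\<dots> = inv (c \<otimes> q)" using G by (simp add: inv_mult_group)
    finally show ?thesis using qc(3) QZ[OF qc(1,2)] by simp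
  qed
  define D where "D = generate G (insert s B)"
  have sBG: "insert s B \<subseteq> carrier G" using sG BG by auto
  have sD: "subgroup D G" unfolding D_def by (rule generate_is_subgroup[OF sBG])
  have DG: "\<And>d. d \<in> D \<Longrightarrow> d \<in> carrier G" using subgroup.mem_carrier[OF sD] .
  have inD: "s \<in> D" "B \<subseteq> D" unfolding D_def by (auto intro: generate.incl)
  \<comment> \<open>Moving s past an element of \<open>B\<close> inverts that element, and s^2 = t
    lies in \<open>B\<close>.\<close>
  have D_form: "D \<subseteq> B \<union> (\<lambda>b. s \<otimes> b) ` B" (is "_ \<subseteq> ?N")
    unfolding D_def
  proof (rule generate_left_closed[OF sBG])
    show "?N \<subseteq> carrier G" using BG sG by auto
    then show "finite ?N" using fin finite_subset by blast
    show "\<one> \<in> ?N" using subgroup.one_closed[OF sB] by simp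
    fix u n assume u: "u \<in> insert s B" and "n \<in> ?N"
    then obtain b where b: "b \<in> B" "n = b \<or> n = s \<otimes> b" by blast
    have ssb: "s \<otimes> (s \<otimes> b) = t \<otimes> b" using sG BG[OF b(1)] by (simp add: t_def m_assoc)
    have tb: "t \<otimes> b \<in> B" using subgroup.m_closed[OF sB _ b(1)] QB by (auto simp: Z_def)
    show "u \<otimes> n \<in> ?N"
    proof (cases "u = s")
      case True
      then show ?thesis using b ssb tb by auto
    next
      case False
      then have uB: "u \<in> B" using u by simp
      have uG: "u \<in> carrier G" using BG[OF uB] .
      have "u \<otimes> s = s \<otimes> (inv s \<otimes> u \<otimes> s)" using uG sG by (simp add: m_assoc)
      then have "u \<otimes> (s \<otimes> b) = s \<otimes> (inv u \<otimes> b)"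
        unfolding Binv[OF uB] using uG sG BG[OF b(1)] by (metis inv_closed m_assoc)
      moreover have "inv u \<otimes> b \<in> B" "u \<otimes> b \<in> B"
        using subgroup.m_closed[OF sB] subgroup.m_inv_closed[OF sB] uB b(1) by auto
      ultimately show ?thesis using b(2) by auto
    qed
  qed
  have DF: "D <#> F = carrier G"
  proof
    show "D <#> F \<subseteq> carrier G"
      by (rule set_mult_subset[OF subgroup_self subgroup.subset[OF sD] subgroup.subset[OF F(1)]])
    have KDF: "g \<in> D <#> F" if "g \<in> K" for g
    proof -
      obtain q e where qe: "q \<in> Q" "e \<in> E" "g = q \<otimes> e" using K_dec[OF \<open>g \<in> K\<close>] by blast
      obtain c f where cf: "c \<in> Z" "f \<in> F" "e = c \<otimes> f" using qe(2) F(4) set_mult_mem by metis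
      have "g = (q \<otimes> c) \<otimes> f"
        using qe(3) cf(3) QG[OF qe(1)] subgroup.mem_carrier[OF sZ cf(1)] subgroup.mem_carrier[OF F(1) cf(2)]
        by (simp add: m_assoc)
      moreover have "q \<otimes> c \<in> D" using set_multI[OF qe(1) cf(1)] inD B_def by auto
      ultimately show ?thesis using set_multI cf(2) by auto
    qed
    show "carrier G \<subseteq> D <#> F"
    proof
      fix g assume g: "g \<in> carrier G"
      show "g \<in> D <#> F"
      proof (cases "g \<in> K")
        case False
        then have "s \<otimes> g \<in> D <#> F" using index[OF g] KDF by blast
        then obtain d f where df: "d \<in> D" "f \<in> F" "s \<otimes> g = d \<otimes> f" by (auto simp: set_mult_mem)
        have "g = inv s \<otimes> (s \<otimes> g)" using g sG by simp
        also have "\<dots> = (inv s \<otimes> d) \<otimes> f" unfolding df(3)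
          using DG[OF df(1)] subgroup.mem_carrier[OF F(1) df(2)] sG by (simp add: m_assoc)
        finally show ?thesis
          using set_multI[OF subgroup.m_closed[OF sD subgroup.m_inv_closed[OF sD inD(1)] df(1)] df(2)] by simp
      qed (rule KDF)
    qed
  qed
  have FC: "F \<subseteq> group_center G"
  proof
    fix f assume "f \<in> F"
    then have "f \<in> E" using F(2) by blast
    then show "f \<in> group_center G" unfolding group_center_mem using ce E_carrier by blast
  qed
  have nD: "D \<lhd> G" by (rule normal_of_central_supplement[OF sD FC DF])
  \<comment> \<open>An element s q c of \<open>E\<close> would put s into \<open>K\<close>; as s is
    in \<open>T\<close>, it would then lie in \<open>E\<close>.\<close>
  have DE: "u \<in> Z" if u: "u \<in> D" "u \<in> E" for u
  proof -
    obtain b where b: "b \<in> B" "u = b \<or> u = s \<otimes> b" using D_form u(1) by blast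
    obtain q c where qc: "q \<in> Q" "c \<in> Z" "b = q \<otimes> c" using b(1) by (auto simp: B_def set_mult_mem)
    have cE: "c \<in> E" using qc ZE by blast
    have G: "q \<in> carrier G" "c \<in> carrier G" using QG[OF qc(1)] E_carrier[OF cE] by auto
    have cc: "c \<otimes> c = \<one>" using E_square[OF cE] .
    show "u \<in> Z"
    proof (cases "u = b")
      case True
      then have "q = u \<otimes> c" using qc(3) G cc by (simp add: m_assoc)
      then have "q \<in> E" using subgroup.m_closed[OF subgroup_E u(2) cE] by simp
      then have "u = c" using QE[OF qc(1)] True qc(3) G by simp
      then show ?thesis using qc(2) by simp
    next
      case False
      then have e: "u = s \<otimes> (q \<otimes> c)" using b(2) qc(3) by simp
      then have "s = (u \<otimes> c) \<otimes> inv q" using G sG cc by (simp add: m_assoc mult_assoc_extend[OF cc])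
      moreover have "u \<otimes> c \<in> K" using subgroup.m_closed[OF subgroup_E u(2) cE] EK by blast
      ultimately have "s \<in> K" using K_closed QK[OF subgroup.m_inv_closed[OF sQ qc(1)]] by simp
      then show ?thesis using T_K_subset_E s by blast
    qed
  qed
  have "D \<inter> F = {\<one>}"
    using DE F(2,3) subgroup.one_closed[OF sD] subgroup.one_closed[OF F(1)] by blast
  then have "internal_direct G D F"
    using nD subgroup_of_center_normal[OF F(1) FC] DF by (simp add: internal_direct_def)
  moreover obtain n where "G\<lparr>carrier := F\<rparr> \<cong> cyclic_power 2 n"
    using exponent_2_cyclic_power[OF F(1,2)] by blast
  moreover obtain m where m: "G\<lparr>carrier := Q\<rparr> \<cong> cyclic_power 3 m"
  proof -
    have "prime (3::nat)" by simp
    moreover have "finite Q" using fin by (simp add: Q_def)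
    moreover have "\<And>x. x \<in> Q \<Longrightarrow> x [^] (3::nat) = \<one>"
      using Q3 QG by (simp add: pow_3)
    ultimately show ?thesis using elementary_abelian_cyclic_power[OF _ sQ _ Qcomm] that by blast
  qed
  \<comment> \<open>For m = 0 the group \<open>Q\<close> is trivial and k would lie in
    \<open>E\<close>.\<close>
  moreover have "m \<ge> 1"
  proof (rule ccontr)
    assume "\<not> m \<ge> 1"
    then have "card Q = 1" using iso_same_card[OF m] by (simp add: card_cyclic_power)
    then have "Q = {\<one>}" using subgroup.one_closed[OF sQ] by (metis card_1_singletonE singletonD)
    then have "k \<in> E" using K_dec[OF k(1)] E_carrier by auto
    then show False using k by simp
  qed
  moreover have "generalized_dicyclic (G\<lparr>carrier := D\<rparr>) (cyclic_power 3 m \<times>\<times> integer_mod_group 2)"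
    unfolding generalized_dicyclic_def
  proof (intro conjI exI)
    show "group (G\<lparr>carrier := D\<rparr>)" using subgroup_imp_group[OF sD] .
    show "comm_group (cyclic_power 3 m \<times>\<times> integer_mod_group 2)" "2 < order (cyclic_power 3 m \<times>\<times> integer_mod_group 2)"
      "\<exists>!t. t \<in> carrier (cyclic_power 3 m \<times>\<times> integer_mod_group 2) \<and> group.ord (cyclic_power 3 m \<times>\<times> integer_mod_group 2) t = 2"
      using dicyclic_kernel[OF \<open>m \<ge> 1\<close>] by auto
    show "subgroup B (G\<lparr>carrier := D\<rparr>)" by (rule subgroup_incl[OF sB sD inD(2)])
    have i: "Q \<inter> Z = {\<one>}" using QE ZE subgroup.one_closed[OF sQ] subgroup.one_closed[OF sZ] by blast
    have gQ: "group (G\<lparr>carrier := Q\<rparr>)" and gZ: "group (G\<lparr>carrier := Z\<rparr>)"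
      using subgroup_imp_group sQ sZ by auto
    have "G\<lparr>carrier := Z\<rparr> \<cong> integer_mod_group 2"
    proof -
      have o: "ord t = 2" using ord_eq_2[OF tG] tt t1 by simp
      have "generate G {t} = Z"
      proof
        show "generate G {t} \<subseteq> Z" by (rule generate_subgroup_incl[OF _ sZ]) (simp add: Z_def)
        show "Z \<subseteq> generate G {t}" by (auto simp: Z_def intro: generate.intros)
      qed
      then show ?thesis using iso_cyclic[OF tG o] tG by (simp add: subgroup_generated_carrier)
    qed
    then have "G\<lparr>carrier := Q\<rparr> \<times>\<times> G\<lparr>carrier := Z\<rparr> \<cong> cyclic_power 3 m \<times>\<times> integer_mod_group 2"
      using group.DirProd_iso_trans[OF gQ m] by blast
    moreover have "G\<lparr>carrier := B\<rparr> \<cong> G\<lparr>carrier := Q\<rparr> \<times>\<times> G\<lparr>carrier := Z\<rparr>"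
      using group.iso_sym[OF DirProd_group[OF gQ gZ] commuting_product_iso[OF sQ sZ QZ i]] by (simp add: B_def)
    ultimately show "G\<lparr>carrier := D\<rparr>\<lparr>carrier := B\<rparr> \<cong> cyclic_power 3 m \<times>\<times> integer_mod_group 2"
      using iso_trans by auto
    show "t \<in> B" using QB by (auto simp: Z_def)
    then have tD: "t \<in> D" using inD by blast
    show "group.ord (G\<lparr>carrier := D\<rparr>) t = 2" using ord_subgroup_eq_2[OF sD tD] tt t1 by simp
    show "s \<in> carrier (G\<lparr>carrier := D\<rparr>)" using inD by simp
    show "s \<otimes>\<^bsub>G\<lparr>carrier := D\<rparr>\<^esub> s = t" by (simp add: t_def)
    show "\<forall>a\<in>B. inv\<^bsub>G\<lparr>carrier := D\<rparr>\<^esub> s \<otimes>\<^bsub>G\<lparr>carrier := D\<rparr>\<^esub> a \<otimes>\<^bsub>G\<lparr>carrier := D\<rparr>\<^esub> s = inv\<^bsub>G\<lparr>carrier := D\<rparr>\<^esub> a"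
      using Binv inD m_inv_consistent[OF sD] by (auto simp: subset_iff)
    show "generate (G\<lparr>carrier := D\<rparr>) (insert s B) = carrier (G\<lparr>carrier := D\<rparr>)"
      using generate_consistent[OF _ sD, of "insert s B"] inD by (simp add: D_def)
  qed
  ultimately show ?thesis unfolding family_a_def by blast
qed

end

subsection \<open>Elements of order three acting without fixed points\<close>

context group
begin

lemma generate_cube_one:
  assumes "z \<in> carrier G" "z \<otimes> (z \<otimes> z) = \<one>"
  shows "generate G {z} = {\<one>, z, inv z}"
proof
  have "inv z = z \<otimes> z" using inv_of_cube_one assms by blast
  then show "generate G {z} \<subseteq> {\<one>, z, inv z}"
    using assms by (intro generate_left_closed) auto
  show "{\<one>, z, inv z} \<subseteq> generate G {z}" by (auto intro: generate.intros)
qed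

lemma ord_eq_3:
  assumes "z \<in> carrier G" "z \<otimes> (z \<otimes> z) = \<one>" "z \<noteq> \<one>"
  shows "ord z = 3"
proof -
  have "ord z dvd 3" using pow_eq_id[of z 3] assms by (simp add: pow_3)
  moreover have "ord z \<noteq> 1" using ord_eq_1 assms by blast
  moreover have "prime (3::nat)" by simp
  ultimately show ?thesis by (meson prime_nat_iff)
qed

text \<open>Conjugation maps the finite H injectively into itself, so equality is automatic.\<close>

lemma normalizerI:
  assumes H: "subgroup H G" "finite H" and z: "z \<in> carrier G" and c: "\<And>h. h \<in> H \<Longrightarrow> z \<otimes> h \<otimes> inv z \<in> H"
  shows "z \<in> normalizer G H"
proof -
  have HG: "\<And>h. h \<in> H \<Longrightarrow> h \<in> carrier G" using subgroup.mem_carrier[OF H(1)] .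
  have "(\<lambda>h. z \<otimes> h \<otimes> inv z) ` H = H"
    by (rule endo_inj_surj[OF H(2)]) (use c z HG in \<open>auto simp: inj_on_def\<close>)
  moreover have "z <# H #> inv z = (\<lambda>h. z \<otimes> h \<otimes> inv z) ` H" by (auto simp: l_coset_def r_coset_def)
  ultimately show ?thesis using z subgroup.subset[OF H(1)] by (simp add: normalizer_def stabilizer_def)
qed

lemma Least_pow_3:
  assumes "z \<in> S" "z \<in> carrier G" "z \<noteq> \<one>" "S \<subseteq> carrier G" "\<And>x. x \<in> S \<Longrightarrow> x \<otimes> (x \<otimes> x) = \<one>"
  shows "(LEAST n. 0 < n \<and> (\<forall>x\<in>S. x [^] n = \<one>)) = (3::nat)"
proof (rule Least_equality)
  show "0 < (3::nat) \<and> (\<forall>x\<in>S. x [^] (3::nat) = \<one>)"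
    using assms(5) pow_3 assms(4) by (simp add: subset_iff)
  fix n :: nat assume n: "0 < n \<and> (\<forall>x\<in>S. x [^] n = \<one>)"
  then have "z [^] n = \<one>" using assms(1) by blast
  then have "3 dvd n" using pow_eq_id[OF assms(2)] ord_eq_3[OF assms(2) assms(5)[OF assms(1)] assms(3)] by simp
  then show "3 \<le> n" using n by (simp add: dvd_imp_le)
qed

end

context P_group
begin

lemma normal_C: "C \<lhd> G"
proof (rule normal_invI[OF subgroup_C])
  fix x c assume x: "x \<in> carrier G" and c: "c \<in> C"
  have cG: "c \<in> carrier G" using C_carrier[OF c] .
  show "x \<otimes> c \<otimes> inv x \<in> C"
    unfolding C_def
  proof (intro CollectI conjI ballI)
    fix e assume e: "e \<in> E"
    have e': "inv x \<otimes> e \<otimes> x \<in> E" using conj_closed(2)[OF normal_E x e] .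
    have eG: "e \<in> carrier G" using E_carrier[OF e] .
    have "x \<otimes> c \<otimes> inv x \<otimes> e = x \<otimes> (c \<otimes> (inv x \<otimes> e \<otimes> x)) \<otimes> inv x" using x cG eG by (simp add: m_assoc)
    also have "\<dots> = e \<otimes> (x \<otimes> c \<otimes> inv x)" unfolding C_commute[OF c e'] using x cG eG by (simp add: m_assoc)
    finally show "x \<otimes> c \<otimes> inv x \<otimes> e = e \<otimes> (x \<otimes> c \<otimes> inv x)" .
  qed (use x cG in simp)
qed

text \<open>An element of \<open>T\<close> outside \<open>C\<close> would have cube 1 and so lie in
  \<open>T\<close> and \<open>K\<close>, whose common part is contained in \<open>E\<close> and thus
  in \<open>C\<close>.\<close>

lemma T_subset_C: "T \<subseteq> C"
proof
  fix g assume g: "g \<in> T"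
  show "g \<in> C"
  proof (rule ccontr)
    assume "g \<notin> C"
    then have "g \<in> K" using outside_C[of g] g subgroup.one_closed[OF subgroup_E] by (simp add: T_mem K_mem)
    then show False using T_K_subset_E[OF g] E_subset_C \<open>g \<notin> C\<close> by blast
  qed
qed

end

section \<open>Noncentral \<open>E\<close>: a fixed element z of order 3 outside
  \<open>C\<close>\<close>

locale noncentral_P_group = P_group +
  fixes z
  assumes zG: "z \<in> carrier G" and zC: "z \<notin> C"
begin

lemma z_cube: "z \<otimes> (z \<otimes> z) = \<one>"
  using outside_C[OF zG zC] .

lemma z_neq_one: "z \<noteq> \<one>"
  using zC subgroup.one_closed[OF subgroup_C] by auto

lemma inv_z_notin: "inv z \<notin> C"
  using zC subgroup.m_inv_closed[OF subgroup_C, of "inv z"] zG by auto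

lemma mult_notin:
  assumes "c \<in> C" "g \<in> carrier G" "g \<notin> C"
  shows "c \<otimes> g \<notin> C"
proof
  assume "c \<otimes> g \<in> C"
  then have "inv c \<otimes> (c \<otimes> g) \<in> C"
    using subgroup.m_closed[OF subgroup_C subgroup.m_inv_closed[OF subgroup_C assms(1)]] by blast
  then show False using assms C_carrier by simp
qed

lemma twisted_cube:
  assumes "c \<in> C" "g \<in> carrier G" "g \<notin> C"
  shows "(c \<otimes> g) \<otimes> ((c \<otimes> g) \<otimes> (c \<otimes> g)) = \<one>"
  using outside_C[OF _ mult_notin[OF assms]] C_carrier[OF assms(1)] assms(2) by simp

text \<open>Otherwise g, z, gz and gz^-1 all lie outside \<open>C\<close>, so their translates by
  \<open>E\<close> have cube 1 and \<open>free_pair_trivial\<close> makes \<open>E\<close> trivial,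
  although an involution exists.\<close>

lemma index_3:
  assumes g: "g \<in> carrier G"
  shows "g \<in> C \<or> g \<otimes> z \<in> C \<or> g \<otimes> inv z \<in> C"
proof (rule ccontr)
  assume n: "\<not> ?thesis"
  have cube: "(x \<otimes> t) \<otimes> ((x \<otimes> t) \<otimes> (x \<otimes> t)) = \<one>"
    if "x \<in> E" "t \<in> {g, z, g \<otimes> z, g \<otimes> inv z}" for x t
    using twisted_cube[of x t] that E_subset_C n g zG zC by blast
  have "x = \<one>" if "x \<in> E" for x
    using free_pair_trivial[OF normal_E E_square g zG cube that] by simp
  then show False using involution_ex E_mem by blast
qed

text \<open>Conjugating by z turns gz in \<open>C\<close> into a statement about g^-1; so for g
  outside \<open>C\<close>, either g or its inverse lies in the coset \<open>C\<close> z.\<close>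

lemma outside_form:
  assumes g: "g \<in> carrier G" "g \<notin> C"
  shows "g \<otimes> inv z \<in> C \<or> inv g \<otimes> inv z \<in> C"
proof -
  have "inv g \<otimes> inv z \<in> C" if "g \<otimes> z \<in> C"
  proof -
    have "inv g \<otimes> inv z = inv (z \<otimes> (g \<otimes> z) \<otimes> inv z)"
      using g zG by (simp add: inv_mult_group m_assoc)
    moreover have "z \<otimes> (g \<otimes> z) \<otimes> inv z \<in> C" using conj_closed(1)[OF normal_C zG that] .
    ultimately show ?thesis using subgroup.m_inv_closed[OF subgroup_C] by simp
  qed
  then show ?thesis using index_3[OF g(1)] g(2) by blast
qed

lemma generate_z: "generate G {z} = {\<one>, z, inv z}"
  by (rule generate_cube_one[OF zG z_cube])

lemma semidirect_C: "internal_semidirect G C (generate G {z})"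
  unfolding internal_semidirect_def
proof (intro conjI)
  show "C \<lhd> G" by (rule normal_C)
  show sZ: "subgroup (generate G {z}) G" using zG by (intro generate_is_subgroup) simp
  show "C \<inter> generate G {z} = {\<one>}"
    unfolding generate_z using zC inv_z_notin subgroup.one_closed[OF subgroup_C] by auto
  show "C <#> generate G {z} = carrier G"
  proof
    show "C <#> generate G {z} \<subseteq> carrier G"
      by (rule set_mult_subset[OF subgroup_self subgroup.subset[OF subgroup_C] subgroup.subset[OF sZ]])
    show "carrier G \<subseteq> C <#> generate G {z}"
    proof
      fix g assume g: "g \<in> carrier G"
      have "g = g \<otimes> \<one>" "g = (g \<otimes> z) \<otimes> inv z" "g = (g \<otimes> inv z) \<otimes> z" using g zG by (simp_all add: m_assoc)
      then show "g \<in> C <#> generate G {z}"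
        using index_3[OF g] set_multI[of _ C _ "{\<one>, z, inv z}"] unfolding generate_z by (metis insertCI)
    qed
  qed
qed

text \<open>cg lies outside \<open>C\<close>, so 1 = (cg)^3 = c^3 g^3 = c^3, while c in
  \<open>T\<close> has c^4 = 1.\<close>

lemma fixed_point_free_2:
  assumes c: "c \<in> T" and g: "g \<in> carrier G" "g \<notin> C" and e: "c \<otimes> g = g \<otimes> c"
  shows "c = \<one>"
proof -
  have cG: "c \<in> carrier G" and c2: "c \<otimes> c \<in> E" using c by (auto simp: T_mem)
  have "c \<otimes> (c \<otimes> c) = \<one>"
    using commuting_cube[OF e cG g(1)] twisted_cube[OF subsetD[OF T_subset_C c] g] outside_C[OF g] cG by simp
  moreover have "(c \<otimes> c) \<otimes> (c \<otimes> c) = \<one>" using E_square[OF c2] .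
  ultimately show ?thesis using cG by (simp add: m_assoc)
qed

end

subsection \<open>The exponent-three quotient\<close>

context noncentral_P_group
begin

lemma tetrahedral_E:
  assumes "x \<in> E" "x \<noteq> \<one>"
  shows "tetrahedral_pair G x z"
  using assms E_carrier E_square z_cube zG twisted_cube[OF subsetD[OF E_subset_C assms(1)] zG zC]
  by (simp add: tetrahedral_pair_def tetrahedral_pair_axioms_def)

text \<open>For nontrivial x in \<open>E\<close> this is the Klein four-group of the tetrahedral
  pair x, z; it is closed because the norm of x under z is 1.\<close>

definition "orbit_group x = {\<one>, x, z \<otimes> x \<otimes> inv z, inv z \<otimes> x \<otimes> z}"

lemma orbit_group_V:
  assumes "x \<in> E" "x \<noteq> \<one>"
  shows "orbit_group x = tetrahedral_pair.V G x z"
proof -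
  interpret P: tetrahedral_pair G x z using tetrahedral_E[OF assms] .
  show ?thesis by (simp add: orbit_group_def P.V_def P.p_def P.q_def)
qed

lemma orbit_group_E:
  assumes "x \<in> E"
  shows "orbit_group x \<subseteq> E"
  using conj_closed[OF normal_E zG assms] assms subgroup.one_closed[OF subgroup_E]
  by (simp add: orbit_group_def)

lemma orbit_group_props:
  assumes x: "x \<in> E" "x \<noteq> \<one>"
  shows "subgroup (orbit_group x) G" "G\<lparr>carrier := orbit_group x\<rparr> \<cong> cyclic_power 2 2"
    "subgroup_generated G (insert z (orbit_group x)) \<cong> alt_group 4"
    "\<And>v. v \<in> orbit_group x \<Longrightarrow> z \<otimes> v \<otimes> inv z \<in> orbit_group x"
proof -
  interpret P: tetrahedral_pair G x z using tetrahedral_E[OF x] .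
  note V = orbit_group_V[OF x]
  show s: "subgroup (orbit_group x) G" unfolding V by (rule P.subgroup_V)
  obtain m where m: "G\<lparr>carrier := orbit_group x\<rparr> \<cong> cyclic_power 2 m"
    using exponent_2_cyclic_power[OF s orbit_group_E[OF x(1)]] by blast
  have "(2::nat) ^ m = 2 ^ 2" using iso_same_card[OF m] P.card_V V by (simp add: card_cyclic_power)
  then have "m = 2" by (simp only: power_inject_exp one_less_numeral_iff semiring_norm(76))
  then show "G\<lparr>carrier := orbit_group x\<rparr> \<cong> cyclic_power 2 2" using m by simp
  have "generate G (insert z (orbit_group x)) = generate G {x, z}"
  proof
    have H: "subgroup (generate G {x, z}) G" using P.xy by (intro generate_is_subgroup) auto
    have "orbit_group x \<subseteq> generate G {x, z}"
      unfolding orbit_group_def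
      using subgroup.m_closed[OF H] subgroup.m_inv_closed[OF H] subgroup.one_closed[OF H]
        generate.incl[of x "{x, z}" G] generate.incl[of z "{x, z}" G] by simp
    then show "generate G (insert z (orbit_group x)) \<subseteq> generate G {x, z}"
      using generate.incl[of z "{x, z}" G] by (intro generate_subgroup_incl[OF _ H]) auto
    show "generate G {x, z} \<subseteq> generate G (insert z (orbit_group x))"
      by (rule mono_generate) (simp add: orbit_group_def)
  qed
  then show "subgroup_generated G (insert z (orbit_group x)) \<cong> alt_group 4"
    using P.iso_A4 subgroup_generated_carrier[of "{x, z}"] P.xy
      subgroup_generated_carrier[of "insert z (orbit_group x)"] subgroup.subset[OF s] by simp
  show "z \<otimes> v \<otimes> inv z \<in> orbit_group x" if "v \<in> orbit_group x" for v
    using P.V_conj_closed(1) that unfolding V by blast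
qed

text \<open>z permutes x and its two conjugates cyclically, so an invariant X containing one of them
  contains x.\<close>

lemma orbit_group_Int:
  assumes x: "x \<in> E" and X: "subgroup X G" "\<And>v. v \<in> X \<Longrightarrow> z \<otimes> v \<otimes> inv z \<in> X" and n: "x \<notin> X"
  shows "X \<inter> orbit_group x = {\<one>}"
proof -
  have xG: "x \<in> carrier G" using E_carrier[OF x] .
  have i: "inv z = z \<otimes> z" using inv_of_cube_one[OF z_cube zG] .
  have 1: "z \<otimes> (z \<otimes> x \<otimes> inv z) \<otimes> inv z = inv z \<otimes> x \<otimes> z"
    using xG zG by (simp add: i m_assoc cube_one_extend[OF z_cube])
  have 2: "z \<otimes> (inv z \<otimes> x \<otimes> z) \<otimes> inv z = x" using xG zG by (simp add: m_assoc)
  have "inv z \<otimes> x \<otimes> z \<notin> X" using X(2)[of "inv z \<otimes> x \<otimes> z"] 2 n by auto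
  moreover from this have "z \<otimes> x \<otimes> inv z \<notin> X" using X(2)[of "z \<otimes> x \<otimes> inv z"] 1 by auto
  ultimately show ?thesis using n subgroup.one_closed[OF X(1)] by (auto simp: orbit_group_def)
qed

text \<open>Invariance of X under z is carried along because it makes the next orbit group meet X
  trivially; the indexing by 1..k is that of \<open>internal_direct_family\<close>.\<close>

definition "decomposition X k Vs \<longleftrightarrow> subgroup X G \<and> X \<subseteq> E \<and> (\<forall>v\<in>X. z \<otimes> v \<otimes> inv z \<in> X) \<and>
  (\<forall>i\<in>{1..k::nat}. \<exists>x\<in>E. x \<noteq> \<one> \<and> Vs i = orbit_group x) \<and> generate G (\<Union>i\<in>{1..k}. Vs i) = X \<and>
  (\<forall>i\<in>{1..k}. Vs i \<inter> generate G (\<Union>j\<in>{1..k} - {i}. Vs j) = {\<one>})"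

lemma decomposition_extend:
  assumes d: "decomposition X k Vs" and x: "x \<in> E" "x \<notin> X"
  shows "decomposition (X <#> orbit_group x) (Suc k) (Vs(Suc k := orbit_group x))"
proof -
  let ?O = "orbit_group x" and ?V = "Vs(Suc k := orbit_group x)"
  have X: "subgroup X G" "X \<subseteq> E" "\<And>v. v \<in> X \<Longrightarrow> z \<otimes> v \<otimes> inv z \<in> X"
    "\<And>i. i \<in> {1..k} \<Longrightarrow> \<exists>x\<in>E. x \<noteq> \<one> \<and> Vs i = orbit_group x" "generate G (\<Union>i\<in>{1..k}. Vs i) = X"
    "\<And>i. i \<in> {1..k} \<Longrightarrow> Vs i \<inter> generate G (\<Union>j\<in>{1..k} - {i}. Vs j) = {\<one>}"
    using d by (auto simp: decomposition_def)
  have x1: "x \<noteq> \<one>" using x subgroup.one_closed[OF X(1)] by auto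
  note O = orbit_group_props[OF x(1) x1]
  have OE: "?O \<subseteq> E" using orbit_group_E[OF x(1)] .
  have XO: "X \<inter> ?O = {\<one>}" by (rule orbit_group_Int[OF x(1) X(1,3) x(2)])
  have comm: "h \<otimes> k = k \<otimes> h" if "h \<in> X" "k \<in> ?O" for h k
    using E_commute[OF subsetD[OF X(2) that(1)] subsetD[OF OE that(2)]] .
  have sXO: "subgroup (X <#> ?O) G" by (rule commuting_product_subgroup[OF X(1) O(1) comm])
  have VG: "Vs i \<subseteq> carrier G" if "i \<in> {1..k}" for i
    using X(4)[OF that] orbit_group_E E_carrier by blast
  have UV: "(\<Union>i\<in>{1..Suc k}. ?V i) = (\<Union>i\<in>{1..k}. Vs i) \<union> ?O"
    by (auto simp: atLeastAtMostSuc_conv)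
  \<comment> \<open>Stated for every subset S of X: it is used both for all old factors and for all
    old factors but one.\<close>
  have gen: "generate G (S \<union> ?O) = generate G S <#> ?O" if S: "S \<subseteq> X" for S
  proof
    have SG: "S \<subseteq> carrier G" using S subgroup.subset[OF X(1)] by blast
    have sS: "subgroup (generate G S) G" by (rule generate_is_subgroup[OF SG])
    have sub: "generate G S \<subseteq> X" by (rule generate_subgroup_incl[OF S X(1)])
    have "subgroup (generate G S <#> ?O) G"
      by (rule commuting_product_subgroup[OF sS O(1)]) (use comm sub in blast)
    then show "generate G (S \<union> ?O) \<subseteq> generate G S <#> ?O"
      using set_mult_upper[OF sS O(1)] generate.incl[of _ S G] by (intro generate_subgroup_incl) blast+
    show "generate G S <#> ?O \<subseteq> generate G (S \<union> ?O)"
    proof (rule set_mult_subset)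
      show "subgroup (generate G (S \<union> ?O)) G"
        using SG subgroup.subset[OF O(1)] by (intro generate_is_subgroup) blast
      show "generate G S \<subseteq> generate G (S \<union> ?O)" by (rule mono_generate) simp
      show "?O \<subseteq> generate G (S \<union> ?O)" by (auto intro: generate.incl)
    qed
  qed
  have USX: "(\<Union>i\<in>I. Vs i) \<subseteq> X" if "I \<subseteq> {1..k}" for I
  proof -
    have "(\<Union>i\<in>I. Vs i) \<subseteq> (\<Union>i\<in>{1..k}. Vs i)" using that by blast
    then show ?thesis using X(5) generate.incl[of _ "\<Union>i\<in>{1..k}. Vs i" G] by blast
  qed
  show ?thesis
    unfolding decomposition_def
  proof (intro conjI ballI)
    show "subgroup (X <#> ?O) G" by (rule sXO)
    show "X <#> ?O \<subseteq> E" by (rule set_mult_subset[OF subgroup_E X(2) OE])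
    fix v assume "v \<in> X <#> ?O"
    then obtain a b where ab: "a \<in> X" "b \<in> ?O" "v = a \<otimes> b" by (auto simp: set_mult_mem)
    have "z \<otimes> v \<otimes> inv z = (z \<otimes> a \<otimes> inv z) \<otimes> (z \<otimes> b \<otimes> inv z)"
      unfolding ab(3) by (rule conj_mult[OF zG subgroup.mem_carrier[OF X(1) ab(1)] subgroup.mem_carrier[OF O(1) ab(2)]])
    then show "z \<otimes> v \<otimes> inv z \<in> X <#> ?O" using set_multI[OF X(3)[OF ab(1)] O(4)[OF ab(2)]] by simp
  next
    fix i assume i: "i \<in> {1..Suc k}"
    show "\<exists>x\<in>E. x \<noteq> \<one> \<and> ?V i = orbit_group x"
      using X(4)[of i] x(1) x1 i by (cases "i = Suc k") auto
  next
    show "generate G (\<Union>i\<in>{1..Suc k}. ?V i) = X <#> ?O"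
      unfolding UV gen[OF USX[OF subset_refl]] X(5) ..
  next
    fix i assume i: "i \<in> {1..Suc k}"
    show "?V i \<inter> generate G (\<Union>j\<in>{1..Suc k} - {i}. ?V j) = {\<one>}"
    proof (cases "i = Suc k")
      case True
      then have I: "{1..Suc k} - {i} = {1..k}" by auto
      have "(\<Union>j\<in>{1..Suc k} - {i}. ?V j) = (\<Union>j\<in>{1..k}. Vs j)"
        unfolding I by (intro SUP_cong refl) auto
      then show ?thesis using True XO X(5) by auto
    next
      case False
      then have ik: "i \<in> {1..k}" using i by auto
      have U: "(\<Union>j\<in>{1..Suc k} - {i}. ?V j) = (\<Union>j\<in>{1..k} - {i}. Vs j) \<union> ?O"
      proof -
        have I: "{1..Suc k} - {i} = insert (Suc k) ({1..k} - {i})" using False by auto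
        have "(\<Union>j\<in>{1..k} - {i}. ?V j) = (\<Union>j\<in>{1..k} - {i}. Vs j)" by (intro SUP_cong refl) auto
        then show ?thesis unfolding I by auto
      qed
      have sub: "generate G (\<Union>j\<in>{1..k} - {i}. Vs j) \<subseteq> X"
        by (rule generate_subgroup_incl[OF USX X(1)]) auto
      \<comment> \<open>From s = y b the factor b = y^-1 s lies in X and in the new orbit group, so
        b = 1 and the independence of the old factors applies.\<close>
      have only: "s = \<one>" if s: "s \<in> Vs i" "s \<in> generate G (\<Union>j\<in>{1..k} - {i}. Vs j) <#> ?O" for s
      proof -
        obtain y b where yb: "y \<in> generate G (\<Union>j\<in>{1..k} - {i}. Vs j)" "b \<in> ?O" "s = y \<otimes> b"
          using s(2) by (auto simp: set_mult_mem)
        have yX: "y \<in> X" using yb(1) sub by blast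
        have sX: "s \<in> X" using USX[of "{i}"] s(1) ik by auto
        have G: "y \<in> carrier G" "b \<in> carrier G"
          using subgroup.mem_carrier[OF X(1) yX] subgroup.mem_carrier[OF O(1) yb(2)] by auto
        have "b = inv y \<otimes> s" using G yb(3) by simp
        then have "b \<in> X" using subgroup.m_closed[OF X(1) subgroup.m_inv_closed[OF X(1) yX] sX] by simp
        then have "b = \<one>" using XO yb(2) by blast
        then have "s \<in> generate G (\<Union>j\<in>{1..k} - {i}. Vs j)" using yb G by simp
        then show ?thesis using X(6)[OF ik] s(1) by blast
      qed
      have Vi: "?V i = Vs i" using False by simp
      have one: "\<one> \<in> Vs i" using X(4)[OF ik] by (auto simp: orbit_group_def)
      have "\<one> \<in> generate G (\<Union>j\<in>{1..Suc k} - {i}. ?V j)" by (rule generate.one)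
      then show ?thesis unfolding Vi U gen[OF USX[OF Diff_subset]] using only one by blast
    qed
  qed
qed

text \<open>A decomposable X of maximal order is all of \<open>E\<close>, since any x outside it
  would contribute one more factor.\<close>

lemma decomposition_ex: "\<exists>k Vs. decomposition E k Vs"
proof -
  let ?P = "\<lambda>X. \<exists>k Vs. decomposition X k Vs"
  have "decomposition {\<one>} 0 (\<lambda>_. {})"
    using subgroup.one_closed[OF subgroup_E] triv_subgroup generate_empty zG by (simp add: decomposition_def)
  then have "?P {\<one>}" by blast
  moreover have "card X \<le> card E" if "?P X" for X
    using that card_mono[OF finite_E] by (auto simp: decomposition_def)
  ultimately obtain X where X: "?P X" and max: "\<And>Y. ?P Y \<Longrightarrow> card Y \<le> card X"
    using ex_max_card[of ?P "{\<one>}" "card E"] by auto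
  obtain k Vs where d: "decomposition X k Vs" using X by blast
  have sX: "subgroup X G" "X \<subseteq> E" using d by (auto simp: decomposition_def)
  have "X = E"
  proof (rule ccontr)
    assume "X \<noteq> E"
    then obtain x where x: "x \<in> E" "x \<notin> X" using sX by blast
    note d' = decomposition_extend[OF d x]
    have x1: "x \<noteq> \<one>" using x subgroup.one_closed[OF sX(1)] by auto
    have "X \<subseteq> X <#> orbit_group x" "x \<in> X <#> orbit_group x"
      using set_mult_upper[OF sX(1) orbit_group_props(1)[OF x(1) x1]] by (auto simp: orbit_group_def)
    moreover have "finite (X <#> orbit_group x)"
      using d' finite_E finite_subset by (auto simp: decomposition_def)
    ultimately have "card X < card (X <#> orbit_group x)" using x(2) by (intro psubset_card_mono) auto
    then show False using max[of "X <#> orbit_group x"] d' by fastforce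
  qed
  then show ?thesis using d by blast
qed

end

context group
begin

lemma subgroup_quotient_exponent:
  assumes H: "subgroup H G" and fin: "finite (carrier G)" and N: "N \<lhd> G\<lparr>carrier := H\<rparr>" and p: "prime p"
    and e: "\<And>h. h \<in> H \<Longrightarrow> h [^] p \<in> N"
  shows "\<exists>n. card H = p ^ n * card N"
proof -
  interpret H: group "G\<lparr>carrier := H\<rparr>" using subgroup_imp_group[OF H] .
  interpret q: group_hom "G\<lparr>carrier := H\<rparr>" "G\<lparr>carrier := H\<rparr> Mod N" "\<lambda>a. N #>\<^bsub>G\<lparr>carrier := H\<rparr>\<^esub> a"
    by (rule H.quotient_hom[OF N])
  have fH: "finite H" using subgroup.subset[OF H] fin finite_subset by blast
  have "\<exists>n. order (G\<lparr>carrier := H\<rparr> Mod N) = p ^ n"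
  proof (rule q.H.order_prime_power[OF _ p])
    show "finite (carrier (G\<lparr>carrier := H\<rparr> Mod N))" using fH by (simp add: carrier_FactGroup)
    fix x assume "x \<in> carrier (G\<lparr>carrier := H\<rparr> Mod N)"
    then obtain h where h: "h \<in> H" "x = N #>\<^bsub>G\<lparr>carrier := H\<rparr>\<^esub> h" by (auto simp: carrier_FactGroup)
    have hp: "h [^]\<^bsub>G\<lparr>carrier := H\<rparr>\<^esub> p \<in> N" using e[OF h(1)] nat_pow_consistent[of h p H] by simp
    have "x [^]\<^bsub>G\<lparr>carrier := H\<rparr> Mod N\<^esub> p = N #>\<^bsub>G\<lparr>carrier := H\<rparr>\<^esub> (h [^]\<^bsub>G\<lparr>carrier := H\<rparr>\<^esub> p)"
      using q.hom_nat_pow[of h p] h by simp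
    also have "\<dots> = \<one>\<^bsub>G\<lparr>carrier := H\<rparr> Mod N\<^esub>"
      using H.rcos_eq_one_iff[OF normal_imp_subgroup[OF N], of "h [^]\<^bsub>G\<lparr>carrier := H\<rparr>\<^esub> p"] hp H.nat_pow_closed h
      by simp
    finally show "\<exists>k. x [^]\<^bsub>G\<lparr>carrier := H\<rparr> Mod N\<^esub> (p ^ k) = \<one>\<^bsub>G\<lparr>carrier := H\<rparr> Mod N\<^esub>"
      by (intro exI[of _ 1]) simp
  qed
  then obtain n where n: "order (G\<lparr>carrier := H\<rparr> Mod N) = p ^ n" ..
  have "card H = order (G\<lparr>carrier := H\<rparr> Mod N) * card N"
    using H.order_mod[OF N] by (simp add: order_def[of "G\<lparr>carrier := H\<rparr>"])
  then show ?thesis unfolding n ..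
qed

lemma Omega1_eq:
  assumes "subgroup Z G" "Z = {x \<in> carrier G. x \<otimes> x = \<one>}"
  shows "Omega1 G = Z"
proof
  have "{x \<in> carrier G. ord x = 2} \<subseteq> Z" using assms(2) ord_eq_2 by auto
  then show "Omega1 G \<subseteq> Z" unfolding Omega1_def by (rule generate_subgroup_incl[OF _ assms(1)])
  show "Z \<subseteq> Omega1 G"
  proof
    fix x assume x: "x \<in> Z"
    show "x \<in> Omega1 G"
    proof (cases "x = \<one>")
      case True
      then show ?thesis unfolding Omega1_def by (simp add: generate.one)
    next
      case False
      then have "ord x = 2" using x assms(2) ord_eq_2 by auto
      then show ?thesis using x assms(2) unfolding Omega1_def by (auto intro: generate.incl)
    qed
  qed
qed

lemma order_power_of_two:
  assumes "subgroup H G" "finite (carrier G)" "\<And>x. x \<in> H \<Longrightarrow> (x \<otimes> x) \<otimes> (x \<otimes> x) = \<one>"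
  shows "p_group 2 (G\<lparr>carrier := H\<rparr>)"
proof -
  interpret H: group "G\<lparr>carrier := H\<rparr>" using subgroup_imp_group[OF assms(1)] .
  have "\<exists>n. order (G\<lparr>carrier := H\<rparr>) = 2 ^ n"
  proof (rule H.order_prime_power[OF _ two_is_prime_nat])
    show "finite (carrier (G\<lparr>carrier := H\<rparr>))"
      using subgroup.subset[OF assms(1)] assms(2) finite_subset by auto
    fix x assume x: "x \<in> carrier (G\<lparr>carrier := H\<rparr>)"
    then have "x \<in> carrier G" using subgroup.mem_carrier[OF assms(1)] by simp
    then have "x [^] (2 ^ 2 :: nat) = \<one>" using assms(3)[of x] x by (simp add: numeral_eq_Suc m_assoc)
    then show "\<exists>k. x [^]\<^bsub>G\<lparr>carrier := H\<rparr>\<^esub> (2 ^ k :: nat) = \<one>\<^bsub>G\<lparr>carrier := H\<rparr>\<^esub>"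
      using nat_pow_consistent[of x "2 ^ 2" H] by (intro exI[of _ 2]) simp
  qed
  then show ?thesis unfolding p_group_def using H.is_group by blast
qed

end

context noncentral_P_group
begin

text \<open>C/E is a 3-group and \<open>E\<close> is central in \<open>C\<close> of exponent 2, so
  \<open>C\<close> is U x E for a Sylow 3-subgroup U. This U consists of all elements of
  \<open>C\<close> with cube 1, hence z normalises it. Elements outside \<open>C\<close> have cube 1
  as well, so <U, z> has exponent 3, even if U is trivial.\<close>

lemma family_b_of_exponent_3:
  assumes K: "\<And>g. g \<in> carrier G \<Longrightarrow> g \<otimes> (g \<otimes> g) \<in> E"
  shows "family_b G"
proof -
  let ?GC = "G\<lparr>carrier := C\<rparr>"
  interpret GC: group ?GC using subgroup_imp_group[OF subgroup_C] .
  have CG: "\<And>c. c \<in> C \<Longrightarrow> c \<in> carrier G" using C_carrier .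
  have EC: "subgroup E ?GC" by (rule subgroup_incl[OF subgroup_E subgroup_C E_subset_C])
  have "E \<subseteq> group_center ?GC"
    using E_subset_C C_commute by (fastforce simp: group_center_def)
  then have nE: "E \<lhd> ?GC" by (rule GC.subgroup_of_center_normal[OF EC])
  have p3: "prime (3::nat)" by simp
  obtain n where n: "card C = 3 ^ n * card E"
    using subgroup_quotient_exponent[OF subgroup_C fin nE p3] K CG pow_3 by auto
  obtain U where U: "subgroup U ?GC" "card U = 3 ^ n"
    using sylow_thm[OF p3 GC.is_group, of n "card E"] n fin subgroup.subset[OF subgroup_C] finite_subset
    by (auto simp: order_def)
  have sU: "subgroup U G" using incl_subgroup[OF subgroup_C U(1)] .
  have UC: "U \<subseteq> C" using subgroup.subset[OF U(1)] by simp
  have UG: "\<And>u. u \<in> U \<Longrightarrow> u \<in> carrier G" using subgroup.mem_carrier[OF sU] .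
  have fU: "finite U" using fin subgroup.subset[OF sU] finite_subset by blast
  have UE: "U \<inter> E = {\<one>}"
  proof -
    have "u = \<one>" if u: "u \<in> U" "u \<in> E" for u
    proof -
      have sg: "subgroup {\<one>, u} G"
        using u E_square UG by (intro subgroupI) (auto simp: inv_of_involution)
      have "card {\<one>, u} dvd 3 ^ n"
        using card_subgroup_dvd[OF sg sU] u subgroup.one_closed[OF sU] U(2) by auto
      then have "card {\<one>, u} \<noteq> 2" by (metis dvd_trans even_power odd_numeral dvd_refl)
      then show ?thesis by (auto simp: card_insert_if split: if_splits)
    qed
    then show ?thesis using subgroup.one_closed[OF sU] subgroup.one_closed[OF subgroup_E] by blast
  qed
  have UEc: "u \<otimes> e = e \<otimes> u" if "u \<in> U" "e \<in> E" for u e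
    using C_commute[OF subsetD[OF UC that(1)] that(2)] .
  have UEC: "U <#> E = C"
  proof (rule card_subset_eq)
    show "finite C" using fin subgroup.subset[OF subgroup_C] finite_subset by blast
    show "U <#> E \<subseteq> C" by (rule set_mult_subset[OF subgroup_C UC E_subset_C])
    have "card (U \<times> E) = card (U <#> E)"
      using iso_same_card[OF commuting_product_iso[OF sU subgroup_E UEc UE]] by simp
    then show "card (U <#> E) = card C" using n U(2) by (simp add: card_cartesian_product)
  qed
  \<comment> \<open>For c = u e the cube of c is e. The resulting description of \<open>U\<close> by
    cubes is invariant under conjugation in G.\<close>
  have U_iff: "c \<in> U \<longleftrightarrow> c \<otimes> (c \<otimes> c) = \<one>" if c: "c \<in> C" for c
  proof -
    obtain u e where ue: "u \<in> U" "e \<in> E" "c = u \<otimes> e" using c UEC set_mult_mem by metis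
    have G: "u \<in> carrier G" "e \<in> carrier G" using ue UG E_carrier by auto
    have "u \<otimes> (u \<otimes> u) \<in> U \<inter> E" using K[OF G(1)] subgroup.m_closed[OF sU] ue(1) by simp
    then have u3: "u \<otimes> (u \<otimes> u) = \<one>" using UE by simp
    have "c \<otimes> (c \<otimes> c) = e"
      unfolding ue(3) using commuting_cube[OF UEc[OF ue(1,2)] G] u3 E_square[OF ue(2)] G by simp
    moreover have "c \<in> U \<longleftrightarrow> e = \<one>"
    proof
      assume "c \<in> U"
      then have "inv u \<otimes> c \<in> U" using subgroup.m_closed[OF sU subgroup.m_inv_closed[OF sU ue(1)]] by blast
      then have "e \<in> U" using ue(3) G by simp
      then show "e = \<one>" using UE ue(2) by blast
    qed (use ue G in simp)
    ultimately show ?thesis by simp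
  qed
  have U3: "\<And>u. u \<in> U \<Longrightarrow> u \<otimes> (u \<otimes> u) = \<one>" using U_iff UC by blast
  have conjU: "x \<otimes> u \<otimes> inv x \<in> U" if x: "x \<in> carrier G" and u: "u \<in> U" for x u
    using U_iff[OF conj_closed(1)[OF normal_C x subsetD[OF UC u]]] conj_cube_one[OF U3[OF u] UG[OF u] x] by simp
  have nU: "U \<lhd> ?GC"
  proof (rule GC.normal_invI[OF U(1)])
    fix x h assume "x \<in> carrier ?GC" "h \<in> U"
    then show "x \<otimes>\<^bsub>?GC\<^esub> h \<otimes>\<^bsub>?GC\<^esub> inv\<^bsub>?GC\<^esub> x \<in> U"
      using conjU CG m_inv_consistent[OF subgroup_C] by simp
  qed
  let ?S = "subgroup_generated G (insert z U)"
  have zU: "insert z U \<subseteq> carrier G" using zG UG by auto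
  have cS: "carrier ?S = generate G (insert z U)" using zU by (simp add: subgroup_generated_carrier)
  have S_form: "generate G (insert z U) \<subseteq> U <#> {\<one>, z, inv z}"
  proof (rule generate_left_closed[OF zU])
    have zz: "inv z = z \<otimes> z" using inv_of_cube_one[OF z_cube zG] .
    show sub: "U <#> {\<one>, z, inv z} \<subseteq> carrier G"
      using UG zG by (auto simp: set_mult_mem)
    show "finite (U <#> {\<one>, z, inv z})" using sub fin finite_subset by blast
    show "\<one> \<in> U <#> {\<one>, z, inv z}" using set_multI[OF subgroup.one_closed[OF sU], of \<one> "{\<one>, z, inv z}"] by simp
    fix s g assume s: "s \<in> insert z U" and "g \<in> U <#> {\<one>, z, inv z}"
    then obtain u c where uc: "u \<in> U" "c \<in> {\<one>, z, inv z}" "g = u \<otimes> c" by (auto simp: set_mult_mem)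
    have G: "u \<in> carrier G" "c \<in> carrier G" using uc UG zG by auto
    have "z \<otimes> g = (z \<otimes> u \<otimes> inv z) \<otimes> (z \<otimes> c)" using uc G zG by (simp add: m_assoc)
    moreover have "z \<otimes> c \<in> {\<one>, z, inv z}" using uc(2) zG zz r_inv[OF zG] by fastforce
    ultimately have 1: "z \<otimes> g \<in> U <#> {\<one>, z, inv z}" using set_multI[OF conjU[OF zG uc(1)]] by simp
    have "s \<otimes> g = (s \<otimes> u) \<otimes> c" if "s \<in> U" using uc G UG[OF that] by (simp add: m_assoc)
    then show "s \<otimes> g \<in> U <#> {\<one>, z, inv z}"
      using s 1 set_multI[OF subgroup.m_closed[OF sU _ uc(1)] uc(2)] by auto
  qed
  have S3: "g \<otimes> (g \<otimes> g) = \<one>" if g: "g \<in> generate G (insert z U)" for g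
  proof -
    obtain u c where uc: "u \<in> U" "c \<in> {\<one>, z, inv z}" "g = u \<otimes> c"
      using subsetD[OF S_form g] by (auto simp: set_mult_mem)
    show ?thesis
    proof (cases "c = \<one>")
      case True
      then show ?thesis using U3[OF uc(1)] uc UG by simp
    next
      case False
      then have "c \<in> carrier G" "c \<notin> C" using uc(2) zG zC inv_z_notin by auto
      then show ?thesis using twisted_cube[OF subsetD[OF UC uc(1)]] uc(3) by simp
    qed
  qed
  have exp: "group_exponent ?S = 3"
  proof -
    have "group_exponent ?S = (LEAST n. 0 < n \<and> (\<forall>x\<in>generate G (insert z U). x [^] n = \<one>))"
      unfolding group_exponent_def cS by (simp add: pow_subgroup_generated)
    also have "\<dots> = 3"
      by (rule Least_pow_3[OF _ zG z_neq_one _ S3])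
         (use generate_incl[OF zU] in \<open>auto intro: generate.incl\<close>)
    finally show ?thesis .
  qed
  have finE: "finite E" by (rule finite_E)
  have dir: "internal_direct ?GC U E"
    unfolding internal_direct_def using nU nE UE UEC by simp
  obtain k Vs where d: "decomposition E k Vs" using decomposition_ex by blast
  have Vs: "\<And>i. i \<in> {1..k} \<Longrightarrow> \<exists>x\<in>E. x \<noteq> \<one> \<and> Vs i = orbit_group x" "generate G (\<Union>i\<in>{1..k}. Vs i) = E"
    "\<And>i. i \<in> {1..k} \<Longrightarrow> Vs i \<inter> generate G (\<Union>j\<in>{1..k} - {i}. Vs j) = {\<one>}"
    using d by (auto simp: decomposition_def)
  have VsE: "Vs i \<subseteq> E" if "i \<in> {1..k}" for i
    using Vs(1)[OF that] orbit_group_E by blast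
  have fam: "internal_direct_family (G\<lparr>carrier := E\<rparr>) {1..k} Vs"
    unfolding internal_direct_family_def
  proof (intro conjI ballI)
    interpret GE: group "G\<lparr>carrier := E\<rparr>" using subgroup_imp_group[OF subgroup_E] .
    have cE: "comm_group (G\<lparr>carrier := E\<rparr>)" by (rule GE.group_comm_groupI) (simp add: E_commute)
    fix i assume i: "i \<in> {1..k}"
    obtain x where x: "x \<in> E" "x \<noteq> \<one>" "Vs i = orbit_group x" using Vs(1)[OF i] by blast
    have "subgroup (Vs i) (G\<lparr>carrier := E\<rparr>)"
      unfolding x(3) by (rule subgroup_incl[OF orbit_group_props(1)[OF x(1,2)] subgroup_E orbit_group_E[OF x(1)]])
    then show "Vs i \<lhd> G\<lparr>carrier := E\<rparr>" by (rule comm_group.subgroup_imp_normal[OF cE])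
    have "generate (G\<lparr>carrier := E\<rparr>) (\<Union>j\<in>{1..k} - {i}. Vs j) = generate G (\<Union>j\<in>{1..k} - {i}. Vs j)"
      by (rule generate_consistent[OF _ subgroup_E]) (use VsE in blast)
    then show "Vs i \<inter> generate (G\<lparr>carrier := E\<rparr>) (\<Union>j\<in>{1..k} - {i}. Vs j) = {\<one>\<^bsub>G\<lparr>carrier := E\<rparr>\<^esub>}"
      using Vs(3)[OF i] by simp
  next
    have "generate (G\<lparr>carrier := E\<rparr>) (\<Union>j\<in>{1..k}. Vs j) = generate G (\<Union>j\<in>{1..k}. Vs j)"
      by (rule generate_consistent[OF _ subgroup_E]) (use VsE in blast)
    then show "generate (G\<lparr>carrier := E\<rparr>) (\<Union>j\<in>{1..k}. Vs j) = carrier (G\<lparr>carrier := E\<rparr>)" using Vs(2) by simp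
  qed
  have each: "G\<lparr>carrier := Vs i\<rparr> \<cong> cyclic_power 2 2 \<and> subgroup_generated G (insert z (Vs i)) \<cong> alt_group 4"
    if i: "i \<in> {1..k}" for i
    using Vs(1)[OF i] orbit_group_props(2,3) by auto
  show ?thesis
    unfolding family_b_def
    using zG semidirect_C dir exp fam each
      normalizerI[OF sU fU zG conjU[OF zG]] normalizerI[OF subgroup_E finE zG conj_closed(1)[OF normal_E zG]]
    by (intro exI[of _ C] exI[of _ U] exI[of _ E] exI[of _ z] exI[of _ k] exI[of _ Vs]) blast
qed

end

subsection \<open>Frobenius groups\<close>

locale frobenius_P_group = noncentral_P_group +
  assumes CT: "C = T" and TE: "T \<noteq> E"
    and T_comm: "\<And>s t. s \<in> T \<Longrightarrow> t \<in> T \<Longrightarrow> s \<otimes> t \<otimes> inv s \<otimes> inv t \<in> E"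
begin

text \<open>The coset \<open>C\<close> z. It turns out to be the conjugacy class of z and, after
  numbering, is the permutation domain.\<close>

definition "X = {u \<in> carrier G. u \<otimes> inv z \<in> C}"

lemma X_carrier: "u \<in> X \<Longrightarrow> u \<in> carrier G"
  by (simp add: X_def)

lemma X_outside: "u \<in> X \<Longrightarrow> u \<notin> C"
  using mult_notin[of u "inv z"] inv_z_notin zG by (auto simp: X_def)

lemma z_in_X: "z \<in> X"
  using zG subgroup.one_closed[OF subgroup_C] by (simp add: X_def)

lemma X_quotient:
  assumes "u \<in> X" "v \<in> X"
  shows "u \<otimes> inv v \<in> C"
proof -
  have "u \<otimes> inv v = (u \<otimes> inv z) \<otimes> inv (v \<otimes> inv z)"
    using assms zG X_carrier by (simp add: inv_mult_group m_assoc)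
  then show ?thesis using assms subgroup.m_closed[OF subgroup_C] subgroup.m_inv_closed[OF subgroup_C]
    by (simp add: X_def)
qed

lemma fixed_point_free:
  assumes "c \<in> C" "u \<in> X" "c \<otimes> u = u \<otimes> c"
  shows "c = \<one>"
  using fixed_point_free_2[of c u] assms X_carrier X_outside CT by blast

text \<open>u v^-1 lies in \<open>C\<close> and commutes with v, so \<open>fixed_point_free\<close>
  makes it trivial.\<close>

lemma commuting_X:
  assumes u: "u \<in> X" and v: "v \<in> X" and e: "u \<otimes> v = v \<otimes> u"
  shows "u = v"
proof -
  have G: "u \<in> carrier G" "v \<in> carrier G" using u v X_carrier by auto
  have "inv v \<otimes> v = v \<otimes> inv v" using G by simp
  then have "(u \<otimes> inv v) \<otimes> v = v \<otimes> (u \<otimes> inv v)" using commute_mult[OF e] G by simp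
  then have "u \<otimes> inv v = \<one>" using fixed_point_free[OF X_quotient[OF u v] v] by blast
  then show ?thesis using G by (metis inv_equality inv_inv inv_closed)
qed

lemma X_conj_closed:
  assumes g: "g \<in> carrier G" and u: "u \<in> X"
  shows "g \<otimes> u \<otimes> inv g \<in> X"
proof -
  have uG: "u \<in> carrier G" using u X_carrier by blast
  have C_case: "c \<otimes> v \<otimes> inv c \<in> X" if c: "c \<in> C" and v: "v \<in> X" for c v
  proof -
    have G: "c \<in> carrier G" "v \<in> carrier G" using c v C_carrier X_carrier by auto
    have "c \<otimes> v \<otimes> inv c \<otimes> inv z = c \<otimes> ((v \<otimes> inv z) \<otimes> (z \<otimes> inv c \<otimes> inv z))"
      using G zG by (simp add: m_assoc)
    also have "\<dots> \<in> C"
      using c v subgroup.m_closed[OF subgroup_C] conj_closed(1)[OF normal_C zG subgroup.m_inv_closed[OF subgroup_C c]]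
      by (simp add: X_def)
    finally show ?thesis using G by (simp add: X_def)
  qed
  have z_case: "y \<otimes> u \<otimes> inv y \<in> X" if y: "y \<in> {\<one>, z, inv z}" for y
  proof -
    have yG: "y \<in> carrier G" using y zG by auto
    have yz: "inv y \<otimes> inv z = inv z \<otimes> inv y" using y zG by auto
    have "y \<otimes> u \<otimes> inv y \<otimes> inv z = y \<otimes> (u \<otimes> (inv y \<otimes> inv z))" using yG uG zG by (simp add: m_assoc)
    also have "\<dots> = y \<otimes> (u \<otimes> inv z) \<otimes> inv y" unfolding yz using yG uG zG by (simp add: m_assoc)
    also have "\<dots> \<in> C" using conj_closed(1)[OF normal_C yG] u by (simp add: X_def)
    finally show ?thesis using yG uG by (simp add: X_def)
  qed
  have "C <#> generate G {z} = carrier G" using semidirect_C by (simp add: internal_semidirect_def)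
  then obtain c y where cy: "c \<in> C" "y \<in> {\<one>, z, inv z}" "g = c \<otimes> y"
    using g unfolding generate_z by (metis set_mult_mem)
  have G: "c \<in> carrier G" "y \<in> carrier G" using cy C_carrier zG by auto
  have "g \<otimes> u \<otimes> inv g = c \<otimes> (y \<otimes> u \<otimes> inv y) \<otimes> inv c" using G uG by (simp add: cy(3) inv_mult_group m_assoc)
  then show ?thesis using C_case[OF cy(1) z_case[OF cy(2)]] by simp
qed

text \<open>Counting: c -> c z c^-1 is injective on \<open>C\<close>, because only 1 commutes with z
  there, and it maps into \<open>X\<close>, which has as many elements as \<open>C\<close>.\<close>

lemma X_conjugate:
  assumes "u \<in> X"
  shows "\<exists>c\<in>C. u = c \<otimes> z \<otimes> inv c"
proof -
  let ?f = "\<lambda>c. c \<otimes> z \<otimes> inv c"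
  have fC: "finite C" using fin subgroup.subset[OF subgroup_C] finite_subset by blast
  have "inj_on ?f C"
  proof (rule inj_onI)
    fix c d assume c: "c \<in> C" and d: "d \<in> C" and e: "?f c = ?f d"
    have G: "c \<in> carrier G" "d \<in> carrier G" using c d C_carrier by auto
    have "(inv d \<otimes> c) \<otimes> z = inv d \<otimes> (?f c) \<otimes> c" using G zG by (simp add: m_assoc)
    also have "\<dots> = z \<otimes> (inv d \<otimes> c)" unfolding e using G zG by (simp add: m_assoc)
    finally have "inv d \<otimes> c = \<one>"
      using fixed_point_free[OF subgroup.m_closed[OF subgroup_C subgroup.m_inv_closed[OF subgroup_C d] c] z_in_X]
      by blast
    then show "c = d" using G by (metis inv_equality inv_inv inv_closed)
  qed
  then have "card (?f ` C) = card C" by (rule card_image)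
  moreover have "card X = card C"
  proof -
    have "X = (\<lambda>c. c \<otimes> z) ` C"
    proof (intro equalityI subsetI)
      fix u assume u: "u \<in> X"
      then have "u = (u \<otimes> inv z) \<otimes> z" using X_carrier zG by (simp add: m_assoc)
      then show "u \<in> (\<lambda>c. c \<otimes> z) ` C" using u by (auto simp: X_def)
    qed (use C_carrier zG in \<open>auto simp: X_def m_assoc\<close>)
    moreover have "inj_on (\<lambda>c. c \<otimes> z) C" using C_carrier zG by (auto simp: inj_on_def)
    ultimately show ?thesis by (simp add: card_image)
  qed
  moreover have "?f ` C \<subseteq> X" using X_conj_closed[OF C_carrier z_in_X] by blast
  moreover have "finite X" using fin by (simp add: X_def)
  ultimately have "?f ` C = X" by (intro card_subset_eq) auto
  then show ?thesis using assms by blast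
qed

lemma outside_in_X:
  assumes "g \<in> carrier G" "g \<notin> C"
  shows "g \<in> X \<or> inv g \<in> X"
  using outside_form[OF assms] assms by (simp add: X_def)

text \<open>G acts on \<open>X\<close> by conjugation. Nontrivial elements of \<open>C\<close>
  commute with nothing in \<open>X\<close>, and for g outside \<open>C\<close> the only element of
  \<open>X\<close> commuting with g is g or g^-1, so g fixes exactly one point. The stabiliser of z
  is <z>.\<close>

lemma frobenius_C: "Frobenius_group G C (generate G {z})"
proof -
  have fX: "finite X" using fin by (simp add: X_def)
  \<comment> \<open>\<open>X\<close> is numbered because \<open>Frobenius_group\<close> asks for a
    domain of natural numbers.\<close>
  obtain h where h: "bij_betw h {0..<card X} X" using ex_bij_betw_nat_finite[OF fX] by blast
  let ?O = "{0..<card X}"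
  define k where "k = inv_into ?O h"
  have hX: "\<And>i. i \<in> ?O \<Longrightarrow> h i \<in> X" using h bij_betwE by blast
  have kO: "\<And>u. u \<in> X \<Longrightarrow> k u \<in> ?O" using bij_betw_inv_into[OF h] bij_betwE unfolding k_def by blast
  have kh: "\<And>i. i \<in> ?O \<Longrightarrow> k (h i) = i" using bij_betw_inv_into_left[OF h] unfolding k_def by blast
  have hk: "\<And>u. u \<in> X \<Longrightarrow> h (k u) = u" using bij_betw_inv_into_right[OF h] unfolding k_def by blast
  have hG: "\<And>i. i \<in> ?O \<Longrightarrow> h i \<in> carrier G" using hX X_carrier by blast
  define \<phi> where "\<phi> g = (\<lambda>i\<in>?O. k (g \<otimes> h i \<otimes> inv g))" for g
  have \<phi>: "\<phi> g i = k (g \<otimes> h i \<otimes> inv g)" if "i \<in> ?O" for g i using that by (simp add: \<phi>_def)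
  have \<phi>O: "\<phi> g i \<in> ?O" if "g \<in> carrier G" "i \<in> ?O" for g i
    using \<phi>[OF that(2)] kO[OF X_conj_closed[OF that(1) hX[OF that(2)]]] by simp
  have h\<phi>: "h (\<phi> g i) = g \<otimes> h i \<otimes> inv g" if "g \<in> carrier G" "i \<in> ?O" for g i
    using \<phi>[OF that(2)] hk[OF X_conj_closed[OF that(1) hX[OF that(2)]]] by simp
  have comp: "\<phi> (g \<otimes> g') i = \<phi> g (\<phi> g' i)" if "g \<in> carrier G" "g' \<in> carrier G" "i \<in> ?O" for g g' i
  proof -
    have "g \<otimes> h (\<phi> g' i) \<otimes> inv g = (g \<otimes> g') \<otimes> h i \<otimes> inv (g \<otimes> g')"
      unfolding h\<phi>[OF that(2,3)] using that hG[OF that(3)] by (simp add: inv_mult_group m_assoc)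
    then show ?thesis using \<phi>[OF \<phi>O[OF that(2,3)]] \<phi>[OF that(3)] by simp
  qed
  have one: "\<phi> \<one> i = i" if "i \<in> ?O" for i using \<phi>[OF that] kh[OF that] hG[OF that] by simp
  have bij: "\<phi> g \<in> Bij ?O" if g: "g \<in> carrier G" for g
  proof -
    have "bij_betw (\<phi> g) ?O ?O"
    proof (rule bij_betw_byWitness[where f' = "\<phi> (inv g)"])
      show "\<forall>i\<in>?O. \<phi> (inv g) (\<phi> g i) = i" using comp[of "inv g" g] one g by simp
      show "\<forall>i\<in>?O. \<phi> g (\<phi> (inv g) i) = i" using comp[of g "inv g"] one g by simp
    qed (use \<phi>O g in auto)
    then show ?thesis by (simp add: Bij_def \<phi>_def)
  qed
  have act: "group_action G ?O \<phi>"
    unfolding group_action_def group_hom_def group_hom_axioms_def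
  proof (intro conjI homI)
    show "group G" "group (BijGroup ?O)" by (auto simp: group_BijGroup)
    show "\<phi> g \<in> carrier (BijGroup ?O)" if "g \<in> carrier G" for g using bij[OF that] by (simp add: BijGroup_def)
    show "\<phi> (g \<otimes> g') = \<phi> g \<otimes>\<^bsub>BijGroup ?O\<^esub> \<phi> g'" if g: "g \<in> carrier G" "g' \<in> carrier G" for g g'
    proof -
      have "\<phi> (g \<otimes> g') = compose ?O (\<phi> g) (\<phi> g')"
      proof
        fix i show "\<phi> (g \<otimes> g') i = compose ?O (\<phi> g) (\<phi> g') i"
          using comp[OF g] by (cases "i \<in> ?O") (auto simp: compose_def \<phi>_def)
      qed
      then show ?thesis using bij g by (simp add: BijGroup_def)
    qed
  qed
  have fixes_iff: "\<phi> g i = i \<longleftrightarrow> g \<otimes> h i = h i \<otimes> g" if "g \<in> carrier G" "i \<in> ?O" for g i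
  proof -
    have "\<phi> g i = i \<longleftrightarrow> h (\<phi> g i) = h i" using kh[OF that(2)] kh[OF \<phi>O[OF that]] by metis
    then show ?thesis unfolding h\<phi>[OF that] using conj_eq_iff that hG by simp
  qed
  have free: "g = \<one>" if g: "g \<in> carrier G" and vw: "v \<in> ?O" "w \<in> ?O" "\<phi> g v = v" "\<phi> g w = w" "v \<noteq> w" for g v w
  proof (rule ccontr)
    assume n: "g \<noteq> \<one>"
    have c: "g \<otimes> h v = h v \<otimes> g" "g \<otimes> h w = h w \<otimes> g" using fixes_iff g vw by auto
    have "g \<notin> C" using fixed_point_free[OF _ hX[OF vw(1)] c(1)] n by blast
    then consider "g \<in> X" | "inv g \<in> X" using outside_in_X g by blast
    then have "h v = h w"
    proof cases
      case 1
      then show ?thesis using commuting_X[OF 1 hX c(1)] commuting_X[OF 1 hX c(2)] vw by metis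
    next
      case 2
      then show ?thesis
        using commuting_X[OF 2 hX[OF vw(1)] commute_inv[OF c(1) g hG[OF vw(1)]]]
          commuting_X[OF 2 hX[OF vw(2)] commute_inv[OF c(2) g hG[OF vw(2)]]] by simp
    qed
    then show False using kh vw by metis
  qed
  \<comment> \<open>Faithfulness is deduced from \<open>free\<close>, which needs two distinct
    points: z and e z for an involution e.\<close>
  have two: "\<exists>v\<in>?O. \<exists>w\<in>?O. v \<noteq> w"
  proof -
    obtain e where e: "e \<in> E" "e \<noteq> \<one>" using involution_ex E_mem by blast
    have eC: "e \<in> C" using e E_subset_C by blast
    have "e \<otimes> z \<in> X" using eC zG C_carrier by (simp add: X_def m_assoc)
    moreover have "e \<otimes> z \<noteq> z" using e zG E_carrier by simp
    ultimately show ?thesis using kO hk z_in_X by metis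
  qed
  have Fr: "Frobenius_action G ?O \<phi>"
    unfolding Frobenius_action_def
  proof (intro conjI)
    show "faithful_action G ?O \<phi>"
      unfolding faithful_action_def faithful_action_axioms_def
    proof (intro conjI act inj_onI)
      fix g g' assume g: "g \<in> carrier G" "g' \<in> carrier G" "\<phi> g = \<phi> g'"
      have "\<phi> (inv g' \<otimes> g) i = i" if "i \<in> ?O" for i
        using comp[of "inv g'" g i] comp[of "inv g'" g' i] one[OF that] g that by simp
      moreover obtain v w where "v \<in> ?O" "w \<in> ?O" "v \<noteq> w" using two by blast
      ultimately have "inv g' \<otimes> g = \<one>" using free[of "inv g' \<otimes> g" v w] g by auto
      then show "g = g'" using g by (metis inv_equality inv_inv inv_closed)
    qed
    show "transitive_action G ?O \<phi>"
      unfolding transitive_action_def transitive_action_axioms_def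
    proof (intro conjI act allI impI)
      fix v w assume v: "v \<in> ?O" and w: "w \<in> ?O"
      obtain c where c: "c \<in> C" "h v = c \<otimes> z \<otimes> inv c" using X_conjugate[OF hX[OF v]] by blast
      obtain d where d: "d \<in> C" "h w = d \<otimes> z \<otimes> inv d" using X_conjugate[OF hX[OF w]] by blast
      have G: "c \<in> carrier G" "d \<in> carrier G" using c d C_carrier by auto
      have "(d \<otimes> inv c) \<otimes> h v \<otimes> inv (d \<otimes> inv c) = h w"
        unfolding c(2) d(2) using G zG by (simp add: inv_mult_group m_assoc)
      then have "\<phi> (d \<otimes> inv c) v = w" using \<phi>[OF v] kh[OF w] by simp
      then show "\<exists>g\<in>carrier G. \<phi> g v = w" using G by blast
    qed
    show "\<forall>w\<in>?O. stabilizer G \<phi> w \<noteq> {\<one>}"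
    proof
      fix w assume w: "w \<in> ?O"
      have "h w \<in> stabilizer G \<phi> w" using fixes_iff[OF hG[OF w] w] hG[OF w] by (simp add: stabilizer_def)
      moreover have "h w \<noteq> \<one>" using X_outside[OF hX[OF w]] subgroup.one_closed[OF subgroup_C] by auto
      ultimately show "stabilizer G \<phi> w \<noteq> {\<one>}" by blast
    qed
    show "\<forall>g\<in>carrier G. g \<noteq> \<one> \<longrightarrow> (\<forall>v\<in>?O. \<forall>w\<in>?O. \<phi> g v = v \<and> \<phi> g w = w \<longrightarrow> v = w)"
      using free by blast
  qed
  have ker: "C = Frobenius_kernel G ?O \<phi>"
  proof (intro equalityI subsetI)
    fix g assume g: "g \<in> C"
    show "g \<in> Frobenius_kernel G ?O \<phi>"
    proof (cases "g = \<one>")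
      case False
      have "\<phi> g w \<noteq> w" if "w \<in> ?O" for w
        using fixed_point_free[OF g hX[OF that]] False fixes_iff[OF C_carrier[OF g] that] by blast
      then show ?thesis using C_carrier[OF g] by (simp add: Frobenius_kernel_def)
    qed (simp add: Frobenius_kernel_def)
  next
    fix g assume g: "g \<in> Frobenius_kernel G ?O \<phi>"
    show "g \<in> C"
    proof (rule ccontr)
      assume n: "g \<notin> C"
      then have gG: "g \<in> carrier G" and nf: "\<And>w. w \<in> ?O \<Longrightarrow> \<phi> g w \<noteq> w"
        using g subgroup.one_closed[OF subgroup_C] by (auto simp: Frobenius_kernel_def)
      have "\<exists>u\<in>X. g \<otimes> u = u \<otimes> g"
        using outside_in_X[OF gG n]
      proof
        show ?thesis if "g \<in> X" using that by (intro bexI[of _ g]) simp_all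
        show ?thesis if "inv g \<in> X" using that gG by (intro bexI[of _ "inv g"]) simp_all
      qed
      then obtain u where u: "u \<in> X" "g \<otimes> u = u \<otimes> g" by blast
      then have "\<phi> g (k u) = k u" using fixes_iff[OF gG kO[OF u(1)]] hk by simp
      then show False using nf[OF kO[OF u(1)]] by simp
    qed
  qed
  have stab: "generate G {z} = stabilizer G \<phi> (k z)"
  proof (intro equalityI subsetI)
    fix g assume "g \<in> generate G {z}"
    then have "g \<in> carrier G" "g \<otimes> z = z \<otimes> g" unfolding generate_z using zG by auto
    then show "g \<in> stabilizer G \<phi> (k z)" using fixes_iff[OF _ kO[OF z_in_X]] hk[OF z_in_X] by (simp add: stabilizer_def)
  next
    fix g assume "g \<in> stabilizer G \<phi> (k z)"
    then have g: "g \<in> carrier G" "g \<otimes> z = z \<otimes> g"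
      using fixes_iff[OF _ kO[OF z_in_X]] hk[OF z_in_X] by (auto simp: stabilizer_def)
    consider "g \<in> C" | "g \<in> X" | "inv g \<in> X" using outside_in_X g by blast
    then show "g \<in> generate G {z}"
    proof cases
      case 1
      then show ?thesis using fixed_point_free[OF 1 z_in_X g(2)] generate_z by simp
    next
      case 2
      then show ?thesis using commuting_X[OF 2 z_in_X g(2)] generate_z by simp
    next
      case 3
      then have "inv g = z" using commuting_X[OF 3 z_in_X commute_inv[OF g(2) g(1) zG]] by simp
      then have "g = inv z" using g by auto
      then show ?thesis using generate_z by simp
    qed
  qed
  show ?thesis
    unfolding Frobenius_group_def using Fr ker stab kO[OF z_in_X] semidirect_C by blast
qed

text \<open>Commutators in \<open>C\<close> = \<open>T\<close> lie in \<open>E\<close>, which is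
  central in \<open>C\<close>, so the class is at most 2. The exponent is exactly 4 because
  \<open>T\<close> is larger than \<open>E\<close>.\<close>

lemma family_c: "family_c G"
proof -
  let ?GC = "G\<lparr>carrier := C\<rparr>"
  interpret GC: group ?GC using subgroup_imp_group[OF subgroup_C] .
  have four: "(x \<otimes> x) \<otimes> (x \<otimes> x) = \<one>" if "x \<in> C" for x
    using that E_square unfolding CT by (simp add: T_mem)
  have EC: "subgroup E ?GC" by (rule subgroup_incl[OF subgroup_E subgroup_C E_subset_C])
  have Ecen: "E \<subseteq> group_center ?GC"
    using E_subset_C C_commute by (fastforce simp: group_center_def)
  have nil: "lower_central ?GC (Suc 1) = {\<one>\<^bsub>?GC\<^esub>}"
  proof (rule GC.nilpotent_of_central)
    have "lower_central ?GC 1 \<subseteq> E"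
      unfolding One_nat_def lower_central_Suc lower_central_0 commutator_subgroup_def
    proof (rule GC.generate_subgroup_incl[OF _ EC], clarify)
      fix a b assume "a \<in> carrier ?GC" "b \<in> carrier ?GC"
      then show "a \<otimes>\<^bsub>?GC\<^esub> b \<otimes>\<^bsub>?GC\<^esub> inv\<^bsub>?GC\<^esub> a \<otimes>\<^bsub>?GC\<^esub> inv\<^bsub>?GC\<^esub> b \<in> E"
        using T_comm[of a b] m_inv_consistent[OF subgroup_C] CT by simp
    qed
    then show "lower_central ?GC 1 \<subseteq> group_center ?GC" using Ecen by blast
  qed
  have "nilpotency_class ?GC \<le> 2" unfolding nilpotency_class_def using nil by (intro Least_le) (simp add: numeral_2_eq_2)
  moreover have "nilpotent_group ?GC" unfolding nilpotent_group_def using nil GC.is_group by blast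
  moreover have "p_group 2 ?GC" by (rule order_power_of_two[OF subgroup_C fin four])
  moreover have "Omega1 ?GC = E"
    by (rule GC.Omega1_eq[OF EC]) (use E_subset_C C_carrier in \<open>auto simp: E_mem\<close>)
  moreover have "group_exponent ?GC = 4"
    unfolding group_exponent_def
  proof (rule Least_equality)
    have p: "x [^]\<^bsub>?GC\<^esub> n = x [^] n" for x and n :: nat using nat_pow_consistent[of x n C] by simp
    have p4: "x [^] (4::nat) = (x \<otimes> x) \<otimes> (x \<otimes> x)" if "x \<in> carrier G" for x
      using that by (simp add: numeral_eq_Suc m_assoc)
    show "0 < (4::nat) \<and> (\<forall>x\<in>carrier ?GC. x [^]\<^bsub>?GC\<^esub> (4::nat) = \<one>\<^bsub>?GC\<^esub>)"
      using four p p4 C_carrier by simp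
    fix n :: nat assume n: "0 < n \<and> (\<forall>x\<in>carrier ?GC. x [^]\<^bsub>?GC\<^esub> n = \<one>\<^bsub>?GC\<^esub>)"
    obtain x where x: "x \<in> C" "x \<notin> E" using TE CT E_subset_C by blast
    have xG: "x \<in> carrier G" using C_carrier[OF x(1)] .
    have "ord x dvd 2 ^ 2" using pow_eq_id[OF xG, of 4] p4[OF xG] four[OF x(1)] by simp
    then obtain i where i: "i \<le> 2" "ord x = 2 ^ i" using divides_primepow_nat two_is_prime_nat by blast
    have "\<not> ord x dvd 2" using pow_eq_id[OF xG, of 2] x(2) xG by (simp add: E_mem numeral_2_eq_2)
    then have "i = 2" using i by (cases "i = 0"; cases "i = 1") auto
    then have "ord x = 4" using i by simp
    moreover have "x [^] n = \<one>" using n x(1) p by simp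
    ultimately have "4 dvd n" using pow_eq_id[OF xG] by simp
    then show "4 \<le> n" using n by (simp add: dvd_imp_le)
  qed
  moreover have "G\<lparr>carrier := generate G {z}\<rparr> \<cong> integer_mod_group 3"
    using iso_cyclic[OF zG ord_eq_3[OF zG z_cube z_neq_one]] zG by (simp add: subgroup_generated_carrier)
  ultimately show ?thesis
    unfolding family_c_def using frobenius_C Ecen by (intro exI[of _ C] exI[of _ "generate G {z}"]) simp
qed

end

subsection \<open>Special kernels\<close>

lemma set_product_Suc: "set_product G Z S (Suc n) = set_product G Z S n <#>\<^bsub>G\<^esub> S (Suc n)"
  by (simp add: set_product_def)

lemma set_product_0: "set_product G Z S 0 = Z"
  by (simp add: set_product_def)

text \<open>Up to a factor 1 or t every element is 1, a, b or ab, and the last three have square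
  t.\<close>

lemma (in quaternion_pair) square_one_form:
  assumes "g \<in> generate G {a, b}" "g \<otimes> g = \<one>"
  shows "g = \<one> \<or> g = t"
proof -
  obtain c d where cd: "c \<in> {\<one>, t}" "d \<in> {\<one>, a, b, a \<otimes> b}" "g = c \<otimes> d"
    using subsetD[OF generate_subset_M assms(1)] unfolding M_def mem_image_pairs by blast
  have G: "c \<in> carrier G" "d \<in> carrier G" using cd ab by auto
  have td: "t \<otimes> d = d \<otimes> t" using cd(2) t_central ab commute_mult[of a t b] by auto
  have cc: "c \<otimes> c = \<one>" and dc: "c \<otimes> d = d \<otimes> c" using cd(1) tt td G by auto
  have dd: "d \<otimes> d = \<one>"
    using assms(2) commuting_square[OF dc G] cc G cd(3) by simp
  have "(a \<otimes> b) \<otimes> (a \<otimes> b) = t"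
  proof -
    have "(a \<otimes> b) \<otimes> (a \<otimes> b) = a \<otimes> ((b \<otimes> a) \<otimes> b)" using ab by (simp add: m_assoc)
    also have "\<dots> = (a \<otimes> t) \<otimes> (a \<otimes> t)" unfolding ba using ab bb by (simp add: m_assoc)
    also have "\<dots> = (a \<otimes> a) \<otimes> (t \<otimes> t)" by (rule commuting_square[OF t_central(1) ab(1) tG])
    finally show ?thesis using aa tt by simp
  qed
  then have "d = \<one>" using cd(2) dd aa bb t1 by auto
  then show ?thesis using cd by auto
qed

section \<open>Set products and the Frattini subgroup\<close>

context group
begin

lemma set_product_subset:
  assumes L: "subgroup L G" and Z: "Z \<subseteq> L" and S: "\<And>i. i \<in> {1..n} \<Longrightarrow> S i \<subseteq> L"
  shows "set_product G Z S n \<subseteq> L"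
  using S
proof (induction n)
  case (Suc n)
  then have "set_product G Z S n \<subseteq> L" by simp
  then show ?case unfolding set_product_Suc by (rule set_mult_subset[OF L]) (use Suc.prems in simp)
qed (simp add: set_product_0 Z)

lemma set_product_upper:
  assumes Z: "subgroup Z G" and S: "\<And>i. i \<in> {1..n} \<Longrightarrow> subgroup (S i) G"
  shows "Z \<subseteq> set_product G Z S n \<and> set_product G Z S n \<subseteq> carrier G \<and>
    (\<forall>i\<in>{1..n}. Z <#> S i \<subseteq> set_product G Z S n)"
  using S
proof (induction n)
  case 0
  then show ?case using subgroup.subset[OF Z] by (simp add: set_product_0)
next
  case (Suc n)
  let ?A = "set_product G Z S n" and ?B = "S (Suc n)"
  have IH: "Z \<subseteq> ?A" "?A \<subseteq> carrier G" "\<And>i. i \<in> {1..n} \<Longrightarrow> Z <#> S i \<subseteq> ?A" using Suc by auto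
  have B: "subgroup ?B G" using Suc.prems by simp
  have up: "?A \<subseteq> ?A <#> ?B"
  proof
    fix x assume x: "x \<in> ?A"
    then have "x = x \<otimes> \<one>" using IH(2) by auto
    then show "x \<in> ?A <#> ?B" using set_multI[OF x subgroup.one_closed[OF B]] by simp
  qed
  have "Z <#> S i \<subseteq> ?A <#> ?B" if "i \<in> {1..Suc n}" for i
  proof (cases "i = Suc n")
    case True
    then show ?thesis using mono_set_mult[OF IH(1) subset_refl] by simp
  next
    case False
    then have "i \<in> {1..n}" using that by simp
    then show ?thesis using IH(3) up by blast
  qed
  moreover have "?A <#> ?B \<subseteq> carrier G"
    by (rule set_mult_subset[OF subgroup_self IH(2) subgroup.subset[OF B]])
  ultimately show ?case unfolding set_product_Suc using IH(1) up by blast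
qed

lemma normal_of_commutators:
  assumes H: "subgroup H G" and c: "\<And>x h. x \<in> carrier G \<Longrightarrow> h \<in> H \<Longrightarrow> x \<otimes> h \<otimes> inv x \<otimes> inv h \<in> H"
  shows "H \<lhd> G"
proof (rule normal_invI[OF H])
  fix x h assume x: "x \<in> carrier G" and h: "h \<in> H"
  have "x \<otimes> h \<otimes> inv x = (x \<otimes> h \<otimes> inv x \<otimes> inv h) \<otimes> h"
    using x subgroup.mem_carrier[OF H h] by (simp add: m_assoc)
  then show "x \<otimes> h \<otimes> inv x \<in> H" using subgroup.m_closed[OF H c[OF x h] h] by simp
qed

text \<open>A subgroup that is maximal among those containing \<open>Z\<close> but not \<open>u\<close> has index 2.\<close>

lemma Frattini_eq_center:
  assumes fin: "finite (carrier G)" and Z: "Z = group_center G" "derived G (carrier G) = Z"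
    and sq: "\<And>x. x \<in> carrier G \<Longrightarrow> x \<otimes> x \<in> Z"
  shows "Frattini G = Z"
proof
  have sZ: "subgroup Z G" unfolding Z(1) by (rule group_center_subgroup)
  have commZ: "x \<otimes> y \<otimes> inv x \<otimes> inv y \<in> Z" if "x \<in> carrier G" "y \<in> carrier G" for x y
    using that generate.incl[of _ "derived_set G (carrier G)" G] unfolding Z(2)[symmetric] derived_def by blast
  show "Z \<subseteq> Frattini G"
    unfolding Frattini_def
  proof (intro Int_greatest Inter_greatest)
    show "Z \<subseteq> carrier G" using subgroup.subset[OF sZ] .
    fix M assume "M \<in> {M. maximal_subgroup M G}"
    then have M: "subgroup M G" "M \<noteq> carrier G" "\<And>H. subgroup H G \<Longrightarrow> M \<subseteq> H \<Longrightarrow> H = M \<or> H = carrier G"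
      by (auto simp: maximal_subgroup_def)
    have comm: "m \<otimes> x = x \<otimes> m" if "m \<in> M" "x \<in> Z" for m x
      using group_center_commute[of x m] that Z(1) subgroup.mem_carrier[OF M(1)] by simp
    have MZ: "subgroup (M <#> Z) G" by (rule commuting_product_subgroup[OF M(1) sZ comm])
    have "M <#> Z = M \<or> M <#> Z = carrier G" using M(3)[OF MZ] set_mult_upper[OF M(1) sZ] by blast
    then show "Z \<subseteq> M"
    proof
      assume "M <#> Z = M"
      then show "Z \<subseteq> M" using set_mult_upper[OF M(1) sZ] by blast
    next
      \<comment> \<open>Central factors cancel in commutators, so all commutators already come from
        M, and Z is the derived subgroup.\<close>
      assume all: "M <#> Z = carrier G"
      have "derived_set G (carrier G) \<subseteq> M"
      proof clarify
        fix x y assume x: "x \<in> carrier G" and y: "y \<in> carrier G"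
        obtain m c where mc: "m \<in> M" "c \<in> Z" "x = m \<otimes> c" using x all set_mult_mem by metis
        obtain n d where nd: "n \<in> M" "d \<in> Z" "y = n \<otimes> d" using y all set_mult_mem by metis
        have G: "m \<in> carrier G" "c \<in> carrier G" "n \<in> carrier G" "d \<in> carrier G"
          using mc nd subgroup.mem_carrier[OF M(1)] subgroup.mem_carrier[OF sZ] by auto
        have xc: "x \<otimes> w \<otimes> inv x = m \<otimes> w \<otimes> inv m" if "w \<in> carrier G" for w
        proof -
          have "x \<otimes> w \<otimes> inv x = m \<otimes> ((c \<otimes> w) \<otimes> (inv c \<otimes> inv m))"
            using that G by (simp add: mc(3) inv_mult_group m_assoc)
          also have "\<dots> = m \<otimes> w \<otimes> inv m"
            using group_center_commute[of c w] mc(2) Z(1) that G by (simp add: m_assoc)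
          finally show ?thesis .
        qed
        have "x \<otimes> y \<otimes> inv x \<otimes> inv y = m \<otimes> (y \<otimes> inv m \<otimes> inv y)"
          using xc[OF y] y G by (simp add: m_assoc)
        also have "y \<otimes> inv m \<otimes> inv y = n \<otimes> inv m \<otimes> inv n"
        proof -
          have "y \<otimes> inv m \<otimes> inv y = n \<otimes> ((d \<otimes> inv m) \<otimes> (inv d \<otimes> inv n))"
            using G by (simp add: nd(3) inv_mult_group m_assoc)
          also have "\<dots> = n \<otimes> inv m \<otimes> inv n"
            using group_center_commute[of d "inv m"] nd(2) Z(1) G by (simp add: m_assoc)
          finally show ?thesis .
        qed
        finally show "x \<otimes> y \<otimes> inv x \<otimes> inv y \<in> M"
          using mc(1) nd(1) subgroup.m_closed[OF M(1)] subgroup.m_inv_closed[OF M(1)] by simp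
      qed
      then have "derived G (carrier G) \<subseteq> M" unfolding derived_def by (rule generate_subgroup_incl[OF _ M(1)])
      then show "Z \<subseteq> M" using Z(2) by simp
    qed
  qed
  show "Frattini G \<subseteq> Z"
  proof
    fix u assume u: "u \<in> Frattini G"
    show "u \<in> Z"
    proof (rule ccontr)
      assume uZ: "u \<notin> Z"
      have uG: "u \<in> carrier G" using u by (simp add: Frattini_def)
      define P where "P M \<longleftrightarrow> subgroup M G \<and> Z \<subseteq> M \<and> u \<notin> M" for M
      have "P Z" using sZ uZ by (simp add: P_def)
      moreover have "card M \<le> card (carrier G)" if "P M" for M
        using card_mono[OF fin] subgroup.subset that by (auto simp: P_def)
      ultimately obtain M where M: "P M" and max: "\<And>N. P N \<Longrightarrow> card N \<le> card M"
        using ex_max_card[of P Z "card (carrier G)"] by auto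
      have sM: "subgroup M G" "Z \<subseteq> M" "u \<notin> M" using M by (auto simp: P_def)
      have MG: "\<And>m. m \<in> M \<Longrightarrow> m \<in> carrier G" using subgroup.mem_carrier[OF sM(1)] .
      have nM: "M \<lhd> G"
        by (rule normal_of_commutators[OF sM(1)]) (use commZ MG sM(2) in blast)
      have larger: "N = M" if N: "P N" "M \<subseteq> N" for N
      proof -
        have "N \<subseteq> carrier G" using N(1) subgroup.subset[of N G] by (simp add: P_def)
        then have "finite N" using fin by (rule finite_subset)
        then show ?thesis using card_seteq[OF _ N(2) max[OF N(1)]] by simp
      qed
      \<comment> \<open>As g^2 lies in M and M is normal, M together with g M contains the group
        generated by M and g. By maximality this group contains u, so u is in g M.\<close>
      have coset: "\<exists>m\<in>M. g = u \<otimes> m" if g: "g \<in> carrier G" "g \<notin> M" for g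
      proof -
        let ?N = "M \<union> (\<lambda>m. g \<otimes> m) ` M"
        have gg: "g \<otimes> g \<in> M" using sq[OF g(1)] sM(2) by blast
        have "generate G (insert g M) \<subseteq> ?N"
        proof (rule generate_left_closed)
          show sub: "?N \<subseteq> carrier G" using MG g(1) by auto
          show "finite ?N" using finite_subset[OF sub fin] .
          show "\<one> \<in> ?N" using subgroup.one_closed[OF sM(1)] by simp
          fix s n assume s: "s \<in> insert g M" and "n \<in> ?N"
          then obtain m where m: "m \<in> M" "n = m \<or> n = g \<otimes> m" by blast
          have 1: "g \<otimes> (g \<otimes> m) \<in> M"
            using subgroup.m_closed[OF sM(1) gg m(1)] g(1) MG[OF m(1)] by (simp add: m_assoc)
          have 2: "s \<otimes> (g \<otimes> m) = g \<otimes> ((inv g \<otimes> s \<otimes> g) \<otimes> m)" if "s \<in> M"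
            using that MG g(1) m(1) by (simp add: m_assoc)
          have 3: "(inv g \<otimes> s \<otimes> g) \<otimes> m \<in> M" if "s \<in> M"
            using subgroup.m_closed[OF sM(1) conj_closed(2)[OF nM g(1) that] m(1)] .
          show "s \<otimes> n \<in> ?N"
            using s m 1 2 3 subgroup.m_closed[OF sM(1) _ m(1)] by auto
        qed (use MG g(1) in auto)
        moreover have sN: "subgroup (generate G (insert g M)) G"
          using MG g(1) by (intro generate_is_subgroup) auto
        have "u \<in> generate G (insert g M)"
        proof (rule ccontr)
          assume "u \<notin> generate G (insert g M)"
          moreover have "M \<subseteq> generate G (insert g M)" "g \<in> generate G (insert g M)"
            by (auto intro: generate.incl)
          ultimately have "generate G (insert g M) = M"
            using larger sN sM(2) unfolding P_def by blast
          then show False using \<open>g \<in> generate G (insert g M)\<close> g(2) by simp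
        qed
        ultimately obtain m where m: "m \<in> M" "u = g \<otimes> m" using sM(3) by blast
        then have "g = u \<otimes> inv m" using g(1) MG by (simp add: m_assoc)
        then show ?thesis using subgroup.m_inv_closed[OF sM(1) m(1)] by blast
      qed
      have "maximal_subgroup M G"
        unfolding maximal_subgroup_def
      proof (intro conjI allI impI)
        show "subgroup M G" by (rule sM(1))
        show "M \<noteq> carrier G" using sM(3) uG by blast
        fix H assume H: "subgroup H G \<and> M \<subseteq> H"
        show "H = M \<or> H = carrier G"
        proof (cases "u \<in> H")
          case True
          have "g \<in> H" if "g \<in> carrier G" for g
          proof (cases "g \<in> M")
            case False
            then obtain m where "m \<in> M" "g = u \<otimes> m" using coset \<open>g \<in> carrier G\<close> by blast
            then show ?thesis using subgroup.m_closed[of H G u m] True H by blast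
          qed (use H in blast)
          then show ?thesis using subgroup.subset[of H G] H by blast
        next
          case False
          then show ?thesis using larger[of H] H sM(2) unfolding P_def by blast
        qed
      qed
      then show False using u sM(3) by (simp add: Frattini_def)
    qed
  qed
qed

end

section \<open>Central \<open>E\<close> with an element of order 3 outside \<open>T\<close>: family
  (d)\<close>

locale special_P_group = P_group +
  fixes z
  assumes central: "C = carrier G" and T_comm: "\<And>s t. s \<in> T \<Longrightarrow> t \<in> T \<Longrightarrow> s \<otimes> t \<otimes> inv s \<otimes> inv t \<in> E"
    and TE: "T \<noteq> E"
    and zG: "z \<in> carrier G" and zT: "z \<notin> T" and z3: "z \<otimes> (z \<otimes> z) = \<one>"
begin

lemma E_central: "e \<in> E \<Longrightarrow> g \<in> carrier G \<Longrightarrow> e \<otimes> g = g \<otimes> e"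
  using C_commute[of g e] central by simp

lemma subgroup_T: "subgroup T G"
  by (rule commuting_lift(1)[OF T_comm])

lemma T_carrier: "u \<in> T \<Longrightarrow> u \<in> carrier G"
  by (simp add: T_mem)

lemma E_subset_T: "E \<subseteq> T"
  using subgroup.one_closed[OF subgroup_E] by (auto simp: E_mem T_mem)

lemma T_four: "u \<in> T \<Longrightarrow> (u \<otimes> u) \<otimes> (u \<otimes> u) = \<one>"
  using E_square by (simp add: T_mem)

lemma T_conj: "g \<in> carrier G \<Longrightarrow> u \<in> T \<Longrightarrow> g \<otimes> u \<otimes> inv g \<in> T"
proof -
  assume g: "g \<in> carrier G" and u: "u \<in> T"
  have "(g \<otimes> u \<otimes> inv g) \<otimes> (g \<otimes> u \<otimes> inv g) = g \<otimes> (u \<otimes> u) \<otimes> inv g"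
    using g T_carrier[OF u] by (simp add: m_assoc)
  then show ?thesis using conj_closed(1)[OF normal_E g, of "u \<otimes> u"] u g by (simp add: T_mem)
qed

lemma index_T: "g \<in> carrier G \<Longrightarrow> g \<in> T \<or> g \<otimes> z \<in> T \<or> g \<otimes> inv z \<in> T"
  using commuting_lift(2)[OF T_comm TE zG zT] .

lemma inv_z_notin_T: "inv z \<notin> T"
  using zT subgroup.m_inv_closed[OF subgroup_T, of "inv z"] zG by auto

lemma z_neq_one: "z \<noteq> \<one>"
  using zT subgroup.one_closed[OF subgroup_T] by auto

lemma generate_z: "generate G {z} = {\<one>, z, inv z}"
  by (rule generate_cube_one[OF zG z3])

text \<open>\<open>S\<close> is a transversal of \<open>E\<close> in \<open>T\<close>. Taking for
  \<open>U\<close> the group it generates, rather than \<open>T\<close>, allows a complement of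
  \<open>Z\<close> in \<open>E\<close> to split off as the elementary abelian direct factor.
  \<open>Z\<close> will be the centre of \<open>U\<close>, and the groups \<open>Qv v\<close> with v
  nontrivial its quaternion subgroups.\<close>

definition "S = {v \<in> T. (v \<otimes> z) \<otimes> ((v \<otimes> z) \<otimes> (v \<otimes> z)) = \<one>}"
definition "U = generate G S"
definition "Z = U \<inter> E"
definition "w v = z \<otimes> v \<otimes> inv z"
definition "Qv v = generate G {v, w v}"

lemma S_T: "v \<in> S \<Longrightarrow> v \<in> T" by (simp add: S_def)

lemma S_cube: "v \<in> S \<Longrightarrow> (v \<otimes> z) \<otimes> ((v \<otimes> z) \<otimes> (v \<otimes> z)) = \<one>" by (simp add: S_def)

lemma S_carrier: "v \<in> S \<Longrightarrow> v \<in> carrier G"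
  using S_T T_carrier by blast

lemma subgroup_U: "subgroup U G"
  unfolding U_def using S_carrier by (intro generate_is_subgroup) blast

lemma S_U: "v \<in> S \<Longrightarrow> v \<in> U"
  unfolding U_def by (rule generate.incl)

lemma U_T: "U \<subseteq> T"
  unfolding U_def using S_T by (intro generate_subgroup_incl[OF _ subgroup_T]) blast

lemma U_carrier: "u \<in> U \<Longrightarrow> u \<in> carrier G"
  using subgroup.mem_carrier[OF subgroup_U] .

text \<open>u z lies outside \<open>T\<close>, so its square is not in \<open>E\<close> and its cube
  has to be.\<close>

lemma twist_in_E:
  assumes u: "u \<in> T"
  shows "(u \<otimes> z) \<otimes> ((u \<otimes> z) \<otimes> (u \<otimes> z)) \<in> E"
proof -
  have uG: "u \<in> carrier G" using T_carrier[OF u] .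
  have "u \<otimes> z \<notin> T"
  proof
    assume "u \<otimes> z \<in> T"
    then have "inv u \<otimes> (u \<otimes> z) \<in> T" using subgroup.m_closed[OF subgroup_T subgroup.m_inv_closed[OF subgroup_T u]] by blast
    then show False using zT uG zG by simp
  qed
  then show ?thesis using square_or_cube[of "u \<otimes> z"] uG zG by (auto simp: T_mem)
qed

text \<open>Each coset \<open>uE\<close> in \<open>T\<close> meets \<open>S\<close> in exactly \<open>u (uz)\<^sup>3\<close>.\<close>

lemma T_form:
  assumes u: "u \<in> T"
  defines "e \<equiv> (u \<otimes> z) \<otimes> ((u \<otimes> z) \<otimes> (u \<otimes> z))"
  shows "u \<otimes> e \<in> S" "e \<in> E" "u = (u \<otimes> e) \<otimes> e"
proof -
  show eE: "e \<in> E" unfolding e_def by (rule twist_in_E[OF u])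
  have G: "u \<in> carrier G" "e \<in> carrier G" using T_carrier[OF u] E_carrier[OF eE] by auto
  \<comment> \<open>e is central of square 1 and is itself the cube of u z, so (u e) z has cube e^3
    e = 1.\<close>
  have c: "e \<otimes> (u \<otimes> z) = (u \<otimes> z) \<otimes> e" using E_central[OF eE] G zG by simp
  have "(u \<otimes> e) \<otimes> z = e \<otimes> (u \<otimes> z)" unfolding E_central[OF eE G(1), symmetric] using G zG by (simp add: m_assoc)
  moreover have "(e \<otimes> (u \<otimes> z)) \<otimes> ((e \<otimes> (u \<otimes> z)) \<otimes> (e \<otimes> (u \<otimes> z))) = (e \<otimes> (e \<otimes> e)) \<otimes> e"
    using commuting_cube[OF c G(2)] G zG by (simp add: e_def)
  moreover have "\<dots> = \<one>" using E_square[OF eE] G by simp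
  moreover have "u \<otimes> e \<in> T" using subgroup.m_closed[OF subgroup_T u] eE E_subset_T by blast
  ultimately show "u \<otimes> e \<in> S" by (simp add: S_def)
  show "u = (u \<otimes> e) \<otimes> e" using E_square[OF eE] G by (simp add: m_assoc)
qed

text \<open>A v in \<open>E\<close> commutes with z, so (vz)^3 = v^3 = v.\<close>

lemma S_E: "v \<in> S \<Longrightarrow> v \<in> E \<Longrightarrow> v = \<one>"
proof -
  assume v: "v \<in> S" "v \<in> E"
  have G: "v \<in> carrier G" using S_carrier[OF v(1)] .
  have "(v \<otimes> (v \<otimes> v)) \<otimes> (z \<otimes> (z \<otimes> z)) = \<one>"
    using commuting_cube[OF E_central[OF v(2) zG] G zG] S_cube[OF v(1)] by simp
  then show "v = \<one>" using z3 E_square[OF v(2)] G by simp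
qed

lemma binary_tetrahedral_S:
  assumes "v \<in> S" "v \<noteq> \<one>"
  shows "binary_tetrahedral_pair G v z"
proof -
  have v: "v \<in> T" "v \<in> carrier G" "v \<notin> E" using assms S_T S_carrier S_E by auto
  then show ?thesis
    using zG z3 S_cube[OF assms(1)] T_four[OF v(1)] E_central[of "v \<otimes> v" z]
    by unfold_locales (auto simp: E_mem T_mem)
qed

text \<open>All read off \<open>binary_tetrahedral_pair\<close>. The intersection with
  \<open>E\<close> is small because v^2 is the only involution of the quaternion group, and swapping
  v and \<open>w v\<close> costs the nontrivial factor v^2.\<close>

lemma Qv_props:
  assumes v: "v \<in> S" "v \<noteq> \<one>"
  shows "subgroup (Qv v) G" "G\<lparr>carrier := Qv v\<rparr> \<cong> quaternion_group"
    "subgroup_generated G (insert z (Qv v)) \<cong> SL23" "card (Qv v) = 8" "card (Qv v \<inter> E) \<le> 2"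
    "\<And>u. u \<in> Qv v \<Longrightarrow> z \<otimes> u \<otimes> inv z \<in> Qv v" "v \<otimes> w v \<noteq> w v \<otimes> v"
proof -
  interpret B: binary_tetrahedral_pair G v z using binary_tetrahedral_S[OF v] .
  have Bw: "B.w = w v" by (simp add: B.w_def w_def)
  have Q: "Qv v = generate G {v, B.w}" by (simp add: Qv_def Bw)
  have vwG: "{v, B.w} \<subseteq> carrier G" using S_carrier[OF v(1)] by simp
  show s: "subgroup (Qv v) G" unfolding Q by (rule B.subgroup_Q)
  show "G\<lparr>carrier := Qv v\<rparr> \<cong> quaternion_group"
    using B.Q.iso_Q8 subgroup_generated_carrier[OF vwG] by (simp add: Q)
  show "card (Qv v) = 8" unfolding Q by (rule B.Q.card_quaternion)
  show "z \<otimes> u \<otimes> inv z \<in> Qv v" if "u \<in> Qv v" for u using B.Q_conj that unfolding Q by blast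
  have "Qv v \<inter> E \<subseteq> {\<one>, B.t}" unfolding Q using B.Q.square_one_form E_square by blast
  then have "card (Qv v \<inter> E) \<le> card {\<one>, B.t}" by (intro card_mono) auto
  also have "\<dots> \<le> 2" by (simp add: card_insert_if)
  finally show "card (Qv v \<inter> E) \<le> 2" .
  have wv: "B.w \<otimes> v = B.t \<otimes> (v \<otimes> B.w)" by (rule B.w_v)
  show "v \<otimes> w v \<noteq> w v \<otimes> v"
    using wv B.Q.t1 S_carrier[OF v(1)] r_cancel_one'[of "v \<otimes> B.w" B.t] by (simp add: Bw[symmetric])
  have "generate G (insert z (Qv v)) = generate G {v, z}"
  proof
    have H: "subgroup (generate G {v, z}) G" using B.vz by (intro generate_is_subgroup) auto
    have i: "v \<in> generate G {v, z}" "z \<in> generate G {v, z}" by (auto intro: generate.incl)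
    then have "w v \<in> generate G {v, z}"
      unfolding w_def using subgroup.m_closed[OF H] subgroup.m_inv_closed[OF H] by simp
    then have "Qv v \<subseteq> generate G {v, z}" unfolding Qv_def using i by (intro generate_subgroup_incl[OF _ H]) auto
    then show "generate G (insert z (Qv v)) \<subseteq> generate G {v, z}"
      using i by (intro generate_subgroup_incl[OF _ H]) auto
    show "generate G {v, z} \<subseteq> generate G (insert z (Qv v))"
      by (rule generate_subgroup_incl)
         (use zG subgroup.subset[OF s] in \<open>auto intro!: generate_is_subgroup generate.incl simp: Qv_def\<close>)
  qed
  then show "subgroup_generated G (insert z (Qv v)) \<cong> SL23"
    using B.iso_SL23 subgroup_generated_carrier[of "{v, z}"] B.vz zG
      subgroup_generated_carrier[of "insert z (Qv v)"] subgroup.subset[OF s] by simp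
qed

lemma S_conj: "v \<in> S \<Longrightarrow> w v \<in> S"
proof -
  assume v: "v \<in> S"
  have G: "v \<in> carrier G" using S_carrier[OF v] .
  have "w v \<otimes> z = z \<otimes> (v \<otimes> z) \<otimes> inv z" using G zG by (simp add: w_def m_assoc)
  then show "w v \<in> S"
    using conj_cube_one[OF S_cube[OF v] _ zG] G zG T_conj[OF zG S_T[OF v]] by (simp add: S_def w_def)
qed

lemma U_conj: "u \<in> U \<Longrightarrow> w u \<in> U"
  unfolding U_def
proof (induction rule: generate.induct)
  case one
  then show ?case using generate.one zG by (simp add: w_def)
next
  case (incl h)
  then show ?case using S_conj by (auto intro: generate.incl)
next
  case (inv h)
  then have "w (inv h) = inv (w h)" using S_carrier zG by (simp add: w_def inv_mult_group m_assoc)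
  then show ?case using generate.inv[OF S_conj[OF inv]] by simp
next
  case (eng a b)
  then have "a \<in> carrier G" "b \<in> carrier G" using U_carrier unfolding U_def by auto
  then have "w (a \<otimes> b) = w a \<otimes> w b" unfolding w_def by (intro conj_mult zG)
  then show ?case using generate.eng[OF eng.IH] by simp
qed

text \<open>The representative in \<open>S\<close> of the coset of u lies in \<open>U\<close>, so
  the correcting factor from \<open>E\<close> lies in \<open>Z\<close>.\<close>

lemma U_form:
  assumes "u \<in> U"
  shows "\<exists>v\<in>S. \<exists>c\<in>Z. u = v \<otimes> c"
proof -
  let ?e = "(u \<otimes> z) \<otimes> ((u \<otimes> z) \<otimes> (u \<otimes> z))"
  note f = T_form[OF subsetD[OF U_T assms]]
  have G: "u \<in> carrier G" "?e \<in> carrier G" using U_carrier[OF assms] zG by auto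
  have "inv u \<otimes> (u \<otimes> ?e) \<in> U"
    using subgroup.m_closed[OF subgroup_U subgroup.m_inv_closed[OF subgroup_U assms] S_U[OF f(1)]] .
  then have "?e \<in> Z" using f(2) G unfolding Z_def by simp
  then show ?thesis using f(1,3) by blast
qed

lemma subgroup_Z: "subgroup Z G"
  unfolding Z_def by (rule subgroups_Inter_pair[OF subgroup_U subgroup_E])

end

lemma (in group) generate_insert_cube_one:
  assumes U: "subgroup U G" and fin: "finite (carrier G)" and z: "z \<in> carrier G" "z \<otimes> (z \<otimes> z) = \<one>"
    and c: "\<And>u. u \<in> U \<Longrightarrow> z \<otimes> u \<otimes> inv z \<in> U"
  shows "generate G (insert z U) = U <#> generate G {z}"
proof
  have UG: "\<And>u. u \<in> U \<Longrightarrow> u \<in> carrier G" using subgroup.mem_carrier[OF U] .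
  have zU: "insert z U \<subseteq> carrier G" using z UG by auto
  have zz: "inv z = z \<otimes> z" using inv_of_cube_one[OF z(2,1)] .
  note gz = generate_cube_one[OF z]
  have sz: "subgroup (generate G {z}) G" using z by (intro generate_is_subgroup) simp
  show "generate G (insert z U) \<subseteq> U <#> generate G {z}"
  proof (rule generate_left_closed[OF zU])
    show sub: "U <#> generate G {z} \<subseteq> carrier G"
      by (rule set_mult_subset[OF subgroup_self subgroup.subset[OF U] subgroup.subset[OF sz]])
    show "finite (U <#> generate G {z})" using sub fin finite_subset by blast
    show "\<one> \<in> U <#> generate G {z}"
      using set_multI[OF subgroup.one_closed[OF U] subgroup.one_closed[OF sz]] by simp
    fix s g assume s: "s \<in> insert z U" and "g \<in> U <#> generate G {z}"
    then obtain u d where ud: "u \<in> U" "d \<in> generate G {z}" "g = u \<otimes> d" by (auto simp: set_mult_mem)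
    have G: "u \<in> carrier G" "d \<in> carrier G" using ud UG subgroup.mem_carrier[OF sz] by auto
    have "z \<otimes> g = (z \<otimes> u \<otimes> inv z) \<otimes> (z \<otimes> d)" using ud G z by (simp add: m_assoc)
    moreover have "z \<otimes> d \<in> generate G {z}"
      using subgroup.m_closed[OF sz _ ud(2)] generate.incl[of z "{z}" G] by simp
    ultimately have 1: "z \<otimes> g \<in> U <#> generate G {z}" using set_multI[OF c[OF ud(1)]] by simp
    have "s \<otimes> g = (s \<otimes> u) \<otimes> d" if "s \<in> U" using ud G UG[OF that] by (simp add: m_assoc)
    then show "s \<otimes> g \<in> U <#> generate G {z}"
      using s 1 set_multI[OF subgroup.m_closed[OF U _ ud(1)] ud(2)] by auto
  qed
  have H: "subgroup (generate G (insert z U)) G" by (rule generate_is_subgroup[OF zU])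
  show "U <#> generate G {z} \<subseteq> generate G (insert z U)"
    by (rule set_mult_subset[OF H]) (auto intro: generate.incl mono_generate[THEN subsetD, rotated])
qed

section \<open>Centre, derived subgroup and Frattini subgroup of \<open>U\<close>; the quaternion
  factors\<close>

context special_P_group
begin

lemma w_inv: "u \<in> carrier G \<Longrightarrow> inv z \<otimes> u \<otimes> z = w (w u)"
  using zG inv_of_cube_one[OF z3 zG] by (simp add: w_def m_assoc cube_one_extend[OF z3 zG])

lemma twist: "u \<in> carrier G \<Longrightarrow> (u \<otimes> z) \<otimes> ((u \<otimes> z) \<otimes> (u \<otimes> z)) = u \<otimes> (w u \<otimes> w (w u))"
  using cube_twist[OF _ zG z3, of u] w_inv[of u] by (simp add: w_def)

lemma E_w: "e \<in> E \<Longrightarrow> w e = e"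
  using E_central[of e z] E_carrier[of e] zG conj_eq_iff[of z e] by (simp add: w_def)

lemma w_carrier [simp]: "u \<in> carrier G \<Longrightarrow> w u \<in> carrier G"
  using zG by (simp add: w_def)

lemma w_mult: "a \<in> carrier G \<Longrightarrow> b \<in> carrier G \<Longrightarrow> w (a \<otimes> b) = w a \<otimes> w b"
  unfolding w_def by (rule conj_mult[OF zG])

abbreviation "GU \<equiv> G\<lparr>carrier := U\<rparr>"

lemma group_GU: "group GU"
  by (rule subgroup_imp_group[OF subgroup_U])

lemma inv_GU: "u \<in> U \<Longrightarrow> inv\<^bsub>GU\<^esub> u = inv u"
  by (rule m_inv_consistent[OF subgroup_U])

lemma U_commutator:
  assumes "x \<in> U" "y \<in> U"
  shows "x \<otimes> y \<otimes> inv x \<otimes> inv y \<in> Z"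
  unfolding Z_def
  using T_comm subsetD[OF U_T] assms subgroup.m_closed[OF subgroup_U] subgroup.m_inv_closed[OF subgroup_U]
  by simp

lemma Z_E: "c \<in> Z \<Longrightarrow> c \<in> E" and Z_U: "c \<in> Z \<Longrightarrow> c \<in> U"
  by (simp_all add: Z_def)

text \<open>Write a central u as v c with v in \<open>S\<close> and c in \<open>Z\<close>. Then v
  commutes with all of \<open>U\<close>, but a nontrivial v does not commute with its conjugate
  \<open>w v\<close>.\<close>

lemma center_U: "group_center GU = Z"
proof (intro equalityI subsetI)
  fix u assume "u \<in> group_center GU"
  then have u: "u \<in> U" "\<And>x. x \<in> U \<Longrightarrow> u \<otimes> x = x \<otimes> u" by (auto simp: group_center_def)
  obtain v c where vc: "v \<in> S" "c \<in> Z" "u = v \<otimes> c" using U_form[OF u(1)] by blast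
  have G: "v \<in> carrier G" "c \<in> carrier G" using S_carrier[OF vc(1)] U_carrier[OF Z_U[OF vc(2)]] by auto
  have v: "v = u \<otimes> c" using vc(3) G E_square[OF Z_E[OF vc(2)]] by (simp add: m_assoc)
  have "v = \<one>"
  proof (rule ccontr)
    assume n: "v \<noteq> \<one>"
    have wv: "w v \<in> U" using S_U[OF S_conj[OF vc(1)]] .
    have wG: "w v \<in> carrier G" using U_carrier[OF wv] .
    have "v \<otimes> w v = w v \<otimes> v"
      using commute_mult[OF u(2)[OF wv] E_central[OF Z_E[OF vc(2)] wG]] v U_carrier[OF u(1)] G wG by simp
    then show False using Qv_props(7)[OF vc(1) n] by simp
  qed
  then show "u \<in> Z" using vc G by simp
next
  fix c assume "c \<in> Z"
  then show "c \<in> group_center GU" using Z_U E_central[OF Z_E] U_carrier by (simp add: group_center_def)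
qed

text \<open>Commutators of \<open>U\<close> lie in \<open>Z\<close>, which gives one inclusion. For
  the other, the norm is multiplicative modulo the derived subgroup and trivial on the generators
  \<open>S\<close>, so its values lie in the derived subgroup; on c in \<open>Z\<close> the norm is
  c^3 = c.\<close>

lemma derived_U: "derived GU (carrier GU) = Z"
proof -
  interpret GU: group GU by (rule group_GU)
  let ?D = "derived GU (carrier GU)"
  have set: "derived_set GU (carrier GU) = (\<Union>x\<in>U. \<Union>y\<in>U. {x \<otimes> y \<otimes> inv x \<otimes> inv y})"
    using inv_GU by simp
  have sD: "subgroup ?D GU" by (rule GU.derived_is_subgroup) simp
  have comD: "x \<otimes> y \<otimes> inv x \<otimes> inv y \<in> ?D" if "x \<in> U" "y \<in> U" for x y
    unfolding derived_def set using that by (intro generate.incl) blast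
  have "?D \<subseteq> Z"
    unfolding derived_def set
    by (rule GU.generate_subgroup_incl[OF _ subgroup_incl[OF subgroup_Z subgroup_U]])
       (use U_commutator Z_U in auto)
  moreover have "Z \<subseteq> ?D"
  proof -
    have DE: "d \<in> E" if "d \<in> ?D" for d using that \<open>?D \<subseteq> Z\<close> Z_E by blast
    let ?N = "{u \<in> U. u \<otimes> (w u \<otimes> w (w u)) \<in> ?D}"
    have "U \<subseteq> ?N"
      unfolding U_def
    proof (rule generate_left_closed)
      show "S \<subseteq> carrier G" using S_carrier by blast
      show sub: "{u \<in> generate G S. u \<otimes> (w u \<otimes> w (w u)) \<in> derived (G\<lparr>carrier := generate G S\<rparr>) (carrier (G\<lparr>carrier := generate G S\<rparr>))} \<subseteq> carrier G"
        using U_carrier unfolding U_def by blast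
      show "finite {u \<in> generate G S. u \<otimes> (w u \<otimes> w (w u)) \<in> derived (G\<lparr>carrier := generate G S\<rparr>) (carrier (G\<lparr>carrier := generate G S\<rparr>))}"
        using finite_subset[OF sub fin] .
      show "\<one> \<in> {u \<in> generate G S. u \<otimes> (w u \<otimes> w (w u)) \<in> derived (G\<lparr>carrier := generate G S\<rparr>) (carrier (G\<lparr>carrier := generate G S\<rparr>))}"
        using subgroup.one_closed[OF subgroup_U] subgroup.one_closed[OF sD] E_w[OF subgroup.one_closed[OF subgroup_E]]
        by (simp add: U_def)
      fix s b assume s: "s \<in> S" and b: "b \<in> {u \<in> generate G S. u \<otimes> (w u \<otimes> w (w u)) \<in> derived (G\<lparr>carrier := generate G S\<rparr>) (carrier (G\<lparr>carrier := generate G S\<rparr>))}"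
      have bU: "b \<in> U" and bD: "b \<otimes> (w b \<otimes> w (w b)) \<in> ?D" using b by (auto simp: U_def)
      have sU: "s \<in> U" "w s \<in> U" "w (w s) \<in> U" "w b \<in> U" "w (w b) \<in> U"
        using S_U[OF s] U_conj bU by auto
      note G = U_carrier[OF sU(1)] U_carrier[OF sU(2)] U_carrier[OF sU(3)] U_carrier[OF bU] U_carrier[OF sU(4)] U_carrier[OF sU(5)]
      \<comment> \<open>The two commutators arising when \<open>w s\<close> is moved past b and
        \<open>w (w s)\<close> past b (w b); both are central and can be pulled to the
        front.\<close>
      define d1 where "d1 = b \<otimes> w s \<otimes> inv b \<otimes> inv (w s)"
      define d2 where "d2 = (b \<otimes> w b) \<otimes> w (w s) \<otimes> inv (b \<otimes> w b) \<otimes> inv (w (w s))"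
      have d: "d1 \<in> ?D" "d2 \<in> ?D"
        unfolding d1_def d2_def using comD[OF bU sU(2)] comD[OF subgroup.m_closed[OF subgroup_U bU sU(4)] sU(3)] by auto
      have dG: "d1 \<in> carrier G" "d2 \<in> carrier G" using E_carrier[OF DE[OF d(1)]] E_carrier[OF DE[OF d(2)]] by auto
      have 1: "b \<otimes> w s = d1 \<otimes> (w s \<otimes> b)" using G by (simp add: d1_def m_assoc)
      have 2: "(b \<otimes> w b) \<otimes> w (w s) = d2 \<otimes> (w (w s) \<otimes> (b \<otimes> w b))" using G by (simp add: d2_def inv_mult_group m_assoc)
      have s1: "s \<otimes> (w s \<otimes> w (w s)) = \<one>" using S_cube[OF s] twist[OF G(1)] by simp
      have "(s \<otimes> b) \<otimes> (w (s \<otimes> b) \<otimes> w (w (s \<otimes> b)))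
          = s \<otimes> ((b \<otimes> w s) \<otimes> (w b \<otimes> (w (w s) \<otimes> w (w b))))"
        using G by (simp add: w_mult m_assoc)
      also have "\<dots> = (s \<otimes> d1) \<otimes> (w s \<otimes> (((b \<otimes> w b) \<otimes> w (w s)) \<otimes> w (w b)))"
        unfolding 1 using G dG by (simp add: m_assoc)
      also have "\<dots> = d1 \<otimes> (s \<otimes> (((w s) \<otimes> d2) \<otimes> (w (w s) \<otimes> (b \<otimes> (w b \<otimes> w (w b))))))"
        unfolding 2 E_central[OF DE[OF d(1)] G(1), symmetric] using G dG by (simp add: m_assoc)
      also have "\<dots> = d1 \<otimes> ((s \<otimes> d2) \<otimes> (w s \<otimes> (w (w s) \<otimes> (b \<otimes> (w b \<otimes> w (w b))))))"
        unfolding E_central[OF DE[OF d(2)] G(2), symmetric] using G dG by (simp add: m_assoc)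
      also have "\<dots> = d1 \<otimes> (d2 \<otimes> ((s \<otimes> (w s \<otimes> w (w s))) \<otimes> (b \<otimes> (w b \<otimes> w (w b)))))"
        unfolding E_central[OF DE[OF d(2)] G(1), symmetric] using G dG by (simp add: m_assoc)
      also have "\<dots> = d1 \<otimes> (d2 \<otimes> (b \<otimes> (w b \<otimes> w (w b))))" unfolding s1 using G by simp
      also have "\<dots> \<in> ?D"
        using subgroup.m_closed[OF sD d(1) subgroup.m_closed[OF sD d(2) bD]] by simp
      finally show "s \<otimes> b \<in> {u \<in> generate G S. u \<otimes> (w u \<otimes> w (w u)) \<in> derived (G\<lparr>carrier := generate G S\<rparr>) (carrier (G\<lparr>carrier := generate G S\<rparr>))}"
        using subgroup.m_closed[OF subgroup_U sU(1) bU] by (simp add: U_def)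
    qed
    then show "Z \<subseteq> ?D"
      using Z_U Z_E E_w E_square E_carrier by (fastforce simp: subset_iff)
  qed
  ultimately show ?thesis by blast
qed

lemma Frattini_U: "Frattini GU = Z"
proof (rule group.Frattini_eq_center[OF group_GU])
  show "finite (carrier GU)" using fin subgroup.subset[OF subgroup_U] finite_subset by auto
  show "Z = group_center GU" by (rule center_U[symmetric])
  show "derived GU (carrier GU) = Z" by (rule derived_U)
  show "x \<otimes>\<^bsub>GU\<^esub> x \<in> Z" if "x \<in> carrier GU" for x
    using that subsetD[OF U_T, of x] subgroup.m_closed[OF subgroup_U, of x x] by (simp add: Z_def T_mem)
qed

lemma Omega1_U: "Omega1 GU = Z"
  by (rule group.Omega1_eq[OF group_GU subgroup_incl[OF subgroup_Z subgroup_U]])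
     (auto simp: Z_def E_mem U_carrier)

text \<open>If u = v c commutes with z, so does v; then (vz)^3 = 1 gives v^3 = 1, and v^4 = 1 leaves
  v = 1.\<close>

lemma centralizer_z: "{u \<in> U. u \<otimes> z = z \<otimes> u} = Z"
proof (intro equalityI subsetI)
  fix u assume "u \<in> {u \<in> U. u \<otimes> z = z \<otimes> u}"
  then have u: "u \<in> U" "u \<otimes> z = z \<otimes> u" by auto
  obtain v c where vc: "v \<in> S" "c \<in> Z" "u = v \<otimes> c" using U_form[OF u(1)] by blast
  have G: "v \<in> carrier G" "c \<in> carrier G" using S_carrier[OF vc(1)] U_carrier[OF Z_U[OF vc(2)]] by auto
  have v: "v = u \<otimes> c" using vc(3) G E_square[OF Z_E[OF vc(2)]] by (simp add: m_assoc)
  have "v \<otimes> z = z \<otimes> v"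
    using commute_mult[OF u(2) E_central[OF Z_E[OF vc(2)] zG]] v U_carrier[OF u(1)] G zG by simp
  then have "v \<otimes> (v \<otimes> v) = \<one>" using commuting_cube[OF _ G(1) zG] S_cube[OF vc(1)] z3 G by simp
  moreover have "(v \<otimes> v) \<otimes> (v \<otimes> v) = v \<otimes> (v \<otimes> (v \<otimes> v))" using G by (simp add: m_assoc)
  ultimately have "v = \<one>" using T_four[OF S_T[OF vc(1)]] G by simp
  then show "u \<in> Z" using vc G by simp
qed (use Z_U E_central[OF Z_E zG] in auto)

lemma Qv_subset_U: "v \<in> S \<Longrightarrow> Qv v \<subseteq> U"
  unfolding Qv_def by (rule generate_subgroup_incl[OF _ subgroup_U]) (use S_U S_conj in auto)

text \<open>\<open>Qv v\<close> is invariant under z and so contains the norm of x, hence also s.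
  Then \<open>Qv s\<close> is contained in \<open>Qv v\<close>, and both have order 8.\<close>

lemma Qv_determined:
  assumes v: "v \<in> S" "v \<noteq> \<one>" and x: "x \<in> Qv v" "x \<notin> E"
  defines "s \<equiv> x \<otimes> ((x \<otimes> z) \<otimes> ((x \<otimes> z) \<otimes> (x \<otimes> z)))"
  shows "Qv v = Qv s"
proof -
  have sQ: "subgroup (Qv v) G" by (rule Qv_props(1)[OF v])
  have xU: "x \<in> U" using Qv_subset_U[OF v(1)] x(1) by blast
  note f = T_form[OF subsetD[OF U_T xU]]
  have s: "s \<in> S" unfolding s_def by (rule f(1))
  have s1: "s \<noteq> \<one>"
  proof
    assume "s = \<one>"
    then have "x \<in> E" using f(2,3) E_carrier[OF f(2)] unfolding s_def by simp
    then show False using x(2) by simp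
  qed
  have cl: "w u \<in> Qv v" if "u \<in> Qv v" for u using Qv_props(6)[OF v that] by (simp add: w_def)
  have sv: "s \<in> Qv v"
    unfolding s_def twist[OF U_carrier[OF xU]]
    using subgroup.m_closed[OF sQ] x(1) cl by simp
  have sub: "Qv s \<subseteq> Qv v"
    unfolding Qv_def[of s] using sv cl by (intro generate_subgroup_incl[OF _ sQ]) auto
  have "finite (Qv v)" using fin subgroup.subset[OF sQ] finite_subset by blast
  then show ?thesis using card_subset_eq[OF _ sub] Qv_props(4)[OF v] Qv_props(4)[OF s s1] by simp
qed

text \<open>An element outside \<open>E\<close> determines the quaternion group containing it, so
  different ones can only meet inside \<open>E\<close>.\<close>

lemma Qv_Int:
  assumes a: "a \<in> S" "a \<noteq> \<one>" and b: "b \<in> S" "b \<noteq> \<one>" and n: "Qv a \<noteq> Qv b"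
  shows "card (Qv a \<inter> Qv b) \<le> 2"
proof -
  have "Qv a \<inter> Qv b \<subseteq> Qv a \<inter> E" using Qv_determined[OF a] Qv_determined[OF b] n by blast
  moreover have "finite (Qv a \<inter> E)" using finite_E by simp
  ultimately show ?thesis using card_mono[of "Qv a \<inter> E"] Qv_props(5)[OF a] le_trans by blast
qed

text \<open>With W = <U, z> and V a complement of \<open>Z\<close> in \<open>E\<close>, G is W x V.
  The U_i are the different groups \<open>Qv v\<close>; since every u is v c with v in
  \<open>S\<close> and c in \<open>Z\<close>, it lies in \<open>Z\<close> or already in a single
  \<open>Z\<close> U_i.\<close>

lemma family_d: "family_d G"
proof -
  let ?W = "generate G (insert z U)"
  have zU: "insert z U \<subseteq> carrier G" using zG U_carrier by auto
  have sW: "subgroup ?W G" by (rule generate_is_subgroup[OF zU])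
  have sz: "subgroup (generate G {z}) G" using zG by (intro generate_is_subgroup) simp
  have W: "?W = U <#> generate G {z}"
    by (rule generate_insert_cube_one[OF subgroup_U fin zG z3]) (use U_conj in \<open>simp add: w_def\<close>)
  have UW: "U \<subseteq> ?W" and zW: "generate G {z} \<subseteq> ?W"
    unfolding W using set_mult_upper[OF subgroup_U sz] by auto
  have conjU: "c \<otimes> u \<otimes> inv c \<in> U" if c: "c \<in> generate G {z}" and u: "u \<in> U" for c u
  proof -
    have "w u \<in> U" "w (w u) \<in> U" using U_conj u by auto
    then show ?thesis using c u U_carrier[OF u] w_inv[of u] zG unfolding generate_z by (auto simp: w_def)
  qed
  obtain V where V: "subgroup V G" "V \<subseteq> E" "Z \<inter> V = {\<one>}" "Z <#> V = E"
    using exponent_2_complement[OF subgroup_E finite_E E_square subgroup_Z] Z_E by blast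
  have VG: "\<And>f. f \<in> V \<Longrightarrow> f \<in> carrier G" using subgroup.mem_carrier[OF V(1)] .
  have VC: "V \<subseteq> group_center G"
    using V(2) E_central E_carrier by (auto simp: group_center_def subset_iff)
  have T_dec: "\<exists>u\<in>U. \<exists>f\<in>V. g = u \<otimes> f" if g: "g \<in> T" for g
  proof -
    let ?e = "(g \<otimes> z) \<otimes> ((g \<otimes> z) \<otimes> (g \<otimes> z))"
    note f = T_form[OF g]
    obtain c f where cf: "c \<in> Z" "f \<in> V" "?e = c \<otimes> f" using f(2) V(4) set_mult_mem by metis
    have G: "g \<otimes> ?e \<in> carrier G" "c \<in> carrier G" "f \<in> carrier G"
      using S_carrier[OF f(1)] U_carrier[OF Z_U[OF cf(1)]] VG[OF cf(2)] by auto
    have "g = (g \<otimes> ?e) \<otimes> (c \<otimes> f)" using f(3) unfolding cf(3) .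
    then have "g = ((g \<otimes> ?e) \<otimes> c) \<otimes> f" using m_assoc[OF G] by simp
    then show ?thesis using subgroup.m_closed[OF subgroup_U S_U[OF f(1)] Z_U[OF cf(1)]] cf(2) by blast
  qed
  have WV: "?W <#> V = carrier G"
  proof
    show "?W <#> V \<subseteq> carrier G"
      by (rule set_mult_subset[OF subgroup_self subgroup.subset[OF sW] subgroup.subset[OF V(1)]])
    show "carrier G \<subseteq> ?W <#> V"
    proof
      fix g assume g: "g \<in> carrier G"
      have "\<exists>y\<in>generate G {z}. g \<otimes> inv y \<in> T"
        using index_T[OF g] g zG unfolding generate_z by auto
      then obtain y where y: "y \<in> generate G {z}" "g \<otimes> inv y \<in> T" by blast
      obtain u f where uf: "u \<in> U" "f \<in> V" "g \<otimes> inv y = u \<otimes> f" using T_dec[OF y(2)] by blast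
      have G: "u \<in> carrier G" "f \<in> carrier G" "y \<in> carrier G"
        using U_carrier[OF uf(1)] VG[OF uf(2)] subgroup.mem_carrier[OF sz y(1)] by auto
      have "f \<in> E" using uf(2) V(2) by blast
      have "g = (g \<otimes> inv y) \<otimes> y" using g G by (simp add: m_assoc)
      also have "\<dots> = u \<otimes> (f \<otimes> y)" unfolding uf(3) using G by (simp add: m_assoc)
      also have "\<dots> = (u \<otimes> y) \<otimes> f" unfolding E_central[OF \<open>f \<in> E\<close> G(3)] using G by (simp add: m_assoc)
      finally show "g \<in> ?W <#> V"
        using set_multI[OF set_multI[OF uf(1) y(1)] uf(2)] unfolding W by simp
    qed
  qed
  \<comment> \<open>The component in <z> of an element of \<open>T\<close> is trivial, since neither
    z nor z^-1 lies in \<open>T\<close>.\<close>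
  have W_T: "u \<in> U" if u: "u \<in> ?W" "u \<in> T" for u
  proof -
    obtain a c where ac: "a \<in> U" "c \<in> generate G {z}" "u = a \<otimes> c" using u(1) unfolding W set_mult_mem by blast
    have G: "a \<in> carrier G" "c \<in> carrier G" using U_carrier[OF ac(1)] subgroup.mem_carrier[OF sz ac(2)] by auto
    have "inv a \<otimes> u \<in> T"
      using subgroup.m_closed[OF subgroup_T subgroup.m_inv_closed[OF subgroup_T subsetD[OF U_T ac(1)]] u(2)] .
    then have "c \<in> T" using ac(3) G by simp
    then have "c = \<one>" using ac(2) zT inv_z_notin_T unfolding generate_z by auto
    then show ?thesis using ac G by simp
  qed
  have dir: "internal_direct G ?W V"
    unfolding internal_direct_def
  proof (intro conjI)
    show "?W \<lhd> G" by (rule normal_of_central_supplement[OF sW VC WV])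
    show "V \<lhd> G" by (rule subgroup_of_center_normal[OF V(1) VC])
    have "x \<in> Z" if "x \<in> ?W" "x \<in> V" for x
      using W_T[OF that(1)] that(2) V(2) E_subset_T unfolding Z_def by blast
    then show "?W \<inter> V = {\<one>}"
      using V(3) subgroup.one_closed[OF sW] subgroup.one_closed[OF V(1)] by blast
    show "?W <#> V = carrier G" by (rule WV)
  qed
  have semi: "internal_semidirect (G\<lparr>carrier := ?W\<rparr>) U (generate G {z})"
    unfolding internal_semidirect_def
  proof (intro conjI)
    interpret GW: group "G\<lparr>carrier := ?W\<rparr>" by (rule subgroup_imp_group[OF sW])
    show "U \<lhd> G\<lparr>carrier := ?W\<rparr>"
    proof (rule GW.normal_invI[OF subgroup_incl[OF subgroup_U sW UW]])
      fix x h assume x: "x \<in> carrier (G\<lparr>carrier := ?W\<rparr>)" and h: "h \<in> U"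
      obtain a c where ac: "a \<in> U" "c \<in> generate G {z}" "x = a \<otimes> c"
      proof -
        have "x \<in> U <#> generate G {z}" using x W by simp
        then show ?thesis using that by (auto simp: set_mult_mem)
      qed
      have G: "a \<in> carrier G" "c \<in> carrier G" "h \<in> carrier G"
        using U_carrier[OF ac(1)] subgroup.mem_carrier[OF sz ac(2)] U_carrier[OF h] by auto
      have "x \<otimes> h \<otimes> inv x = a \<otimes> (c \<otimes> h \<otimes> inv c) \<otimes> inv a" using G by (simp add: ac(3) inv_mult_group m_assoc)
      also have "\<dots> \<in> U"
        using subgroup.m_closed[OF subgroup_U subgroup.m_closed[OF subgroup_U ac(1) conjU[OF ac(2) h]]
            subgroup.m_inv_closed[OF subgroup_U ac(1)]] .
      finally show "x \<otimes>\<^bsub>G\<lparr>carrier := ?W\<rparr>\<^esub> h \<otimes>\<^bsub>G\<lparr>carrier := ?W\<rparr>\<^esub> inv\<^bsub>G\<lparr>carrier := ?W\<rparr>\<^esub> x \<in> U"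
        using m_inv_consistent[OF sW] x by simp
    qed
    show "subgroup (generate G {z}) (G\<lparr>carrier := ?W\<rparr>)" by (rule subgroup_incl[OF sz sW zW])
    have "z \<notin> U" "inv z \<notin> U" using zT inv_z_notin_T U_T by auto
    then show "U \<inter> generate G {z} = {\<one>\<^bsub>G\<lparr>carrier := ?W\<rparr>\<^esub>}"
      unfolding generate_z using subgroup.one_closed[OF subgroup_U] by auto
    show "U <#>\<^bsub>G\<lparr>carrier := ?W\<rparr>\<^esub> generate G {z} = carrier (G\<lparr>carrier := ?W\<rparr>)" using W by simp
  qed
  have cyc: "subgroup_generated G {z} \<cong> integer_mod_group 3"
    using iso_cyclic[OF zG ord_eq_3[OF zG z3 z_neq_one]] by simp
  obtain m where m: "G\<lparr>carrier := V\<rparr> \<cong> cyclic_power 2 m" using exponent_2_cyclic_power[OF V(1,2)] by blast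
  obtain v0 where v0: "v0 \<in> S" "v0 \<noteq> \<one>"
  proof -
    obtain u where u: "u \<in> T" "u \<notin> E" using TE E_subset_T by blast
    note f = T_form[OF u(1)]
    have "u \<otimes> ((u \<otimes> z) \<otimes> ((u \<otimes> z) \<otimes> (u \<otimes> z))) \<noteq> \<one>"
      using f(2,3) u(2) E_carrier[OF f(2)] by (metis l_one)
    then show ?thesis using that f(1) by blast
  qed
  have nc: "\<not> comm_group GU"
  proof
    assume "comm_group GU"
    then have "v0 \<otimes> w v0 = w v0 \<otimes> v0" using comm_groupE(4)[of GU v0 "w v0"] S_U v0 S_conj by simp
    then show False using Qv_props(7)[OF v0] by simp
  qed
  have spec: "special_p_group 2 GU"
    unfolding special_p_group_def
  proof (intro conjI disjI2)
    show "p_group 2 GU" by (rule order_power_of_two[OF subgroup_U fin]) (use T_four U_T in blast)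
    show "derived GU (carrier GU) = Frattini GU" unfolding derived_U Frattini_U ..
    show "Frattini GU = group_center GU" unfolding Frattini_U center_U ..
    interpret GZ: group "G\<lparr>carrier := Z\<rparr>" by (rule subgroup_imp_group[OF subgroup_Z])
    have "comm_group (G\<lparr>carrier := Z\<rparr>)" by (rule GZ.group_comm_groupI) (use E_commute Z_E in simp)
    moreover have "x [^]\<^bsub>G\<lparr>carrier := Z\<rparr>\<^esub> (2::nat) = \<one>" if "x \<in> Z" for x
      using E_square[OF Z_E[OF that]] E_carrier[OF Z_E[OF that]] by (simp add: numeral_2_eq_2)
    ultimately show "elementary_abelian 2 (GU\<lparr>carrier := group_center GU\<rparr>)"
      unfolding center_U elementary_abelian_def by simp
  qed
  \<comment> \<open>The groups are enumerated, not the elements v, so that different indices carry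
    different groups.\<close>
  let ?Qs = "Qv ` (S - {\<one>})"
  define n where "n = card ?Qs"
  have "finite S" by (rule finite_subset[OF _ fin]) (use S_carrier in blast)
  then have "finite ?Qs" by simp
  from ex_bij_betw_nat_finite_1[OF this] obtain Us where bij: "bij_betw Us {1..n} ?Qs"
    unfolding n_def by (rule exE)
  have Us: "\<exists>v\<in>S. v \<noteq> \<one> \<and> Us i = Qv v" if "i \<in> {1..n}" for i
    using bij_betwE[OF bij] that by blast
  have sUs: "subgroup (Us i) G" if "i \<in> {1..n}" for i using Us[OF that] Qv_props(1) by auto
  have UsU: "Us i \<subseteq> U" if "i \<in> {1..n}" for i using Us[OF that] Qv_subset_U by auto
  have prod: "U = set_product G (group_center GU) Us n"
    unfolding center_U
  proof
    show "set_product G Z Us n \<subseteq> U" using Z_U UsU by (intro set_product_subset[OF subgroup_U]) auto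
    have up: "Z \<subseteq> set_product G Z Us n \<and> set_product G Z Us n \<subseteq> carrier G \<and>
        (\<forall>i\<in>{1..n}. Z <#> Us i \<subseteq> set_product G Z Us n)"
      by (rule set_product_upper[OF subgroup_Z]) (rule sUs)
    show "U \<subseteq> set_product G Z Us n"
    proof
      fix u assume "u \<in> U"
      then obtain v c where vc: "v \<in> S" "c \<in> Z" "u = v \<otimes> c" using U_form by blast
      have G: "v \<in> carrier G" "c \<in> carrier G" using S_carrier[OF vc(1)] U_carrier[OF Z_U[OF vc(2)]] by auto
      show "u \<in> set_product G Z Us n"
      proof (cases "v = \<one>")
        case True
        then have "u \<in> Z" using vc G by simp
        then show ?thesis using up by blast
      next
        case False
        then have "Qv v \<in> ?Qs" using vc(1) by blast
        then obtain i where i: "i \<in> {1..n}" "Us i = Qv v" using bij_betw_imp_surj_on[OF bij] by (metis imageE)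
        have "v \<in> Us i" unfolding i(2) Qv_def by (rule generate.incl) simp
        moreover have "u = c \<otimes> v" using vc(3) E_central[OF Z_E[OF vc(2)] G(1)] by simp
        ultimately have "u \<in> Z <#> Us i" using set_multI[OF vc(2)] by simp
        then show ?thesis using up i(1) by blast
      qed
    qed
  qed
  have each: "subgroup (Us i) GU \<and> group_center GU <#> Us i \<lhd> GU \<and>
      G\<lparr>carrier := Us i\<rparr> \<cong> quaternion_group \<and> subgroup_generated G (insert z (Us i)) \<cong> SL23"
    if i: "i \<in> {1..n}" for i
  proof -
    have ZU: "subgroup (Z <#> Us i) G"
      by (rule commuting_product_subgroup[OF subgroup_Z sUs[OF i]])
         (use E_central Z_E subgroup.mem_carrier[OF sUs[OF i]] in blast)
    have sub: "Z <#> Us i \<subseteq> U" using Z_U by (intro set_mult_subset[OF subgroup_U _ UsU[OF i]]) blast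
    have "Z <#> Us i \<lhd> GU"
    proof (rule group.normal_of_commutators[OF group_GU subgroup_incl[OF ZU subgroup_U sub]])
      fix x h assume x: "x \<in> carrier GU" and h: "h \<in> Z <#> Us i"
      have "x \<otimes> h \<otimes> inv x \<otimes> inv h \<in> Z" using U_commutator[of x h] x h sub by auto
      then have "x \<otimes> h \<otimes> inv x \<otimes> inv h \<in> Z <#> Us i" using set_mult_upper(1)[OF subgroup_Z sUs[OF i]] by blast
      then show "x \<otimes>\<^bsub>GU\<^esub> h \<otimes>\<^bsub>GU\<^esub> inv\<^bsub>GU\<^esub> x \<otimes>\<^bsub>GU\<^esub> inv\<^bsub>GU\<^esub> h \<in> Z <#> Us i"
        using inv_GU x h sub by (auto simp: subset_iff)
    qed
    then show ?thesis
      using Us[OF i] Qv_props(2,3) subgroup_incl[OF sUs[OF i] subgroup_U UsU[OF i]] unfolding center_U by auto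
  qed
  have inter: "card (Us i \<inter> Us j) \<le> 2" if ij: "i \<in> {1..n}" "j \<in> {1..n}" "i \<noteq> j" for i j
  proof -
    have "Us i \<noteq> Us j" using bij_betw_imp_inj_on[OF bij] ij by (auto dest: inj_onD)
    then show ?thesis using Us[OF ij(1)] Us[OF ij(2)] Qv_Int by metis
  qed
  have Om: "{u \<in> U. u \<otimes> z = z \<otimes> u} = Omega1 GU" "Omega1 GU = group_center GU"
    unfolding centralizer_z Omega1_U center_U by simp_all
  show ?thesis
    unfolding family_d_def
    using zG dir semi cyc m nc spec Om prod each inter
    by (intro exI[of _ ?W] exI[of _ V] exI[of _ U] exI[of _ z] exI[of _ m] exI[of _ n] exI[of _ Us]) blast
qed

end

section \<open>The families have property (P)\<close>

context group
begin

lemma pow_4: "x \<in> carrier G \<Longrightarrow> x [^] (4::nat) = (x \<otimes> x) \<otimes> (x \<otimes> x)"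
  by (simp add: numeral_eq_Suc m_assoc)

lemma pow_6: "x \<in> carrier G \<Longrightarrow> x [^] (6::nat) = (x \<otimes> (x \<otimes> x)) \<otimes> (x \<otimes> (x \<otimes> x))"
  by (simp add: numeral_eq_Suc m_assoc)

lemma pow_2: "x \<in> carrier G \<Longrightarrow> x [^] (2::nat) = x \<otimes> x"
  by (simp add: numeral_2_eq_2)

lemma property_PI:
  assumes fin: "finite (carrier G)" and x: "x \<in> carrier G" "x \<otimes> x = \<one>" "x \<noteq> \<one>"
    and P: "\<And>x y. x \<in> carrier G \<Longrightarrow> y \<in> carrier G \<Longrightarrow> x \<otimes> x = \<one> \<Longrightarrow> x \<noteq> \<one> \<Longrightarrow>
       x \<otimes> y = y \<otimes> x \<and> (y [^] (4::nat) = \<one> \<or> y [^] (6::nat) = \<one>) \<or>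
       y \<otimes> (y \<otimes> y) = \<one> \<and> (x \<otimes> y) \<otimes> ((x \<otimes> y) \<otimes> (x \<otimes> y)) = \<one>"
  shows "property_P G"
proof -
  have "ord x = 2" using ord_eq_2[OF x(1)] x(2,3) by blast
  then have "even (order G)" using ord_dvd_group_order[OF x(1)] by simp
  then show ?thesis unfolding property_P_iff[OF fin] using P by blast
qed

lemma iso_subgroup_pow:
  assumes H: "subgroup H G" and i: "G\<lparr>carrier := H\<rparr> \<cong> B" and B: "group B"
    and e: "\<And>t. t \<in> carrier B \<Longrightarrow> t [^]\<^bsub>B\<^esub> (n::nat) = \<one>\<^bsub>B\<^esub> \<or> t [^]\<^bsub>B\<^esub> (m::nat) = \<one>\<^bsub>B\<^esub>"
    and h: "h \<in> H"
  shows "h [^] n = \<one> \<or> h [^] m = \<one>"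
  using group.iso_pow_one[OF subgroup_imp_group[OF H] i B e, of h] h
    nat_pow_consistent[of h n H] nat_pow_consistent[of h m H] by simp

lemma cyclic_power_2_square:
  assumes "subgroup H G" "G\<lparr>carrier := H\<rparr> \<cong> cyclic_power 2 n" "h \<in> H"
  shows "h \<otimes> h = \<one>"
  using iso_subgroup_pow[OF assms(1,2) group_cyclic_power _ assms(3), of 2 2] cyclic_power_pow[of _ 2 n]
    pow_2 subgroup.mem_carrier[OF assms(1,3)] by auto

lemma group_exponent_pow:
  assumes fin: "finite (carrier G)" and x: "x \<in> carrier G"
  shows "x [^] group_exponent G = \<one>"
proof -
  have "\<exists>n::nat. 0 < n \<and> (\<forall>x\<in>carrier G. x [^] n = \<one>)"
    using fin order_gt_0_iff_finite pow_order_eq_1 by blast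
  from LeastI_ex[OF this] show ?thesis using x unfolding group_exponent_def by blast
qed

lemma subgroup_exponent_pow:
  assumes "subgroup H G" "finite (carrier G)" "x \<in> H"
  shows "x [^] group_exponent (G\<lparr>carrier := H\<rparr>) = \<one>"
proof -
  have "finite H" using assms(2) subgroup.subset[OF assms(1)] finite_subset by blast
  then show ?thesis
    using group.group_exponent_pow[OF subgroup_imp_group[OF assms(1)], of x] assms(3)
      nat_pow_consistent[of x _ H] by simp
qed

text \<open>Elements of D outside the abelian B have square t, so every involution of G is 1 or t
  times an element of F and therefore central. Elements of B F have sixth power 1, all others fourth
  power 1.\<close>

lemma property_P_of_family_a:
  assumes fin: "finite (carrier G)" and a: "family_a G"
  shows "property_P G"
proof -
  obtain D F m n where D: "internal_direct G D F"
    and dic: "generalized_dicyclic (G\<lparr>carrier := D\<rparr>) (cyclic_power 3 m \<times>\<times> integer_mod_group 2)"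
    and F: "G\<lparr>carrier := F\<rparr> \<cong> cyclic_power 2 n" using a unfolding family_a_def by blast
  let ?A = "cyclic_power 3 m \<times>\<times> integer_mod_group 2" and ?GD = "G\<lparr>carrier := D\<rparr>"
  have nD: "D \<lhd> G" "F \<lhd> G" "D \<inter> F = {\<one>}" "D <#> F = carrier G" using D by (auto simp: internal_direct_def)
  have sD: "subgroup D G" and sF: "subgroup F G" using nD normal_imp_subgroup by auto
  have DG: "\<And>d. d \<in> D \<Longrightarrow> d \<in> carrier G" and FG: "\<And>f. f \<in> F \<Longrightarrow> f \<in> carrier G"
    by (fact subgroup.mem_carrier[OF sD] subgroup.mem_carrier[OF sF])+
  have DF: "d \<otimes> f = f \<otimes> d" if "d \<in> D" "f \<in> F" for d f
    using normal_imp_commuting[OF nD(1,2) _ that] nD(3) by simp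
  have F2: "f \<otimes> f = \<one>" if "f \<in> F" for f by (rule cyclic_power_2_square[OF sF F that])
  have FF: "f \<otimes> f' = f' \<otimes> f" if "f \<in> F" "f' \<in> F" for f f' by (rule exponent_2_commute[OF sF F2 that])
  obtain B t x where un: "\<exists>!t. t \<in> carrier ?A \<and> group.ord ?A t = 2"
    and B: "subgroup B ?GD" "?GD\<lparr>carrier := B\<rparr> \<cong> ?A" and t: "t \<in> B" "group.ord ?GD t = 2"
    and x: "x \<in> carrier ?GD" "x \<otimes>\<^bsub>?GD\<^esub> x = t"
    and inv: "\<forall>a\<in>B. inv\<^bsub>?GD\<^esub> x \<otimes>\<^bsub>?GD\<^esub> a \<otimes>\<^bsub>?GD\<^esub> x = inv\<^bsub>?GD\<^esub> a"
    and gen: "generate ?GD (insert x B) = carrier ?GD"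
    using dic unfolding generalized_dicyclic_def by auto
  have BD: "B \<subseteq> D" using subgroup.subset[OF B(1)] by simp
  have sB: "subgroup B G" by (rule incl_subgroup[OF sD B(1)])
  have BG: "\<And>b. b \<in> B \<Longrightarrow> b \<in> carrier G" using BD DG by blast
  have xG: "x \<in> carrier G" "x \<in> D" and xt: "x \<otimes> x = t" using x DG by auto
  have tG: "t \<in> carrier G" using BG[OF t(1)] .
  have tt: "t \<otimes> t = \<one>" "t \<noteq> \<one>" using ord_subgroup_eq_2[OF sD subsetD[OF BD t(1)]] t(2) by auto
  have invx: "inv x \<otimes> b \<otimes> x = inv b" if "b \<in> B" for b
    using inv that m_inv_consistent[OF sD] xG BD by (auto simp: subset_iff)
  have gA: "group ?A" by (intro DirProd_group) auto
  have cA: "comm_group ?A" by (intro comm_group_DirProd) auto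
  have BA: "G\<lparr>carrier := B\<rparr> \<cong> ?A" using B(2) by simp
  interpret GB: group "G\<lparr>carrier := B\<rparr>" by (rule subgroup_imp_group[OF sB])
  have cB: "comm_group (G\<lparr>carrier := B\<rparr>)"
    using comm_group.iso_imp_comm_group[OF cA GB.iso_sym[OF BA] GB.is_monoid] .
  have BB: "b \<otimes> b' = b' \<otimes> b" if "b \<in> B" "b' \<in> B" for b b'
    using comm_groupE(4)[OF cB, of b b'] that by simp
  have B6: "b [^] (6::nat) = \<one>" if b: "b \<in> B" for b
  proof -
    have "s [^]\<^bsub>?A\<^esub> (6::nat) = \<one>\<^bsub>?A\<^esub>" if s: "s \<in> carrier ?A" for s
    proof -
      obtain f i where fi: "s = (f, i)" by (cases s)
      have f: "f \<in> carrier (cyclic_power 3 m)" using s fi by simp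
      interpret Z: group "cyclic_power 3 m" by simp
      have "f [^]\<^bsub>cyclic_power 3 m\<^esub> (3 * 2 :: nat) = \<one>\<^bsub>cyclic_power 3 m\<^esub>"
        using cyclic_power_pow[OF f] Z.nat_pow_pow[OF f, of 3 2] by simp
      then show ?thesis by (simp add: fi DirProd_nat_pow)
    qed
    then show ?thesis using iso_subgroup_pow[OF sB BA gA _ b, of 6 6] by blast
  qed
  have Bt: "b = \<one> \<or> b = t" if b: "b \<in> B" "b \<otimes> b = \<one>" for b
  proof (rule ccontr)
    assume n: "\<not> ?thesis"
    obtain f where f: "f \<in> iso (G\<lparr>carrier := B\<rparr>) ?A" using BA by (auto simp: is_iso_def)
    interpret h: group_hom "G\<lparr>carrier := B\<rparr>" ?A f using f gA GB.is_group
      by (simp add: group_hom_def group_hom_axioms_def iso_def)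
    have inj: "inj_on f B" using f by (simp add: iso_def bij_betw_def)
    have "f b \<in> carrier ?A \<and> group.ord ?A (f b) = 2" if b: "b \<in> B" "b \<otimes> b = \<one>" "b \<noteq> \<one>" for b
    proof -
      have "f b \<otimes>\<^bsub>?A\<^esub> f b = \<one>\<^bsub>?A\<^esub>" using h.hom_mult[of b b] h.hom_one b by simp
      moreover have "f b \<noteq> \<one>\<^bsub>?A\<^esub>"
        using inj_onD[OF inj, of b \<one>] h.hom_one b subgroup.one_closed[OF sB] by auto
      ultimately show ?thesis using group.ord_eq_2[OF gA, of "f b"] h.hom_closed[of b] b(1) by simp
    qed
    then have "f b = f t" using un n b tt t(1) by blast
    then show False using inj_onD[OF inj] b(1) t(1) n by blast
  qed
  have D_form: "d \<in> B \<or> (\<exists>b\<in>B. d = x \<otimes> b)" if d: "d \<in> D" for d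
  proof -
    let ?N = "B \<union> (\<lambda>b. x \<otimes> b) ` B"
    have "generate G (insert x B) \<subseteq> ?N"
    proof (rule generate_left_closed)
      show "insert x B \<subseteq> carrier G" using BG xG by auto
      show sub: "?N \<subseteq> carrier G" using BG xG by auto
      show "finite ?N" using finite_subset[OF sub fin] .
      show "\<one> \<in> ?N" using subgroup.one_closed[OF sB] by simp
      fix u g assume u: "u \<in> insert x B" and "g \<in> ?N"
      then obtain b where b: "b \<in> B" "g = b \<or> g = x \<otimes> b" by blast
      have 1: "x \<otimes> (x \<otimes> b) = t \<otimes> b" using xG BG[OF b(1)] xt by (simp flip: m_assoc)
      have 2: "u \<otimes> (x \<otimes> b) = x \<otimes> ((inv x \<otimes> u \<otimes> x) \<otimes> b)" if "u \<in> B"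
        using BG[OF that] xG BG[OF b(1)] by (simp add: m_assoc)
      have 3: "(inv x \<otimes> u \<otimes> x) \<otimes> b \<in> B" if "u \<in> B"
        unfolding invx[OF that] using subgroup.m_closed[OF sB subgroup.m_inv_closed[OF sB that] b(1)] .
      show "u \<otimes> g \<in> ?N"
        using u b 1 2 3 subgroup.m_closed[OF sB _ b(1)] t(1) by auto
    qed
    moreover have "generate G (insert x B) = D"
      using gen generate_consistent[OF _ sD, of "insert x B"] BD xG by simp
    ultimately show ?thesis using d by blast
  qed
  have xb2: "(x \<otimes> b) \<otimes> (x \<otimes> b) = t" if b: "b \<in> B" for b
  proof -
    have "(x \<otimes> b) \<otimes> (x \<otimes> b) = (x \<otimes> x) \<otimes> ((inv x \<otimes> b \<otimes> x) \<otimes> b)" using xG BG[OF b] by (simp add: m_assoc)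
    then show ?thesis unfolding invx[OF b] xt using BG[OF b] tG by simp
  qed
  have tD: "t \<otimes> d = d \<otimes> t" if d: "d \<in> D" for d
  proof -
    have xt': "t \<otimes> x = x \<otimes> t" using xG by (simp add: xt[symmetric] m_assoc)
    consider "d \<in> B" | b where "b \<in> B" "d = x \<otimes> b" using D_form[OF d] by blast
    then show ?thesis
    proof cases
      case 1
      then show ?thesis using BB t(1) by blast
    next
      case 2
      then show ?thesis
        using commute_mult[OF xt'[symmetric] BB[OF 2(1) t(1)] xG(1) BG[OF 2(1)] tG] by simp
    qed
  qed
  have form: "\<exists>d\<in>D. \<exists>f\<in>F. g = d \<otimes> f" if "g \<in> carrier G" for g
    using that nD(4) set_mult_mem by metis
  show ?thesis
  proof (rule property_PI[OF fin tG tt])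
    fix g y assume g: "g \<in> carrier G" "g \<otimes> g = \<one>" "g \<noteq> \<one>" and y: "y \<in> carrier G"
    obtain d f where df: "d \<in> D" "f \<in> F" "g = d \<otimes> f" using form[OF g(1)] by blast
    obtain d' f' where df': "d' \<in> D" "f' \<in> F" "y = d' \<otimes> f'" using form[OF y] by blast
    note G = DG[OF df(1)] FG[OF df(2)] DG[OF df'(1)] FG[OF df'(2)]
    have dd: "d \<otimes> d = \<one>"
      using g(2) commuting_square[OF DF[OF df(1,2)] G(1,2)] F2[OF df(2)] G df(3) by simp
    have "d \<in> B" using D_form[OF df(1)] xb2 dd tt by auto
    then have d: "d = \<one> \<or> d = t" using Bt dd by blast
    then have "d \<otimes> d' = d' \<otimes> d" using tD[OF df'(1)] G by auto
    then have 1: "g \<otimes> d' = d' \<otimes> g"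
      unfolding df(3) using DF[OF df'(1) df(2)] by (intro commute_mult) (use G in auto)
    have 2: "g \<otimes> f' = f' \<otimes> g"
      unfolding df(3) using DF[OF df(1) df'(2)] FF[OF df(2) df'(2)] by (intro commute_mult) (use G in auto)
    have "g \<otimes> y = y \<otimes> g"
      unfolding df'(3) using commute_mult[OF 1[symmetric] 2[symmetric] G(3,4) g(1)] by simp
    moreover have "y [^] (4::nat) = \<one> \<or> y [^] (6::nat) = \<one>"
    proof -
      note c = DF[OF df'(1,2)]
      consider "d' \<in> B" | "d' \<otimes> d' = t" using D_form[OF df'(1)] xb2 by blast
      then show ?thesis
      proof cases
        case 1
        have "f' [^] (6::nat) = \<one>" using F2[OF df'(2)] G by (simp add: pow_6 involution_extend)
        then show ?thesis using pow_mult_distrib[OF c G(3,4), of 6] B6[OF 1] df'(3) by simp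
      next
        case 2
        then have "y \<otimes> y = t" using commuting_square[OF c G(3,4)] F2[OF df'(2)] tG df'(3) by simp
        then show ?thesis using pow_4[OF y] tt by simp
      qed
    qed
    ultimately show "g \<otimes> y = y \<otimes> g \<and> (y [^] (4::nat) = \<one> \<or> y [^] (6::nat) = \<one>) \<or>
       y \<otimes> (y \<otimes> y) = \<one> \<and> (g \<otimes> y) \<otimes> ((g \<otimes> y) \<otimes> (g \<otimes> y)) = \<one>" by blast
  qed
qed

text \<open>An element outside K fixes a point, so it is conjugate into H and has cube 1. Hence
  involutions lie in Omega_1(K) and are central in K; and if y is outside K, so is xy, and both have
  cube 1.\<close>

lemma property_P_of_family_c:
  assumes fin: "finite (carrier G)" and c: "family_c G"
  shows "property_P G"
proof -
  obtain K H where FG: "Frobenius_group G K H" and pK: "p_group 2 (G\<lparr>carrier := K\<rparr>)"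
    and ex: "group_exponent (G\<lparr>carrier := K\<rparr>) = 4"
    and Om: "Omega1 (G\<lparr>carrier := K\<rparr>) \<subseteq> group_center (G\<lparr>carrier := K\<rparr>)"
    and H: "G\<lparr>carrier := H\<rparr> \<cong> integer_mod_group 3"
    using c unfolding family_c_def by blast
  obtain \<Omega> :: "nat set" and \<phi> w where act: "Frobenius_action G \<Omega> \<phi>" and K: "K = Frobenius_kernel G \<Omega> \<phi>"
    and w: "w \<in> \<Omega>" "H = stabilizer G \<phi> w" and sd: "internal_semidirect G K H"
    using FG unfolding Frobenius_group_def by blast
  have sK: "subgroup K G" and sH: "subgroup H G"
    using sd normal_imp_subgroup by (auto simp: internal_semidirect_def)
  have KG: "\<And>k. k \<in> K \<Longrightarrow> k \<in> carrier G" using subgroup.mem_carrier[OF sK] .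
  interpret A: transitive_action G \<Omega> \<phi> using act by (simp add: Frobenius_action_def)
  have H3: "h \<otimes> (h \<otimes> h) = \<one>" if h: "h \<in> H" for h
    using iso_subgroup_pow[OF sH H group_integer_mod_group _ h, of 3 3] pow_3[OF subgroup.mem_carrier[OF sH h]]
    by simp
  have out: "g \<otimes> (g \<otimes> g) = \<one>" if g: "g \<in> carrier G" "g \<notin> K" for g
  proof -
    obtain v where v: "v \<in> \<Omega>" "\<phi> g v = v" using g K by (auto simp: Frobenius_kernel_def)
    obtain h where h: "h \<in> carrier G" "\<phi> h v = w" using A.unique_orbit[OF v(1) w(1)] by blast
    have "\<phi> (inv h) w = v" using A.orbit_sym_aux[OF h(1) v(1) h(2)] .
    then have "\<phi> (h \<otimes> g \<otimes> inv h) w = w"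
      using A.composition_rule[OF w(1), of "h \<otimes> g" "inv h"] A.composition_rule[OF v(1) h(1) g(1)] g h v by simp
    then have "h \<otimes> g \<otimes> inv h \<in> H" using w(2) g h by (simp add: stabilizer_def)
    from conj_cube_one[OF H3[OF this] _ inv_closed[OF h(1)]] show ?thesis
      using g h by (simp add: m_assoc)
  qed
  have inv_K: "x \<in> K" if x: "x \<in> carrier G" "x \<otimes> x = \<one>" for x
    using out[OF x(1)] square_cube_one[OF x(2) _ x(1)] subgroup.one_closed[OF sK] by blast
  have K4: "k [^] (4::nat) = \<one>" if "k \<in> K" for k using subgroup_exponent_pow[OF sK fin that] ex by simp
  interpret GK: group "G\<lparr>carrier := K\<rparr>" by (rule subgroup_imp_group[OF sK])
  have fK: "finite K" using fin subgroup.subset[OF sK] finite_subset by blast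
  obtain i where i: "card K = 2 ^ i" using pK by (auto simp: p_group_def order_def)
  have "i \<noteq> 0"
  proof
    assume "i = 0"
    then have K1: "K = {\<one>}" using i subgroup.one_closed[OF sK] by (metis card_1_singletonE power_0 singletonD)
    have "group_exponent (G\<lparr>carrier := K\<rparr>) \<le> 1"
      unfolding group_exponent_def by (rule Least_le) (simp add: K1)
    then show False using ex by simp
  qed
  then have "2 dvd order (G\<lparr>carrier := K\<rparr>)" using i by (simp add: order_def)
  then obtain x0 where x0: "x0 \<in> K" "x0 \<noteq> \<one>" "x0 \<otimes> x0 = \<one>"
    using GK.cauchy[OF _ two_is_prime_nat] fK KG by (auto simp: numeral_2_eq_2)
  show ?thesis
  proof (rule property_PI[OF fin KG[OF x0(1)] x0(3,2)])
    fix x y assume x: "x \<in> carrier G" "x \<otimes> x = \<one>" "x \<noteq> \<one>" and y: "y \<in> carrier G"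
    have xK: "x \<in> K" by (rule inv_K[OF x(1,2)])
    show "x \<otimes> y = y \<otimes> x \<and> (y [^] (4::nat) = \<one> \<or> y [^] (6::nat) = \<one>) \<or>
       y \<otimes> (y \<otimes> y) = \<one> \<and> (x \<otimes> y) \<otimes> ((x \<otimes> y) \<otimes> (x \<otimes> y)) = \<one>"
    proof (cases "y \<in> K")
      case True
      have "group.ord (G\<lparr>carrier := K\<rparr>) x = 2" using ord_subgroup_eq_2[OF sK xK] x by simp
      then have "x \<in> Omega1 (G\<lparr>carrier := K\<rparr>)"
        unfolding Omega1_def using xK by (intro generate.incl) simp
      then have "x \<otimes> y = y \<otimes> x" using Om True by (auto simp: group_center_def)
      then show ?thesis using K4[OF True] by blast
    next
      case False
      have "x \<otimes> y \<notin> K"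
      proof
        assume "x \<otimes> y \<in> K"
        then have "inv x \<otimes> (x \<otimes> y) \<in> K"
          using subgroup.m_closed[OF sK subgroup.m_inv_closed[OF sK xK]] by blast
        then show False using False x y by simp
      qed
      then show ?thesis using out[OF y False] out[of "x \<otimes> y"] x y by simp
    qed
  qed
qed

end

section \<open>Multiplicativity of norms; family (b) has property (P)\<close>

context group
begin

lemma normalizer_conj:
  assumes "H \<subseteq> carrier G" "z \<in> normalizer G H" "h \<in> H"
  shows "z \<otimes> h \<otimes> inv z \<in> H"
proof -
  have "z <# H #> inv z = H" using assms by (simp add: normalizer_def stabilizer_def)
  moreover have "z \<otimes> h \<otimes> inv z \<in> z <# H #> inv z"
    using assms(3) unfolding l_coset_def r_coset_def by blast
  ultimately show ?thesis by simp
qed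

text \<open>The factors are written for \<open>s\<close>, \<open>b\<close> and their images \<open>s\<^sub>1, s\<^sub>2, b\<^sub>1, b\<^sub>2\<close> under the powers of an
  automorphism of order 3.\<close>

lemma norm_of_product:
  assumes G: "s \<in> carrier G" "s1 \<in> carrier G" "s2 \<in> carrier G" "b \<in> carrier G" "b1 \<in> carrier G" "b2 \<in> carrier G"
    and d1: "d1 \<in> group_center G" "b \<otimes> s1 = d1 \<otimes> (s1 \<otimes> b)"
    and d2: "d2 \<in> group_center G" "(b \<otimes> b1) \<otimes> s2 = d2 \<otimes> (s2 \<otimes> (b \<otimes> b1))"
  shows "(s \<otimes> b) \<otimes> ((s1 \<otimes> b1) \<otimes> (s2 \<otimes> b2)) =
    d1 \<otimes> (d2 \<otimes> ((s \<otimes> (s1 \<otimes> s2)) \<otimes> (b \<otimes> (b1 \<otimes> b2))))"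
proof -
  note c1 = group_center_commute[OF d1(1)] and c2 = group_center_commute[OF d2(1)]
  have dG: "d1 \<in> carrier G" "d2 \<in> carrier G" using group_center_carrier d1 d2 by auto
  have "(s \<otimes> b) \<otimes> ((s1 \<otimes> b1) \<otimes> (s2 \<otimes> b2)) = s \<otimes> ((b \<otimes> s1) \<otimes> (b1 \<otimes> (s2 \<otimes> b2)))"
    using G by (simp add: m_assoc)
  also have "\<dots> = (s \<otimes> d1) \<otimes> (s1 \<otimes> (((b \<otimes> b1) \<otimes> s2) \<otimes> b2))"
    unfolding d1(2) using G dG by (simp add: m_assoc)
  also have "\<dots> = d1 \<otimes> (s \<otimes> ((s1 \<otimes> d2) \<otimes> (s2 \<otimes> (b \<otimes> (b1 \<otimes> b2)))))"
    unfolding d2(2) c1[OF G(1), symmetric] using G dG by (simp add: m_assoc)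
  also have "\<dots> = d1 \<otimes> ((s \<otimes> d2) \<otimes> (s1 \<otimes> (s2 \<otimes> (b \<otimes> (b1 \<otimes> b2)))))"
    unfolding c2[OF G(2), symmetric] using G dG by (simp add: m_assoc)
  also have "\<dots> = d1 \<otimes> (d2 \<otimes> ((s \<otimes> (s1 \<otimes> s2)) \<otimes> (b \<otimes> (b1 \<otimes> b2))))"
    unfolding c2[OF G(1), symmetric] using G dG by (simp add: m_assoc)
  finally show ?thesis .
qed

lemma commuting_norm_of_product:
  assumes G: "s \<in> carrier G" "s1 \<in> carrier G" "s2 \<in> carrier G" "b \<in> carrier G" "b1 \<in> carrier G" "b2 \<in> carrier G"
    and c: "b \<otimes> s1 = s1 \<otimes> b" "b \<otimes> s2 = s2 \<otimes> b" "b1 \<otimes> s2 = s2 \<otimes> b1"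
  shows "(s \<otimes> b) \<otimes> ((s1 \<otimes> b1) \<otimes> (s2 \<otimes> b2)) = (s \<otimes> (s1 \<otimes> s2)) \<otimes> (b \<otimes> (b1 \<otimes> b2))"
proof -
  have 1: "\<one> \<in> group_center G" by (simp add: group_center_def)
  show ?thesis
    using norm_of_product[OF G 1 _ 1] c commute_mult[OF c(2,3) G(4,5,3)] G by simp
qed

lemma semidirect_order_3:
  assumes W: "internal_semidirect G W (generate G {z})" and z: "z \<in> carrier G" "z \<otimes> (z \<otimes> z) = \<one>" "z \<noteq> \<one>"
  shows "z \<notin> W" "inv z \<notin> W"
    "\<And>g. g \<in> carrier G \<Longrightarrow> \<exists>u\<in>W. g = u \<or> g = u \<otimes> z \<or> g = u \<otimes> inv z"
proof -
  have W': "W \<inter> {\<one>, z, inv z} = {\<one>}" "W <#> {\<one>, z, inv z} = carrier G" "subgroup W G"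
    using W normal_imp_subgroup unfolding internal_semidirect_def generate_cube_one[OF z(1,2)] by auto
  show "z \<notin> W" using W'(1) z(3) by blast
  have "inv z \<noteq> \<one>" using z by simp
  then show "inv z \<notin> W" using W'(1) by blast
  show "\<exists>u\<in>W. g = u \<or> g = u \<otimes> z \<or> g = u \<otimes> inv z" if "g \<in> carrier G" for g
  proof -
    have "g \<in> W <#> {\<one>, z, inv z}" using that W'(2) by simp
    then obtain u c where "u \<in> W" "c \<in> {\<one>, z, inv z}" "g = u \<otimes> c" by (auto simp: set_mult_mem)
    then show ?thesis using subgroup.mem_carrier[OF W'(3)] by auto
  qed
qed

text \<open>Norms are trivial on each \<open>Vs i\<close>, by the element orders of A_4, and on
  \<open>U\<close>, by the exponent of <U, z>. All factors involved commute, so norms are trivial on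
  W and every element outside W has cube 1.\<close>

lemma property_P_of_family_b:
  assumes fin: "finite (carrier G)" and nn: "\<not> nilpotent_group G" and b: "family_b G"
  shows "property_P G"
proof -
  obtain W U V z n Vs where zG: "z \<in> carrier G" and sd: "internal_semidirect G W (generate G {z})"
    and dir: "internal_direct (G\<lparr>carrier := W\<rparr>) U V"
    and nz: "z \<in> normalizer G U" "z \<in> normalizer G V"
    and ex: "group_exponent (subgroup_generated G (insert z U)) = 3"
    and fam: "internal_direct_family (G\<lparr>carrier := V\<rparr>) {1..n::nat} Vs"
    and each: "\<forall>i\<in>{1..n}. G\<lparr>carrier := Vs i\<rparr> \<cong> cyclic_power 2 2 \<and>
           subgroup_generated G (insert z (Vs i)) \<cong> alt_group 4"
    using b unfolding family_b_def by blast
  have nW: "W \<lhd> G" and sW: "subgroup W G" using sd normal_imp_subgroup by (auto simp: internal_semidirect_def)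
  let ?GW = "G\<lparr>carrier := W\<rparr>"
  interpret GW: group ?GW by (rule subgroup_imp_group[OF sW])
  have UV: "U \<lhd> ?GW" "V \<lhd> ?GW" "U \<inter> V = {\<one>}" "U <#> V = W" using dir by (auto simp: internal_direct_def)
  have sU: "subgroup U G" and sV: "subgroup V G"
    using incl_subgroup[OF sW] UV(1,2) normal_imp_subgroup by blast+
  have UG: "\<And>u. u \<in> U \<Longrightarrow> u \<in> carrier G" and VG: "\<And>v. v \<in> V \<Longrightarrow> v \<in> carrier G"
    by (fact subgroup.mem_carrier[OF sU] subgroup.mem_carrier[OF sV])+
  have VW: "V \<subseteq> W" and UW: "U \<subseteq> W"
    using subgroup.subset[OF normal_imp_subgroup[OF UV(2)]] subgroup.subset[OF normal_imp_subgroup[OF UV(1)]] by auto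
  have WG: "\<And>g. g \<in> W \<Longrightarrow> g \<in> carrier G" using subgroup.mem_carrier[OF sW] .
  have cUV: "u \<otimes> v = v \<otimes> u" if "u \<in> U" "v \<in> V" for u v
    using GW.normal_imp_commuting[OF UV(1,2) _ that] UV(3) by simp
  have conjU: "z \<otimes> u \<otimes> inv z \<in> U" if "u \<in> U" for u by (rule normalizer_conj[OF subgroup.subset[OF sU] nz(1) that])
  have conjV: "z \<otimes> v \<otimes> inv z \<in> V" if "v \<in> V" for v by (rule normalizer_conj[OF subgroup.subset[OF sV] nz(2) that])
  have zU: "insert z U \<subseteq> carrier G" using zG UG by auto
  let ?S = "generate G (insert z U)"
  have sS: "subgroup ?S G" by (rule generate_is_subgroup[OF zU])
  have S3: "g \<otimes> (g \<otimes> g) = \<one>" if g: "g \<in> ?S" for g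
    using subgroup_exponent_pow[OF sS fin g] ex pow_3[OF subgroup.mem_carrier[OF sS g]]
    by (simp add: subgroup_generated_carrier[OF zU])
  have inS: "z \<in> ?S" "\<And>u. u \<in> U \<Longrightarrow> u \<in> ?S" by (auto intro: generate.incl)
  note z3 = S3[OF inS(1)]
  have U3: "u \<otimes> (u \<otimes> u) = \<one>" if "u \<in> U" for u using S3 inS(2) that by blast
  have uz3: "(u \<otimes> z) \<otimes> ((u \<otimes> z) \<otimes> (u \<otimes> z)) = \<one>" if "u \<in> U" for u
    using S3 subgroup.m_closed[OF sS inS(2)[OF that] inS(1)] by blast
  have iz: "inv z = z \<otimes> z" by (rule inv_of_cube_one[OF z3 zG])
  define c where "c g = z \<otimes> g \<otimes> inv z" for g
  have cG: "c g \<in> carrier G" if "g \<in> carrier G" for g using that zG by (simp add: c_def)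
  have cm: "c (g \<otimes> h) = c g \<otimes> c h" if "g \<in> carrier G" "h \<in> carrier G" for g h
    unfolding c_def by (rule conj_mult[OF zG that])
  have cV: "c v \<in> V" if "v \<in> V" for v using conjV that by (simp add: c_def)
  have cU: "c u \<in> U" if "u \<in> U" for u using conjU that by (simp add: c_def)
  have twist: "(g \<otimes> z) \<otimes> ((g \<otimes> z) \<otimes> (g \<otimes> z)) = g \<otimes> (c g \<otimes> c (c g))" if "g \<in> carrier G" for g
    using cube_twist[OF that zG z3] that zG by (simp add: c_def iz m_assoc cube_one_extend[OF z3 zG])
  let ?GV = "G\<lparr>carrier := V\<rparr>"
  interpret GV: group ?GV by (rule subgroup_imp_group[OF sV])
  have Vs: "Vs i \<lhd> ?GV" "Vs i \<inter> generate ?GV (\<Union>j\<in>{1..n} - {i}. Vs j) = {\<one>}" if "i \<in> {1..n}" for i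
    using fam that by (auto simp: internal_direct_family_def)
  have Vgen: "generate ?GV (\<Union>i\<in>{1..n}. Vs i) = V" using fam by (simp add: internal_direct_family_def)
  have VsV: "Vs i \<subseteq> V" if "i \<in> {1..n}" for i
    using subgroup.subset[OF normal_imp_subgroup[OF Vs(1)[OF that]]] by simp
  have sVs: "subgroup (Vs i) G" if "i \<in> {1..n}" for i
    by (rule incl_subgroup[OF sV normal_imp_subgroup[OF Vs(1)[OF that]]])
  have Vs2: "v \<otimes> v = \<one>" if "i \<in> {1..n}" "v \<in> Vs i" for i v
    using cyclic_power_2_square[OF sVs[OF that(1)] _ that(2)] each that(1) by blast
  have Vcomm: "s \<otimes> v = v \<otimes> s" if i: "i \<in> {1..n}" "s \<in> Vs i" and j: "j \<in> {1..n}" "v \<in> Vs j" for i j s v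
  proof (cases "i = j")
    case True
    then show ?thesis using exponent_2_commute[OF sVs[OF i(1)] Vs2[OF i(1)]] i j by blast
  next
    case False
    then have "Vs j \<subseteq> (\<Union>j\<in>{1..n} - {i}. Vs j)" using j(1) by blast
    then have "Vs j \<subseteq> generate ?GV (\<Union>j\<in>{1..n} - {i}. Vs j)" by (blast intro: generate.incl)
    then have "Vs i \<inter> Vs j \<subseteq> {\<one>\<^bsub>?GV\<^esub>}" using Vs(2)[OF i(1)] by auto
    then show ?thesis using GV.normal_imp_commuting[OF Vs(1)[OF i(1)] Vs(1)[OF j(1)] _ i(2) j(2)] by simp
  qed
  have V_induct: "V \<subseteq> N" if N: "N \<subseteq> V" "\<one> \<in> N"
      "\<And>i s v. i \<in> {1..n} \<Longrightarrow> s \<in> Vs i \<Longrightarrow> v \<in> N \<Longrightarrow> s \<otimes> v \<in> N" for N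
  proof -
    have fN: "finite N" by (rule finite_subset[OF subset_trans[OF N(1) subgroup.subset[OF sV]] fin])
    have "generate ?GV (\<Union>i\<in>{1..n}. Vs i) \<subseteq> N"
    proof (rule GV.generate_left_closed)
      show "(\<Union>i\<in>{1..n}. Vs i) \<subseteq> carrier ?GV" using VsV by (simp add: UN_subset_iff)
      fix s v assume "s \<in> (\<Union>i\<in>{1..n}. Vs i)" "v \<in> N"
      then obtain i where "i \<in> {1..n}" "s \<in> Vs i" by blast
      then show "s \<otimes>\<^bsub>?GV\<^esub> v \<in> N" using N(3)[of i s v] \<open>v \<in> N\<close> by simp
    qed (use N(1,2) fN in simp_all)
    then show ?thesis using Vgen by simp
  qed
  have "V \<subseteq> {v \<in> V. v \<otimes> v = \<one> \<and> (\<forall>i\<in>{1..n}. \<forall>s\<in>Vs i. s \<otimes> v = v \<otimes> s)}" (is "_ \<subseteq> ?N")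
  proof (rule V_induct)
    show "\<one> \<in> ?N"
    proof (intro CollectI conjI ballI)
      fix i s assume "i \<in> {1..n}" "s \<in> Vs i"
      then show "s \<otimes> \<one> = \<one> \<otimes> s" using VG[OF subsetD[OF VsV]] by simp
    qed (use subgroup.one_closed[OF sV] in simp_all)
    fix i s v assume i: "i \<in> {1..n}" "s \<in> Vs i" and v: "v \<in> ?N"
    have G: "s \<in> carrier G" "v \<in> carrier G" using VsV i VG v by auto
    have sv: "s \<otimes> v = v \<otimes> s" using v i by blast
    have "s' \<otimes> (s \<otimes> v) = (s \<otimes> v) \<otimes> s'" if s': "j \<in> {1..n}" "s' \<in> Vs j" for j s'
    proof -
      have "s' \<in> carrier G" using VsV s' VG by blast
      moreover have "v \<otimes> s' = s' \<otimes> v" using v s' by auto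
      ultimately show ?thesis using commute_mult[OF Vcomm[OF i s'] _ G] by simp
    qed
    moreover have "s \<otimes> v \<in> V" using subgroup.m_closed[OF sV] VsV i v by blast
    moreover have "(s \<otimes> v) \<otimes> (s \<otimes> v) = \<one>" using commuting_square[OF sv G] Vs2[OF i] v by simp
    ultimately show "s \<otimes> v \<in> ?N" by blast
  qed blast
  then have V2: "v \<otimes> v = \<one>" if "v \<in> V" for v using that by blast
  have VV: "v \<otimes> v' = v' \<otimes> v" if "v \<in> V" "v' \<in> V" for v v' by (rule exponent_2_commute[OF sV V2 that])
  \<comment> \<open>Without any factor \<open>Vs i\<close> every element would have cube 1, and G
    would be a 3-group; this is where non-nilpotency enters.\<close>
  have n1: "1 \<in> {1..n}"
  proof (rule ccontr)
    assume "1 \<notin> {1..n}"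
    then have "{1..n} = {}" by auto
    then have "V = {\<one>}" using Vgen GV.generate_empty by simp
    then have WU: "W = U" using UV(4) UG by (auto simp: set_mult_def)
    have "g \<otimes> (g \<otimes> g) = \<one>" if g: "g \<in> carrier G" for g
    proof -
      have sz: "subgroup (generate G {z}) G" using zG by (intro generate_is_subgroup) simp
      have "generate G {z} \<subseteq> ?S" by (rule mono_generate) simp
      then have "W <#> generate G {z} \<subseteq> ?S" unfolding WU using inS(2) by (intro set_mult_subset[OF sS]) auto
      then show ?thesis using S3 g sd by (auto simp: internal_semidirect_def)
    qed
    then have "\<exists>k. g [^] (3 ^ k :: nat) = \<one>" if "g \<in> carrier G" for g
      using that pow_3[OF that] by (intro exI[of _ 1]) simp
    moreover have "prime (3::nat)" by simp
    ultimately obtain k where "order G = 3 ^ k" using order_prime_power[OF fin, of 3] by blast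
    then show False using prime_power_nilpotent[OF fin, of 3 k] nn by simp
  qed
  have card4: "card (Vs 1) = 4"
    using each n1 iso_same_card[of "G\<lparr>carrier := Vs 1\<rparr>" "cyclic_power 2 2"] by (simp add: card_cyclic_power)
  \<comment> \<open>For z = 1 the group generated by z and \<open>Vs 1\<close> would have order 4
    instead of 12.\<close>
  have z1: "z \<noteq> \<one>"
  proof
    assume "z = \<one>"
    then have "generate G (insert z (Vs 1)) = Vs 1"
      using generate_subgroup_incl[OF _ sVs[OF n1], of "insert z (Vs 1)"] subgroup.one_closed[OF sVs[OF n1]]
        generate.incl[of _ "insert z (Vs 1)" G] by blast
    moreover have "insert z (Vs 1) \<subseteq> carrier G" using zG subgroup.subset[OF sVs[OF n1]] by simp
    ultimately have "carrier (subgroup_generated G (insert z (Vs 1))) = Vs 1"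
      by (simp add: subgroup_generated_carrier)
    then have "card (carrier (alt_group 4)) = 4"
      using card4 iso_same_card[of "subgroup_generated G (insert z (Vs 1))" "alt_group 4"] each n1 by simp
    then show False using A4.card_generate A4_generate by simp
  qed
  note semi = semidirect_order_3[OF sd zG z3 z1]
  have Vs3: "(v \<otimes> z) \<otimes> ((v \<otimes> z) \<otimes> (v \<otimes> z)) = \<one>" if i: "i \<in> {1..n}" "v \<in> Vs i" for i v
  proof -
    let ?T = "subgroup_generated G (insert z (Vs i))"
    have vG: "v \<in> carrier G" "v \<in> W" using VsV i VG VW by auto
    have zV: "insert z (Vs i) \<subseteq> carrier G" using zG subgroup.subset[OF sVs[OF i(1)]] by simp
    have sT: "subgroup (generate G (insert z (Vs i))) G" by (rule generate_is_subgroup[OF zV])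
    have "v \<otimes> z \<in> generate G (insert z (Vs i))"
      using subgroup.m_closed[OF sT] i(2) by (auto intro: generate.incl)
    moreover have "G\<lparr>carrier := generate G (insert z (Vs i))\<rparr> \<cong> alt_group 4"
      using bspec[OF each i(1)] unfolding subgroup_generated_carrier[OF zV] by blast
    ultimately have "(v \<otimes> z) [^] (2::nat) = \<one> \<or> (v \<otimes> z) [^] (3::nat) = \<one>"
      using iso_subgroup_pow[OF sT _ alt_group_is_group A4_exponents] by blast
    \<comment> \<open>A square equal to 1 would give z = v (z v z^-1), an element of W.\<close>
    moreover have "(v \<otimes> z) \<otimes> (v \<otimes> z) \<noteq> \<one>"
    proof
      assume e: "(v \<otimes> z) \<otimes> (v \<otimes> z) = \<one>"
      have "(v \<otimes> z) \<otimes> (v \<otimes> z) = (v \<otimes> c v) \<otimes> inv z"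
        using vG zG by (simp add: c_def iz m_assoc cube_one_extend[OF z3 zG])
      then have "(v \<otimes> c v) \<otimes> inv z = \<one>" using e by simp
      from inv_equality[OF this] have "z = v \<otimes> c v" using vG cG[OF vG(1)] zG by simp
      moreover have "v \<otimes> c v \<in> W"
        using subgroup.m_closed[OF sW vG(2)] conj_closed(1)[OF nW zG vG(2)] by (simp add: c_def)
      ultimately show False using semi(1) by simp
    qed
    ultimately show ?thesis using pow_2 pow_3 vG zG by auto
  qed
  have "V \<subseteq> {v \<in> V. v \<otimes> (c v \<otimes> c (c v)) = \<one>}" (is "_ \<subseteq> ?N")
  proof (rule V_induct)
    show "\<one> \<in> ?N" using subgroup.one_closed[OF sV] zG by (simp add: c_def)
    fix i s v assume i: "i \<in> {1..n}" "s \<in> Vs i" and v: "v \<in> ?N"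
    have m: "s \<in> V" "v \<in> V" using VsV i v by auto
    note mm = m cV[OF m(1)] cV[OF cV[OF m(1)]] cV[OF m(2)] cV[OF cV[OF m(2)]]
    have "(s \<otimes> v) \<otimes> (c (s \<otimes> v) \<otimes> c (c (s \<otimes> v))) = (s \<otimes> (c s \<otimes> c (c s))) \<otimes> (v \<otimes> (c v \<otimes> c (c v)))"
      using commuting_norm_of_product[of s "c s" "c (c s)" v "c v" "c (c v)"] mm VG VV by (simp add: cm cG)
    then have "(s \<otimes> v) \<otimes> (c (s \<otimes> v) \<otimes> c (c (s \<otimes> v))) = \<one>"
      using Vs3[OF i] twist[OF VG[OF m(1)]] v by simp
    then show "s \<otimes> v \<in> ?N" using subgroup.m_closed[OF sV m] by simp
  qed blast
  then have normV: "v \<otimes> (c v \<otimes> c (c v)) = \<one>" if "v \<in> V" for v using that by blast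
  have Wz: "(g \<otimes> z) \<otimes> ((g \<otimes> z) \<otimes> (g \<otimes> z)) = \<one>" if g: "g \<in> W" for g
  proof -
    obtain u v where uv: "u \<in> U" "v \<in> V" "g = u \<otimes> v" using g UV(4) set_mult_mem by metis
    note mU = uv(1) cU[OF uv(1)] cU[OF cU[OF uv(1)]] and mV = uv(2) cV[OF uv(2)] cV[OF cV[OF uv(2)]]
    have "g \<otimes> (c g \<otimes> c (c g)) = (u \<otimes> (c u \<otimes> c (c u))) \<otimes> (v \<otimes> (c v \<otimes> c (c v)))"
      using commuting_norm_of_product[OF UG[OF mU(1)] UG[OF mU(2)] UG[OF mU(3)]
          VG[OF mV(1)] VG[OF mV(2)] VG[OF mV(3)] cUV[OF mU(2) mV(1), symmetric]
          cUV[OF mU(3) mV(1), symmetric] cUV[OF mU(3) mV(2), symmetric]]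
        UG[OF mU(1)] VG[OF mV(1)] by (simp add: uv(3) cm cG)
    also have "\<dots> = \<one>" using normV[OF uv(2)] uz3[OF uv(1)] twist[OF UG[OF uv(1)]] by simp
    finally show ?thesis using twist[OF WG[OF g]] by simp
  qed
  have out: "g \<otimes> (g \<otimes> g) = \<one>" if g: "g \<in> carrier G" "g \<notin> W" for g
  proof -
    obtain u where u: "u \<in> W" "g = u \<otimes> z \<or> g = u \<otimes> inv z" using semi(3)[OF g(1)] g(2) by auto
    show ?thesis
    proof (cases "g = u \<otimes> z")
      case True
      then show ?thesis using Wz[OF u(1)] by simp
    next
      case False
      \<comment> \<open>For g = u z^-1 the inverse of g lies in the coset W z, which is already
        settled.\<close>
      then have e: "inv g = z \<otimes> inv u" using u WG zG by (simp add: inv_mult_group)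
      have m: "z \<otimes> inv u \<otimes> inv z \<in> W" using conj_closed(1)[OF nW zG subgroup.m_inv_closed[OF sW u(1)]] .
      have "inv g = (z \<otimes> inv u \<otimes> inv z) \<otimes> z" using e WG[OF u(1)] zG by (simp add: m_assoc)
      then have "inv g \<otimes> (inv g \<otimes> inv g) = \<one>" using Wz[OF m] by simp
      from inv_cube_one[OF this] show ?thesis using g by simp
    qed
  qed
  obtain x0 where x0: "x0 \<in> Vs 1" "x0 \<noteq> \<one>"
  proof -
    have "\<not> Vs 1 \<subseteq> {\<one>}" using card4 card_mono[of "{\<one>}" "Vs 1"] by auto
    then show ?thesis using that by blast
  qed
  have x0V: "x0 \<in> V" using VsV[OF n1] x0 by blast
  show ?thesis
  proof (rule property_PI[OF fin VG[OF x0V] V2[OF x0V] x0(2)])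
    fix x y assume x: "x \<in> carrier G" "x \<otimes> x = \<one>" "x \<noteq> \<one>" and y: "y \<in> carrier G"
    have xW: "x \<in> W" using out[OF x(1)] square_cube_one[OF x(2) _ x(1)] x(3) by blast
    obtain u v where uv: "u \<in> U" "v \<in> V" "x = u \<otimes> v" using xW UV(4) set_mult_mem by metis
    have "u \<otimes> u = \<one>"
      using commuting_square[OF cUV[OF uv(1,2)] UG[OF uv(1)] VG[OF uv(2)]] V2[OF uv(2)] x(2) uv UG by simp
    then have "u = \<one>" using square_cube_one[OF _ U3[OF uv(1)] UG[OF uv(1)]] by blast
    then have xV: "x \<in> V" using uv VG by simp
    show "x \<otimes> y = y \<otimes> x \<and> (y [^] (4::nat) = \<one> \<or> y [^] (6::nat) = \<one>) \<or>
       y \<otimes> (y \<otimes> y) = \<one> \<and> (x \<otimes> y) \<otimes> ((x \<otimes> y) \<otimes> (x \<otimes> y)) = \<one>"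
    proof (cases "y \<in> W")
      case True
      obtain u' v' where y': "u' \<in> U" "v' \<in> V" "y = u' \<otimes> v'" using True UV(4) set_mult_mem by metis
      note G = UG[OF y'(1)] VG[OF y'(2)]
      have "y \<otimes> x = x \<otimes> y"
        unfolding y'(3) by (rule commute_mult[OF cUV[OF y'(1) xV] VV[OF y'(2) xV] G x(1)])
      moreover have "u' [^] (6::nat) = \<one>" "v' [^] (6::nat) = \<one>"
        using U3[OF y'(1)] V2[OF y'(2)] G by (simp_all add: pow_6 involution_extend)
      then have "y [^] (6::nat) = \<one>" using pow_mult_distrib[OF cUV[OF y'(1,2)] G, of 6] y'(3) by simp
      ultimately show ?thesis by simp
    next
      case False
      have "x \<otimes> y \<notin> W"
      proof
        assume "x \<otimes> y \<in> W"
        then have "inv x \<otimes> (x \<otimes> y) \<in> W" using subgroup.m_closed[OF sW subgroup.m_inv_closed[OF sW xW]] by blast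
        then show False using False x y by simp
      qed
      then show ?thesis using out[OF y False] out[of "x \<otimes> y"] x y by simp
    qed
  qed
qed

end

section \<open>Family (d) has property (P)\<close>

context group
begin
text \<open>Norms take values in Z: on the \<open>Us i\<close> by the element orders of SL(2,3), and
  on U because norms are multiplicative up to central commutators. As Z has exponent 2, all (uz)^6
  are 1. Involutions of G lie in Z V and are therefore central.\<close>

lemma property_P_of_family_d:
  assumes fin: "finite (carrier G)" and d: "family_d G"
  shows "property_P G"
proof -
  obtain W U V z m n Us where zG: "z \<in> carrier G" and dir: "internal_direct G W V"
    and sd: "internal_semidirect (G\<lparr>carrier := W\<rparr>) U (generate G {z})"
    and z_iso: "subgroup_generated G {z} \<cong> integer_mod_group 3"
    and V_iso: "G\<lparr>carrier := V\<rparr> \<cong> cyclic_power 2 m"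
    and nc: "\<not> comm_group (G\<lparr>carrier := U\<rparr>)" and sp: "special_p_group 2 (G\<lparr>carrier := U\<rparr>)"
    and CU: "{u \<in> U. u \<otimes> z = z \<otimes> u} = Omega1 (G\<lparr>carrier := U\<rparr>)"
    and Om: "Omega1 (G\<lparr>carrier := U\<rparr>) = group_center (G\<lparr>carrier := U\<rparr>)"
    and U_prod: "U = set_product G (group_center (G\<lparr>carrier := U\<rparr>)) Us n"
    and each: "\<forall>i\<in>{1..n}. subgroup (Us i) (G\<lparr>carrier := U\<rparr>) \<and>
           group_center (G\<lparr>carrier := U\<rparr>) <#> Us i \<lhd> G\<lparr>carrier := U\<rparr> \<and>
           G\<lparr>carrier := Us i\<rparr> \<cong> quaternion_group \<and>
           subgroup_generated G (insert z (Us i)) \<cong> SL23"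
    using d unfolding family_d_def by blast
  have WV: "W \<lhd> G" "V \<lhd> G" "W \<inter> V = {\<one>}" "W <#> V = carrier G" using dir by (auto simp: internal_direct_def)
  have sW: "subgroup W G" and sV: "subgroup V G" using WV(1,2) normal_imp_subgroup by blast+
  let ?GW = "G\<lparr>carrier := W\<rparr>" and ?GU = "G\<lparr>carrier := U\<rparr>"
  interpret GW: group ?GW by (rule subgroup_imp_group[OF sW])
  have UW: "U \<lhd> ?GW" "subgroup (generate G {z}) ?GW" "U \<inter> generate G {z} = {\<one>}" "U <#> generate G {z} = W"
    using sd by (auto simp: internal_semidirect_def)
  have sU: "subgroup U G" by (rule incl_subgroup[OF sW normal_imp_subgroup[OF UW(1)]])
  interpret GU: group ?GU by (rule subgroup_imp_group[OF sU])
  have U_W: "U \<subseteq> W" using subgroup.subset[OF normal_imp_subgroup[OF UW(1)]] by simp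
  have UG: "\<And>u. u \<in> U \<Longrightarrow> u \<in> carrier G" and VG: "\<And>v. v \<in> V \<Longrightarrow> v \<in> carrier G"
    by (fact subgroup.mem_carrier[OF sU] subgroup.mem_carrier[OF sV])+
  have zW: "z \<in> W" using subgroup.subset[OF UW(2)] generate.incl[of z "{z}" G] by auto
  have cWV: "w \<otimes> v = v \<otimes> w" if "w \<in> W" "v \<in> V" for w v
    using normal_imp_commuting[OF WV(1,2) _ that] WV(3) by simp
  have V2: "v \<otimes> v = \<one>" if "v \<in> V" for v by (rule cyclic_power_2_square[OF sV V_iso that])
  have VV: "v \<otimes> v' = v' \<otimes> v" if "v \<in> V" "v' \<in> V" for v v' by (rule exponent_2_commute[OF sV V2 that])
  have z_sub: "{z} \<subseteq> carrier G" using zG by simp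
  have sz: "subgroup (generate G {z}) G" by (rule generate_is_subgroup[OF z_sub])
  have iso_z: "G\<lparr>carrier := generate G {z}\<rparr> \<cong> integer_mod_group 3"
    using z_iso unfolding subgroup_generated_carrier[OF z_sub] .
  have Z3: "t [^]\<^bsub>integer_mod_group 3\<^esub> (3::nat) = \<one>\<^bsub>integer_mod_group 3\<^esub>" if "t \<in> carrier (integer_mod_group 3)" for t
    by simp
  have "z [^] (3::nat) = \<one>"
    using iso_subgroup_pow[OF sz iso_z group_integer_mod_group, of 3 3 z] generate.incl[of z "{z}" G] Z3 by blast
  then have z3: "z \<otimes> (z \<otimes> z) = \<one>" using pow_3[OF zG] by simp
  have gz: "generate G {z} = {\<one>, z, inv z}" by (rule generate_cube_one[OF zG z3])
  have z1: "z \<noteq> \<one>"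
  proof
    assume "z = \<one>"
    then have "card (carrier (integer_mod_group 3)) = 1"
      using iso_same_card[OF iso_z] gz by simp
    then show False by (simp add: carrier_integer_mod_group)
  qed
  have zU: "z \<notin> U" using UW(3) z1 gz by auto
  have iz: "inv z = z \<otimes> z" by (rule inv_of_cube_one[OF z3 zG])
  define c where "c g = z \<otimes> g \<otimes> inv z" for g
  have cG: "c g \<in> carrier G" if "g \<in> carrier G" for g using that zG by (simp add: c_def)
  have cm: "c (g \<otimes> h) = c g \<otimes> c h" if "g \<in> carrier G" "h \<in> carrier G" for g h
    unfolding c_def by (rule conj_mult[OF zG that])
  have cU: "c u \<in> U" if "u \<in> U" for u
    using GW.conj_closed(1)[OF UW(1) _ that, of z] zW m_inv_consistent[OF sW zW] by (simp add: c_def)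
  have twist: "(g \<otimes> z) \<otimes> ((g \<otimes> z) \<otimes> (g \<otimes> z)) = g \<otimes> (c g \<otimes> c (c g))" if "g \<in> carrier G" for g
    using cube_twist[OF that zG z3] that zG by (simp add: c_def iz m_assoc cube_one_extend[OF z3 zG])

  define Z where "Z = group_center ?GU"
  have ZU: "e \<in> U" if "e \<in> Z" for e using GU.group_center_carrier that by (simp add: Z_def)
  have Zc: "e \<otimes> u = u \<otimes> e" if "e \<in> Z" "u \<in> U" for e u
    using GU.group_center_commute[of e u] that by (simp add: Z_def)
  have sZU: "subgroup Z ?GU" unfolding Z_def by (rule GU.group_center_subgroup)
  have sZ: "subgroup Z G" by (rule incl_subgroup[OF sU sZU])
  have ZG: "e \<in> carrier G" if "e \<in> Z" for e using UG ZU that by blast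
  have pU: "p_group 2 ?GU" using sp by (simp add: special_p_group_def)
  have "\<not> elementary_abelian 2 ?GU" using nc by (simp add: elementary_abelian_def)
  then have der: "derived ?GU U = Z" and el: "elementary_abelian 2 (G\<lparr>carrier := Z\<rparr>)"
    using sp by (auto simp: special_p_group_def Z_def)
  have Z2: "e \<otimes> e = \<one>" if "e \<in> Z" for e
  proof -
    have "e [^]\<^bsub>G\<lparr>carrier := Z\<rparr>\<^esub> (2::nat) = \<one>" using el that by (simp add: elementary_abelian_def)
    then show ?thesis using pow_2[OF ZG[OF that]] nat_pow_consistent[of e 2 Z] by simp
  qed
  have Z_comm_z: "e \<otimes> z = z \<otimes> e" if "e \<in> Z" for e
    using that CU unfolding Om Z_def[symmetric] by blast
  have commZ: "x \<otimes> u \<otimes> inv x \<otimes> inv u \<in> Z" if x: "x \<in> U" and u: "u \<in> U" for x u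
  proof -
    have "x \<otimes>\<^bsub>?GU\<^esub> u \<otimes>\<^bsub>?GU\<^esub> inv\<^bsub>?GU\<^esub> x \<otimes>\<^bsub>?GU\<^esub> inv\<^bsub>?GU\<^esub> u \<in> derived_set ?GU U" using that by blast
    then have "x \<otimes>\<^bsub>?GU\<^esub> u \<otimes>\<^bsub>?GU\<^esub> inv\<^bsub>?GU\<^esub> x \<otimes>\<^bsub>?GU\<^esub> inv\<^bsub>?GU\<^esub> u \<in> Z"
      unfolding der[symmetric] derived_def by (rule generate.incl)
    then show ?thesis using m_inv_consistent[OF sU x] m_inv_consistent[OF sU u] by simp
  qed
  have swap: "x \<otimes> u = (x \<otimes> u \<otimes> inv x \<otimes> inv u) \<otimes> (u \<otimes> x)" if "x \<in> U" "u \<in> U" for x u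
    using UG[OF that(1)] UG[OF that(2)] by (simp add: m_assoc)
  \<comment> \<open>Commutators are central of square 1, so moving x past u^2 produces the same
    commutator twice, and it cancels.\<close>
  have sqZ: "u \<otimes> u \<in> Z" if u: "u \<in> U" for u
  proof -
    have uu: "u \<otimes> u \<in> U" by (rule subgroup.m_closed[OF sU u u])
    have "u \<otimes> u \<otimes> x = x \<otimes> (u \<otimes> u)" if x: "x \<in> U" for x
    proof -
      let ?d = "u \<otimes> x \<otimes> inv u \<otimes> inv x"
      have d: "?d \<in> Z" by (rule commZ[OF u x])
      have G: "u \<in> carrier G" "x \<in> carrier G" "?d \<in> carrier G" using UG[OF u] UG[OF x] ZG[OF d] by auto
      have "u \<otimes> u \<otimes> x = u \<otimes> (?d \<otimes> (x \<otimes> u))" using swap[OF u x] G by (simp add: m_assoc)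
      also have "\<dots> = (u \<otimes> ?d) \<otimes> (x \<otimes> u)" using G by (simp only: m_assoc m_closed)
      also have "\<dots> = ?d \<otimes> ((u \<otimes> x) \<otimes> u)" unfolding Zc[OF d u, symmetric] using G by (simp only: m_assoc m_closed)
      also have "(u \<otimes> x) \<otimes> u = (?d \<otimes> (x \<otimes> u)) \<otimes> u" using swap[OF u x] by simp
      also have "?d \<otimes> ((?d \<otimes> (x \<otimes> u)) \<otimes> u) = (?d \<otimes> ?d) \<otimes> (x \<otimes> (u \<otimes> u))" using G by (simp only: m_assoc m_closed)
      finally show ?thesis unfolding Z2[OF d] using G by (simp only: l_one m_closed)
    qed
    then show ?thesis unfolding Z_def GU.group_center_mem using uu by simp
  qed
  have UsU: "Us i \<subseteq> U" and sUs: "subgroup (Us i) G" if "i \<in> {1..n}" for i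
    using bspec[OF each that] subgroup.subset[of "Us i" ?GU] incl_subgroup[OF sU, of "Us i"] by auto
  define nm where "nm u = u \<otimes> (c u \<otimes> c (c u))" for u
  have nmU: "nm u \<in> U" if "u \<in> U" for u
    unfolding nm_def
    by (rule subgroup.m_closed[OF sU that subgroup.m_closed[OF sU cU[OF that] cU[OF cU[OF that]]]])
  have cZ: "c e = e" if "e \<in> Z" for e
    using Z_comm_z[OF that] ZG[OF that] zG by (simp add: c_def m_assoc[symmetric])
      (simp add: Z_comm_z[OF that, symmetric] m_assoc)
  have nm_Z: "nm e \<in> Z" if "e \<in> Z" for e
    unfolding nm_def cZ[OF that] by (rule subgroup.m_closed[OF sZ that subgroup.m_closed[OF sZ that that]])
  have invol_Z: "u \<in> Z" if u: "u \<in> U" and uu: "u \<otimes> u = \<one>" for u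
  proof (cases "u = \<one>")
    case True
    then show ?thesis using subgroup.one_closed[OF sZ] by simp
  next
    case False
    then have "u [^]\<^bsub>?GU\<^esub> (2::nat) = \<one>" using uu nat_pow_consistent[of u 2 U] pow_2[OF UG[OF u]] by simp
    then have "group.ord ?GU u = 2" using GU.ord_eq_2[of u] u uu False by simp
    then have "u \<in> Omega1 ?GU" using u unfolding Omega1_def by (intro generate.incl) simp
    then show ?thesis unfolding Om Z_def .
  qed
  have nm_Us: "nm v \<in> Z" if i: "i \<in> {1..n}" "v \<in> Us i" for i v
  proof -
    have vU: "v \<in> U" using subsetD[OF UsU[OF i(1)] i(2)] .
    note vG = UG[OF vU]
    have sub: "insert z (Us i) \<subseteq> carrier G" using zG subgroup.subset[OF sUs[OF i(1)]] by simp
    have sT: "subgroup (generate G (insert z (Us i))) G" by (rule generate_is_subgroup[OF sub])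
    have "G\<lparr>carrier := generate G (insert z (Us i))\<rparr> \<cong> SL23"
      using bspec[OF each i(1)] unfolding subgroup_generated_carrier[OF sub] by blast
    moreover have "v \<otimes> z \<in> generate G (insert z (Us i))"
      using subgroup.m_closed[OF sT] i(2) by (auto intro: generate.incl)
    ultimately have *: "(v \<otimes> z) [^] (4::nat) = \<one> \<or> (v \<otimes> z) [^] (6::nat) = \<one>"
      using iso_subgroup_pow[OF sT _ group_SL23 SL23_exponent] by blast
    have vzG: "v \<otimes> z \<in> carrier G" using vG zG by simp
    have cube: "(v \<otimes> z) \<otimes> ((v \<otimes> z) \<otimes> (v \<otimes> z)) = nm v" using twist[OF vG] by (simp add: nm_def)
    have "nm v \<otimes> nm v = \<one>"
    proof (cases "(v \<otimes> z) [^] (6::nat) = \<one>")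
      case True
      then show ?thesis unfolding pow_6[OF vzG] cube .
    next
      case False
      \<comment> \<open>Fourth power 1 would give z^-1 = nm(v) v, an element of U, which is
        impossible.\<close>
      then have "(v \<otimes> z) [^] (4::nat) = \<one>" using * by blast
      then have "((v \<otimes> z) \<otimes> ((v \<otimes> z) \<otimes> (v \<otimes> z))) \<otimes> (v \<otimes> z) = \<one>"
        unfolding pow_4[OF vzG] using vzG by (simp add: m_assoc)
      then have "(nm v \<otimes> v) \<otimes> z = \<one>" unfolding cube using UG[OF nmU[OF vU]] vG zG by (simp add: m_assoc)
      from inv_equality[OF this] have "inv z = nm v \<otimes> v" using UG[OF nmU[OF vU]] vG zG by simp
      then have "inv z \<in> U" using subgroup.m_closed[OF sU nmU[OF vU] vU] by simp
      from subgroup.m_inv_closed[OF sU this] show ?thesis using zU zG by simp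
    qed
    from invol_Z[OF nmU[OF vU] this] show ?thesis .
  qed
  have step: "nm (s \<otimes> b) \<in> Z" if s: "s \<in> U" "nm s \<in> Z" and b: "b \<in> U" "nm b \<in> Z" for s b
  proof -
    note mS = s(1) cU[OF s(1)] cU[OF cU[OF s(1)]] and mB = b(1) cU[OF b(1)] cU[OF cU[OF b(1)]]
    have bb: "b \<otimes> c b \<in> U" by (rule subgroup.m_closed[OF sU mB(1,2)])
    let ?d1 = "b \<otimes> c s \<otimes> inv b \<otimes> inv (c s)" and ?d2 = "(b \<otimes> c b) \<otimes> c (c s) \<otimes> inv (b \<otimes> c b) \<otimes> inv (c (c s))"
    have d: "?d1 \<in> Z" "?d2 \<in> Z" by (rule commZ[OF mB(1) mS(2)], rule commZ[OF bb mS(3)])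
    have "nm (s \<otimes> b) = (s \<otimes> b) \<otimes> ((c s \<otimes> c b) \<otimes> (c (c s) \<otimes> c (c b)))"
      unfolding nm_def using cm[OF UG[OF mS(1)] UG[OF mB(1)]] cm[OF UG[OF mS(2)] UG[OF mB(2)]] by simp
    also have "\<dots> = ?d1 \<otimes> (?d2 \<otimes> (nm s \<otimes> nm b))"
      using GU.norm_of_product[of s "c s" "c (c s)" b "c b" "c (c b)" ?d1 ?d2] mS mB d[unfolded Z_def]
        swap[OF mB(1) mS(2)] swap[OF bb mS(3)] by (simp add: nm_def)
    finally show ?thesis
      using subgroup.m_closed[OF sZ d(1) subgroup.m_closed[OF sZ d(2) subgroup.m_closed[OF sZ s(2) b(2)]]] by simp
  qed
  let ?N = "{u \<in> U. nm u \<in> Z}" and ?S = "Z \<union> (\<Union>i\<in>{1..n}. Us i)"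
  have S_N: "s \<in> U \<and> nm s \<in> Z" if "s \<in> ?S" for s
    using that ZU nm_Z subsetD[OF UsU] nm_Us by blast
  have S_G: "?S \<subseteq> carrier G" using S_N UG by blast
  have fU: "finite U" by (rule finite_subset[OF subgroup.subset[OF sU] fin])
  have gN: "generate G ?S \<subseteq> ?N"
  proof (rule generate_left_closed[OF S_G])
    show "finite ?N" using fU by simp
    show "?N \<subseteq> carrier G" using UG by blast
    show "\<one> \<in> ?N" using subgroup.one_closed[OF sU] nm_Z[OF subgroup.one_closed[OF sZ]] by simp
    show "s \<otimes> u \<in> ?N" if s: "s \<in> ?S" and u: "u \<in> ?N" for s u
      using step[of s u] subgroup.m_closed[OF sU, of s u] S_N[OF s] u by simp
  qed
  have "U \<subseteq> generate G ?S"
  proof -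
    have "set_product G Z Us n \<subseteq> generate G ?S"
    proof (rule set_product_subset[OF generate_is_subgroup[OF S_G]])
      show "Z \<subseteq> generate G ?S" by (rule subsetI) (rule generate.incl, blast)
      show "Us i \<subseteq> generate G ?S" if "i \<in> {1..n}" for i by (rule subsetI) (rule generate.incl, use that in blast)
    qed
    then show ?thesis using U_prod by (simp add: Z_def)
  qed
  then have nmZ: "nm u \<in> Z" if "u \<in> U" for u using subsetD[OF gN] that by blast
  have uz6: "(u \<otimes> z) [^] (6::nat) = \<one>" if u: "u \<in> U" for u
    unfolding pow_6[OF m_closed[OF UG[OF u] zG]] twist[OF UG[OF u]] using Z2[OF nmZ[OF u]] by (simp add: nm_def)
  have W_form: "\<exists>u\<in>U. w = u \<or> w = u \<otimes> z \<or> w = u \<otimes> inv z" if "w \<in> W" for w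
  proof -
    have "w \<in> U <#> generate G {z}" using UW(4) that by simp
    then obtain u k where uk: "u \<in> U" "k \<in> generate G {z}" "w = u \<otimes> k" by (auto simp: set_mult_mem)
    then show ?thesis using UG[OF uk(1)] unfolding gz by auto
  qed
  have U4: "u [^] (4::nat) = \<one>" if "u \<in> U" for u
    unfolding pow_4[OF UG[OF that]] by (rule Z2[OF sqZ[OF that]])
  have W_cases: "w \<in> U \<or> w \<notin> U \<and> w [^] (6::nat) = \<one>" if w: "w \<in> W" for w
  proof (rule disjCI)
    assume nU: "\<not> (w \<notin> U \<and> w [^] (6::nat) = \<one>)"
    show "w \<in> U"
    proof (rule ccontr)
      assume wU: "w \<notin> U"
      obtain u where u: "u \<in> U" "w = u \<or> w = u \<otimes> z \<or> w = u \<otimes> inv z" using W_form[OF w] by blast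
      have uG: "u \<in> carrier G" by (rule UG[OF u(1)])
      consider "w = u \<otimes> z" | "w = u \<otimes> inv z" using u wU by blast
      then have "w [^] (6::nat) = \<one>"
      proof cases
        case 1
        then show ?thesis using uz6[OF u(1)] by simp
      next
        case 2
        have m: "c (inv u) \<in> U" by (rule cU[OF subgroup.m_inv_closed[OF sU u(1)]])
        have "inv w = c (inv u) \<otimes> z" using 2 uG zG by (simp add: c_def inv_mult_group m_assoc)
        then have "(inv w) [^] (6::nat) = \<one>" using uz6[OF m] by simp
        then show ?thesis using 2 uG zG by (simp add: nat_pow_inv)
      qed
      then show False using nU wU by blast
    qed
  qed
  have "\<exists>u\<in>U. u \<otimes> u = \<one> \<and> u \<noteq> \<one>"
  proof -
    obtain k where k: "order ?GU = 2 ^ k" using pU by (auto simp: p_group_def)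
    have "k \<noteq> 0"
    proof
      assume "k = 0"
      then have "card U = 1" using k by (simp add: order_def)
      then obtain a where "U = {a}" by (rule card_1_singletonE)
      then show False using nc GU.group_comm_groupI by auto
    qed
    then have "2 dvd order ?GU" using k by simp
    from GU.cauchy[OF _ two_is_prime_nat this] fU obtain u
      where u: "u \<in> U" "u \<noteq> \<one>" "u [^]\<^bsub>?GU\<^esub> (2::nat) = \<one>" by auto
    then show ?thesis using GU.pow_2[of u] by auto
  qed
  then obtain x0 where x0: "x0 \<in> U" "x0 \<otimes> x0 = \<one>" "x0 \<noteq> \<one>" by blast
  have form: "\<exists>w\<in>W. \<exists>v\<in>V. g = w \<otimes> v" if "g \<in> carrier G" for g
    using that unfolding WV(4)[symmetric] set_mult_mem by blast
  have WG: "\<And>w. w \<in> W \<Longrightarrow> w \<in> carrier G" by (fact subgroup.mem_carrier[OF sW])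
  show ?thesis
  proof (rule property_PI[OF fin UG[OF x0(1)] x0(2,3)])
    fix x y assume x: "x \<in> carrier G" "x \<otimes> x = \<one>" "x \<noteq> \<one>" and y: "y \<in> carrier G"
    obtain w v where wv: "w \<in> W" "v \<in> V" "x = w \<otimes> v" using form[OF x(1)] by blast
    note G = WG[OF wv(1)] VG[OF wv(2)]
    have ww: "w \<otimes> w = \<one>" using commuting_square[OF cWV[OF wv(1,2)] G] V2[OF wv(2)] x(2) wv(3) G by simp
    have "w \<in> U"
    proof (rule ccontr)
      assume wU: "w \<notin> U"
      obtain u where u: "u \<in> U" "w = u \<or> w = u \<otimes> z \<or> w = u \<otimes> inv z" using W_form[OF wv(1)] by blast
      have uG: "u \<in> carrier G" by (rule UG[OF u(1)])
      have iw: "inv w = w" by (rule inv_of_involution[OF ww G(1)])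
      have "\<exists>u\<in>U. w = u \<otimes> z"
      proof (cases "w = u \<otimes> z")
        case False
        then have "w = u \<otimes> inv z" using u wU by blast
        then have "inv w = c (inv u) \<otimes> z" using uG zG by (simp add: c_def inv_mult_group m_assoc)
        then show ?thesis using iw cU[OF subgroup.m_inv_closed[OF sU u(1)]] by auto
      qed (use u in blast)
      then obtain b where b: "b \<in> U" "w = b \<otimes> z" by blast
      \<comment> \<open>An element of square 1 equals its own cube, and the cube of b z is the norm
        of b, which lies in U.\<close>
      have "w = nm b" using twist[OF UG[OF b(1)]] ww G(1) unfolding b(2)[symmetric] nm_def by simp
      then show False using nmU[OF b(1)] wU by simp
    qed
    then have wZ: "w \<in> Z" using invol_Z ww by blast
    obtain w' v' where wv': "w' \<in> W" "v' \<in> V" "y = w' \<otimes> v'" using form[OF y] by blast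
    note G' = WG[OF wv'(1)] VG[OF wv'(2)]
    have ww': "w' \<otimes> w = w \<otimes> w'"
    proof -
      obtain u where u: "u \<in> U" "w' = u \<or> w' = u \<otimes> z \<or> w' = u \<otimes> inv z" using W_form[OF wv'(1)] by blast
      have uw: "u \<otimes> w = w \<otimes> u" using Zc[OF wZ u(1)] by simp
      have zw: "z \<otimes> w = w \<otimes> z" using Z_comm_z[OF wZ] by simp
      have "inv z \<otimes> w = w \<otimes> inv z" by (rule commute_inv[OF zw zG G(1)])
      then show ?thesis
        using uw commute_mult[OF uw zw UG[OF u(1)] zG G(1)] commute_mult[OF uw _ UG[OF u(1)] inv_closed[OF zG] G(1)] u(2)
        by blast
    qed
    have "w' \<otimes> x = x \<otimes> w'"
      unfolding wv(3) using commute_mult[OF ww'[symmetric] cWV[OF wv'(1) wv(2), symmetric] G G'(1)] by simp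
    moreover have "v' \<otimes> x = x \<otimes> v'"
      unfolding wv(3) using commute_mult[OF cWV[OF wv(1) wv'(2)] VV[OF wv(2) wv'(2)] G G'(2)] by simp
    ultimately have "x \<otimes> y = y \<otimes> x" unfolding wv'(3) using commute_mult[OF _ _ G' x(1)] by simp
    moreover have "y [^] (4::nat) = \<one> \<or> y [^] (6::nat) = \<one>"
    proof -
      have v4: "v' [^] (4::nat) = \<one>" and v6: "v' [^] (6::nat) = \<one>"
        using V2[OF wv'(2)] G'(2) by (simp_all add: pow_4 pow_6)
      have "w' [^] (4::nat) = \<one> \<or> w' [^] (6::nat) = \<one>" using W_cases[OF wv'(1)] U4 by blast
      then show ?thesis
        using pow_mult_distrib[OF cWV[OF wv'(1,2)] G', of 4] pow_mult_distrib[OF cWV[OF wv'(1,2)] G', of 6] v4 v6 wv'(3)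
        by auto
    qed
    ultimately show "x \<otimes> y = y \<otimes> x \<and> (y [^] (4::nat) = \<one> \<or> y [^] (6::nat) = \<one>) \<or>
       y \<otimes> (y \<otimes> y) = \<one> \<and> (x \<otimes> y) \<otimes> ((x \<otimes> y) \<otimes> (x \<otimes> y)) = \<one>" by blast
  qed
qed

end

section \<open>Exclusion of nilpotent groups and the final case distinction\<close>

context P_group
begin

lemma nilpotent_of_T:
  assumes "T = carrier G"
  shows "nilpotent_group G"
proof -
  have "\<exists>k. g [^] (2 ^ k :: nat) = \<one>" if "g \<in> carrier G" for g
  proof -
    have "g \<otimes> g \<in> E" using that assms T_mem by blast
    then have "g [^] (2 ^ 2 :: nat) = \<one>" using E_square pow_4[OF that] by simp
    then show ?thesis ..
  qed
  then obtain k where "order G = 2 ^ k" using order_prime_power[OF fin two_is_prime_nat] by blast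
  then show ?thesis by (rule prime_power_nilpotent[OF fin two_is_prime_nat])
qed

lemma nilpotent_of_K:
  assumes central: "C = carrier G" and K: "\<And>g. g \<in> carrier G \<Longrightarrow> g \<otimes> (g \<otimes> g) \<in> E"
  shows "nilpotent_group G"
proof -
  have p3: "prime (3::nat)" by simp
  have finQ: "finite (carrier (G Mod E))"
    using finite_imageI[OF fin, of "\<lambda>g. E #> g"] unfolding carrier_FactGroup by (simp add: RCOSETS_def image_def)
  have "\<exists>k. q [^]\<^bsub>G Mod E\<^esub> (3 ^ k :: nat) = \<one>\<^bsub>G Mod E\<^esub>" if q: "q \<in> carrier (G Mod E)" for q
  proof -
    obtain g where g: "g \<in> carrier G" "q = coset_E g" using coset_E_ex[OF q] by blast
    have "q [^]\<^bsub>G Mod E\<^esub> (3 ^ 1 :: nat) = coset_E (g \<otimes> (g \<otimes> g))"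
      using group.pow_3[OF quotient.H.is_group q] g by simp
    also have "\<dots> = \<one>\<^bsub>G Mod E\<^esub>" using coset_E_one[of "g \<otimes> (g \<otimes> g)"] K[OF g(1)] g(1) by simp
    finally show ?thesis ..
  qed
  then obtain k where "order (G Mod E) = 3 ^ k" using group.order_prime_power[OF quotient.H.is_group finQ p3] by blast
  moreover have "E \<subseteq> group_center G"
    using C_commute central E_carrier unfolding group_center_def by fastforce
  ultimately show ?thesis using nilpotent_of_central_prime_power_index[OF fin p3 subgroup_E] by blast
qed

text \<open>s lies in \<open>C\<close>, so modulo \<open>C\<close> the element s z s z is z^2. For z
  of order 3 outside \<open>C\<close> this would put z^2 = z^-1 into \<open>C\<close>.\<close>

lemma dihedral_central:
  assumes s: "s \<in> T" and inv: "\<And>a. a \<in> K \<Longrightarrow> s \<otimes> (a \<otimes> (s \<otimes> a)) \<in> E"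
  shows "C = carrier G"
proof (rule ccontr)
  assume "C \<noteq> carrier G"
  then obtain z where z: "z \<in> carrier G" "z \<notin> C" using subgroup.subset[OF subgroup_C] by blast
  have z3: "z \<otimes> (z \<otimes> z) = \<one>" by (rule outside_C[OF z])
  have sC: "s \<in> C" using subsetD[OF T_subset_C s] .
  have sG: "s \<in> carrier G" using s by (simp add: T_mem)
  have "z \<in> K" using z z3 by (simp add: K_mem E_mem)
  then have *: "s \<otimes> (z \<otimes> (s \<otimes> z)) \<in> C" using inv E_subset_C by blast
  have c: "z \<otimes> s \<otimes> inv z \<in> C" by (rule conj_closed(1)[OF normal_C z(1) sC])
  have "s \<otimes> (z \<otimes> s \<otimes> inv z) \<in> C" by (rule subgroup.m_closed[OF subgroup_C sC c])
  from subgroup.m_closed[OF subgroup_C subgroup.m_inv_closed[OF subgroup_C this] *]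
  have "inv (s \<otimes> (z \<otimes> s \<otimes> inv z)) \<otimes> (s \<otimes> (z \<otimes> (s \<otimes> z))) \<in> C" .
  moreover have "s \<otimes> (z \<otimes> (s \<otimes> z)) = (s \<otimes> (z \<otimes> s \<otimes> inv z)) \<otimes> (z \<otimes> z)"
    using sG z(1) by (simp add: m_assoc)
  ultimately have "z \<otimes> z \<in> C" using sG z(1) by simp
  from subgroup.m_inv_closed[OF subgroup_C this] have "inv (inv z) \<in> C"
    using inv_of_cube_one[OF z3 z(1)] by simp
  then show False using z by simp
qed

theorem one_of_families:
  assumes nn: "\<not> nilpotent_group G"
  shows "family_a G \<or> family_b G \<or> family_c G \<or> family_d G"
proof (cases "\<exists>s\<in>T. \<exists>t\<in>T. s \<otimes> t \<otimes> inv s \<otimes> inv t \<notin> E")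
  case True
  then obtain s where s: "s \<in> T" "s \<notin> E"
      "\<forall>a\<in>K. \<forall>b\<in>K. a \<otimes> b \<in> K \<and> a \<otimes> b \<otimes> inv a \<otimes> inv b \<in> E"
      "\<forall>a\<in>K. s \<otimes> (a \<otimes> (s \<otimes> a)) \<in> E" "\<forall>g\<in>carrier G. g \<in> K \<or> s \<otimes> g \<in> K" "\<exists>k\<in>K. k \<notin> E"
    using dihedral_lift by blast
  obtain k where k: "k \<in> K" "k \<notin> E" using s(6) by blast
  have "family_a G"
    by (rule family_a_of_central[OF dihedral_central[OF s(1)] s(1,2) _ _ _ _ k]) (use s in blast)+
  then show ?thesis ..
next
  case False
  then have comm: "s \<otimes> t \<otimes> inv s \<otimes> inv t \<in> E" if "s \<in> T" "t \<in> T" for s t using that by blast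
  have sT: "subgroup T G" by (rule commuting_lift(1)) (rule comm)
  have T_index: "g \<in> T \<or> g \<otimes> y \<in> T \<or> g \<otimes> inv y \<in> T"
    if "T \<noteq> E" "y \<in> carrier G" "y \<notin> T" "g \<in> carrier G" for g y
    by (rule commuting_lift(2)[OF _ that]) (rule comm)
  have T_G: "T \<subseteq> carrier G" by (rule subgroup.subset[OF sT])
  show ?thesis
  proof (cases "T = E")
    case True
    have K: "g \<otimes> (g \<otimes> g) \<in> E" if g: "g \<in> carrier G" for g
    proof (cases "g \<otimes> g \<in> E")
      case sq: True
      then have "g \<in> E" using True T_mem g by blast
      then show ?thesis using E_square g by simp
    qed (use square_or_cube[OF g] in blast)
    have "C \<noteq> carrier G" using nilpotent_of_K[OF _ K] nn by blast
    then obtain z where z: "z \<in> carrier G" "z \<notin> C" using subgroup.subset[OF subgroup_C] by blast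
    interpret noncentral_P_group G z by unfold_locales (fact z)+
    show ?thesis using family_b_of_exponent_3[OF K] by blast
  next
    case TE: False
    show ?thesis
    proof (cases "C = carrier G")
      case central: True
      have "T \<noteq> carrier G" using nilpotent_of_T nn by blast
      then obtain g where g: "g \<in> carrier G" "g \<notin> T" using T_G by blast
      then have g3: "g \<otimes> (g \<otimes> g) \<in> E" using square_or_cube[OF g(1)] T_mem by blast
      \<comment> \<open>z = g^4 has cube g^12 = 1 because g^3 lies in \<open>E\<close>. It differs
        from g by g^3, so it stays outside \<open>T\<close>.\<close>
      define z where "z = g \<otimes> (g \<otimes> (g \<otimes> g))"
      have zG: "z \<in> carrier G" using g by (simp add: z_def)
      have gE: "g \<otimes> (g \<otimes> (g \<otimes> g)) = (g \<otimes> (g \<otimes> g)) \<otimes> g" using g by (simp add: m_assoc)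
      have "z \<notin> T"
      proof
        assume "z \<in> T"
        moreover have "E \<subseteq> T" using E_mem T_mem E_square by auto
        then have "inv (g \<otimes> (g \<otimes> g)) \<in> T" using g3 subgroup.m_inv_closed[OF sT] by blast
        ultimately have "inv (g \<otimes> (g \<otimes> g)) \<otimes> ((g \<otimes> (g \<otimes> g)) \<otimes> g) \<in> T"
          unfolding z_def gE using subgroup.m_closed[OF sT] by blast
        then show False using g l_inv[of "g \<otimes> (g \<otimes> g)"]
          m_assoc[of "inv (g \<otimes> (g \<otimes> g))" "g \<otimes> (g \<otimes> g)" g] by simp
      qed
      moreover have "z \<otimes> (z \<otimes> z) = \<one>"
      proof -
        let ?e = "g \<otimes> (g \<otimes> g)"
        have "z \<otimes> (z \<otimes> z) = (?e \<otimes> ?e) \<otimes> (?e \<otimes> ?e)" using g(1) by (simp add: z_def m_assoc)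
        then show ?thesis using E_square[OF g3] by simp
      qed
      ultimately interpret special_P_group G z
        by unfold_locales (rule central comm TE zG | assumption)+
      show ?thesis using family_d by blast
    next
      case False
      then obtain z where z: "z \<in> carrier G" "z \<notin> C" using subgroup.subset[OF subgroup_C] by blast
      have zT: "z \<notin> T" using T_subset_C z by blast
      \<comment> \<open>One of c, c z, c z^-1 lies in \<open>T\<close>, hence in \<open>C\<close>;
        the last two would put z into \<open>C\<close>.\<close>
      have "C \<subseteq> T"
      proof
        fix c assume c: "c \<in> C"
        have cG: "c \<in> carrier G" using subgroup.mem_carrier[OF subgroup_C c] .
        have cz: "z \<in> C" if "c \<otimes> z \<in> C"
          using subgroup.m_closed[OF subgroup_C subgroup.m_inv_closed[OF subgroup_C c] that] cG z by simp
        have ciz: "z \<in> C" if "c \<otimes> inv z \<in> C"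
          using subgroup.m_inv_closed[OF subgroup_C subgroup.m_closed[OF subgroup_C
              subgroup.m_inv_closed[OF subgroup_C c] that]] cG z by simp
        show "c \<in> T" using T_index[OF TE z(1) zT cG] T_subset_C cz ciz z(2) by blast
      qed
      then have CT: "C = T" using T_subset_C by blast
      interpret frobenius_P_group G z by unfold_locales (rule z CT comm TE | assumption)+
      show ?thesis using family_c by blast
    qed
  qed
qed

end

theorem theorem1p3:
  fixes G :: "('a, 'b) monoid_scheme"
  assumes "group G" and "finite (carrier G)" and "\<not> nilpotent_group G"
  shows "property_P G \<longleftrightarrow> family_a G \<or> family_b G \<or> family_c G \<or> family_d G"
proof
  interpret group G by fact
  assume "property_P G"
  then have ev: "2 dvd order G" and P: "\<forall>x\<in>carrier G. \<forall>y\<in>carrier G. x \<otimes>\<^bsub>G\<^esub> x = \<one>\<^bsub>G\<^esub> \<and> x \<noteq> \<one>\<^bsub>G\<^esub> \<longrightarrow>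
      x \<otimes>\<^bsub>G\<^esub> y = y \<otimes>\<^bsub>G\<^esub> x \<and> (y [^]\<^bsub>G\<^esub> (4::nat) = \<one>\<^bsub>G\<^esub> \<or> y [^]\<^bsub>G\<^esub> (6::nat) = \<one>\<^bsub>G\<^esub>) \<or>
      y \<otimes>\<^bsub>G\<^esub> (y \<otimes>\<^bsub>G\<^esub> y) = \<one>\<^bsub>G\<^esub> \<and> (x \<otimes>\<^bsub>G\<^esub> y) \<otimes>\<^bsub>G\<^esub> ((x \<otimes>\<^bsub>G\<^esub> y) \<otimes>\<^bsub>G\<^esub> (x \<otimes>\<^bsub>G\<^esub> y)) = \<one>\<^bsub>G\<^esub>"
    unfolding property_P_iff[OF assms(2)] by blast+
  \<comment> \<open>Even order provides, by Cauchy, the involution that \<open>P_group\<close>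
    assumes.\<close>
  have "\<exists>x\<in>carrier G. x \<otimes>\<^bsub>G\<^esub> x = \<one>\<^bsub>G\<^esub> \<and> x \<noteq> \<one>\<^bsub>G\<^esub>"
    using cauchy[OF assms(2) two_is_prime_nat ev] pow_2 by auto
  then interpret P_group G by unfold_locales (use assms(2) P in blast)+
  show "family_a G \<or> family_b G \<or> family_c G \<or> family_d G" by (rule one_of_families[OF assms(3)])
next
  interpret group G by fact
  assume "family_a G \<or> family_b G \<or> family_c G \<or> family_d G"
  then show "property_P G"
    using property_P_of_family_a[OF assms(2)] property_P_of_family_b[OF assms(2,3)]
      property_P_of_family_c[OF assms(2)] property_P_of_family_d[OF assms(2)] by blast
qed

end
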